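(* There is a functor $\mathrm{X}_2\colon \{\mathrm{SimpHopf}^{cc}_{\le 2}\}\to\{\mathrm{X_2Hopf}^{cc}\}$ from the category of simplicial cocommutative Hopf algebras over $\kappa$ with Moore complex of length two to the category of 2-crossed modules of cocommutative Hopf algebras over $\kappa$, which sends $\mathcal H=(H_n,d_i,s_j)$ to $$NH_2\xrightarrow{\partial_2}NH_1\xrightarrow{\partial_1}H_0$$ equipped with the actions $n\vartriangleright_\rho m=s_0(n)\vartriangleright_{ad}m$ and $n\vartriangleright_\rho l=s_1s_0(n)\vartriangleright_{ad}l$ ($n\in H_0$, $m\in NH_1$, $l\in NH_2$) and the Peiffer lifting $$\{x,y\}=\sum_{(x)(y)}\big(s_1(x')\vartriangleright_{ad}s_1(y')\big)\,S\big(s_0(x'')\vartriangleright_{ad}s_1(y'')\big)\qquad(x,y\in NH_1).$$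
   Context: All Hopf algebras are cocommutative over an arbitrary field $\kappa$, with coproduct $\delta(x)=\sum_{(x)}x'\otimes x''$ (iterated: $x',x'',x''',\dots$), counit $\epsilon$, antipode $S$. The zero object is $\kappa$; the zero morphism $A\to B$ is $x\mapsto\epsilon(x)1_B$. Adjoint action: $x\vartriangleright_{ad}y=\sum_{(x)}x'\,y\,S(x'')$. For a Hopf algebra map $f\colon A\to B$, $\mathrm{HKer}(f)=\{x\in A:\sum_{(x)}x'\otimes f(x'')=x\otimes 1_B\}$. A simplicial (cocommutative) Hopf algebra is a simplicial object in cocommutative Hopf algebras, with faces $d_i\colon H_n\to H_{n-1}$ and degeneracies $s_j\colon H_n\to H_{n+1}$ ($0\le i,j\le n$). Its Moore complex is $NH_0=H_0$, $NH_n=\bigcap_{i=0}^{n-1}\mathrm{HKer}(d_i)\subset H_n$ for $n\ge1$, with $\partial_n\colon NH_n\to NH_{n-1}$ the restriction of $d_n$. It has length $n$ if $NH_i$ is the zero object $\kappa$ for all $i>n$. Morphisms of simplicial Hopf algebras are morphisms of simplicial objects. An $H$-module bialgebra $I$ is a bialgebra with an $H$-module structure $\vartriangleright_\rho\colon H\otimes I\to I$ such that $x\vartriangleright_\rho 1=\epsilon(x)1$, $x\vartriangleright_\rho(uv)=\sum(x'\vartriangleright_\rho u)(x''\vartriangleright_\rho v)$, $\delta(x\vartriangleright_\rho v)=\sum(x'\vartriangleright_\rho v')\otimes(x''\vartriangleright_\rho v'')$, $\epsilon(x\vartriangleright_\rho v)=\epsilon(x)\epsilon(v)$. A crossed module is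 a Hopf algebra map $\partial\colon I\to H$ with an $H$-module bialgebra structure on $I$ such that $\partial(x\vartriangleright_\rho v)=x\vartriangleright_{ad}\partial(v)$ and $\partial(u)\vartriangleright_\rho v=u\vartriangleright_{ad}v$ for $x\in H$, $u,v\in I$. A 2-crossed module of Hopf algebras is a chain complex $K\xrightarrow{\partial_2}I\xrightarrow{\partial_1}H$ of Hopf algebras ($\partial_1\partial_2$ is the zero morphism) with actions $\vartriangleright_\rho$ of $H$ on $I$ and $K$, and on itself by the adjoint action, together with a bilinear map (Peiffer lifting) $\{\ ,\ \}$ from pairs of elements of $I$ to $K$ which is $H$-equivariant, i.e. $a\vartriangleright_\rho\{x,y\}=\sum_{(a)}\{a'\vartriangleright_\rho x,a''\vartriangleright_\rho y\}$, such that for all $x,y,z\in I$, $k,l\in K$: 1) it is a complex of $H$-module bialgebras: $\partial_2(a\vartriangleright_\rho k)=a\vartriangleright_\rho\partial_2(k)$ and $\partial_1(a\vartriangleright_\rho x)=a\vartriangleright_{ad}\partial_1(x)$ for $a\in H$; 2) $\partial_2\{x,y\}=\sum_{(x)(y)}(x'\vartriangleright_{ad}y')\,\big(\partial_1(x'')\vartriangleright_\rho S(y'')\big)$; 3) $\{\partial_2(k),\partial_2(l)\}=\sum_{(l)}(k\vartriangleright_{ad}l')\,S(l'')$; 4) $\{x,yz\}=\sum_{(x)(y)}\{x',y'\}\,\big((\partial_1(x'')\vartriangleright_\rho y'')\vartriangleright'_\rho\{x''',z\}\big)$; 5) $\{xy,z\}=\sum_{(x)(y)(z)}\{x',y'\vartriangleright_{ad}z'\}\,\big(\partial_1(x'')\vartriangleright_\rho\{y'',z''\}\big)$;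 6) $\sum_{(k)(x)}\{\partial_2(k'),x'\}\{x'',\partial_2(k'')\}=\sum_{(k)}k'\,\big(\partial_1(x)\vartriangleright_\rho S(k'')\big)$; where in 4) the action of $I$ on $K$ is $x\vartriangleright'_\rho k=\sum_{(k)}k'\,\{\partial_2(S(k'')),x\}$, such that $(\partial_2\colon K\to I,\vartriangleright'_\rho)$ becomes a crossed module. A morphism of 2-crossed modules from $K\to I\to H$ to $K'\to I'\to H'$ is a triple of Hopf algebra maps $f_0\colon H\to H'$, $f_1\colon I\to I'$, $f_2\colon K\to K'$ commuting with the boundary maps and satisfying $f_1(a\vartriangleright_\rho x)=f_0(a)\vartriangleright_\rho f_1(x)$, $f_2(a\vartriangleright_\rho k)=f_0(a)\vartriangleright_\rho f_2(k)$, $f_2\{x,y\}=\{f_1(x),f_1(y)\}$. *)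

theory Defs
  imports "HOL-Algebra.Module"
begin

section \<open>Linear maps and associative algebras\<close>

definition linear_maps ::
    "('k, 'r) ring_scheme \<Rightarrow> ('k, 'a, 'm) module_scheme \<Rightarrow> ('k, 'b, 'n) module_scheme \<Rightarrow> ('a \<Rightarrow> 'b) set"
  where "linear_maps R M N = {f \<in> carrier M \<rightarrow> carrier N.
      (\<forall>x \<in> carrier M. \<forall>y \<in> carrier M. f (x \<oplus>\<^bsub>M\<^esub> y) = f x \<oplus>\<^bsub>N\<^esub> f y) \<and>
      (\<forall>c \<in> carrier R. \<forall>x \<in> carrier M. f (c \<odot>\<^bsub>M\<^esub> x) = c \<odot>\<^bsub>N\<^esub> f x)}"

definition bilinear_maps ::
    "('k, 'r) ring_scheme \<Rightarrow> ('k, 'a, 'm) module_scheme \<Rightarrow> ('k, 'b, 'n) module_scheme \<Rightarrow>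
      ('k, 'c, 'p) module_scheme \<Rightarrow> ('a \<Rightarrow> 'b \<Rightarrow> 'c) set"
  where "bilinear_maps R A B M = {f.
      (\<forall>a \<in> carrier A. f a \<in> linear_maps R B M) \<and>
      (\<forall>b \<in> carrier B. (\<lambda>a. f a b) \<in> linear_maps R A M)}"

text \<open>Unlike the locale \<open>algebra\<close> of the library, the multiplication need not be commutative.\<close>

locale assoc_algebra = module R A + ring A for R (structure) and A (structure) +
  assumes smult_mult_l: "\<lbrakk>c \<in> carrier R; x \<in> carrier A; y \<in> carrier A\<rbrakk> \<Longrightarrow>
      (c \<odot>\<^bsub>A\<^esub> x) \<otimes>\<^bsub>A\<^esub> y = c \<odot>\<^bsub>A\<^esub> (x \<otimes>\<^bsub>A\<^esub> y)"
    and smult_mult_r: "\<lbrakk>c \<in> carrier R; x \<in> carrier A; y \<in> carrier A\<rbrakk> \<Longrightarrow>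
      x \<otimes>\<^bsub>A\<^esub> (c \<odot>\<^bsub>A\<^esub> y) = c \<odot>\<^bsub>A\<^esub> (x \<otimes>\<^bsub>A\<^esub> y)"

definition algebra_maps ::
    "('k, 'r) ring_scheme \<Rightarrow> ('k, 'a, 'm) module_scheme \<Rightarrow> ('k, 'b, 'n) module_scheme \<Rightarrow> ('a \<Rightarrow> 'b) set"
  where "algebra_maps R A B = {f \<in> linear_maps R A B.
      (\<forall>x \<in> carrier A. \<forall>y \<in> carrier A. f (x \<otimes>\<^bsub>A\<^esub> y) = f x \<otimes>\<^bsub>B\<^esub> f y) \<and> f \<one>\<^bsub>A\<^esub> = \<one>\<^bsub>B\<^esub>}"

text \<open>The ground ring as a module (and algebra) over itself.\<close>

definition ground :: "('k, 'r) ring_scheme \<Rightarrow> ('k, 'k) module"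
  where "ground R = \<lparr>carrier = carrier R, mult = mult R, one = one R,
      zero = zero R, add = add R, smult = mult R\<rparr>"


section \<open>Tensor products\<close>

text \<open>
  A list \<open>[(a1, b1), \<dots>, (an, bn)]\<close> stands for the formal sum \<open>a1 \<otimes> b1 + \<dots> + an \<otimes> bn\<close>;
  the tensor product consists of the classes of such lists modulo the congruence
  (with respect to concatenation) generated by commutativity and bilinearity.
\<close>

inductive tensor_eq ::
    "('k, 'r) ring_scheme \<Rightarrow> ('k, 'a, 'm) module_scheme \<Rightarrow> ('k, 'b, 'n) module_scheme \<Rightarrow>
      ('a \<times> 'b) list \<Rightarrow> ('a \<times> 'b) list \<Rightarrow> bool"
  for R :: "('k, 'r) ring_scheme"
    and A :: "('k, 'a, 'm) module_scheme" and B :: "('k, 'b, 'n) module_scheme"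
  where
    refl: "xs \<in> lists (carrier A \<times> carrier B) \<Longrightarrow> tensor_eq R A B xs xs"
  | sym: "tensor_eq R A B xs ys \<Longrightarrow> tensor_eq R A B ys xs"
  | trans: "tensor_eq R A B xs ys \<Longrightarrow> tensor_eq R A B ys zs \<Longrightarrow> tensor_eq R A B xs zs"
  | append: "tensor_eq R A B xs xs' \<Longrightarrow> tensor_eq R A B ys ys' \<Longrightarrow>
      tensor_eq R A B (xs @ ys) (xs' @ ys')"
  | comm: "xs \<in> lists (carrier A \<times> carrier B) \<Longrightarrow> ys \<in> lists (carrier A \<times> carrier B) \<Longrightarrow>
      tensor_eq R A B (xs @ ys) (ys @ xs)"
  | add_l: "a \<in> carrier A \<Longrightarrow> a' \<in> carrier A \<Longrightarrow> b \<in> carrier B \<Longrightarrow>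
      tensor_eq R A B [(a \<oplus>\<^bsub>A\<^esub> a', b)] [(a, b), (a', b)]"
  | add_r: "a \<in> carrier A \<Longrightarrow> b \<in> carrier B \<Longrightarrow> b' \<in> carrier B \<Longrightarrow>
      tensor_eq R A B [(a, b \<oplus>\<^bsub>B\<^esub> b')] [(a, b), (a, b')]"
  | balanced: "c \<in> carrier R \<Longrightarrow> a \<in> carrier A \<Longrightarrow> b \<in> carrier B \<Longrightarrow>
      tensor_eq R A B [(c \<odot>\<^bsub>A\<^esub> a, b)] [(a, c \<odot>\<^bsub>B\<^esub> b)]"
  | zero: "b \<in> carrier B \<Longrightarrow> tensor_eq R A B [(\<zero>\<^bsub>A\<^esub>, b)] []"

definition tclass ::
    "('k, 'r) ring_scheme \<Rightarrow> ('k, 'a, 'm) module_scheme \<Rightarrow> ('k, 'b, 'n) module_scheme \<Rightarrow>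
      ('a \<times> 'b) list \<Rightarrow> ('a \<times> 'b) list set"
  where "tclass R A B xs = {ys. tensor_eq R A B xs ys}"

definition trep :: "('a \<times> 'b) list set \<Rightarrow> ('a \<times> 'b) list"
  where "trep t = (SOME xs. xs \<in> t)"

text \<open>The operations below do not depend on the representatives chosen by \<^const>\<open>trep\<close>.\<close>

definition tensor ::
    "('k, 'r) ring_scheme \<Rightarrow> ('k, 'a, 'm) module_scheme \<Rightarrow> ('k, 'b, 'n) module_scheme \<Rightarrow>
      ('k, ('a \<times> 'b) list set) module"
  where "tensor R A B = \<lparr>
      carrier = tclass R A B ` lists (carrier A \<times> carrier B),
      mult = (\<lambda>s t. tclass R A B
        (concat (map (\<lambda>(a, b). map (\<lambda>(a', b'). (a \<otimes>\<^bsub>A\<^esub> a', b \<otimes>\<^bsub>B\<^esub> b')) (trep t)) (trep s)))),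
      one = tclass R A B [(\<one>\<^bsub>A\<^esub>, \<one>\<^bsub>B\<^esub>)],
      zero = tclass R A B [],
      add = (\<lambda>s t. tclass R A B (trep s @ trep t)),
      smult = (\<lambda>c t. tclass R A B (map (\<lambda>(a, b). (c \<odot>\<^bsub>A\<^esub> a, b)) (trep t)))\<rparr>"

definition pure_tensor ::
    "('k, 'r) ring_scheme \<Rightarrow> ('k, 'a, 'm) module_scheme \<Rightarrow> ('k, 'b, 'n) module_scheme \<Rightarrow>
      'a \<Rightarrow> 'b \<Rightarrow> ('a \<times> 'b) list set"
  where "pure_tensor R A B a b = tclass R A B [(a, b)]"

text \<open>
  The linear map \<open>A \<otimes> B \<rightarrow> M\<close> induced by a bilinear map \<open>f\<close>; it does not depend on the
  chosen representative when \<open>f\<close> is bilinear.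
\<close>

definition tensor_lift ::
    "('k, 'c, 'p) module_scheme \<Rightarrow> ('a \<Rightarrow> 'b \<Rightarrow> 'c) \<Rightarrow> ('a \<times> 'b) list set \<Rightarrow> 'c"
  where "tensor_lift M f t = foldr (\<lambda>(a, b) s. f a b \<oplus>\<^bsub>M\<^esub> s) (trep t) \<zero>\<^bsub>M\<^esub>"


section \<open>Cocommutative Hopf algebras\<close>

record ('k, 'a) hopf = "('k, 'a) module" +
  comult :: "'a \<Rightarrow> ('a \<times> 'a) list set"
  counit :: "'a \<Rightarrow> 'k"
  antipode :: "'a \<Rightarrow> 'a"

text \<open>
  Sweedler notation: \<open>sweedler A M x f\<close> is the sum of the \<open>f x' x''\<close> in \<open>M\<close>, and
  \<open>sweedler3 A M x f\<close> is the sum of the \<open>f x' x'' x'''\<close>, for (multi)linear \<open>f\<close>.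
\<close>

definition sweedler ::
    "('k, 'a, 'm) hopf_scheme \<Rightarrow> ('k, 'c, 'p) module_scheme \<Rightarrow> 'a \<Rightarrow> ('a \<Rightarrow> 'a \<Rightarrow> 'c) \<Rightarrow> 'c"
  where "sweedler A M x f = tensor_lift M f (comult A x)"

definition sweedler3 ::
    "('k, 'a, 'm) hopf_scheme \<Rightarrow> ('k, 'c, 'p) module_scheme \<Rightarrow> 'a \<Rightarrow> ('a \<Rightarrow> 'a \<Rightarrow> 'a \<Rightarrow> 'c) \<Rightarrow> 'c"
  where "sweedler3 A M x f = sweedler A M x (\<lambda>x1 y. sweedler A M y (\<lambda>x2 x3. f x1 x2 x3))"

locale bialgebra = field R + assoc_algebra R A
  for R (structure) and A :: "('k, 'a, 'm) hopf_scheme" (structure) +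
  assumes comult_algebra_map: "comult A \<in> algebra_maps R A (tensor R A A)"
    and counit_algebra_map: "counit A \<in> algebra_maps R A (ground R)"
    and coassoc: "x \<in> carrier A \<Longrightarrow>
      sweedler A (tensor R A (tensor R A A)) x (\<lambda>y x3.
        sweedler A (tensor R A (tensor R A A)) y (\<lambda>x1 x2.
          pure_tensor R A (tensor R A A) x1 (pure_tensor R A A x2 x3))) =
      sweedler A (tensor R A (tensor R A A)) x (\<lambda>x1 y.
        sweedler A (tensor R A (tensor R A A)) y (\<lambda>x2 x3.
          pure_tensor R A (tensor R A A) x1 (pure_tensor R A A x2 x3)))"
    and counit_l: "x \<in> carrier A \<Longrightarrow> sweedler A A x (\<lambda>x1 x2. counit A x1 \<odot>\<^bsub>A\<^esub> x2) = x"
    and counit_r: "x \<in> carrier A \<Longrightarrow> sweedler A A x (\<lambda>x1 x2. counit A x2 \<odot>\<^bsub>A\<^esub> x1) = x"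

locale hopf_algebra = bialgebra R A
  for R (structure) and A :: "('k, 'a, 'm) hopf_scheme" (structure) +
  assumes antipode_linear: "antipode A \<in> linear_maps R A A"
    and antipode_l: "x \<in> carrier A \<Longrightarrow>
      sweedler A A x (\<lambda>x1 x2. antipode A x1 \<otimes>\<^bsub>A\<^esub> x2) = counit A x \<odot>\<^bsub>A\<^esub> \<one>\<^bsub>A\<^esub>"
    and antipode_r: "x \<in> carrier A \<Longrightarrow>
      sweedler A A x (\<lambda>x1 x2. x1 \<otimes>\<^bsub>A\<^esub> antipode A x2) = counit A x \<odot>\<^bsub>A\<^esub> \<one>\<^bsub>A\<^esub>"

locale cocomm_hopf_algebra = hopf_algebra R A
  for R (structure) and A :: "('k, 'a, 'm) hopf_scheme" (structure) +
  assumes cocomm: "x \<in> carrier A \<Longrightarrow>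
      sweedler A (tensor R A A) x (\<lambda>x1 x2. pure_tensor R A A x2 x1) = comult A x"

text \<open>
  Hopf algebra maps are extensional, so that two of them are equal as soon as they agree on
  the carrier. Compatibility with the antipodes is automatic.
\<close>

definition hopf_maps ::
    "('k, 'r) ring_scheme \<Rightarrow> ('k, 'a, 'm) hopf_scheme \<Rightarrow> ('k, 'b, 'n) hopf_scheme \<Rightarrow> ('a \<Rightarrow> 'b) set"
  where "hopf_maps R A B = {f \<in> extensional (carrier A). f \<in> algebra_maps R A B \<and>
      (\<forall>x \<in> carrier A.
        comult B (f x) = sweedler A (tensor R B B) x (\<lambda>x1 x2. pure_tensor R B B (f x1) (f x2)) \<and>
        counit B (f x) = counit A x)}"

definition ad :: "('k, 'a, 'm) hopf_scheme \<Rightarrow> 'a \<Rightarrow> 'a \<Rightarrow> 'a"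
  where "ad A x y = sweedler A A x (\<lambda>x1 x2. x1 \<otimes>\<^bsub>A\<^esub> y \<otimes>\<^bsub>A\<^esub> antipode A x2)"

definition HKer ::
    "('k, 'r) ring_scheme \<Rightarrow> ('k, 'a, 'm) hopf_scheme \<Rightarrow> ('k, 'b, 'n) hopf_scheme \<Rightarrow> ('a \<Rightarrow> 'b) \<Rightarrow> 'a set"
  where "HKer R A B f = {x \<in> carrier A.
      sweedler A (tensor R A B) x (\<lambda>x1 x2. pure_tensor R A B x1 (f x2)) = pure_tensor R A B x \<one>\<^bsub>B\<^esub>}"

text \<open>
  The Hopf algebra structure induced on a subset \<open>N\<close> of \<open>A\<close>: the coproduct of \<open>x\<close> is the element
  of \<open>N \<otimes> N\<close> whose image under the map \<open>N \<otimes> N \<rightarrow> A \<otimes> A\<close> induced by the inclusion is the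
  coproduct of \<open>x\<close> in \<open>A\<close>.
\<close>

definition sub_hopf :: "('k, 'r) ring_scheme \<Rightarrow> ('k, 'a) hopf \<Rightarrow> 'a set \<Rightarrow> ('k, 'a) hopf"
  where "sub_hopf R A N = A\<lparr>carrier := N,
      comult := (\<lambda>x. THE t. t \<in> carrier (tensor R (A\<lparr>carrier := N\<rparr>) (A\<lparr>carrier := N\<rparr>)) \<and>
        tensor_lift (tensor R A A) (pure_tensor R A A) t = comult A x)\<rparr>"


section \<open>Crossed modules and 2-crossed modules\<close>

locale module_bialgebra = H: hopf_algebra R H + I: bialgebra R I
  for R :: "('k, 'r) ring_scheme" and H :: "('k, 'h, 'm) hopf_scheme"
    and I :: "('k, 'i, 'n) hopf_scheme" and act :: "'h \<Rightarrow> 'i \<Rightarrow> 'i" +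
  assumes act_bilinear: "act \<in> bilinear_maps R H I I"
    and act_one_l: "v \<in> carrier I \<Longrightarrow> act \<one>\<^bsub>H\<^esub> v = v"
    and act_mult_l: "\<lbrakk>x \<in> carrier H; y \<in> carrier H; v \<in> carrier I\<rbrakk> \<Longrightarrow>
      act (x \<otimes>\<^bsub>H\<^esub> y) v = act x (act y v)"
    and act_one: "x \<in> carrier H \<Longrightarrow> act x \<one>\<^bsub>I\<^esub> = counit H x \<odot>\<^bsub>I\<^esub> \<one>\<^bsub>I\<^esub>"
    and act_mult: "\<lbrakk>x \<in> carrier H; u \<in> carrier I; v \<in> carrier I\<rbrakk> \<Longrightarrow>
      act x (u \<otimes>\<^bsub>I\<^esub> v) = sweedler H I x (\<lambda>x1 x2. act x1 u \<otimes>\<^bsub>I\<^esub> act x2 v)"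
    and act_comult: "\<lbrakk>x \<in> carrier H; v \<in> carrier I\<rbrakk> \<Longrightarrow>
      comult I (act x v) = sweedler H (tensor R I I) x (\<lambda>x1 x2.
        sweedler I (tensor R I I) v (\<lambda>v1 v2. pure_tensor R I I (act x1 v1) (act x2 v2)))"
    and act_counit: "\<lbrakk>x \<in> carrier H; v \<in> carrier I\<rbrakk> \<Longrightarrow>
      counit I (act x v) = counit H x \<otimes>\<^bsub>R\<^esub> counit I v"

locale crossed_module =
  H: cocomm_hopf_algebra R H + I: cocomm_hopf_algebra R I + module_bialgebra R H I act
  for R :: "('k, 'r) ring_scheme" and H :: "('k, 'h, 'm) hopf_scheme"
    and I :: "('k, 'i, 'n) hopf_scheme" and bd :: "'i \<Rightarrow> 'h" and act :: "'h \<Rightarrow> 'i \<Rightarrow> 'i" +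
  assumes bd_hopf_map: "bd \<in> hopf_maps R I H"
    and bd_act: "\<lbrakk>x \<in> carrier H; v \<in> carrier I\<rbrakk> \<Longrightarrow> bd (act x v) = ad H x (bd v)"
    and peiffer_id: "\<lbrakk>u \<in> carrier I; v \<in> carrier I\<rbrakk> \<Longrightarrow> act (bd u) v = ad I u v"

text \<open>
  The action of \<open>I\<close> on \<open>K\<close> defined by a Peiffer lifting \<open>P\<close>: \<open>x\<close> sends \<open>k\<close> to the sum
  of the \<open>k' {bd2 (S k''), x}\<close>.
\<close>

definition lifting_act ::
    "('k, 'b, 'm) hopf_scheme \<Rightarrow> ('b \<Rightarrow> 'i) \<Rightarrow> ('i \<Rightarrow> 'i \<Rightarrow> 'b) \<Rightarrow> 'i \<Rightarrow> 'b \<Rightarrow> 'b"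
  where "lifting_act K bd2 P x k =
      sweedler K K k (\<lambda>k1 k2. k1 \<otimes>\<^bsub>K\<^esub> P (bd2 (antipode K k2)) x)"

locale two_crossed_module =
  H: cocomm_hopf_algebra R H + I: cocomm_hopf_algebra R I + K: cocomm_hopf_algebra R K +
  HI: module_bialgebra R H I act1 + HK: module_bialgebra R H K act2
  for R :: "('k, 'r) ring_scheme" and H :: "('k, 'h, 'm) hopf_scheme"
    and I :: "('k, 'i, 'n) hopf_scheme" and K :: "('k, 'b, 'p) hopf_scheme"
    and bd2 :: "'b \<Rightarrow> 'i" and bd1 :: "'i \<Rightarrow> 'h"
    and act1 :: "'h \<Rightarrow> 'i \<Rightarrow> 'i" and act2 :: "'h \<Rightarrow> 'b \<Rightarrow> 'b" and P :: "'i \<Rightarrow> 'i \<Rightarrow> 'b" +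
  assumes bd2_hopf_map: "bd2 \<in> hopf_maps R K I"
    and bd1_hopf_map: "bd1 \<in> hopf_maps R I H"
    and complex: "k \<in> carrier K \<Longrightarrow> bd1 (bd2 k) = counit K k \<odot>\<^bsub>H\<^esub> \<one>\<^bsub>H\<^esub>"
    and lifting_bilinear: "P \<in> bilinear_maps R I I K"
    and lifting_equivariant: "\<lbrakk>a \<in> carrier H; x \<in> carrier I; y \<in> carrier I\<rbrakk> \<Longrightarrow>
      act2 a (P x y) = sweedler H K a (\<lambda>a1 a2. P (act1 a1 x) (act1 a2 y))"
    and bd2_equivariant: "\<lbrakk>a \<in> carrier H; k \<in> carrier K\<rbrakk> \<Longrightarrow> bd2 (act2 a k) = act1 a (bd2 k)"
    and bd1_equivariant: "\<lbrakk>a \<in> carrier H; x \<in> carrier I\<rbrakk> \<Longrightarrow> bd1 (act1 a x) = ad H a (bd1 x)"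
    and bd2_lifting: "\<lbrakk>x \<in> carrier I; y \<in> carrier I\<rbrakk> \<Longrightarrow>
      bd2 (P x y) = sweedler I I x (\<lambda>x1 x2. sweedler I I y (\<lambda>y1 y2.
        ad I x1 y1 \<otimes>\<^bsub>I\<^esub> act1 (bd1 x2) (antipode I y2)))"
    and lifting_bd2: "\<lbrakk>k \<in> carrier K; l \<in> carrier K\<rbrakk> \<Longrightarrow>
      P (bd2 k) (bd2 l) = sweedler K K l (\<lambda>l1 l2. ad K k l1 \<otimes>\<^bsub>K\<^esub> antipode K l2)"
    and lifting_mult_r: "\<lbrakk>x \<in> carrier I; y \<in> carrier I; z \<in> carrier I\<rbrakk> \<Longrightarrow>
      P x (y \<otimes>\<^bsub>I\<^esub> z) = sweedler3 I K x (\<lambda>x1 x2 x3. sweedler I K y (\<lambda>y1 y2.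
        P x1 y1 \<otimes>\<^bsub>K\<^esub> lifting_act K bd2 P (act1 (bd1 x2) y2) (P x3 z)))"
    and lifting_mult_l: "\<lbrakk>x \<in> carrier I; y \<in> carrier I; z \<in> carrier I\<rbrakk> \<Longrightarrow>
      P (x \<otimes>\<^bsub>I\<^esub> y) z = sweedler I K x (\<lambda>x1 x2. sweedler I K y (\<lambda>y1 y2. sweedler I K z (\<lambda>z1 z2.
        P x1 (ad I y1 z1) \<otimes>\<^bsub>K\<^esub> act2 (bd1 x2) (P y2 z2))))"
    and lifting_bd2_mixed: "\<lbrakk>k \<in> carrier K; x \<in> carrier I\<rbrakk> \<Longrightarrow>
      sweedler K K k (\<lambda>k1 k2. sweedler I K x (\<lambda>x1 x2. P (bd2 k1) x1 \<otimes>\<^bsub>K\<^esub> P x2 (bd2 k2))) =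
      sweedler K K k (\<lambda>k1 k2. k1 \<otimes>\<^bsub>K\<^esub> act2 (bd1 x) (antipode K k2))"
    and lifting_crossed: "crossed_module R I K bd2 (lifting_act K bd2 P)"


section \<open>Simplicial Hopf algebras and the Moore complex\<close>

text \<open>
  \<open>face X n i\<close> is the map \<open>d\<^sub>i\<close> from \<open>H\<^sub>n\<close> to \<open>H\<^sub>n\<^sub>-\<^sub>1\<close> and \<open>degen X n j\<close> the map \<open>s\<^sub>j\<close> from
  \<open>H\<^sub>n\<close> to \<open>H\<^sub>n\<^sub>+\<^sub>1\<close>.
\<close>

record ('k, 'a) simp_hopf =
  level :: "nat \<Rightarrow> ('k, 'a) hopf"
  face :: "nat \<Rightarrow> nat \<Rightarrow> 'a \<Rightarrow> 'a"
  degen :: "nat \<Rightarrow> nat \<Rightarrow> 'a \<Rightarrow> 'a"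

locale simplicial_hopf =
  fixes R :: "('k, 'r) ring_scheme" and X :: "('k, 'a) simp_hopf"
  assumes level_hopf: "cocomm_hopf_algebra R (level X n)"
    and face_hopf_map: "i \<le> Suc n \<Longrightarrow> face X (Suc n) i \<in> hopf_maps R (level X (Suc n)) (level X n)"
    and degen_hopf_map: "j \<le> n \<Longrightarrow> degen X n j \<in> hopf_maps R (level X n) (level X (Suc n))"
    and face_face: "\<lbrakk>i \<le> j; j \<le> Suc n; x \<in> carrier (level X (Suc (Suc n)))\<rbrakk> \<Longrightarrow>
      face X (Suc n) i (face X (Suc (Suc n)) (Suc j) x) =
      face X (Suc n) j (face X (Suc (Suc n)) i x)"
    and degen_degen: "\<lbrakk>i \<le> j; j \<le> n; x \<in> carrier (level X n)\<rbrakk> \<Longrightarrow>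
      degen X (Suc n) i (degen X n j x) = degen X (Suc n) (Suc j) (degen X n i x)"
    and face_degen_less: "\<lbrakk>i \<le> j; j \<le> n; x \<in> carrier (level X (Suc n))\<rbrakk> \<Longrightarrow>
      face X (Suc (Suc n)) i (degen X (Suc n) (Suc j) x) = degen X n j (face X (Suc n) i x)"
    and face_degen_same: "\<lbrakk>j \<le> n; x \<in> carrier (level X n)\<rbrakk> \<Longrightarrow>
      face X (Suc n) j (degen X n j x) = x"
    and face_degen_Suc: "\<lbrakk>j \<le> n; x \<in> carrier (level X n)\<rbrakk> \<Longrightarrow>
      face X (Suc n) (Suc j) (degen X n j x) = x"
    and face_degen_greater: "\<lbrakk>j < i; i \<le> Suc n; x \<in> carrier (level X (Suc n))\<rbrakk> \<Longrightarrow>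
      face X (Suc (Suc n)) (Suc i) (degen X (Suc n) j x) = degen X n j (face X (Suc n) i x)"

definition moore_carrier :: "('k, 'r) ring_scheme \<Rightarrow> ('k, 'a) simp_hopf \<Rightarrow> nat \<Rightarrow> 'a set"
  where "moore_carrier R X n = {x \<in> carrier (level X n).
      \<forall>i < n. x \<in> HKer R (level X n) (level X (n - 1)) (face X n i)}"

definition moore :: "('k, 'r) ring_scheme \<Rightarrow> ('k, 'a) simp_hopf \<Rightarrow> nat \<Rightarrow> ('k, 'a) hopf"
  where "moore R X n = sub_hopf R (level X n) (moore_carrier R X n)"

definition moore_bd :: "('k, 'r) ring_scheme \<Rightarrow> ('k, 'a) simp_hopf \<Rightarrow> nat \<Rightarrow> 'a \<Rightarrow> 'a"
  where "moore_bd R X n = restrict (face X n n) (moore_carrier R X n)"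

text \<open>
  The \<open>i\<close>-th term of the Moore complex is the zero object when it is the image \<open>\<kappa> 1\<close> of the
  unit map (which is always injective, as it is split by the counit).
\<close>

definition moore_length_le :: "('k, 'r) ring_scheme \<Rightarrow> nat \<Rightarrow> ('k, 'a) simp_hopf \<Rightarrow> bool"
  where "moore_length_le R n X \<longleftrightarrow>
      (\<forall>i > n. moore_carrier R X i = (\<lambda>c. c \<odot>\<^bsub>level X i\<^esub> \<one>\<^bsub>level X i\<^esub>) ` carrier R)"


section \<open>Categories and functors\<close>

record ('o, 'm) cat =
  Ob :: "'o set"
  Hom :: "'o \<Rightarrow> 'o \<Rightarrow> 'm set"
  Ident :: "'o \<Rightarrow> 'm"
  Comp :: "'o \<Rightarrow> 'o \<Rightarrow> 'o \<Rightarrow> 'm \<Rightarrow> 'm \<Rightarrow> 'm"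

text \<open>
  \<open>Comp C x y z g f\<close> is the composite of \<open>f : x \<rightarrow> y\<close> and \<open>g : y \<rightarrow> z\<close>. Morphisms are always
  considered together with their domain and codomain, so hom-sets need not be disjoint.
\<close>

locale category =
  fixes C :: "('o, 'm) cat"
  assumes ident_in: "x \<in> Ob C \<Longrightarrow> Ident C x \<in> Hom C x x"
    and comp_in: "\<lbrakk>x \<in> Ob C; y \<in> Ob C; z \<in> Ob C; f \<in> Hom C x y; g \<in> Hom C y z\<rbrakk> \<Longrightarrow>
      Comp C x y z g f \<in> Hom C x z"
    and comp_ident_r: "\<lbrakk>x \<in> Ob C; y \<in> Ob C; f \<in> Hom C x y\<rbrakk> \<Longrightarrow> Comp C x x y f (Ident C x) = f"
    and comp_ident_l: "\<lbrakk>x \<in> Ob C; y \<in> Ob C; f \<in> Hom C x y\<rbrakk> \<Longrightarrow> Comp C x y y (Ident C y) f = f"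
    and comp_assoc: "\<lbrakk>w \<in> Ob C; x \<in> Ob C; y \<in> Ob C; z \<in> Ob C;
        f \<in> Hom C w x; g \<in> Hom C x y; h \<in> Hom C y z\<rbrakk> \<Longrightarrow>
      Comp C w y z h (Comp C w x y g f) = Comp C w x z (Comp C x y z h g) f"

locale cat_functor = C: category C + D: category D
  for C :: "('o, 'm) cat" and D :: "('p, 'n) cat"
    and Fo :: "'o \<Rightarrow> 'p" and Fm :: "'o \<Rightarrow> 'o \<Rightarrow> 'm \<Rightarrow> 'n" +
  assumes ob_in: "x \<in> Ob C \<Longrightarrow> Fo x \<in> Ob D"
    and hom_in: "\<lbrakk>x \<in> Ob C; y \<in> Ob C; f \<in> Hom C x y\<rbrakk> \<Longrightarrow> Fm x y f \<in> Hom D (Fo x) (Fo y)"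
    and map_ident: "x \<in> Ob C \<Longrightarrow> Fm x x (Ident C x) = Ident D (Fo x)"
    and map_comp: "\<lbrakk>x \<in> Ob C; y \<in> Ob C; z \<in> Ob C; f \<in> Hom C x y; g \<in> Hom C y z\<rbrakk> \<Longrightarrow>
      Fm x z (Comp C x y z g f) = Comp D (Fo x) (Fo y) (Fo z) (Fm y z g) (Fm x y f)"

definition simp_hopf_maps ::
    "('k, 'r) ring_scheme \<Rightarrow> ('k, 'a) simp_hopf \<Rightarrow> ('k, 'a) simp_hopf \<Rightarrow> (nat \<Rightarrow> 'a \<Rightarrow> 'a) set"
  where "simp_hopf_maps R X Y = {f.
      (\<forall>n. f n \<in> hopf_maps R (level X n) (level Y n)) \<and>
      (\<forall>n. \<forall>i \<le> Suc n. \<forall>x \<in> carrier (level X (Suc n)).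
        f n (face X (Suc n) i x) = face Y (Suc n) i (f (Suc n) x)) \<and>
      (\<forall>n. \<forall>j \<le> n. \<forall>x \<in> carrier (level X n).
        f (Suc n) (degen X n j x) = degen Y n j (f n x))}"

definition SimpHopf_le ::
    "('k, 'r) ring_scheme \<Rightarrow> nat \<Rightarrow> (('k, 'a) simp_hopf, nat \<Rightarrow> 'a \<Rightarrow> 'a) cat"
  where "SimpHopf_le R n = \<lparr>
      Ob = {X. simplicial_hopf R X \<and> moore_length_le R n X},
      Hom = simp_hopf_maps R,
      Ident = (\<lambda>X m. restrict (\<lambda>x. x) (carrier (level X m))),
      Comp = (\<lambda>X Y Z g f m. compose (carrier (level X m)) (g m) (f m))\<rparr>"

record ('k, 'a) two_crossed =
  base_alg :: "('k, 'a) hopf"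
  mid_alg :: "('k, 'a) hopf"
  top_alg :: "('k, 'a) hopf"
  bdry2 :: "'a \<Rightarrow> 'a"
  bdry1 :: "'a \<Rightarrow> 'a"
  act_mid :: "'a \<Rightarrow> 'a \<Rightarrow> 'a"
  act_top :: "'a \<Rightarrow> 'a \<Rightarrow> 'a"
  lifting :: "'a \<Rightarrow> 'a \<Rightarrow> 'a"

text \<open>A morphism is the triple \<open>(f0, f1, f2)\<close> of its components on base, middle and top.\<close>

definition two_crossed_maps ::
    "('k, 'r) ring_scheme \<Rightarrow> ('k, 'a) two_crossed \<Rightarrow> ('k, 'a) two_crossed \<Rightarrow>
      (('a \<Rightarrow> 'a) \<times> ('a \<Rightarrow> 'a) \<times> ('a \<Rightarrow> 'a)) set"
  where "two_crossed_maps R X Y = {(f0, f1, f2).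
      f0 \<in> hopf_maps R (base_alg X) (base_alg Y) \<and>
      f1 \<in> hopf_maps R (mid_alg X) (mid_alg Y) \<and>
      f2 \<in> hopf_maps R (top_alg X) (top_alg Y) \<and>
      (\<forall>k \<in> carrier (top_alg X). f1 (bdry2 X k) = bdry2 Y (f2 k)) \<and>
      (\<forall>x \<in> carrier (mid_alg X). f0 (bdry1 X x) = bdry1 Y (f1 x)) \<and>
      (\<forall>a \<in> carrier (base_alg X). \<forall>x \<in> carrier (mid_alg X).
        f1 (act_mid X a x) = act_mid Y (f0 a) (f1 x)) \<and>
      (\<forall>a \<in> carrier (base_alg X). \<forall>k \<in> carrier (top_alg X).
        f2 (act_top X a k) = act_top Y (f0 a) (f2 k)) \<and>
      (\<forall>x \<in> carrier (mid_alg X). \<forall>y \<in> carrier (mid_alg X).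
        f2 (lifting X x y) = lifting Y (f1 x) (f1 y))}"

definition X2Hopf ::
    "('k, 'r) ring_scheme \<Rightarrow>
      (('k, 'a) two_crossed, ('a \<Rightarrow> 'a) \<times> ('a \<Rightarrow> 'a) \<times> ('a \<Rightarrow> 'a)) cat"
  where "X2Hopf R = \<lparr>
      Ob = {X. two_crossed_module R (base_alg X) (mid_alg X) (top_alg X)
        (bdry2 X) (bdry1 X) (act_mid X) (act_top X) (lifting X)},
      Hom = two_crossed_maps R,
      Ident = (\<lambda>X. (restrict (\<lambda>x. x) (carrier (base_alg X)),
        restrict (\<lambda>x. x) (carrier (mid_alg X)), restrict (\<lambda>x. x) (carrier (top_alg X)))),
      Comp = (\<lambda>X Y Z (g0, g1, g2) (f0, f1, f2). (compose (carrier (base_alg X)) g0 f0,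
        compose (carrier (mid_alg X)) g1 f1, compose (carrier (top_alg X)) g2 f2))\<rparr>"


section \<open>The functor\<close>

definition X2_ob :: "('k, 'r) ring_scheme \<Rightarrow> ('k, 'a) simp_hopf \<Rightarrow> ('k, 'a) two_crossed"
  where "X2_ob R X = \<lparr>
      base_alg = level X 0,
      mid_alg = moore R X 1,
      top_alg = moore R X 2,
      bdry2 = moore_bd R X 2,
      bdry1 = moore_bd R X 1,
      act_mid = (\<lambda>n m. ad (level X 1) (degen X 0 0 n) m),
      act_top = (\<lambda>n l. ad (level X 2) (degen X 1 1 (degen X 0 0 n)) l),
      lifting = (\<lambda>x y.
        sweedler (level X 1) (level X 2) x (\<lambda>x1 x2. sweedler (level X 1) (level X 2) y (\<lambda>y1 y2.
          ad (level X 2) (degen X 1 1 x1) (degen X 1 1 y1) \<otimes>\<^bsub>level X 2\<^esub>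
          antipode (level X 2) (ad (level X 2) (degen X 1 0 x2) (degen X 1 1 y2)))))\<rparr>"

definition X2_map ::
    "('k, 'r) ring_scheme \<Rightarrow> ('k, 'a) simp_hopf \<Rightarrow> ('k, 'a) simp_hopf \<Rightarrow> (nat \<Rightarrow> 'a \<Rightarrow> 'a) \<Rightarrow>
      ('a \<Rightarrow> 'a) \<times> ('a \<Rightarrow> 'a) \<times> ('a \<Rightarrow> 'a)"
  where "X2_map R X Y f =
      (f 0, restrict (f 1) (moore_carrier R X 1), restrict (f 2) (moore_carrier R X 2))"

end

theory Submission
  imports Defs
begin

text \<open>
  The axioms of a 2-crossed module are group identities in disguise. A cocommutative Hopf algebra is
  a group object in the category of cocommutative coalgebras: for every cocommutative coalgebra \<open>C\<close>
  the coalgebra maps \<open>C \<rightarrow> H\<close>, the generalized elements of \<open>H\<close>, form a group under convolution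
  (\<open>cgroup_group\<close>), and every Hopf algebra map induces a group homomorphism. A simplicial Hopf algebra
  thus gives a simplicial group for each \<open>C\<close>. The generalized elements of \<open>NH\<^sub>n\<close> are its Moore
  subgroups (\<open>moore_coalg_map\<close>): a generalized element that a Hopf algebra map sends to the trivial one
  takes its values in the Hopf kernel. In particular, if \<open>NH\<^sub>3\<close> is trivial, so is the third Moore group.

  In a simplicial group with trivial third Moore group, a product \<open>w\<close> of degenerate elements of
  dimension three that is killed by \<open>d\<^sub>0\<close>, \<open>d\<^sub>1\<close> and \<open>d\<^sub>2\<close> is trivial, and therefore \<open>d\<^sub>3 w = 1\<close>. Three
  choices of \<open>w\<close> give \<open>conj_via_bd\<close>, \<open>lift_bd_l\<close> and \<open>lift_bd_r\<close>: conjugation by \<open>s\<^sub>1d\<^sub>2k\<close> and by \<open>k\<close> agree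
  on \<open>N\<^sub>2\<close>, and there are formulas for the Peiffer lifting when one of its arguments is a boundary. The
  remaining axioms follow from these by calculations with commutators.

  To return from groups to Hopf algebras, let \<open>C\<close> be a tensor product of one copy of \<open>H\<^sub>0\<close>, \<open>NH\<^sub>1\<close> or
  \<open>NH\<^sub>2\<close> for each variable of the axiom, and let the generalized elements be the projections. Evaluated
  at a pure tensor, the group identity becomes the identity between Sweedler sums that the axiom
  states, because the coproduct of a pure tensor is computed factor by factor (\<open>sw_tensor0\<close>) and
  superfluous components are absorbed by counits (\<open>sw_proj12\<close>).

  The method needs \<open>NH\<^sub>n\<close> to be a Hopf algebra itself, in particular that the coproduct of \<open>H\<^sub>n\<close> maps it
  into \<open>NH\<^sub>n \<otimes> NH\<^sub>n\<close>. Over a field, a subspace is the image of a retraction \<open>r\<close>, and \<open>r\<close> may be chosen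
  such that \<open>id \<otimes> r\<close> fixes every tensor that the maps \<open>id \<otimes> f\<^sub>i\<close> kill, where \<open>f\<^sub>i\<close> are the maps that
  define the subspace (\<open>common_kernel_retraction\<close>). With coassociativity and cocommutativity this
  yields the claim (\<open>common_HKer_subcoalg\<close>).

  Functoriality is easy: a simplicial map is compatible with faces, degeneracies and Hopf algebra
  operations, hence with the Moore complex, the actions and the lifting.
\<close>

section \<open>Tensor products of vector spaces\<close>

(* keeps membership in lists in a form that is decided entry by entry *)
declare in_listsD [rule del] in_listsI [rule del]

locale ground_field = field R for R :: "('k, 'r) ring_scheme" (structure)
begin

abbreviation lin ::
    "('k, 'u, 'm) module_scheme \<Rightarrow> ('k, 'v, 'n) module_scheme \<Rightarrow> ('u \<Rightarrow> 'v) \<Rightarrow> bool"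
  where "lin M V f \<equiv> f \<in> linear_maps R M V"

abbreviation bil ::
    "('k, 'u, 'm) module_scheme \<Rightarrow> ('k, 'w, 'n) module_scheme \<Rightarrow> ('k, 'v, 'p) module_scheme \<Rightarrow>
      ('u \<Rightarrow> 'w \<Rightarrow> 'v) \<Rightarrow> bool"
  where "bil A B V f \<equiv> f \<in> bilinear_maps R A B V"

lemma mod_add_closed [simp]:
    "module R V \<Longrightarrow> u \<in> carrier V \<Longrightarrow> v \<in> carrier V \<Longrightarrow> u \<oplus>\<^bsub>V\<^esub> v \<in> carrier V"
  and mod_zero_closed [simp]: "module R V \<Longrightarrow> \<zero>\<^bsub>V\<^esub> \<in> carrier V"
  and mod_smult_closed [simp]:
    "module R V \<Longrightarrow> c \<in> carrier R \<Longrightarrow> v \<in> carrier V \<Longrightarrow> c \<odot>\<^bsub>V\<^esub> v \<in> carrier V"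
  and mod_minus_closed [simp]: "module R V \<Longrightarrow> v \<in> carrier V \<Longrightarrow> \<ominus>\<^bsub>V\<^esub> v \<in> carrier V"
  and mod_l_zero [simp]: "module R V \<Longrightarrow> v \<in> carrier V \<Longrightarrow> \<zero>\<^bsub>V\<^esub> \<oplus>\<^bsub>V\<^esub> v = v"
  and mod_r_zero [simp]: "module R V \<Longrightarrow> v \<in> carrier V \<Longrightarrow> v \<oplus>\<^bsub>V\<^esub> \<zero>\<^bsub>V\<^esub> = v"
  and mod_smult_zero [simp]: "module R V \<Longrightarrow> c \<in> carrier R \<Longrightarrow> c \<odot>\<^bsub>V\<^esub> \<zero>\<^bsub>V\<^esub> = \<zero>\<^bsub>V\<^esub>"
  and mod_zero_smult [simp]: "module R V \<Longrightarrow> v \<in> carrier V \<Longrightarrow> \<zero> \<odot>\<^bsub>V\<^esub> v = \<zero>\<^bsub>V\<^esub>"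
  and mod_one_smult [simp]: "module R V \<Longrightarrow> v \<in> carrier V \<Longrightarrow> \<one> \<odot>\<^bsub>V\<^esub> v = v"
  by (simp_all add: module.axioms(2) abelian_group.axioms abelian_monoid.a_closed
      abelian_monoid.zero_closed module.smult_closed abelian_group.a_inv_closed
      abelian_monoid.l_zero abelian_monoid.r_zero module.smult_r_null module.smult_l_null
      module.smult_one)

lemma mod_add_assoc:
    "module R V \<Longrightarrow> u \<in> carrier V \<Longrightarrow> v \<in> carrier V \<Longrightarrow> w \<in> carrier V \<Longrightarrow>
      (u \<oplus>\<^bsub>V\<^esub> v) \<oplus>\<^bsub>V\<^esub> w = u \<oplus>\<^bsub>V\<^esub> (v \<oplus>\<^bsub>V\<^esub> w)"
  and mod_add_comm:
    "module R V \<Longrightarrow> u \<in> carrier V \<Longrightarrow> v \<in> carrier V \<Longrightarrow> u \<oplus>\<^bsub>V\<^esub> v = v \<oplus>\<^bsub>V\<^esub> u"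
  and mod_add_lcomm:
    "module R V \<Longrightarrow> u \<in> carrier V \<Longrightarrow> v \<in> carrier V \<Longrightarrow> w \<in> carrier V \<Longrightarrow>
      u \<oplus>\<^bsub>V\<^esub> (v \<oplus>\<^bsub>V\<^esub> w) = v \<oplus>\<^bsub>V\<^esub> (u \<oplus>\<^bsub>V\<^esub> w)"
  and mod_smult_add:
    "module R V \<Longrightarrow> c \<in> carrier R \<Longrightarrow> u \<in> carrier V \<Longrightarrow> v \<in> carrier V \<Longrightarrow>
      c \<odot>\<^bsub>V\<^esub> (u \<oplus>\<^bsub>V\<^esub> v) = c \<odot>\<^bsub>V\<^esub> u \<oplus>\<^bsub>V\<^esub> c \<odot>\<^bsub>V\<^esub> v"
  and mod_add_smult:
    "module R V \<Longrightarrow> c \<in> carrier R \<Longrightarrow> d \<in> carrier R \<Longrightarrow> v \<in> carrier V \<Longrightarrow>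
      (c \<oplus> d) \<odot>\<^bsub>V\<^esub> v = c \<odot>\<^bsub>V\<^esub> v \<oplus>\<^bsub>V\<^esub> d \<odot>\<^bsub>V\<^esub> v"
  and mod_smult_smult:
    "module R V \<Longrightarrow> c \<in> carrier R \<Longrightarrow> d \<in> carrier R \<Longrightarrow> v \<in> carrier V \<Longrightarrow>
      (c \<otimes> d) \<odot>\<^bsub>V\<^esub> v = c \<odot>\<^bsub>V\<^esub> (d \<odot>\<^bsub>V\<^esub> v)"
  and mod_smult_lcomm:
    "module R V \<Longrightarrow> c \<in> carrier R \<Longrightarrow> d \<in> carrier R \<Longrightarrow> v \<in> carrier V \<Longrightarrow>
      c \<odot>\<^bsub>V\<^esub> (d \<odot>\<^bsub>V\<^esub> v) = d \<odot>\<^bsub>V\<^esub> (c \<odot>\<^bsub>V\<^esub> v)"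
  and mod_minus_smult:
    "module R V \<Longrightarrow> v \<in> carrier V \<Longrightarrow> \<ominus>\<^bsub>V\<^esub> v = (\<ominus> \<one>) \<odot>\<^bsub>V\<^esub> v"
  and mod_r_neg: "module R V \<Longrightarrow> v \<in> carrier V \<Longrightarrow> v \<oplus>\<^bsub>V\<^esub> \<ominus>\<^bsub>V\<^esub> v = \<zero>\<^bsub>V\<^esub>"
  and mod_l_neg: "module R V \<Longrightarrow> v \<in> carrier V \<Longrightarrow> \<ominus>\<^bsub>V\<^esub> v \<oplus>\<^bsub>V\<^esub> v = \<zero>\<^bsub>V\<^esub>"
  and mod_eq_iff_minus: "module R V \<Longrightarrow> u \<in> carrier V \<Longrightarrow> v \<in> carrier V \<Longrightarrow>
      u = v \<longleftrightarrow> u \<oplus>\<^bsub>V\<^esub> \<ominus>\<^bsub>V\<^esub> v = \<zero>\<^bsub>V\<^esub>"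
proof -
  assume "module R V"
  then interpret V: module R V .
  {
    assume "u \<in> carrier V" "v \<in> carrier V" "w \<in> carrier V"
    then show "(u \<oplus>\<^bsub>V\<^esub> v) \<oplus>\<^bsub>V\<^esub> w = u \<oplus>\<^bsub>V\<^esub> (v \<oplus>\<^bsub>V\<^esub> w)"
      by (simp add: V.M.a_assoc)
  next
    assume "u \<in> carrier V" "v \<in> carrier V"
    then show "u \<oplus>\<^bsub>V\<^esub> v = v \<oplus>\<^bsub>V\<^esub> u" by (simp add: V.M.a_comm)
  next
    assume "u \<in> carrier V" "v \<in> carrier V" "w \<in> carrier V"
    then show "u \<oplus>\<^bsub>V\<^esub> (v \<oplus>\<^bsub>V\<^esub> w) = v \<oplus>\<^bsub>V\<^esub> (u \<oplus>\<^bsub>V\<^esub> w)" by (simp add: V.M.a_lcomm)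
  next
    assume "c \<in> carrier R" "u \<in> carrier V" "v \<in> carrier V"
    then show "c \<odot>\<^bsub>V\<^esub> (u \<oplus>\<^bsub>V\<^esub> v) = c \<odot>\<^bsub>V\<^esub> u \<oplus>\<^bsub>V\<^esub> c \<odot>\<^bsub>V\<^esub> v" by (simp add: V.smult_r_distr)
  next
    assume "c \<in> carrier R" "d \<in> carrier R" "v \<in> carrier V"
    then show "(c \<oplus> d) \<odot>\<^bsub>V\<^esub> v = c \<odot>\<^bsub>V\<^esub> v \<oplus>\<^bsub>V\<^esub> d \<odot>\<^bsub>V\<^esub> v" by (simp add: V.smult_l_distr)
  next
    assume "c \<in> carrier R" "d \<in> carrier R" "v \<in> carrier V"
    then show "(c \<otimes> d) \<odot>\<^bsub>V\<^esub> v = c \<odot>\<^bsub>V\<^esub> (d \<odot>\<^bsub>V\<^esub> v)" by (simp add: V.smult_assoc1)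
  next
    assume "c \<in> carrier R" "d \<in> carrier R" "v \<in> carrier V"
    then show "c \<odot>\<^bsub>V\<^esub> (d \<odot>\<^bsub>V\<^esub> v) = d \<odot>\<^bsub>V\<^esub> (c \<odot>\<^bsub>V\<^esub> v)"
      by (metis V.smult_assoc1 m_comm)
  next
    assume "v \<in> carrier V"
    then show "\<ominus>\<^bsub>V\<^esub> v = (\<ominus> \<one>) \<odot>\<^bsub>V\<^esub> v" by (simp add: V.smult_l_minus)
  next
    assume "v \<in> carrier V"
    then show "v \<oplus>\<^bsub>V\<^esub> \<ominus>\<^bsub>V\<^esub> v = \<zero>\<^bsub>V\<^esub>" by (simp add: V.M.r_neg)
  next
    assume "v \<in> carrier V"
    then show "\<ominus>\<^bsub>V\<^esub> v \<oplus>\<^bsub>V\<^esub> v = \<zero>\<^bsub>V\<^esub>" by (simp add: V.M.l_neg)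
  next
    assume "u \<in> carrier V" "v \<in> carrier V"
    then show "u = v \<longleftrightarrow> u \<oplus>\<^bsub>V\<^esub> \<ominus>\<^bsub>V\<^esub> v = \<zero>\<^bsub>V\<^esub>"
      by (metis V.M.minus_equality V.M.minus_minus V.M.r_neg V.M.a_inv_closed)
  }
qed

lemma lin_closed: "lin M V f \<Longrightarrow> x \<in> carrier M \<Longrightarrow> f x \<in> carrier V"
  by (auto simp: linear_maps_def)

lemma lin_add: "lin M V f \<Longrightarrow> x \<in> carrier M \<Longrightarrow> y \<in> carrier M \<Longrightarrow> f (x \<oplus>\<^bsub>M\<^esub> y) = f x \<oplus>\<^bsub>V\<^esub> f y"
  unfolding linear_maps_def by blast

lemma lin_smult: "lin M V f \<Longrightarrow> c \<in> carrier R \<Longrightarrow> x \<in> carrier M \<Longrightarrow> f (c \<odot>\<^bsub>M\<^esub> x) = c \<odot>\<^bsub>V\<^esub> f x"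
  unfolding linear_maps_def by blast

lemma linI:
  assumes "\<And>x. x \<in> carrier M \<Longrightarrow> f x \<in> carrier V"
    and "\<And>x y. x \<in> carrier M \<Longrightarrow> y \<in> carrier M \<Longrightarrow> f (x \<oplus>\<^bsub>M\<^esub> y) = f x \<oplus>\<^bsub>V\<^esub> f y"
    and "\<And>c x. c \<in> carrier R \<Longrightarrow> x \<in> carrier M \<Longrightarrow> f (c \<odot>\<^bsub>M\<^esub> x) = c \<odot>\<^bsub>V\<^esub> f x"
  shows "lin M V f"
  unfolding linear_maps_def using assms by blast

lemma lin_zero:
  assumes "module R M" "module R V" "lin M V f"
  shows "f \<zero>\<^bsub>M\<^esub> = \<zero>\<^bsub>V\<^esub>"
proof -
  have "f (\<zero> \<odot>\<^bsub>M\<^esub> \<zero>\<^bsub>M\<^esub>) = \<zero> \<odot>\<^bsub>V\<^esub> f \<zero>\<^bsub>M\<^esub>"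
    using assms by (subst lin_smult) auto
  then show ?thesis using assms by (simp add: lin_closed[OF assms(3)])
qed

lemma lin_minus:
  assumes "module R M" "module R V" "lin M V f" "x \<in> carrier M"
  shows "f (\<ominus>\<^bsub>M\<^esub> x) = \<ominus>\<^bsub>V\<^esub> f x"
  using assms by (simp add: mod_minus_smult lin_smult lin_closed[OF assms(3)])

lemma lin_comp:
  assumes "lin M V f" "lin V W g"
  shows "lin M W (\<lambda>x. g (f x))"
  by (rule linI) (simp_all add: assms lin_closed[OF assms(2)] lin_closed[OF assms(1)]
      lin_add[OF assms(1)] lin_add[OF assms(2)] lin_smult[OF assms(1)] lin_smult[OF assms(2)])

lemma lin_cong:
  assumes "lin M V f" "\<And>x. x \<in> carrier M \<Longrightarrow> f x = g x" "module R M"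
  shows "lin M V g"
  by (rule linI) (simp_all flip: assms(2) add: assms(1,3) lin_closed[OF assms(1)]
      lin_add[OF assms(1)] lin_smult[OF assms(1)])

lemma lin_id [simp]: "lin M M (\<lambda>x. x)"
  by (auto simp: linear_maps_def)

lemma bilI:
  "(\<And>a. a \<in> carrier A \<Longrightarrow> lin B V (\<lambda>b. f a b)) \<Longrightarrow> (\<And>b. b \<in> carrier B \<Longrightarrow> lin A V (\<lambda>a. f a b)) \<Longrightarrow>
    bil A B V f"
  by (auto simp: bilinear_maps_def)

lemma bil_l: "bil A B V f \<Longrightarrow> b \<in> carrier B \<Longrightarrow> lin A V (\<lambda>a. f a b)"
  by (auto simp: bilinear_maps_def)

lemma bil_r: "bil A B V f \<Longrightarrow> a \<in> carrier A \<Longrightarrow> lin B V (\<lambda>b. f a b)"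
  by (auto simp: bilinear_maps_def)

lemma bil_closed:
  "bil A B V f \<Longrightarrow> a \<in> carrier A \<Longrightarrow> b \<in> carrier B \<Longrightarrow> f a b \<in> carrier V"
  by (rule lin_closed[OF bil_r])

lemma ground_module [simp]: "module R (ground R)"
  by (rule moduleI)
    (auto simp: ground_def is_cring l_distr r_distr m_assoc
      intro!: abelian_groupI a_assoc a_comm add.l_inv_ex)

lemma ground_simps [simp]:
  "carrier (ground R) = carrier R" "mult (ground R) = mult R" "one (ground R) = one R"
  "zero (ground R) = zero R" "add (ground R) = add R" "smult (ground R) = mult R"
  by (auto simp: ground_def)

text \<open>This is the extension of \<open>f\<close> to the representatives of tensors, which are formal sums of pairs; on
  classes it becomes the lift of a bilinear map.\<close>

definition psum :: "('k, 'v, 'p) module_scheme \<Rightarrow> ('u \<Rightarrow> 'w \<Rightarrow> 'v) \<Rightarrow> ('u \<times> 'w) list \<Rightarrow> 'v"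
  where "psum V f xs = foldr (\<lambda>(a, b) s. f a b \<oplus>\<^bsub>V\<^esub> s) xs \<zero>\<^bsub>V\<^esub>"

lemma tensor_lift_psum: "tensor_lift V f t = psum V f (trep t)"
  by (simp add: tensor_lift_def psum_def)

lemma psum_Nil [simp]: "psum V f [] = \<zero>\<^bsub>V\<^esub>"
  and psum_Cons [simp]: "psum V f ((a, b) # xs) = f a b \<oplus>\<^bsub>V\<^esub> psum V f xs"
  by (auto simp: psum_def)

lemma psum_closed [simp]:
  "module R V \<Longrightarrow> xs \<in> lists (S \<times> T) \<Longrightarrow>
    (\<And>a b. a \<in> S \<Longrightarrow> b \<in> T \<Longrightarrow> f a b \<in> carrier V) \<Longrightarrow> psum V f xs \<in> carrier V"
  by (induction xs) auto

lemma psum_cong: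
  "xs \<in> lists (S \<times> T) \<Longrightarrow> (\<And>a b. a \<in> S \<Longrightarrow> b \<in> T \<Longrightarrow> f a b = g a b) \<Longrightarrow> psum V f xs = psum V g xs"
  by (induction xs) auto

lemma psum_append:
  assumes "module R V" "\<And>a b. a \<in> S \<Longrightarrow> b \<in> T \<Longrightarrow> f a b \<in> carrier V"
    "xs \<in> lists (S \<times> T)" "ys \<in> lists (S \<times> T)"
  shows "psum V f (xs @ ys) = psum V f xs \<oplus>\<^bsub>V\<^esub> psum V f ys"
  using assms(3)
proof (induction xs)
  case Nil
  then show ?case using assms by (simp add: psum_closed[of V ys S T])
next
  case (Cons p xs)
  then show ?case using assms
    by (cases p) (auto simp: mod_add_assoc psum_closed[of V _ S T])
qed

lemma psum_lin:
  assumes "module R V" "module R W" "lin V W g" "\<And>a b. a \<in> S \<Longrightarrow> b \<in> T \<Longrightarrow> f a b \<in> carrier V"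
    "xs \<in> lists (S \<times> T)"
  shows "g (psum V f xs) = psum W (\<lambda>a b. g (f a b)) xs"
  using assms(5)
proof (induction xs)
  case Nil
  then show ?case using assms by (simp add: lin_zero)
next
  case (Cons p xs)
  then show ?case using assms
    by (cases p) (auto simp: lin_add psum_closed[of V _ S T])
qed

lemma psum_add:
  assumes "module R V" "\<And>a b. a \<in> S \<Longrightarrow> b \<in> T \<Longrightarrow> f a b \<in> carrier V"
    "\<And>a b. a \<in> S \<Longrightarrow> b \<in> T \<Longrightarrow> g a b \<in> carrier V" "xs \<in> lists (S \<times> T)"
  shows "psum V (\<lambda>a b. f a b \<oplus>\<^bsub>V\<^esub> g a b) xs = psum V f xs \<oplus>\<^bsub>V\<^esub> psum V g xs"
  using assms(4)
proof (induction xs)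
  case Nil
  then show ?case using assms by simp
next
  case (Cons p xs)
  then show ?case using assms
    by (cases p) (auto simp: mod_add_assoc mod_add_lcomm psum_closed[of V _ S T])
qed

lemma psum_smult:
  assumes "module R V" "\<And>a b. a \<in> S \<Longrightarrow> b \<in> T \<Longrightarrow> f a b \<in> carrier V"
    "xs \<in> lists (S \<times> T)" "c \<in> carrier R"
  shows "psum V (\<lambda>a b. c \<odot>\<^bsub>V\<^esub> f a b) xs = c \<odot>\<^bsub>V\<^esub> psum V f xs"
  using assms(3)
proof (induction xs)
  case Nil
  then show ?case using assms by simp
next
  case (Cons p xs)
  then show ?case using assms
    by (cases p) (auto simp: mod_smult_add psum_closed[of V _ S T])
qed

lemma psum_zero: "module R V \<Longrightarrow> psum V (\<lambda>a b. \<zero>\<^bsub>V\<^esub>) xs = \<zero>\<^bsub>V\<^esub>"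
  by (induction xs) auto

lemma psum_swap:
  assumes "module R V" "xs \<in> lists (S \<times> T)" "ys \<in> lists (S' \<times> T')"
    "\<And>a b c d. a \<in> S \<Longrightarrow> b \<in> T \<Longrightarrow> c \<in> S' \<Longrightarrow> d \<in> T' \<Longrightarrow> f a b c d \<in> carrier V"
  shows "psum V (\<lambda>a b. psum V (f a b) ys) xs = psum V (\<lambda>c d. psum V (\<lambda>a b. f a b c d) xs) ys"
  using assms(2)
proof (induction xs)
  case Nil
  then show ?case using assms by (simp add: psum_zero)
next
  case (Cons p xs)
  obtain a b where p: "p = (a, b)" by (cases p)
  have "psum V (\<lambda>c d. f a b c d \<oplus>\<^bsub>V\<^esub> psum V (\<lambda>a b. f a b c d) xs) ys =
     psum V (f a b) ys \<oplus>\<^bsub>V\<^esub> psum V (\<lambda>c d. psum V (\<lambda>a b. f a b c d) xs) ys"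
    using Cons assms p by (intro psum_add[of V S' T']) (auto intro!: psum_closed[of V _ S T])
  then show ?case using Cons p by simp
qed

lemma psum_map:
  "psum V f (map (\<lambda>(a, b). (g a b, h a b)) xs) = psum V (\<lambda>a b. f (g a b) (h a b)) xs"
  by (induction xs) auto


subsection \<open>The tensor product is a module\<close>

lemma tensor_eq_in:
  assumes "module R A" "module R B" "tensor_eq R A B xs ys"
  shows "xs \<in> lists (carrier A \<times> carrier B) \<and> ys \<in> lists (carrier A \<times> carrier B)"
  using assms(3) by (induction) (use assms in auto)

lemma tclass_eq_iff:
  assumes "xs \<in> lists (carrier A \<times> carrier B)"
  shows "tclass R A B xs = tclass R A B ys \<longleftrightarrow> tensor_eq R A B xs ys"
proof
  assume "tclass R A B xs = tclass R A B ys"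
  moreover have "xs \<in> tclass R A B xs" using assms by (simp add: tclass_def tensor_eq.refl)
  ultimately show "tensor_eq R A B xs ys" by (auto simp: tclass_def intro: tensor_eq.sym)
next
  assume "tensor_eq R A B xs ys"
  then show "tclass R A B xs = tclass R A B ys"
    by (auto simp: tclass_def intro: tensor_eq.sym tensor_eq.trans)
qed

text \<open>The chosen representative of a class is congruent to any other, which makes the operations
  that are defined by means of it independent of the choice.\<close>

lemma trep_tclass:
  assumes "xs \<in> lists (carrier A \<times> carrier B)"
  shows "tensor_eq R A B xs (trep (tclass R A B xs))"
  using someI[of "\<lambda>ys. ys \<in> tclass R A B xs" xs] assms
  by (auto simp: tclass_def trep_def tensor_eq.refl)

text \<open>A bilinear map has the same value on congruent formal sums: this is the universal property
  of the tensor product on the level of representatives.\<close>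

lemma psum_tensor_eq:
  assumes "module R A" "module R B" "module R V" "bil A B V f" "tensor_eq R A B xs ys"
  shows "psum V f xs = psum V f ys"
proof -
  note cl = bil_closed[OF assms(4)]
  show ?thesis using assms(5)
proof (induction)
  case (append xs xs' ys ys')
  then show ?case
    using tensor_eq_in[OF assms(1,2) append(1)] tensor_eq_in[OF assms(1,2) append(2)] assms(1-4)
    by (simp add: psum_append[of V "carrier A" "carrier B"] cl del: lists_Int_eq)
next
  case (comm xs ys)
  then show ?case using assms(1-4)
    by (simp add: psum_append[of V "carrier A" "carrier B"] cl mod_add_comm
        psum_closed[of V _ "carrier A" "carrier B"])
next
  case (add_l a a' b)
  then show ?case using assms(1-4) lin_add[OF bil_l[OF assms(4), of b]]
    by (simp add: cl mod_add_assoc)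
next
  case (add_r a b b')
  then show ?case using assms(1-4) lin_add[OF bil_r[OF assms(4), of a]]
    by (simp add: cl mod_add_assoc)
next
  case (balanced c a b)
  then show ?case using assms(1-4) lin_smult[OF bil_r[OF assms(4), of a], of c b]
      lin_smult[OF bil_l[OF assms(4), of b], of c a]
    by simp
next
  case (zero b)
  then show ?case using assms(1-4) lin_zero[OF _ _ bil_l[OF assms(4), of b]]
    by simp
qed auto
qed

lemma tensor_lift_tclass:
  assumes "module R A" "module R B" "module R V" "bil A B V f"
    "xs \<in> lists (carrier A \<times> carrier B)"
  shows "tensor_lift V f (tclass R A B xs) = psum V f xs"
  using psum_tensor_eq[OF assms(1-4) trep_tclass[OF assms(5)]] by (simp add: tensor_lift_psum)

lemma tensor_carrier: "carrier (tensor R A B) = tclass R A B ` lists (carrier A \<times> carrier B)"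
  and tensor_zero: "\<zero>\<^bsub>tensor R A B\<^esub> = tclass R A B []"
  and tensor_one: "\<one>\<^bsub>tensor R A B\<^esub> = pure_tensor R A B \<one>\<^bsub>A\<^esub> \<one>\<^bsub>B\<^esub>"
  by (auto simp: tensor_def pure_tensor_def)

lemma tensor_add:
  assumes "xs \<in> lists (carrier A \<times> carrier B)" "ys \<in> lists (carrier A \<times> carrier B)"
  shows "tclass R A B xs \<oplus>\<^bsub>tensor R A B\<^esub> tclass R A B ys = tclass R A B (xs @ ys)"
  unfolding tensor_def using assms
  by (simp, subst eq_commute, subst tclass_eq_iff) (auto intro!: tensor_eq.append trep_tclass)

lemma map_smult_in_lists [simp]:
  "module R A \<Longrightarrow> c \<in> carrier R \<Longrightarrow> xs \<in> lists (carrier A \<times> carrier B) \<Longrightarrow>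
    map (\<lambda>(a, b). (c \<odot>\<^bsub>A\<^esub> a, b)) xs \<in> lists (carrier A \<times> carrier B)"
  by (induction xs) auto

lemma tensor_eq_smult:
  assumes "module R A" "module R B" "c \<in> carrier R" "tensor_eq R A B xs ys"
  shows "tensor_eq R A B (map (\<lambda>(a, b). (c \<odot>\<^bsub>A\<^esub> a, b)) xs) (map (\<lambda>(a, b). (c \<odot>\<^bsub>A\<^esub> a, b)) ys)"
  using assms(4)
proof (induction)
  case (refl xs)
  then show ?case using assms by (intro tensor_eq.refl) auto
next
  case (comm xs ys)
  then have "tensor_eq R A B (map (\<lambda>(a, b). (c \<odot>\<^bsub>A\<^esub> a, b)) xs @ map (\<lambda>(a, b). (c \<odot>\<^bsub>A\<^esub> a, b)) ys)
      (map (\<lambda>(a, b). (c \<odot>\<^bsub>A\<^esub> a, b)) ys @ map (\<lambda>(a, b). (c \<odot>\<^bsub>A\<^esub> a, b)) xs)"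
    using assms by (intro tensor_eq.comm) auto
  then show ?case by simp
next
  case (add_l a a' b)
  then show ?case using assms by (simp add: mod_smult_add tensor_eq.add_l)
next
  case (add_r a b b')
  then show ?case using assms by (simp add: tensor_eq.add_r)
next
  case (balanced c' a b)
  then show ?case using assms
    by (simp add: mod_smult_lcomm[of A c] tensor_eq.balanced)
next
  case (zero b)
  then show ?case using assms by (simp add: tensor_eq.zero)
qed (auto intro: tensor_eq.intros)

lemma tensor_smult:
  assumes "module R A" "module R B" "c \<in> carrier R" "xs \<in> lists (carrier A \<times> carrier B)"
  shows "c \<odot>\<^bsub>tensor R A B\<^esub> tclass R A B xs = tclass R A B (map (\<lambda>(a, b). (c \<odot>\<^bsub>A\<^esub> a, b)) xs)"
  unfolding tensor_def using assms
  by (simp, subst eq_commute, subst tclass_eq_iff) (auto intro!: tensor_eq_smult trep_tclass)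

lemma tclass_Cons:
  assumes "a \<in> carrier A" "b \<in> carrier B" "xs \<in> lists (carrier A \<times> carrier B)"
  shows "tclass R A B ((a, b) # xs) = pure_tensor R A B a b \<oplus>\<^bsub>tensor R A B\<^esub> tclass R A B xs"
  using assms by (simp add: pure_tensor_def tensor_add)

lemma tclass_in [simp]:
  "xs \<in> lists (carrier A \<times> carrier B) \<Longrightarrow> tclass R A B xs \<in> carrier (tensor R A B)"
  by (auto simp: tensor_carrier)

lemma pure_in [simp]:
  "a \<in> carrier A \<Longrightarrow> b \<in> carrier B \<Longrightarrow> pure_tensor R A B a b \<in> carrier (tensor R A B)"
  by (auto simp: pure_tensor_def)

lemma tensor_abelian_monoid: "abelian_monoid (tensor R A B)"
proof (rule abelian_monoidI)
  fix x y z assume "x \<in> carrier (tensor R A B)" "y \<in> carrier (tensor R A B)"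
    "z \<in> carrier (tensor R A B)"
  then show "x \<oplus>\<^bsub>tensor R A B\<^esub> y \<oplus>\<^bsub>tensor R A B\<^esub> z = x \<oplus>\<^bsub>tensor R A B\<^esub> (y \<oplus>\<^bsub>tensor R A B\<^esub> z)"
    unfolding tensor_carrier by (elim imageE) (simp add: tensor_add)
next
  fix x y assume "x \<in> carrier (tensor R A B)" "y \<in> carrier (tensor R A B)"
  then show "x \<oplus>\<^bsub>tensor R A B\<^esub> y = y \<oplus>\<^bsub>tensor R A B\<^esub> x"
    unfolding tensor_carrier
    by (elim imageE) (simp add: tensor_add tclass_eq_iff tensor_eq.comm)
qed (auto simp: tensor_carrier tensor_add tensor_zero)

lemma tensor_pure_smult:
  assumes "module R A" "module R B" "c \<in> carrier R" "a \<in> carrier A" "b \<in> carrier B"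
  shows "c \<odot>\<^bsub>tensor R A B\<^esub> pure_tensor R A B a b = pure_tensor R A B (c \<odot>\<^bsub>A\<^esub> a) b"
  using assms by (simp add: pure_tensor_def tensor_smult)

lemma tensor_smult_closed:
  assumes "module R A" "module R B" "c \<in> carrier R" "t \<in> carrier (tensor R A B)"
  shows "c \<odot>\<^bsub>tensor R A B\<^esub> t \<in> carrier (tensor R A B)"
proof -
  obtain xs where xs: "t = tclass R A B xs" "xs \<in> lists (carrier A \<times> carrier B)"
    using assms by (auto simp: tensor_carrier)
  then show ?thesis using assms by (simp add: tensor_smult)
qed

lemma tensor_smult_add:
  assumes "module R A" "module R B" "c \<in> carrier R" "s \<in> carrier (tensor R A B)"
    "t \<in> carrier (tensor R A B)"
  shows "c \<odot>\<^bsub>tensor R A B\<^esub> (s \<oplus>\<^bsub>tensor R A B\<^esub> t) =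
    c \<odot>\<^bsub>tensor R A B\<^esub> s \<oplus>\<^bsub>tensor R A B\<^esub> c \<odot>\<^bsub>tensor R A B\<^esub> t"
proof -
  obtain xs ys where xs: "s = tclass R A B xs" "xs \<in> lists (carrier A \<times> carrier B)"
    and ys: "t = tclass R A B ys" "ys \<in> lists (carrier A \<times> carrier B)"
    using assms by (auto simp: tensor_carrier)
  show ?thesis
    using xs ys assms(1-3) by (simp add: tensor_add tensor_smult)
qed

lemma tensor_induct0:
  assumes "t \<in> carrier (tensor R A B)" "P \<zero>\<^bsub>tensor R A B\<^esub>"
    "\<And>a b. a \<in> carrier A \<Longrightarrow> b \<in> carrier B \<Longrightarrow> P (pure_tensor R A B a b)"
    "\<And>s t. s \<in> carrier (tensor R A B) \<Longrightarrow> t \<in> carrier (tensor R A B) \<Longrightarrow> P s \<Longrightarrow> P t \<Longrightarrow>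
      P (s \<oplus>\<^bsub>tensor R A B\<^esub> t)"
  shows "P t"
proof -
  have "P (tclass R A B xs)" if "xs \<in> lists (carrier A \<times> carrier B)" for xs
    using that
  proof (induction xs)
    case Nil
    then show ?case using assms(2) by (simp add: tensor_zero)
  next
    case (Cons p xs)
    then show ?case using assms(3,4) by (cases p) (simp add: tclass_Cons)
  qed
  then show ?thesis using assms(1) by (auto simp: tensor_carrier)
qed

lemma pure_add_l:
    "a \<in> carrier A \<Longrightarrow> a' \<in> carrier A \<Longrightarrow> b \<in> carrier B \<Longrightarrow> module R A \<Longrightarrow>
    pure_tensor R A B (a \<oplus>\<^bsub>A\<^esub> a') b =
      pure_tensor R A B a b \<oplus>\<^bsub>tensor R A B\<^esub> pure_tensor R A B a' b"
  and pure_add_r: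
    "a \<in> carrier A \<Longrightarrow> b \<in> carrier B \<Longrightarrow> b' \<in> carrier B \<Longrightarrow> module R B \<Longrightarrow>
    pure_tensor R A B a (b \<oplus>\<^bsub>B\<^esub> b') =
      pure_tensor R A B a b \<oplus>\<^bsub>tensor R A B\<^esub> pure_tensor R A B a b'"
  and pure_balanced:
    "c \<in> carrier R \<Longrightarrow> a \<in> carrier A \<Longrightarrow> b \<in> carrier B \<Longrightarrow> module R A \<Longrightarrow>
    pure_tensor R A B (c \<odot>\<^bsub>A\<^esub> a) b = pure_tensor R A B a (c \<odot>\<^bsub>B\<^esub> b)"
  and pure_zero_l: "b \<in> carrier B \<Longrightarrow> module R A \<Longrightarrow> pure_tensor R A B \<zero>\<^bsub>A\<^esub> b = \<zero>\<^bsub>tensor R A B\<^esub>"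
  by (auto simp: pure_tensor_def tensor_add tclass_eq_iff tensor_zero intro: tensor_eq.intros)

lemma tensor_module [simp]:
  assumes A: "module R A" and B: "module R B"
  shows "module R (tensor R A B)"
proof -
  let ?T = "tensor R A B"
  interpret T: abelian_monoid ?T by (rule tensor_abelian_monoid)
  note [simp] = tensor_smult_closed[OF A B] tensor_smult_add[OF A B] T.a_closed T.zero_closed
  have zero_smult: "c \<odot>\<^bsub>?T\<^esub> \<zero>\<^bsub>?T\<^esub> = \<zero>\<^bsub>?T\<^esub>" if "c \<in> carrier R" for c
    using that A B by (simp add: tensor_zero tensor_smult)
  have one: "\<one> \<odot>\<^bsub>?T\<^esub> t = t" if "t \<in> carrier ?T" for t
    by (rule tensor_induct0[OF that])
      (use A B in \<open>simp_all add: zero_smult tensor_pure_smult\<close>)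
  have distr: "(c \<oplus> d) \<odot>\<^bsub>?T\<^esub> t = c \<odot>\<^bsub>?T\<^esub> t \<oplus>\<^bsub>?T\<^esub> d \<odot>\<^bsub>?T\<^esub> t"
    if "c \<in> carrier R" "d \<in> carrier R" "t \<in> carrier ?T" for c d t
  proof (rule tensor_induct0[OF that(3)], goal_cases)
    case 1
    then show ?case using that by (simp add: zero_smult)
  next
    case (2 a b)
    then show ?case using that A B by (simp add: tensor_pure_smult mod_add_smult pure_add_l)
  next
    case (3 s t)
    then show ?case using that by (simp add: T.a_ac)
  qed
  have assoc: "(c \<otimes> d) \<odot>\<^bsub>?T\<^esub> t = c \<odot>\<^bsub>?T\<^esub> (d \<odot>\<^bsub>?T\<^esub> t)"
    if "c \<in> carrier R" "d \<in> carrier R" "t \<in> carrier ?T" for c d t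
  proof (rule tensor_induct0[OF that(3)], goal_cases)
    case 1
    then show ?case using that by (simp add: zero_smult)
  next
    case (2 a b)
    then show ?case using that A B by (simp add: tensor_pure_smult mod_smult_smult)
  next
    case (3 s t)
    then show ?case using that by (simp add: T.a_ac)
  qed
  have zero: "\<zero> \<odot>\<^bsub>?T\<^esub> t = \<zero>\<^bsub>?T\<^esub>" if "t \<in> carrier ?T" for t
    by (rule tensor_induct0[OF that])
      (use A B in \<open>simp_all add: zero_smult tensor_pure_smult pure_zero_l\<close>)
  have "abelian_group ?T"
  proof (rule abelian_groupI)
    fix t assume t: "t \<in> carrier ?T"
    have "(\<ominus> \<one>) \<odot>\<^bsub>?T\<^esub> t \<oplus>\<^bsub>?T\<^esub> \<one> \<odot>\<^bsub>?T\<^esub> t = (\<ominus> \<one> \<oplus> \<one>) \<odot>\<^bsub>?T\<^esub> t"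
      using t by (simp add: distr)
    also have "\<dots> = \<zero>\<^bsub>?T\<^esub>" using t by (simp add: l_neg zero)
    finally show "\<exists>s \<in> carrier ?T. s \<oplus>\<^bsub>?T\<^esub> t = \<zero>\<^bsub>?T\<^esub>"
      using t by (intro bexI[of _ "(\<ominus> \<one>) \<odot>\<^bsub>?T\<^esub> t"]) (auto simp: one)
  qed (auto simp: T.a_ac)
  then show ?thesis
    using is_cring by (intro moduleI) (auto simp: one distr assoc)
qed

lemma tensor_induct [consumes 3, case_names pure add]:
  assumes "module R A" "module R B" "t \<in> carrier (tensor R A B)"
    "\<And>a b. a \<in> carrier A \<Longrightarrow> b \<in> carrier B \<Longrightarrow> P (pure_tensor R A B a b)"
    "\<And>s t. s \<in> carrier (tensor R A B) \<Longrightarrow> t \<in> carrier (tensor R A B) \<Longrightarrow> P s \<Longrightarrow> P t \<Longrightarrow>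
      P (s \<oplus>\<^bsub>tensor R A B\<^esub> t)"
  shows "P t"
proof (rule tensor_induct0[OF assms(3)])
  show "P \<zero>\<^bsub>tensor R A B\<^esub>"
    using assms(4)[of "\<zero>\<^bsub>A\<^esub>" "\<zero>\<^bsub>B\<^esub>"] assms(1,2) by (simp add: pure_zero_l)
qed (use assms in auto)

lemma pure_bil: "module R A \<Longrightarrow> module R B \<Longrightarrow> bil A B (tensor R A B) (pure_tensor R A B)"
  by (intro bilI linI) (auto simp: pure_add_l pure_add_r tensor_pure_smult pure_balanced)

lemma tensor_lift_pure:
  assumes "module R A" "module R B" "module R V" "bil A B V f" "a \<in> carrier A" "b \<in> carrier B"
  shows "tensor_lift V f (pure_tensor R A B a b) = f a b"
  using assms unfolding pure_tensor_def by (simp add: tensor_lift_tclass bil_closed[OF assms(4)])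

lemma tensor_lift_lin:
  assumes "module R A" "module R B" "module R V" "bil A B V f"
  shows "lin (tensor R A B) V (tensor_lift V f)"
proof (rule linI)
  have cl: "psum V f xs \<in> carrier V" if "xs \<in> lists (carrier A \<times> carrier B)" for xs
    using that assms by (intro psum_closed[of V _ "carrier A" "carrier B"] bil_closed[OF assms(4)])
  fix s assume "s \<in> carrier (tensor R A B)"
  then obtain xs where s: "s = tclass R A B xs" "xs \<in> lists (carrier A \<times> carrier B)"
    by (auto simp: tensor_carrier)
  then show "tensor_lift V f s \<in> carrier V"
    using assms cl by (simp add: tensor_lift_tclass)
  {
    fix t assume "t \<in> carrier (tensor R A B)"
    then obtain ys where t: "t = tclass R A B ys" "ys \<in> lists (carrier A \<times> carrier B)"
      by (auto simp: tensor_carrier)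
    show "tensor_lift V f (s \<oplus>\<^bsub>tensor R A B\<^esub> t) = tensor_lift V f s \<oplus>\<^bsub>V\<^esub> tensor_lift V f t"
      using s t assms
      by (simp add: tensor_add tensor_lift_tclass psum_append[of V "carrier A" "carrier B"]
          bil_closed[OF assms(4)])
  next
    fix c assume c: "c \<in> carrier R"
    then have "psum V (\<lambda>a b. f (c \<odot>\<^bsub>A\<^esub> a) b) xs = psum V (\<lambda>a b. c \<odot>\<^bsub>V\<^esub> f a b) xs"
      using assms c s lin_smult[OF bil_l[OF assms(4)]]
      by (intro psum_cong[of _ "carrier A" "carrier B"]) auto
    then show "tensor_lift V f (c \<odot>\<^bsub>tensor R A B\<^esub> s) = c \<odot>\<^bsub>V\<^esub> tensor_lift V f s"
      using s c assms
      by (simp add: tensor_smult tensor_lift_tclass psum_map psum_smult[of V "carrier A" "carrier B"]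
          bil_closed[OF assms(4)])
  }
qed

text \<open>Identities between linear maps on a tensor product need only be checked on pure tensors.\<close>

lemma lin_tensor_ext:
  assumes "module R A" "module R B" "module R V" "lin (tensor R A B) V f" "lin (tensor R A B) V g"
    "\<And>a b. a \<in> carrier A \<Longrightarrow> b \<in> carrier B \<Longrightarrow> f (pure_tensor R A B a b) = g (pure_tensor R A B a b)"
    "t \<in> carrier (tensor R A B)"
  shows "f t = g t"
  using assms(1,2,7)
  by (induction rule: tensor_induct)
    (use assms in \<open>auto simp: lin_add[OF assms(4)] lin_add[OF assms(5)]\<close>)

end

context ground_field
begin

section \<open>Subspaces, retractions and generalized inverses\<close>

definition vsubspace :: "('k, 'u, 'm) module_scheme \<Rightarrow> 'u set \<Rightarrow> bool"
  where "vsubspace A N \<longleftrightarrow> N \<subseteq> carrier A \<and> \<zero>\<^bsub>A\<^esub> \<in> N \<and> (\<forall>x \<in> N. \<forall>y \<in> N. x \<oplus>\<^bsub>A\<^esub> y \<in> N) \<and>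
    (\<forall>c \<in> carrier R. \<forall>x \<in> N. c \<odot>\<^bsub>A\<^esub> x \<in> N)"

lemma vsubspaceD:
  assumes "vsubspace A N"
  shows "x \<in> N \<Longrightarrow> x \<in> carrier A" "\<zero>\<^bsub>A\<^esub> \<in> N" "x \<in> N \<Longrightarrow> y \<in> N \<Longrightarrow> x \<oplus>\<^bsub>A\<^esub> y \<in> N"
    "c \<in> carrier R \<Longrightarrow> x \<in> N \<Longrightarrow> c \<odot>\<^bsub>A\<^esub> x \<in> N"
  using assms by (auto simp: vsubspace_def)

lemma vsubspace_minus:
  assumes "module R A" "vsubspace A N" "x \<in> N"
  shows "\<ominus>\<^bsub>A\<^esub> x \<in> N"
  using assms vsubspaceD[OF assms(2)] by (simp add: mod_minus_smult)

lemma vsubspace_module: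
  assumes "module R A" "vsubspace A N"
  shows "module R (A\<lparr>carrier := N\<rparr>)"
proof (rule moduleI)
  note N = vsubspaceD[OF assms(2)]
  show "abelian_group (A\<lparr>carrier := N\<rparr>)"
  proof (rule abelian_groupI)
    fix x assume "x \<in> carrier (A\<lparr>carrier := N\<rparr>)"
    then show "\<exists>y \<in> carrier (A\<lparr>carrier := N\<rparr>).
        y \<oplus>\<^bsub>A\<lparr>carrier := N\<rparr>\<^esub> x = \<zero>\<^bsub>A\<lparr>carrier := N\<rparr>\<^esub>"
      using assms N by (intro bexI[of _ "\<ominus>\<^bsub>A\<^esub> x"]) (auto simp: mod_l_neg vsubspace_minus)
  qed (use assms N in \<open>auto intro: mod_add_assoc mod_add_comm\<close>)
qed (use assms vsubspaceD[OF assms(2)] in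
    \<open>auto simp: is_cring mod_smult_add mod_add_smult mod_smult_smult\<close>)

text \<open>Every subspace has a complement, and the projection along it is a retraction.\<close>

lemma retraction_ex:
  fixes A :: "('k, 'u, 'm) module_scheme"
  assumes A: "module R A" and N: "vsubspace A N"
  obtains r where "lin A A r" "\<And>x. x \<in> carrier A \<Longrightarrow> r x \<in> N" "\<And>x. x \<in> N \<Longrightarrow> r x = x"
proof -
  note N' = vsubspaceD[OF N]
  (* W is maximal among the subspaces that meet N trivially, hence a complement of N *)
  define \<W> where "\<W> = {W. vsubspace A W \<and> W \<inter> N = {\<zero>\<^bsub>A\<^esub>}}"
  have "\<exists>W \<in> \<W>. \<forall>X \<in> \<W>. W \<subseteq> X \<longrightarrow> X = W"
  proof (rule subset_Zorn_nonempty)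
    have "{\<zero>\<^bsub>A\<^esub>} \<in> \<W>" using A N' by (auto simp: \<W>_def vsubspace_def)
    then show "\<W> \<noteq> {}" by blast
  next
    fix \<C> assume ne: "\<C> \<noteq> {}" and ch: "subset.chain \<W> \<C>"
    have sub: "vsubspace A W" "W \<inter> N = {\<zero>\<^bsub>A\<^esub>}" if "W \<in> \<C>" for W
      using ch that by (auto simp: subset_chain_def \<W>_def)
    note D = vsubspaceD[OF sub(1)]
    have "vsubspace A (\<Union>\<C>)"
      unfolding vsubspace_def
    proof (intro conjI ballI)
      show "\<Union>\<C> \<subseteq> carrier A" using D(1) by blast
      show "\<zero>\<^bsub>A\<^esub> \<in> \<Union>\<C>" using ne D(2) by blast
      fix x y assume "x \<in> \<Union>\<C>" "y \<in> \<Union>\<C>"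
      then obtain X Y where "x \<in> X" "y \<in> Y" "X \<in> \<C>" "Y \<in> \<C>" by blast
      moreover from this have "X \<subseteq> Y \<or> Y \<subseteq> X"
        using ch by (auto simp: subset_chain_def)
      ultimately obtain Z where "Z \<in> \<C>" "x \<in> Z" "y \<in> Z" by blast
      then show "x \<oplus>\<^bsub>A\<^esub> y \<in> \<Union>\<C>" using D(3) by blast
    next
      fix c x assume "c \<in> carrier R" "x \<in> \<Union>\<C>"
      then show "c \<odot>\<^bsub>A\<^esub> x \<in> \<Union>\<C>" using D(4) by blast
    qed
    moreover have "\<Union>\<C> \<inter> N = {\<zero>\<^bsub>A\<^esub>}" using sub(2) ne by blast
    ultimately show "\<Union>\<C> \<in> \<W>" by (simp add: \<W>_def)
  qed
  then obtain W where W: "vsubspace A W" "W \<inter> N = {\<zero>\<^bsub>A\<^esub>}"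
    and max: "\<And>X. vsubspace A X \<Longrightarrow> X \<inter> N = {\<zero>\<^bsub>A\<^esub>} \<Longrightarrow> W \<subseteq> X \<Longrightarrow> X = W"
    by (auto simp: \<W>_def)
  note W' = vsubspaceD[OF W(1)]
  interpret A: module R A by (rule A)
  have ex: "\<exists>n \<in> N. \<exists>w \<in> W. a = n \<oplus>\<^bsub>A\<^esub> w" if a: "a \<in> carrier A" for a
  proof (rule ccontr)
    assume no: "\<not> ?thesis"
    define X where "X = {w \<oplus>\<^bsub>A\<^esub> c \<odot>\<^bsub>A\<^esub> a |w c. w \<in> W \<and> c \<in> carrier R}"
    have "vsubspace A X"
      unfolding vsubspace_def
    proof (intro conjI ballI)
      show "X \<subseteq> carrier A" using a W' A by (auto simp: X_def)
      show "\<zero>\<^bsub>A\<^esub> \<in> X" unfolding X_def using a W' A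
        by (intro CollectI exI[of _ "\<zero>\<^bsub>A\<^esub>"] exI[of _ \<zero>]) auto
      fix x y assume "x \<in> X" "y \<in> X"
      then obtain w c w' c' where "x = w \<oplus>\<^bsub>A\<^esub> c \<odot>\<^bsub>A\<^esub> a" "y = w' \<oplus>\<^bsub>A\<^esub> c' \<odot>\<^bsub>A\<^esub> a" "w \<in> W" "w' \<in> W"
        "c \<in> carrier R" "c' \<in> carrier R" by (auto simp: X_def)
      moreover from this have "x \<oplus>\<^bsub>A\<^esub> y = (w \<oplus>\<^bsub>A\<^esub> w') \<oplus>\<^bsub>A\<^esub> (c \<oplus> c') \<odot>\<^bsub>A\<^esub> a"
        using a W' by (simp add: A.smult_l_distr A.M.a_ac)
      ultimately show "x \<oplus>\<^bsub>A\<^esub> y \<in> X" using W' unfolding X_def by blast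
    next
      fix d x assume "d \<in> carrier R" "x \<in> X"
      then obtain w c where "x = w \<oplus>\<^bsub>A\<^esub> c \<odot>\<^bsub>A\<^esub> a" "w \<in> W" "c \<in> carrier R" by (auto simp: X_def)
      moreover from this have "d \<odot>\<^bsub>A\<^esub> x = d \<odot>\<^bsub>A\<^esub> w \<oplus>\<^bsub>A\<^esub> (d \<otimes> c) \<odot>\<^bsub>A\<^esub> a"
        using a W' \<open>d \<in> carrier R\<close> by (simp add: A.smult_r_distr A.smult_assoc1)
      ultimately show "d \<odot>\<^bsub>A\<^esub> x \<in> X" using W' \<open>d \<in> carrier R\<close> unfolding X_def by blast
    qed
    moreover have "X \<inter> N = {\<zero>\<^bsub>A\<^esub>}"
    proof -
      have "x = \<zero>\<^bsub>A\<^esub>" if x: "x \<in> X" "x \<in> N" for x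
      proof -
        obtain w c where wc: "x = w \<oplus>\<^bsub>A\<^esub> c \<odot>\<^bsub>A\<^esub> a" "w \<in> W" "c \<in> carrier R"
          using x by (auto simp: X_def)
        have "c = \<zero>"
        proof (rule ccontr)
          assume "c \<noteq> \<zero>"
          then have c: "inv c \<in> carrier R" "inv c \<otimes> c = \<one>"
            using wc(3) by (auto simp: field_Units)
          have "c \<odot>\<^bsub>A\<^esub> a = x \<oplus>\<^bsub>A\<^esub> \<ominus>\<^bsub>A\<^esub> w"
            using wc a W' by (simp add: A.M.a_ac A.M.r_neg1 A.M.r_neg2 A.M.r_neg)
          then have "inv c \<odot>\<^bsub>A\<^esub> (c \<odot>\<^bsub>A\<^esub> a) = inv c \<odot>\<^bsub>A\<^esub> (x \<oplus>\<^bsub>A\<^esub> \<ominus>\<^bsub>A\<^esub> w)" by simp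
          then have "a = inv c \<odot>\<^bsub>A\<^esub> x \<oplus>\<^bsub>A\<^esub> inv c \<odot>\<^bsub>A\<^esub> (\<ominus>\<^bsub>A\<^esub> w)"
            using c wc a W' N' x by (simp flip: A.smult_assoc1 add: A.smult_r_distr)
          then show False
            using no c x(2) N'(4) W'(4) vsubspace_minus[OF A W(1) wc(2)] by blast
        qed
        then have "x \<in> W" using wc a W' by simp
        then show ?thesis using x W(2) by blast
      qed
      moreover have "\<zero>\<^bsub>A\<^esub> \<in> X" by (rule vsubspaceD(2)[OF \<open>vsubspace A X\<close>])
      ultimately show ?thesis using N'(2) by blast
    qed
    moreover have "W \<subseteq> X"
    proof
      fix w assume "w \<in> W"
      then show "w \<in> X" unfolding X_def using a W'
        by (intro CollectI exI[of _ w] exI[of _ \<zero>]) auto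
    qed
    ultimately have "X = W" by (rule max)
    moreover have "\<zero>\<^bsub>A\<^esub> \<oplus>\<^bsub>A\<^esub> \<one> \<odot>\<^bsub>A\<^esub> a \<in> X" using W' unfolding X_def by blast
    ultimately have "a \<in> W" using a by simp
    then show False using no a N'(2) by force
  qed
  have uniq: "n = n' \<and> w = w'"
    if "n \<oplus>\<^bsub>A\<^esub> w = n' \<oplus>\<^bsub>A\<^esub> w'" "n \<in> N" "n' \<in> N" "w \<in> W" "w' \<in> W" for n n' w w'
  proof -
    note c = N'(1)[OF that(2)] N'(1)[OF that(3)] W'(1)[OF that(4)] W'(1)[OF that(5)]
    have "n \<oplus>\<^bsub>A\<^esub> \<ominus>\<^bsub>A\<^esub> n' = (n \<oplus>\<^bsub>A\<^esub> w) \<oplus>\<^bsub>A\<^esub> (\<ominus>\<^bsub>A\<^esub> w \<oplus>\<^bsub>A\<^esub> \<ominus>\<^bsub>A\<^esub> n')"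
      using c by (simp add: A.M.a_ac A.M.r_neg1 A.M.r_neg2 A.M.r_neg)
    also have "\<dots> = (w' \<oplus>\<^bsub>A\<^esub> \<ominus>\<^bsub>A\<^esub> w) \<oplus>\<^bsub>A\<^esub> (n' \<oplus>\<^bsub>A\<^esub> \<ominus>\<^bsub>A\<^esub> n')"
      unfolding that(1) using c by (simp add: A.M.a_ac)
    also have "\<dots> = w' \<oplus>\<^bsub>A\<^esub> \<ominus>\<^bsub>A\<^esub> w"
      using c by (simp add: A.M.r_neg)
    finally have e: "n \<oplus>\<^bsub>A\<^esub> \<ominus>\<^bsub>A\<^esub> n' = w' \<oplus>\<^bsub>A\<^esub> \<ominus>\<^bsub>A\<^esub> w" .
    have "n \<oplus>\<^bsub>A\<^esub> \<ominus>\<^bsub>A\<^esub> n' \<in> N"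
      using that N'(3) vsubspace_minus[OF A N] by blast
    moreover have "w' \<oplus>\<^bsub>A\<^esub> \<ominus>\<^bsub>A\<^esub> w \<in> W"
      using that W'(3) vsubspace_minus[OF A W(1)] by blast
    ultimately have "n \<oplus>\<^bsub>A\<^esub> \<ominus>\<^bsub>A\<^esub> n' = \<zero>\<^bsub>A\<^esub>" using e W(2) by auto
    then have "n = n'" using mod_eq_iff_minus[OF A c(1,2)] by simp
    then show ?thesis using that c by simp
  qed
  define r where "r a = (THE n. n \<in> N \<and> (\<exists>w \<in> W. a = n \<oplus>\<^bsub>A\<^esub> w))" for a
  have r: "r (n \<oplus>\<^bsub>A\<^esub> w) = n" if "n \<in> N" "w \<in> W" for n w
    unfolding r_def
  proof (rule the_equality)
    show "n \<in> N \<and> (\<exists>v \<in> W. n \<oplus>\<^bsub>A\<^esub> w = n \<oplus>\<^bsub>A\<^esub> v)" using that by blast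
    fix m assume "m \<in> N \<and> (\<exists>v \<in> W. n \<oplus>\<^bsub>A\<^esub> w = m \<oplus>\<^bsub>A\<^esub> v)"
    then obtain v where v: "m \<in> N" "v \<in> W" "n \<oplus>\<^bsub>A\<^esub> w = m \<oplus>\<^bsub>A\<^esub> v" by blast
    show "m = n" using uniq[OF v(3) that(1) v(1) that(2) v(2)] by simp
  qed
  show thesis
  proof
    show "r x = x" if "x \<in> N" for x
      using r[OF that W'(2)] N'(1)[OF that] by simp
    show rN: "r x \<in> N" if "x \<in> carrier A" for x
      using ex[OF that] r by force
    show "lin A A r"
    proof (rule linI)
      fix x assume x: "x \<in> carrier A"
      show "r x \<in> carrier A" using rN[OF x] N' by blast
      obtain n w where nw: "n \<in> N" "w \<in> W" "x = n \<oplus>\<^bsub>A\<^esub> w" using ex[OF x] by blast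
      {
        fix y assume y: "y \<in> carrier A"
        obtain m v where mv: "m \<in> N" "v \<in> W" "y = m \<oplus>\<^bsub>A\<^esub> v" using ex[OF y] by blast
        have "x \<oplus>\<^bsub>A\<^esub> y = (n \<oplus>\<^bsub>A\<^esub> m) \<oplus>\<^bsub>A\<^esub> (w \<oplus>\<^bsub>A\<^esub> v)"
          using nw mv N' W' by (simp add: A.M.a_ac)
        then show "r (x \<oplus>\<^bsub>A\<^esub> y) = r x \<oplus>\<^bsub>A\<^esub> r y"
          using r nw mv N' W' by simp
      next
        fix c assume c: "c \<in> carrier R"
        have "c \<odot>\<^bsub>A\<^esub> x = c \<odot>\<^bsub>A\<^esub> n \<oplus>\<^bsub>A\<^esub> c \<odot>\<^bsub>A\<^esub> w"
          using nw c N' W' by (simp add: A.smult_r_distr)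
        then show "r (c \<odot>\<^bsub>A\<^esub> x) = c \<odot>\<^bsub>A\<^esub> r x"
          using r nw c N' W' by simp
      }
    qed
  qed
qed

lemma lin_diff:
  assumes "module R M" "module R V" "lin M V f" "lin M V g"
  shows "lin M V (\<lambda>x. f x \<oplus>\<^bsub>V\<^esub> \<ominus>\<^bsub>V\<^esub> g x)"
proof (rule linI)
  interpret V: module R V by (rule assms)
  note cl = lin_closed[OF assms(3)] lin_closed[OF assms(4)]
  fix x assume x: "x \<in> carrier M"
  show "f x \<oplus>\<^bsub>V\<^esub> \<ominus>\<^bsub>V\<^esub> g x \<in> carrier V" using cl x by simp
  {
    fix y assume "y \<in> carrier M"
    then show "f (x \<oplus>\<^bsub>M\<^esub> y) \<oplus>\<^bsub>V\<^esub> \<ominus>\<^bsub>V\<^esub> g (x \<oplus>\<^bsub>M\<^esub> y) =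
        f x \<oplus>\<^bsub>V\<^esub> \<ominus>\<^bsub>V\<^esub> g x \<oplus>\<^bsub>V\<^esub> (f y \<oplus>\<^bsub>V\<^esub> \<ominus>\<^bsub>V\<^esub> g y)"
      using x cl by (simp add: lin_add[OF assms(3)] lin_add[OF assms(4)] V.M.a_ac V.M.minus_add)
  next
    fix c assume "c \<in> carrier R"
    then show "f (c \<odot>\<^bsub>M\<^esub> x) \<oplus>\<^bsub>V\<^esub> \<ominus>\<^bsub>V\<^esub> g (c \<odot>\<^bsub>M\<^esub> x) = c \<odot>\<^bsub>V\<^esub> (f x \<oplus>\<^bsub>V\<^esub> \<ominus>\<^bsub>V\<^esub> g x)"
      using x cl by (simp add: lin_smult[OF assms(3)] lin_smult[OF assms(4)] V.smult_r_distr
          V.smult_r_minus)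
  }
qed

text \<open>A linear map \<open>f\<close> is injective on a complement of its kernel; its inverse there, extended by a
  retraction onto the image of \<open>f\<close>, satisfies \<open>f g f = f\<close>.\<close>

lemma generalized_inverse_ex:
  assumes A: "module R A" and V: "module R V" and f: "lin A V f"
  obtains g where "lin V A g" "\<And>a. a \<in> carrier A \<Longrightarrow> f (g (f a)) = f a"
proof -
  note f' = lin_closed[OF f] lin_add[OF f] lin_smult[OF f]
  let ?K = "{a \<in> carrier A. f a = \<zero>\<^bsub>V\<^esub>}" and ?I = "f ` carrier A"
  have "vsubspace A ?K"
    using A V f' lin_zero[OF A V f] by (auto simp: vsubspace_def)
  then obtain r where r: "lin A A r" "\<And>x. x \<in> carrier A \<Longrightarrow> r x \<in> ?K" "\<And>x. x \<in> ?K \<Longrightarrow> r x = x"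
    by (rule retraction_ex[OF A]) blast
  have "vsubspace V ?I"
    unfolding vsubspace_def
  proof (intro conjI ballI)
    show "?I \<subseteq> carrier V" using f'(1) by blast
    show "\<zero>\<^bsub>V\<^esub> \<in> ?I" 
      using imageI[of "\<zero>\<^bsub>A\<^esub>" "carrier A" f] lin_zero[OF A V f] A by simp
    fix v assume "v \<in> ?I"
    then obtain a where a: "a \<in> carrier A" "v = f a" by blast
    {
      fix w assume "w \<in> ?I"
      then obtain b where "b \<in> carrier A" "w = f b" by blast
      then show "v \<oplus>\<^bsub>V\<^esub> w \<in> ?I" using a A by (intro image_eqI[of _ _ "a \<oplus>\<^bsub>A\<^esub> b"]) (simp_all add: f')
    next
      fix c assume "c \<in> carrier R"
      then show "c \<odot>\<^bsub>V\<^esub> v \<in> ?I" using a A by (intro image_eqI[of _ _ "c \<odot>\<^bsub>A\<^esub> a"]) (simp_all add: f')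
    }
  qed
  then obtain q where q: "lin V V q" "\<And>x. x \<in> carrier V \<Longrightarrow> q x \<in> ?I" "\<And>x. x \<in> ?I \<Longrightarrow> q x = x"
    by (rule retraction_ex[OF V]) blast
  interpret A: module R A by (rule A)
  interpret V: module R V by (rule V)
  let ?p = "\<lambda>a. a \<oplus>\<^bsub>A\<^esub> \<ominus>\<^bsub>A\<^esub> r a"
  have p: "lin A A ?p" by (rule lin_diff[OF A A lin_id r(1)])
  note p' = lin_closed[OF p] lin_add[OF p] lin_smult[OF p]
  have pf: "?p a = ?p b" if "f a = f b" "a \<in> carrier A" "b \<in> carrier A" for a b
  proof -
    let ?d = "a \<oplus>\<^bsub>A\<^esub> \<ominus>\<^bsub>A\<^esub> b"
    have "f ?d = \<zero>\<^bsub>V\<^esub>" using that f' by (simp add: lin_minus[OF A V f] V.M.r_neg)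
    then have "r ?d = ?d" using r(3) that by simp
    then have "?p ?d = \<zero>\<^bsub>A\<^esub>" using that by (simp add: A.M.r_neg)
    moreover have "?p ?d = ?p a \<oplus>\<^bsub>A\<^esub> \<ominus>\<^bsub>A\<^esub> ?p b"
      using that p'(2)[of a "\<ominus>\<^bsub>A\<^esub> b"] lin_minus[OF A A p, of b] by simp
    ultimately have "?p a \<oplus>\<^bsub>A\<^esub> \<ominus>\<^bsub>A\<^esub> ?p b = \<zero>\<^bsub>A\<^esub>" by simp
    moreover have "?p a \<in> carrier A" "?p b \<in> carrier A" using p'(1) that by blast+
    ultimately show ?thesis using mod_eq_iff_minus[OF A] by blast
  qed
  have fp: "f (?p a) = f a" if "a \<in> carrier A" for a
  proof -
    have "r a \<in> carrier A" "f (r a) = \<zero>\<^bsub>V\<^esub>" using r(2)[OF that] by auto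
    then show ?thesis using that f' by (simp add: lin_minus[OF A V f])
  qed
  define h where "h v = (SOME a. a \<in> carrier A \<and> f a = q v)" for v
  have h: "h v \<in> carrier A" "f (h v) = q v" if "v \<in> carrier V" for v
  proof -
    have "\<exists>a. a \<in> carrier A \<and> f a = q v" using q(2)[OF that] by auto
    then have "h v \<in> carrier A \<and> f (h v) = q v" unfolding h_def by (rule someI_ex)
    then show "h v \<in> carrier A" "f (h v) = q v" by auto
  qed
  note q' = lin_closed[OF q(1)] lin_add[OF q(1)] lin_smult[OF q(1)]
  let ?g = "\<lambda>v. ?p (h v)"
  show thesis
  proof
    show "lin V A ?g"
    proof (rule linI)
      show "?g v \<in> carrier A" if "v \<in> carrier V" for v using p'(1) h(1) that by blast
      fix v assume v: "v \<in> carrier V"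
      {
        fix w assume w: "w \<in> carrier V"
        have "?p (h (v \<oplus>\<^bsub>V\<^esub> w)) = ?p (h v \<oplus>\<^bsub>A\<^esub> h w)"
          using h v w q' f' by (intro pf) auto
        then show "?g (v \<oplus>\<^bsub>V\<^esub> w) = ?g v \<oplus>\<^bsub>A\<^esub> ?g w" using p'(2) h(1) v w by simp
      next
        fix c assume c: "c \<in> carrier R"
        have "?p (h (c \<odot>\<^bsub>V\<^esub> v)) = ?p (c \<odot>\<^bsub>A\<^esub> h v)"
          using h v c q' f' by (intro pf) auto
        then show "?g (c \<odot>\<^bsub>V\<^esub> v) = c \<odot>\<^bsub>A\<^esub> ?g v" using p'(3) h(1) v c by simp
      }
    qed
    fix a assume "a \<in> carrier A"
    then show "f (?g (f a)) = f a" using fp h q(3) f' by simp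
  qed
qed


section \<open>Tensor products of algebras\<close>

lemma alg_module [simp]: "assoc_algebra R E \<Longrightarrow> module R E"
  by (simp add: assoc_algebra_def)

lemma alg_simps [simp]:
  assumes "assoc_algebra R E"
  shows "x \<in> carrier E \<Longrightarrow> y \<in> carrier E \<Longrightarrow> x \<otimes>\<^bsub>E\<^esub> y \<in> carrier E"
    "\<one>\<^bsub>E\<^esub> \<in> carrier E"
    "x \<in> carrier E \<Longrightarrow> \<one>\<^bsub>E\<^esub> \<otimes>\<^bsub>E\<^esub> x = x"
    "x \<in> carrier E \<Longrightarrow> x \<otimes>\<^bsub>E\<^esub> \<one>\<^bsub>E\<^esub> = x"
    "c \<in> carrier R \<Longrightarrow> x \<in> carrier E \<Longrightarrow> y \<in> carrier E \<Longrightarrow>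
      (c \<odot>\<^bsub>E\<^esub> x) \<otimes>\<^bsub>E\<^esub> y = c \<odot>\<^bsub>E\<^esub> (x \<otimes>\<^bsub>E\<^esub> y)"
    "c \<in> carrier R \<Longrightarrow> x \<in> carrier E \<Longrightarrow> y \<in> carrier E \<Longrightarrow>
      x \<otimes>\<^bsub>E\<^esub> (c \<odot>\<^bsub>E\<^esub> y) = c \<odot>\<^bsub>E\<^esub> (x \<otimes>\<^bsub>E\<^esub> y)"
proof -
  interpret E: assoc_algebra R E by (rule assms)
  show "x \<in> carrier E \<Longrightarrow> y \<in> carrier E \<Longrightarrow> x \<otimes>\<^bsub>E\<^esub> y \<in> carrier E"
    "\<one>\<^bsub>E\<^esub> \<in> carrier E"
    "x \<in> carrier E \<Longrightarrow> \<one>\<^bsub>E\<^esub> \<otimes>\<^bsub>E\<^esub> x = x"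
    "x \<in> carrier E \<Longrightarrow> x \<otimes>\<^bsub>E\<^esub> \<one>\<^bsub>E\<^esub> = x"
    "c \<in> carrier R \<Longrightarrow> x \<in> carrier E \<Longrightarrow> y \<in> carrier E \<Longrightarrow>
      (c \<odot>\<^bsub>E\<^esub> x) \<otimes>\<^bsub>E\<^esub> y = c \<odot>\<^bsub>E\<^esub> (x \<otimes>\<^bsub>E\<^esub> y)"
    "c \<in> carrier R \<Longrightarrow> x \<in> carrier E \<Longrightarrow> y \<in> carrier E \<Longrightarrow>
      x \<otimes>\<^bsub>E\<^esub> (c \<odot>\<^bsub>E\<^esub> y) = c \<odot>\<^bsub>E\<^esub> (x \<otimes>\<^bsub>E\<^esub> y)"
    by (auto simp: E.smult_mult_l E.smult_mult_r)
qed

lemma alg_mult_assoc: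
  assumes "assoc_algebra R E" "x \<in> carrier E" "y \<in> carrier E" "z \<in> carrier E"
  shows "x \<otimes>\<^bsub>E\<^esub> y \<otimes>\<^bsub>E\<^esub> z = x \<otimes>\<^bsub>E\<^esub> (y \<otimes>\<^bsub>E\<^esub> z)"
proof -
  interpret E: assoc_algebra R E by (rule assms)
  show ?thesis using assms by (simp add: E.m_assoc)
qed

lemma alg_mult_bil:
  assumes "assoc_algebra R E"
  shows "bil E E E (\<otimes>\<^bsub>E\<^esub>)"
proof -
  interpret E: assoc_algebra R E by (rule assms)
  show ?thesis
    by (intro bilI linI) (auto simp: E.smult_mult_l E.smult_mult_r E.l_distr E.r_distr)
qed

lemma lin_mult_l: "assoc_algebra R E \<Longrightarrow> lin M E f \<Longrightarrow> v \<in> carrier E \<Longrightarrow> lin M E (\<lambda>x. f x \<otimes>\<^bsub>E\<^esub> v)"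
  by (rule lin_comp[OF _ bil_l[OF alg_mult_bil]])

lemma lin_mult_r: "assoc_algebra R E \<Longrightarrow> lin M E f \<Longrightarrow> v \<in> carrier E \<Longrightarrow> lin M E (\<lambda>x. v \<otimes>\<^bsub>E\<^esub> f x)"
  by (rule lin_comp[OF _ bil_r[OF alg_mult_bil]])

lemma lin_pure_l: "module R A \<Longrightarrow> module R B \<Longrightarrow> lin M A f \<Longrightarrow> b \<in> carrier B \<Longrightarrow>
    lin M (tensor R A B) (\<lambda>x. pure_tensor R A B (f x) b)"
  by (rule lin_comp[OF _ bil_l[OF pure_bil]])

lemma lin_pure_r: "module R A \<Longrightarrow> module R B \<Longrightarrow> lin M B f \<Longrightarrow> a \<in> carrier A \<Longrightarrow>
    lin M (tensor R A B) (\<lambda>x. pure_tensor R A B a (f x))"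
  by (rule lin_comp[OF _ bil_r[OF pure_bil]])

lemma lin_smult_l: "module R V \<Longrightarrow> lin M (ground R) f \<Longrightarrow> v \<in> carrier V \<Longrightarrow> lin M V (\<lambda>x. f x \<odot>\<^bsub>V\<^esub> v)"
  by (rule linI)
    (simp_all add: lin_add lin_smult lin_closed[of f M "ground R", simplified] mod_add_smult
      mod_smult_smult)

lemma lin_smult_r:
  assumes "module R V" "lin M V f" "c \<in> carrier R"
  shows "lin M V (\<lambda>x. c \<odot>\<^bsub>V\<^esub> f x)"
  using assms by (intro linI)
    (simp_all add: lin_add lin_smult lin_closed[OF assms(2)] mod_smult_add mod_smult_lcomm[of V c])

lemma lin_psum:
  assumes "module R V" "xs \<in> lists (S \<times> T)" "\<And>a b. a \<in> S \<Longrightarrow> b \<in> T \<Longrightarrow> lin M V (\<lambda>x. f x a b)"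
  shows "lin M V (\<lambda>x. psum V (f x) xs)"
proof (rule linI)
  note f = lin_closed[OF assms(3)] lin_add[OF assms(3)] lin_smult[OF assms(3)]
  show "psum V (f x) xs \<in> carrier V" if "x \<in> carrier M" for x
    using that assms f(1) by (intro psum_closed[of V _ S T]) auto
  fix x assume x: "x \<in> carrier M"
  {
    fix y assume "y \<in> carrier M"
    then show "psum V (f (x \<oplus>\<^bsub>M\<^esub> y)) xs = psum V (f x) xs \<oplus>\<^bsub>V\<^esub> psum V (f y) xs"
      using x assms f by (subst psum_add[of V S T, symmetric]) (auto intro!: psum_cong[of _ S T])
  next
    fix c assume "c \<in> carrier R"
    then show "psum V (f (c \<odot>\<^bsub>M\<^esub> x)) xs = c \<odot>\<^bsub>V\<^esub> psum V (f x) xs"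
      using x assms f by (subst psum_smult[of V S T, symmetric]) (auto intro!: psum_cong[of _ S T])
  }
qed

lemma trep_in:
  assumes "module R A" "module R B" "t \<in> carrier (tensor R A B)"
  shows "trep t \<in> lists (carrier A \<times> carrier B)"
  using assms tensor_eq_in[OF assms(1,2) trep_tclass] by (auto simp: tensor_carrier)

lemma lin_tensor_lift:
  assumes "module R A" "module R B" "module R V" "bil A B V f" "lin M (tensor R A B) g"
  shows "lin M V (\<lambda>x. tensor_lift V f (g x))"
  by (rule lin_comp[OF assms(5) tensor_lift_lin[OF assms(1-4)]])

lemma lin_tensor_lift_param:
  assumes "module R A" "module R B" "module R V" "t \<in> carrier (tensor R A B)"
    "\<And>a b. a \<in> carrier A \<Longrightarrow> b \<in> carrier B \<Longrightarrow> lin M V (\<lambda>x. f x a b)"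
  shows "lin M V (\<lambda>x. tensor_lift V (f x) t)"
  unfolding tensor_lift_psum
  by (rule lin_psum[OF assms(3) trep_in[OF assms(1,2,4)] assms(5)])

lemma tensor_lift_closed:
  assumes "module R A" "module R B" "module R V" "t \<in> carrier (tensor R A B)"
    "\<And>a b. a \<in> carrier A \<Longrightarrow> b \<in> carrier B \<Longrightarrow> f a b \<in> carrier V"
  shows "tensor_lift V f t \<in> carrier V"
  unfolding tensor_lift_psum
  by (rule psum_closed[OF assms(3) trep_in[OF assms(1,2,4)] assms(5)])

text \<open>The product of two tensors, defined by means of lists of representatives, in the bilinear form
  in which all later computations use it.\<close>

lemma tensor_mult_lift:
  assumes A: "assoc_algebra R A" and B: "assoc_algebra R B"
    and s: "s \<in> carrier (tensor R A B)" and t: "t \<in> carrier (tensor R A B)"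
  shows "s \<otimes>\<^bsub>tensor R A B\<^esub> t = tensor_lift (tensor R A B) (\<lambda>a b.
    tensor_lift (tensor R A B) (\<lambda>a' b'. pure_tensor R A B (a \<otimes>\<^bsub>A\<^esub> a') (b \<otimes>\<^bsub>B\<^esub> b')) t) s"
proof -
  let ?T = "tensor R A B"
  have AB [simp]: "module R A" "module R B" using A B by auto
  have 1: "tclass R A B (map (\<lambda>(a', b'). (a \<otimes>\<^bsub>A\<^esub> a', b \<otimes>\<^bsub>B\<^esub> b')) ys) =
      psum ?T (\<lambda>a' b'. pure_tensor R A B (a \<otimes>\<^bsub>A\<^esub> a') (b \<otimes>\<^bsub>B\<^esub> b')) ys \<and>
      map (\<lambda>(a', b'). (a \<otimes>\<^bsub>A\<^esub> a', b \<otimes>\<^bsub>B\<^esub> b')) ys \<in> lists (carrier A \<times> carrier B)"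
    if "a \<in> carrier A" "b \<in> carrier B" "ys \<in> lists (carrier A \<times> carrier B)" for a b ys
    using that(3)
  proof (induction ys)
    case Nil
    then show ?case by (simp add: tensor_zero)
  next
    case (Cons p ys)
    then show ?case using that(1,2) A B by (cases p) (simp add: tclass_Cons)
  qed
  have 2: "tclass R A B (concat (map (\<lambda>(a, b). map (\<lambda>(a', b'). (a \<otimes>\<^bsub>A\<^esub> a', b \<otimes>\<^bsub>B\<^esub> b')) ys) xs)) =
      psum ?T (\<lambda>a b. psum ?T (\<lambda>a' b'. pure_tensor R A B (a \<otimes>\<^bsub>A\<^esub> a') (b \<otimes>\<^bsub>B\<^esub> b')) ys) xs \<and>
      concat (map (\<lambda>(a, b). map (\<lambda>(a', b'). (a \<otimes>\<^bsub>A\<^esub> a', b \<otimes>\<^bsub>B\<^esub> b')) ys) xs) \<in>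
        lists (carrier A \<times> carrier B)"
    if "ys \<in> lists (carrier A \<times> carrier B)" "xs \<in> lists (carrier A \<times> carrier B)" for xs ys
    using that(2)
  proof (induction xs)
    case Nil
    then show ?case by (simp add: tensor_zero)
  next
    case (Cons p xs)
    then show ?case using 1[OF _ _ that(1)]
      by (cases p) (auto simp flip: tensor_add)
  qed
  show ?thesis
    using 2[OF trep_in[OF AB t] trep_in[OF AB s]]
    unfolding tensor_lift_psum by (simp add: tensor_def)
qed

lemma tensor_mult_bil0:
  assumes A: "assoc_algebra R A" and B: "assoc_algebra R B"
    and t: "t \<in> carrier (tensor R A B)"
  shows "bil A B (tensor R A B) (\<lambda>a b. tensor_lift (tensor R A B)
      (\<lambda>a' b'. pure_tensor R A B (a \<otimes>\<^bsub>A\<^esub> a') (b \<otimes>\<^bsub>B\<^esub> b')) t)"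
  using A B t
  by (intro bilI lin_tensor_lift_param[of A B] lin_pure_l lin_pure_r lin_mult_l) auto

lemma tensor_mult_bil1:
  assumes A: "assoc_algebra R A" and B: "assoc_algebra R B"
    and "a \<in> carrier A" "b \<in> carrier B"
  shows "bil A B (tensor R A B) (\<lambda>a' b'. pure_tensor R A B (a \<otimes>\<^bsub>A\<^esub> a') (b \<otimes>\<^bsub>B\<^esub> b'))"
  using assms
  by (intro bilI lin_pure_l lin_pure_r lin_mult_r) auto

lemma tensor_mult_bil:
  assumes A: "assoc_algebra R A" and B: "assoc_algebra R B"
  shows "bil (tensor R A B) (tensor R A B) (tensor R A B) (\<otimes>\<^bsub>tensor R A B\<^esub>)"
proof (rule bilI)
  let ?T = "tensor R A B"
  have AB [simp]: "module R A" "module R B" using A B by auto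
  fix s assume s: "s \<in> carrier ?T"
  have "lin ?T ?T (\<lambda>t. tensor_lift ?T (\<lambda>a b. tensor_lift ?T
      (\<lambda>a' b'. pure_tensor R A B (a \<otimes>\<^bsub>A\<^esub> a') (b \<otimes>\<^bsub>B\<^esub> b')) t) s)"
    using s A B
    by (intro lin_tensor_lift_param[of A B] lin_tensor_lift[of A B] tensor_mult_bil1) auto
  then show "lin ?T ?T (\<lambda>t. s \<otimes>\<^bsub>?T\<^esub> t)"
    by (rule lin_cong) (use s A B in \<open>simp_all add: tensor_mult_lift\<close>)
next
  let ?T = "tensor R A B"
  have AB [simp]: "module R A" "module R B" using A B by auto
  fix t assume t: "t \<in> carrier ?T"
  have "lin ?T ?T (\<lambda>s. tensor_lift ?T (\<lambda>a b. tensor_lift ?T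
      (\<lambda>a' b'. pure_tensor R A B (a \<otimes>\<^bsub>A\<^esub> a') (b \<otimes>\<^bsub>B\<^esub> b')) t) s)"
    using t A B
    by (intro tensor_lift_lin[of A B] tensor_mult_bil0) auto
  then show "lin ?T ?T (\<lambda>s. s \<otimes>\<^bsub>?T\<^esub> t)"
    by (rule lin_cong) (use t A B in \<open>simp_all add: tensor_mult_lift\<close>)
qed

lemma pure_mult [simp]:
  assumes A: "assoc_algebra R A" and B: "assoc_algebra R B"
    and "a \<in> carrier A" "b \<in> carrier B" "a' \<in> carrier A" "b' \<in> carrier B"
  shows "pure_tensor R A B a b \<otimes>\<^bsub>tensor R A B\<^esub> pure_tensor R A B a' b' =
    pure_tensor R A B (a \<otimes>\<^bsub>A\<^esub> a') (b \<otimes>\<^bsub>B\<^esub> b')"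
  using assms
  by (simp add: tensor_mult_lift tensor_lift_pure[of A B] tensor_mult_bil0 tensor_mult_bil1)

lemma tensor_algebra:
  assumes A: "assoc_algebra R A" and B: "assoc_algebra R B"
  shows "assoc_algebra R (tensor R A B)"
proof -
  let ?T = "tensor R A B"
  have AB [simp]: "module R A" "module R B" using A B by auto
  have T: "module R ?T" by simp
  then interpret T: module R ?T .
  note bil = tensor_mult_bil[OF A B]
  note l = bil_l[OF bil] and r = bil_r[OF bil] and cl = bil_closed[OF bil]
  have one: "\<one>\<^bsub>?T\<^esub> \<in> carrier ?T" using A B by (simp add: tensor_one)
  have assoc: "s \<otimes>\<^bsub>?T\<^esub> t \<otimes>\<^bsub>?T\<^esub> u = s \<otimes>\<^bsub>?T\<^esub> (t \<otimes>\<^bsub>?T\<^esub> u)"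
    if s: "s \<in> carrier ?T" and t: "t \<in> carrier ?T" and u: "u \<in> carrier ?T" for s t u
    using AB s
  proof (induction rule: tensor_induct)
    case (pure a b)
    note ab = this
    show ?case using AB t
    proof (induction rule: tensor_induct)
      case (pure a' b')
      note ab' = this
      show ?case using AB u
      proof (induction rule: tensor_induct)
        case (pure a'' b'')
        then show ?case using A B ab ab' by (simp add: alg_mult_assoc)
      next
        case (add v w)
        then show ?case using ab ab' A B by (simp add: lin_add[OF r] cl)
      qed
    next
      case (add v w)
      then show ?case using ab u A B by (simp add: lin_add[OF r] lin_add[OF l] cl)
    qed
  next
    case (add v w)
    then show ?case using t u A B by (simp add: lin_add[OF l] cl)
  qed
  have unit: "\<one>\<^bsub>?T\<^esub> \<otimes>\<^bsub>?T\<^esub> s = s \<and> s \<otimes>\<^bsub>?T\<^esub> \<one>\<^bsub>?T\<^esub> = s" if s: "s \<in> carrier ?T" for s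
    using AB s
  proof (induction rule: tensor_induct)
    case (pure a b)
    then show ?case using A B by (simp add: tensor_one)
  next
    case (add v w)
    then show ?case using one A B by (simp add: lin_add[OF l] lin_add[OF r])
  qed
  have "ring ?T"
    by (intro ringI monoidI T.abelian_group_axioms)
      (use assoc unit one cl lin_add[OF l] lin_add[OF r] in auto)
  then show ?thesis
    using T cl lin_smult[OF l] lin_smult[OF r]
    by (intro assoc_algebra.intro assoc_algebra_axioms.intro) auto
qed

end

context ground_field
begin

section \<open>Cocommutative coalgebras and Sweedler sums\<close>

text \<open>
  The prefix \<open>sw\<close> of the lemmas below stands for Sweedler sums. The coalgebra axioms speak of the
  particular tensor \<open>x' \<otimes> x'' \<otimes> x'''\<close>; they are turned into rules for sums of the values
  \<open>F x' x'' x'''\<close> of a multilinear map into an arbitrary module, which is the form in which Sweedler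
  notation is used.
\<close>

definition cocoalgebra :: "('k, 'c, 'm) hopf_scheme \<Rightarrow> bool"
  where "cocoalgebra C \<longleftrightarrow> module R C \<and> lin C (tensor R C C) (comult C) \<and>
    lin C (ground R) (counit C) \<and>
    (\<forall>x \<in> carrier C.
      sweedler C (tensor R C (tensor R C C)) x (\<lambda>y x3.
        sweedler C (tensor R C (tensor R C C)) y (\<lambda>x1 x2.
          pure_tensor R C (tensor R C C) x1 (pure_tensor R C C x2 x3))) =
      sweedler C (tensor R C (tensor R C C)) x (\<lambda>x1 y.
        sweedler C (tensor R C (tensor R C C)) y (\<lambda>x2 x3.
          pure_tensor R C (tensor R C C) x1 (pure_tensor R C C x2 x3)))) \<and>
    (\<forall>x \<in> carrier C. sweedler C C x (\<lambda>x1 x2. counit C x1 \<odot>\<^bsub>C\<^esub> x2) = x) \<and>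
    (\<forall>x \<in> carrier C. sweedler C (tensor R C C) x (\<lambda>x1 x2. pure_tensor R C C x2 x1) = comult C x)"

lemma coalg_module [simp]: "cocoalgebra C \<Longrightarrow> module R C"
  by (simp add: cocoalgebra_def)

lemma comult_lin: "cocoalgebra C \<Longrightarrow> lin C (tensor R C C) (comult C)"
  by (simp add: cocoalgebra_def)

lemma comult_in [simp]:
  "cocoalgebra C \<Longrightarrow> c \<in> carrier C \<Longrightarrow> comult C c \<in> carrier (tensor R C C)"
  by (rule lin_closed[OF comult_lin])

lemma counit_lin: "cocoalgebra C \<Longrightarrow> lin C (ground R) (counit C)"
  by (simp add: cocoalgebra_def)

lemma counit_in [simp]: "cocoalgebra C \<Longrightarrow> c \<in> carrier C \<Longrightarrow> counit C c \<in> carrier R"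
  using lin_closed[OF counit_lin] by fastforce

lemma sw_closed [simp]:
  assumes "cocoalgebra C" "module R V" "c \<in> carrier C"
    "\<And>a b. a \<in> carrier C \<Longrightarrow> b \<in> carrier C \<Longrightarrow> F a b \<in> carrier V"
  shows "sweedler C V c F \<in> carrier V"
  unfolding sweedler_def using assms by (intro tensor_lift_closed[of C C]) auto

lemma sw_cong:
  assumes "cocoalgebra C" "c \<in> carrier C"
    "\<And>a b. a \<in> carrier C \<Longrightarrow> b \<in> carrier C \<Longrightarrow> F a b = G a b"
  shows "sweedler C V c F = sweedler C V c G"
  unfolding sweedler_def tensor_lift_psum using assms
  by (intro psum_cong[OF trep_in[of C C]]) auto

lemma lin_sw:
  assumes "cocoalgebra C" "module R V" "bil C C V F" "lin M C f"
  shows "lin M V (\<lambda>x. sweedler C V (f x) F)"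
  unfolding sweedler_def using assms
  by (intro lin_tensor_lift[of C C] lin_comp[OF assms(4) comult_lin]) auto

lemma lin_sw_param:
  assumes "cocoalgebra C" "module R V" "c \<in> carrier C"
    "\<And>a b. a \<in> carrier C \<Longrightarrow> b \<in> carrier C \<Longrightarrow> lin M V (\<lambda>x. F x a b)"
  shows "lin M V (\<lambda>x. sweedler C V c (\<lambda>a b. F x a b))"
  unfolding sweedler_def using assms by (intro lin_tensor_lift_param[of C C]) auto

lemma lin_counit: "cocoalgebra C \<Longrightarrow> lin M C f \<Longrightarrow> lin M (ground R) (\<lambda>x. counit C (f x))"
  by (rule lin_comp[OF _ counit_lin])

lemmas lin_intros = lin_id lin_sw lin_sw_param lin_counit lin_mult_l lin_mult_r lin_pure_l lin_pure_r
  lin_smult_l lin_smult_r bilI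

lemma sw_map:
  assumes "cocoalgebra C" "module R V" "module R W" "lin V W g" "c \<in> carrier C"
    "\<And>a b. a \<in> carrier C \<Longrightarrow> b \<in> carrier C \<Longrightarrow> F a b \<in> carrier V"
  shows "g (sweedler C V c F) = sweedler C W c (\<lambda>a b. g (F a b))"
  unfolding sweedler_def tensor_lift_psum using assms
  by (intro psum_lin[OF _ _ _ _ trep_in[of C C]]) auto

lemma sw_swap:
  assumes "cocoalgebra C" "cocoalgebra D" "module R V" "c \<in> carrier C" "d \<in> carrier D"
    "\<And>a b a' b'. a \<in> carrier C \<Longrightarrow> b \<in> carrier C \<Longrightarrow> a' \<in> carrier D \<Longrightarrow> b' \<in> carrier D \<Longrightarrow>
      F a b a' b' \<in> carrier V"
  shows "sweedler C V c (\<lambda>a b. sweedler D V d (\<lambda>a' b'. F a b a' b')) =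
    sweedler D V d (\<lambda>a' b'. sweedler C V c (\<lambda>a b. F a b a' b'))"
  unfolding sweedler_def tensor_lift_psum using assms
  by (intro psum_swap[OF _ trep_in[of C C] trep_in[of D D]]) auto

lemma tensor_lift_id:
  assumes "module R A" "module R B" "t \<in> carrier (tensor R A B)"
  shows "tensor_lift (tensor R A B) (pure_tensor R A B) t = t"
  by (rule lin_tensor_ext[OF assms(1,2) _ tensor_lift_lin lin_id _ assms(3)])
    (use assms in \<open>simp_all add: pure_bil tensor_lift_pure\<close>)

lemma sw_pure: "cocoalgebra C \<Longrightarrow> c \<in> carrier C \<Longrightarrow>
    sweedler C (tensor R C C) c (pure_tensor R C C) = comult C c"
  by (simp add: sweedler_def tensor_lift_id)

text \<open>
  Sweedler sums of \<open>y\<close> are computed from any formula for its coproduct; this is how they are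
  transported along maps that are compatible with coproducts.
\<close>

lemma sw_of_comult:
  assumes C: "cocoalgebra C" and E: "module R E" and V: "module R V" and c: "c \<in> carrier C"
    and y: "comult E y = sweedler C (tensor R E E) c (\<lambda>a b. pure_tensor R E E (g a b) (h a b))"
    and gh: "\<And>a b. a \<in> carrier C \<Longrightarrow> b \<in> carrier C \<Longrightarrow> g a b \<in> carrier E \<and> h a b \<in> carrier E"
    and F: "bil E E V F"
  shows "sweedler E V y F = sweedler C V c (\<lambda>a b. F (g a b) (h a b))"
proof -
  have "sweedler E V y F = tensor_lift V F (comult E y)" by (simp add: sweedler_def)
  also have "\<dots> = sweedler C V c (\<lambda>a b. tensor_lift V F (pure_tensor R E E (g a b) (h a b)))"
    unfolding y using assms by (intro sw_map tensor_lift_lin) auto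
  also have "\<dots> = sweedler C V c (\<lambda>a b. F (g a b) (h a b))"
    using assms by (intro sw_cong) (auto simp: tensor_lift_pure)
  finally show ?thesis .
qed

definition trilinear :: "('k, 'c, 'm) module_scheme \<Rightarrow> ('k, 'v, 'n) module_scheme \<Rightarrow>
    ('c \<Rightarrow> 'c \<Rightarrow> 'c \<Rightarrow> 'v) \<Rightarrow> bool"
  where "trilinear C V F \<longleftrightarrow> (\<forall>a \<in> carrier C. \<forall>b \<in> carrier C.
    lin C V (\<lambda>c. F a b c) \<and> lin C V (\<lambda>c. F a c b) \<and> lin C V (\<lambda>c. F c a b))"

lemma trilinearI:
  assumes "\<And>a b. a \<in> carrier C \<Longrightarrow> b \<in> carrier C \<Longrightarrow> lin C V (\<lambda>c. F a b c)"
    "\<And>a b. a \<in> carrier C \<Longrightarrow> b \<in> carrier C \<Longrightarrow> lin C V (\<lambda>c. F a c b)"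
    "\<And>a b. a \<in> carrier C \<Longrightarrow> b \<in> carrier C \<Longrightarrow> lin C V (\<lambda>c. F c a b)"
  shows "trilinear C V F"
  using assms by (simp add: trilinear_def)

lemma trilinearD:
  assumes "trilinear C V F"
  shows "a \<in> carrier C \<Longrightarrow> b \<in> carrier C \<Longrightarrow> lin C V (\<lambda>c. F a b c)"
    "a \<in> carrier C \<Longrightarrow> b \<in> carrier C \<Longrightarrow> lin C V (\<lambda>c. F a c b)"
    "a \<in> carrier C \<Longrightarrow> b \<in> carrier C \<Longrightarrow> lin C V (\<lambda>c. F c a b)"
  using assms by (simp_all add: trilinear_def)

text \<open>The linear map on \<open>C \<otimes> (C \<otimes> C)\<close> induced by \<open>F\<close> is applied to both sides of the axiom.\<close>

lemma coassoc:
  assumes C: "cocoalgebra C" and V: "module R V" and F: "trilinear C V F" and c: "c \<in> carrier C"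
  shows "sweedler C V c (\<lambda>y x3. sweedler C V y (\<lambda>x1 x2. F x1 x2 x3)) =
    sweedler C V c (\<lambda>x1 y. sweedler C V y (\<lambda>x2 x3. F x1 x2 x3))"
proof -
  let ?T = "tensor R C C" and ?W = "tensor R C (tensor R C C)"
  let ?P = "\<lambda>x1 x2 x3. pure_tensor R C ?T x1 (pure_tensor R C C x2 x3)"
  have M [simp]: "module R C" using C by simp
  have f1: "bil C C V (F a)" if "a \<in> carrier C" for a
    using trilinearD[OF F] that by (intro bilI) auto
  have f2: "bil C ?T V (\<lambda>a. tensor_lift V (F a))"
    using V trilinearD[OF F]
    by (intro bilI tensor_lift_lin[of C C] lin_tensor_lift_param[of C C]) auto
  define g where "g = tensor_lift V (\<lambda>a. tensor_lift V (F a))"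
  have g: "lin ?W V g" unfolding g_def using V f2 by (intro tensor_lift_lin) auto
  have gP: "g (?P x1 x2 x3) = F x1 x2 x3"
    if "x1 \<in> carrier C" "x2 \<in> carrier C" "x3 \<in> carrier C" for x1 x2 x3
    unfolding g_def using that V f1 f2 by (simp add: tensor_lift_pure)
  have "sweedler C V c (\<lambda>y x3. sweedler C V y (\<lambda>x1 x2. F x1 x2 x3)) =
      g (sweedler C ?W c (\<lambda>y x3. sweedler C ?W y (\<lambda>x1 x2. ?P x1 x2 x3)))"
    using C V g c by (subst sw_map[of C ?W V g]) (auto intro!: sw_cong simp: sw_map[of C ?W V g] gP)
  also have "sweedler C ?W c (\<lambda>y x3. sweedler C ?W y (\<lambda>x1 x2. ?P x1 x2 x3)) =
      sweedler C ?W c (\<lambda>x1 y. sweedler C ?W y (\<lambda>x2 x3. ?P x1 x2 x3))"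
    using C c by (simp add: cocoalgebra_def)
  also have "g \<dots> = sweedler C V c (\<lambda>x1 y. sweedler C V y (\<lambda>x2 x3. F x1 x2 x3))"
    using C V g c by (subst sw_map[of C ?W V g]) (auto intro!: sw_cong simp: sw_map[of C ?W V g] gP)
  finally show ?thesis .
qed

lemma cocomm:
  assumes C: "cocoalgebra C" and V: "module R V" and F: "bil C C V F" and c: "c \<in> carrier C"
  shows "sweedler C V c (\<lambda>a b. F b a) = sweedler C V c F"
  using sw_of_comult[OF C _ V c _ _ F, of c "\<lambda>a b. b" "\<lambda>a b. a"] C c
  by (simp add: cocoalgebra_def)

lemma counit_sw_l:
  assumes C: "cocoalgebra C" and V: "module R V" and f: "lin C V f" and c: "c \<in> carrier C"
  shows "sweedler C V c (\<lambda>a b. counit C a \<odot>\<^bsub>V\<^esub> f b) = f c"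
proof -
  have "f (sweedler C C c (\<lambda>a b. counit C a \<odot>\<^bsub>C\<^esub> b)) =
      sweedler C V c (\<lambda>a b. f (counit C a \<odot>\<^bsub>C\<^esub> b))"
    using assms by (intro sw_map) auto
  also have "\<dots> = sweedler C V c (\<lambda>a b. counit C a \<odot>\<^bsub>V\<^esub> f b)"
    using assms by (intro sw_cong) (auto simp: lin_smult[OF f])
  finally show ?thesis using C c by (simp add: cocoalgebra_def)
qed

lemma counit_sw_r:
  assumes C: "cocoalgebra C" and V: "module R V" and f: "lin C V f" and c: "c \<in> carrier C"
  shows "sweedler C V c (\<lambda>a b. counit C b \<odot>\<^bsub>V\<^esub> f a) = f c"
proof -
  have "bil C C V (\<lambda>a b. counit C a \<odot>\<^bsub>V\<^esub> f b)"
    using assms lin_closed[OF f] by (intro bilI lin_smult_l lin_smult_r counit_lin) auto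
  from cocomm[OF C V this c] show ?thesis using counit_sw_l[OF assms] by simp
qed

text \<open>Cocommutativity inside a threefold coproduct: reassociate, exchange the two factors that come
  from the same coproduct, and reassociate back.\<close>

lemma sw_lcomm:
  assumes C: "cocoalgebra C" and V: "module R V" and F: "trilinear C V F" and c: "c \<in> carrier C"
  shows "sweedler C V c (\<lambda>x1 y. sweedler C V y (\<lambda>x2 x3. F x1 x2 x3)) =
    sweedler C V c (\<lambda>x1 y. sweedler C V y (\<lambda>x2 x3. F x2 x1 x3))"
proof -
  note D = trilinearD[OF F]
  have F': "trilinear C V (\<lambda>x1 x2 x3. F x2 x1 x3)" using D by (intro trilinearI) auto
  have "sweedler C V c (\<lambda>x1 y. sweedler C V y (\<lambda>x2 x3. F x1 x2 x3)) =
      sweedler C V c (\<lambda>y x3. sweedler C V y (\<lambda>x1 x2. F x1 x2 x3))"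
    by (rule coassoc[OF C V F c, symmetric])
  also have "\<dots> = sweedler C V c (\<lambda>y x3. sweedler C V y (\<lambda>x1 x2. F x2 x1 x3))"
    using assms D by (intro sw_cong cocomm[symmetric] bilI) auto
  also have "\<dots> = sweedler C V c (\<lambda>x1 y. sweedler C V y (\<lambda>x2 x3. F x2 x1 x3))"
    by (rule coassoc[OF C V F' c])
  finally show ?thesis .
qed

definition quadrilinear :: "('k, 'c, 'm) module_scheme \<Rightarrow> ('k, 'v, 'n) module_scheme \<Rightarrow>
    ('c \<Rightarrow> 'c \<Rightarrow> 'c \<Rightarrow> 'c \<Rightarrow> 'v) \<Rightarrow> bool"
  where "quadrilinear C V F \<longleftrightarrow> (\<forall>a \<in> carrier C. trilinear C V (F a)) \<and>
    (\<forall>a \<in> carrier C. \<forall>b \<in> carrier C. \<forall>c \<in> carrier C. lin C V (\<lambda>x. F x a b c))"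

lemma quadrilinearI:
  assumes "\<And>a. a \<in> carrier C \<Longrightarrow> trilinear C V (\<lambda>b c d. F a b c d)"
    "\<And>a b c. a \<in> carrier C \<Longrightarrow> b \<in> carrier C \<Longrightarrow> c \<in> carrier C \<Longrightarrow> lin C V (\<lambda>x. F x a b c)"
  shows "quadrilinear C V F"
  using assms by (simp add: quadrilinear_def)

lemma quadrilinearD:
  assumes "quadrilinear C V F" "a \<in> carrier C" "b \<in> carrier C" "c \<in> carrier C"
  shows "lin C V (\<lambda>x. F a b c x)" "lin C V (\<lambda>x. F a b x c)" "lin C V (\<lambda>x. F a x b c)"
    "lin C V (\<lambda>x. F x a b c)"
  using assms by (simp_all add: quadrilinear_def trilinear_def)

text \<open>Cocommutativity in the form needed for products of coalgebra maps.\<close>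

lemma sw_middle_four:
  assumes C: "cocoalgebra C" and V: "module R V" and F: "quadrilinear C V F" and c: "c \<in> carrier C"
  shows "sweedler C V c (\<lambda>x y. sweedler C V x (\<lambda>x1 x2. sweedler C V y (\<lambda>y1 y2. F x1 x2 y1 y2))) =
    sweedler C V c (\<lambda>x y. sweedler C V x (\<lambda>x1 x2. sweedler C V y (\<lambda>y1 y2. F x1 y1 x2 y2)))"
proof -
  note D = quadrilinearD[OF F]
  have F2: "quadrilinear C V (\<lambda>a b c d. F a c b d)" using D by (intro quadrilinearI trilinearI) auto
  have red: "sweedler C V c (\<lambda>x y. sweedler C V x (\<lambda>x1 x2. sweedler C V y (\<lambda>y1 y2. G x1 x2 y1 y2))) =
     sweedler C V c (\<lambda>x1 z. sweedler C V z (\<lambda>x2 y. sweedler C V y (\<lambda>y1 y2. G x1 x2 y1 y2)))"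
    if G: "quadrilinear C V G" for G
  proof -
    note D = quadrilinearD[OF G]
    show ?thesis
      using assms D
      by (intro coassoc[OF C V _ c, of "\<lambda>x1 x2 y. sweedler C V y (\<lambda>y1 y2. G x1 x2 y1 y2)"]
          trilinearI lin_sw lin_sw_param lin_id bilI) auto
  qed
  have "sweedler C V c (\<lambda>x1 z. sweedler C V z (\<lambda>x2 y. sweedler C V y (\<lambda>y1 y2. F x1 x2 y1 y2))) =
    sweedler C V c (\<lambda>x1 z. sweedler C V z (\<lambda>x2 y. sweedler C V y (\<lambda>y1 y2. F x1 y1 x2 y2)))"
    using F by (intro sw_cong[OF C c] sw_lcomm[OF C V]) (auto simp: quadrilinear_def)
  then show ?thesis by (simp add: red[OF F] red[OF F2])
qed


section \<open>The tensor product of two coalgebras\<close>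

lemma module_cong:
  fixes M :: "('k, 'c, 'm) module_scheme" and M' :: "('k, 'c, 'n) module_scheme"
  assumes "module R M" "carrier M' = carrier M" "add M' = add M" "zero M' = zero M"
    "smult M' = smult M"
  shows "module R M'"
proof -
  interpret M: module R M by (rule assms)
  show ?thesis
    using assms(2-)
    by (intro moduleI is_cring abelian_groupI)
      (auto simp: M.smult_l_distr M.smult_r_distr M.smult_assoc1 M.M.a_assoc M.M.a_comm M.M.a_lcomm
        intro: M.M.l_neg)
qed

text \<open>
  Tensor products depend only on the ring and module structure of the factors. This identifies
  the tensor square of a module with that of a coalgebra, or of a Hopf subalgebra, that extends it.
\<close>

lemma tensor_eq_cong:
  fixes A :: "('k, 'u, 'm) module_scheme" and A' :: "('k, 'u, 'm2) module_scheme"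
    and B :: "('k, 'v, 'n) module_scheme" and B' :: "('k, 'v, 'n2) module_scheme"
  assumes "carrier A' = carrier A" "add A' = add A" "zero A' = zero A" "smult A' = smult A"
    "carrier B' = carrier B" "add B' = add B" "smult B' = smult B"
  shows "tensor_eq R A' B' = tensor_eq R A B"
proof (intro ext iffI)
  fix xs ys
  show "tensor_eq R A B xs ys" if "tensor_eq R A' B' xs ys"
    using that by (induction) (auto simp: assms intro: tensor_eq.intros)
  show "tensor_eq R A' B' xs ys" if "tensor_eq R A B xs ys"
    using that
  proof (induction)
    case (refl xs)
    then show ?case by (intro tensor_eq.refl) (simp add: assms)
  next
    case (comm xs ys)
    then show ?case by (intro tensor_eq.comm) (simp_all add: assms)
  next
    case (add_l a a' b)
    then show ?case using tensor_eq.add_l[of a A' a' b B' R] by (simp add: assms)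
  next
    case (add_r a b b')
    then show ?case using tensor_eq.add_r[of a A' b B' b' R] by (simp add: assms)
  next
    case (balanced c a b)
    then show ?case using tensor_eq.balanced[of c R a A' b B'] by (simp add: assms)
  next
    case (zero b)
    then show ?case using tensor_eq.zero[of b B' R A'] by (simp add: assms)
  qed (auto intro: tensor_eq.intros)
qed

lemma tensor_cong:
  fixes A :: "('k, 'u, 'm) module_scheme" and A' :: "('k, 'u, 'm2) module_scheme"
    and B :: "('k, 'v, 'n) module_scheme" and B' :: "('k, 'v, 'n2) module_scheme"
  assumes "carrier A' = carrier A" "add A' = add A" "zero A' = zero A" "smult A' = smult A"
    "carrier B' = carrier B" "add B' = add B" "smult B' = smult B"
    "mult A' = mult A" "one A' = one A" "mult B' = mult B" "one B' = one B"
  shows "tensor R A' B' = tensor R A B" "pure_tensor R A' B' = pure_tensor R A B"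
proof -
  have c: "tclass R A' B' = tclass R A B"
    unfolding tclass_def tensor_eq_cong[OF assms(1-7)] ..
  show "tensor R A' B' = tensor R A B" unfolding tensor_def c assms ..
  show "pure_tensor R A' B' = pure_tensor R A B" unfolding pure_tensor_def c ..
qed

text \<open>
  The coproduct is \<open>(a \<otimes> b)' \<otimes> (a \<otimes> b)'' = (a' \<otimes> b') \<otimes> (a'' \<otimes> b'')\<close>. The
  record is that of Hopf algebras, with a default value as antipode, and it stands for a coalgebra.
\<close>

definition tensor_coalg ::
    "('k, 'u, 'm) hopf_scheme \<Rightarrow> ('k, 'v, 'n) hopf_scheme \<Rightarrow> ('k, ('u \<times> 'v) list set) hopf"
  where "tensor_coalg A B = (let T = tensor R A B; TT = tensor R T T in
    \<lparr>carrier = carrier T, mult = mult T, one = one T, zero = zero T, add = add T, smult = smult T,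
     comult = tensor_lift TT (\<lambda>a b. sweedler A TT a (\<lambda>a1 a2. sweedler B TT b (\<lambda>b1 b2.
       pure_tensor R T T (pure_tensor R A B a1 b1) (pure_tensor R A B a2 b2)))),
     counit = tensor_lift (ground R) (\<lambda>a b. counit A a \<otimes>\<^bsub>R\<^esub> counit B b),
     antipode = (\<lambda>t. t)\<rparr>)"

lemma tensor_coalg_simps [simp]:
  "carrier (tensor_coalg A B) = carrier (tensor R A B)"
  "add (tensor_coalg A B) = add (tensor R A B)" "zero (tensor_coalg A B) = zero (tensor R A B)"
  "smult (tensor_coalg A B) = smult (tensor R A B)"
  "mult (tensor_coalg A B) = mult (tensor R A B)" "one (tensor_coalg A B) = one (tensor R A B)"
  by (auto simp: tensor_coalg_def Let_def)

lemma tensor_coalg_TT: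
  "tensor R (tensor_coalg A B) (tensor_coalg A B) = tensor R (tensor R A B) (tensor R A B)"
  "pure_tensor R (tensor_coalg A B) (tensor_coalg A B) = pure_tensor R (tensor R A B) (tensor R A B)"
  by (rule tensor_cong; simp)+

lemma lin_tensor_coalg [simp]:
  "linear_maps R (tensor_coalg A B) V = linear_maps R (tensor R A B) V"
  "linear_maps R V (tensor_coalg A B) = linear_maps R V (tensor R A B)"
  by (simp_all add: linear_maps_def)

lemma bil_tensor_coalg [simp]:
  "bilinear_maps R (tensor_coalg A B) (tensor_coalg A B) V =
    bilinear_maps R (tensor R A B) (tensor R A B) V"
  by (simp add: bilinear_maps_def)

lemma comult_tensor_coalg:
  "comult (tensor_coalg A B) = tensor_lift (tensor R (tensor R A B) (tensor R A B))
    (\<lambda>a b. sweedler A (tensor R (tensor R A B) (tensor R A B)) a (\<lambda>a1 a2.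
      sweedler B (tensor R (tensor R A B) (tensor R A B)) b (\<lambda>b1 b2.
       pure_tensor R (tensor R A B) (tensor R A B) (pure_tensor R A B a1 b1) (pure_tensor R A B a2 b2))))"
  "counit (tensor_coalg A B) = tensor_lift (ground R) (\<lambda>a b. counit A a \<otimes>\<^bsub>R\<^esub> counit B b)"
  by (simp_all add: tensor_coalg_def Let_def)

context
  fixes A :: "('k, 'u, 'm) hopf_scheme" and B :: "('k, 'v, 'n) hopf_scheme"
  assumes A: "cocoalgebra A" and B: "cocoalgebra B"
begin

lemma AB_mod [simp]: "module R A" "module R B" using A B by auto

lemma tensor_coalg_comult_bil:
  "bil A B (tensor R (tensor R A B) (tensor R A B)) (\<lambda>a b.
    sweedler A (tensor R (tensor R A B) (tensor R A B)) a (\<lambda>a1 a2.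
      sweedler B (tensor R (tensor R A B) (tensor R A B)) b (\<lambda>b1 b2.
       pure_tensor R (tensor R A B) (tensor R A B) (pure_tensor R A B a1 b1) (pure_tensor R A B a2 b2))))"
  using A B by (auto intro!: lin_intros)

lemma tensor_coalg_counit_bil: "bil A B (ground R) (\<lambda>a b. counit A a \<otimes>\<^bsub>R\<^esub> counit B b)"
proof (rule bilI)
  show "lin B (ground R) (\<lambda>b. counit A a \<otimes>\<^bsub>R\<^esub> counit B b)" if "a \<in> carrier A" for a
    using lin_smult_r[of "ground R" "counit B" B "counit A a"] that A B by (simp add: counit_lin)
  show "lin A (ground R) (\<lambda>a. counit A a \<otimes>\<^bsub>R\<^esub> counit B b)" if "b \<in> carrier B" for b
    using lin_smult_l[of "ground R" "counit A" A "counit B b"] that A B by (simp add: counit_lin)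
qed

lemma tensor_coalg_counit [simp]:
  "a \<in> carrier A \<Longrightarrow> b \<in> carrier B \<Longrightarrow>
    counit (tensor_coalg A B) (pure_tensor R A B a b) = counit A a \<otimes>\<^bsub>R\<^esub> counit B b"
  unfolding comult_tensor_coalg by (simp add: tensor_lift_pure tensor_coalg_counit_bil)

text \<open>The components of a pure tensor split independently; all computations with several variables
  rest on this.\<close>

lemma sw_tensor0:
  assumes V: "module R V" and F: "bil (tensor R A B) (tensor R A B) V F"
    and a: "a \<in> carrier A" and b: "b \<in> carrier B"
  shows "sweedler (tensor_coalg A B) V (pure_tensor R A B a b) F =
    sweedler A V a (\<lambda>a1 a2. sweedler B V b (\<lambda>b1 b2.
      F (pure_tensor R A B a1 b1) (pure_tensor R A B a2 b2)))"
proof -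
  let ?T = "tensor R A B" let ?TT = "tensor R ?T ?T"
  let ?g = "tensor_lift V F"
  have T [simp]: "module R ?T" "module R ?TT" by simp_all
  have g: "lin ?TT V ?g" using V F by (intro tensor_lift_lin) auto
  have "sweedler (tensor_coalg A B) V (pure_tensor R A B a b) F =
      ?g (sweedler A ?TT a (\<lambda>a1 a2. sweedler B ?TT b (\<lambda>b1 b2.
       pure_tensor R ?T ?T (pure_tensor R A B a1 b1) (pure_tensor R A B a2 b2))))"
    unfolding sweedler_def[of "tensor_coalg A B"] comult_tensor_coalg
    using a b tensor_coalg_comult_bil by (simp add: tensor_lift_pure[of A B])
  also have "\<dots> = sweedler A V a (\<lambda>a1 a2. sweedler B V b (\<lambda>b1 b2.
      F (pure_tensor R A B a1 b1) (pure_tensor R A B a2 b2)))"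
    using A B V F a b g
    by (subst sw_map[of A ?TT V ?g])
      (auto intro!: sw_cong simp: sw_map[of B ?TT V ?g] tensor_lift_pure[of ?T ?T])
  finally show ?thesis .
qed

lemma tensor_coalg_cocoalgebra: "cocoalgebra (tensor_coalg A B)"
proof -
  let ?C = "tensor_coalg A B" and ?T = "tensor R A B" let ?TT = "tensor R ?T ?T"
  let ?W = "tensor R ?T ?TT"
  have T [simp]: "module R ?T" "module R ?TT" "module R ?W" by simp_all
  have C: "module R ?C" by (rule module_cong[of ?T]) auto
  have dl: "lin ?T ?TT (comult ?C)"
    unfolding comult_tensor_coalg using tensor_coalg_comult_bil by (intro tensor_lift_lin) auto
  have el: "lin ?T (ground R) (counit ?C)"
    unfolding comult_tensor_coalg using tensor_coalg_counit_bil by (intro tensor_lift_lin) auto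
  have CT: "tensor R ?C ?TT = ?W" "pure_tensor R ?C ?TT = pure_tensor R ?T ?TT"
    by (rule tensor_cong; simp)+
  have ls: "lin M V (\<lambda>x. sweedler ?C V (f x) F)"
    if "module R V" "bil ?T ?T V F" "lin M ?T f"
    for M :: "('k, 'u2, 'm2) module_scheme" and V :: "('k, 'v2, 'n2) module_scheme" and f F
    unfolding sweedler_def using that
    by (intro lin_tensor_lift[of ?T ?T] lin_comp[OF that(3) dl]) auto
  have lp: "lin M V (\<lambda>x. sweedler ?C V c (\<lambda>a b. F x a b))"
    if "module R V" "c \<in> carrier ?T"
      "\<And>a b. a \<in> carrier ?T \<Longrightarrow> b \<in> carrier ?T \<Longrightarrow> lin M V (\<lambda>x. F x a b)"
    for M :: "('k, 'u2, 'm2) module_scheme" and V :: "('k, 'v2, 'n2) module_scheme" and c F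
    unfolding sweedler_def using that lin_closed[OF dl]
    by (intro lin_tensor_lift_param[of ?T ?T]) auto
  let ?P = "\<lambda>x1 x2 x3. pure_tensor R ?T ?TT x1 (pure_tensor R ?T ?T x2 x3)"
  let ?p = "pure_tensor R A B"
  have coas: "sweedler ?C ?W x (\<lambda>y x3. sweedler ?C ?W y (\<lambda>x1 x2. ?P x1 x2 x3)) =
      sweedler ?C ?W x (\<lambda>x1 y. sweedler ?C ?W y (\<lambda>x2 x3. ?P x1 x2 x3))"
    if x: "x \<in> carrier ?T" for x
  proof (rule lin_tensor_ext[OF AB_mod T(3) _ _ _ x])
    show "lin ?T ?W (\<lambda>x. sweedler ?C ?W x (\<lambda>y x3. sweedler ?C ?W y (\<lambda>x1 x2. ?P x1 x2 x3)))"
      by (intro ls lp lin_id bilI lin_pure_l lin_pure_r) auto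
    show "lin ?T ?W (\<lambda>x. sweedler ?C ?W x (\<lambda>x1 y. sweedler ?C ?W y (\<lambda>x2 x3. ?P x1 x2 x3)))"
      by (intro ls lp lin_id bilI lin_pure_l lin_pure_r) auto
    fix a b assume a: "a \<in> carrier A" and b: "b \<in> carrier B"
    let ?Q = "\<lambda>a1 b1 a2 b2 a3 b3. ?P (?p a1 b1) (?p a2 b2) (?p a3 b3)"
    have "sweedler ?C ?W (?p a b) (\<lambda>y x3. sweedler ?C ?W y (\<lambda>x1 x2. ?P x1 x2 x3)) =
        sweedler A ?W a (\<lambda>y a3. sweedler B ?W b (\<lambda>z b3.
          sweedler ?C ?W (?p y z) (\<lambda>x1 x2. ?P x1 x2 (?p a3 b3))))"
      using a b by (intro sw_tensor0 ls lp lin_id bilI lin_pure_l lin_pure_r) auto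
    also have "\<dots> = sweedler A ?W a (\<lambda>y a3. sweedler B ?W b (\<lambda>z b3.
        sweedler A ?W y (\<lambda>a1 a2. sweedler B ?W z (\<lambda>b1 b2. ?Q a1 b1 a2 b2 a3 b3))))"
      using A B a b by (intro sw_cong sw_tensor0 lin_id bilI lin_pure_l lin_pure_r) auto
    also have "\<dots> = sweedler A ?W a (\<lambda>y a3. sweedler A ?W y (\<lambda>a1 a2.
        sweedler B ?W b (\<lambda>z b3. sweedler B ?W z (\<lambda>b1 b2. ?Q a1 b1 a2 b2 a3 b3))))"
      using A B a b by (intro sw_cong sw_swap) auto
    also have "\<dots> = sweedler A ?W a (\<lambda>a1 y. sweedler A ?W y (\<lambda>a2 a3.
        sweedler B ?W b (\<lambda>z b3. sweedler B ?W z (\<lambda>b1 b2. ?Q a1 b1 a2 b2 a3 b3))))"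
      using A B a b by (intro coassoc trilinearI) (auto intro!: lin_intros)
    also have "\<dots> = sweedler A ?W a (\<lambda>a1 y. sweedler A ?W y (\<lambda>a2 a3.
        sweedler B ?W b (\<lambda>b1 z. sweedler B ?W z (\<lambda>b2 b3. ?Q a1 b1 a2 b2 a3 b3))))"
      using A B a b by (intro sw_cong coassoc trilinearI) (auto intro!: lin_intros)
    also have "\<dots> = sweedler A ?W a (\<lambda>a1 y. sweedler B ?W b (\<lambda>b1 z.
        sweedler A ?W y (\<lambda>a2 a3. sweedler B ?W z (\<lambda>b2 b3. ?Q a1 b1 a2 b2 a3 b3))))"
      using A B a b by (intro sw_cong sw_swap) auto
    also have "\<dots> = sweedler A ?W a (\<lambda>a1 y. sweedler B ?W b (\<lambda>b1 z.
          sweedler ?C ?W (?p y z) (\<lambda>x2 x3. ?P (?p a1 b1) x2 x3)))"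
      using A B a b by (intro sw_cong sw_tensor0[symmetric] lin_id bilI lin_pure_l lin_pure_r) auto
    also have "\<dots> = sweedler ?C ?W (?p a b) (\<lambda>x1 y. sweedler ?C ?W y (\<lambda>x2 x3. ?P x1 x2 x3))"
      using a b by (intro sw_tensor0[symmetric] ls lp lin_id bilI lin_pure_l lin_pure_r) auto
    finally show "sweedler ?C ?W (?p a b) (\<lambda>y x3. sweedler ?C ?W y (\<lambda>x1 x2. ?P x1 x2 x3)) =
      sweedler ?C ?W (?p a b) (\<lambda>x1 y. sweedler ?C ?W y (\<lambda>x2 x3. ?P x1 x2 x3))" .
  qed
  have counit: "sweedler ?C ?T x (\<lambda>x1 x2. counit ?C x1 \<odot>\<^bsub>?T\<^esub> x2) = x" if x: "x \<in> carrier ?T" for x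
  proof (rule lin_tensor_ext[OF AB_mod T(1) _ lin_id _ x])
    have bl: "bil ?T ?T ?T (\<lambda>x1 x2. counit ?C x1 \<odot>\<^bsub>?T\<^esub> x2)"
      using el lin_closed[OF el] by (intro bilI lin_smult_l lin_smult_r lin_id) auto
    then show "lin ?T ?T (\<lambda>x. sweedler ?C ?T x (\<lambda>x1 x2. counit ?C x1 \<odot>\<^bsub>?T\<^esub> x2))"
      by (intro ls lin_id) auto
    fix a b assume a: "a \<in> carrier A" and b: "b \<in> carrier B"
    have "sweedler ?C ?T (?p a b) (\<lambda>x1 x2. counit ?C x1 \<odot>\<^bsub>?T\<^esub> x2) =
        sweedler A ?T a (\<lambda>a1 a2. sweedler B ?T b (\<lambda>b1 b2. counit ?C (?p a1 b1) \<odot>\<^bsub>?T\<^esub> ?p a2 b2))"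
      using a b bl by (intro sw_tensor0) auto
    also have "\<dots> = sweedler A ?T a (\<lambda>a1 a2. sweedler B ?T b (\<lambda>b1 b2.
        counit B b1 \<odot>\<^bsub>?T\<^esub> (counit A a1 \<odot>\<^bsub>?T\<^esub> ?p a2 b2)))"
      using A B a b by (intro sw_cong) (auto simp: mod_smult_smult mod_smult_lcomm)
    also have "\<dots> = sweedler A ?T a (\<lambda>a1 a2. counit A a1 \<odot>\<^bsub>?T\<^esub> ?p a2 b)"
      using A B a b by (intro sw_cong counit_sw_l) (auto intro!: lin_intros)
    also have "\<dots> = ?p a b"
      using A B a b by (intro counit_sw_l) (auto intro!: lin_intros)
    finally show "sweedler ?C ?T (?p a b) (\<lambda>x1 x2. counit ?C x1 \<odot>\<^bsub>?T\<^esub> x2) = ?p a b" .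
  qed
  have comm: "sweedler ?C ?TT x (\<lambda>x1 x2. pure_tensor R ?T ?T x2 x1) = comult ?C x"
    if x: "x \<in> carrier ?T" for x
  proof (rule lin_tensor_ext[OF AB_mod T(2) _ dl _ x])
    show "lin ?T ?TT (\<lambda>x. sweedler ?C ?TT x (\<lambda>x1 x2. pure_tensor R ?T ?T x2 x1))"
      by (intro ls lin_id bilI lin_pure_l lin_pure_r) auto
    fix a b assume a: "a \<in> carrier A" and b: "b \<in> carrier B"
    let ?q = "pure_tensor R ?T ?T"
    have "sweedler ?C ?TT (?p a b) (\<lambda>x1 x2. ?q x2 x1) =
        sweedler A ?TT a (\<lambda>a1 a2. sweedler B ?TT b (\<lambda>b1 b2. ?q (?p a2 b2) (?p a1 b1)))"
      using a b by (intro sw_tensor0 bilI lin_id lin_pure_l lin_pure_r) auto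
    also have "\<dots> = sweedler A ?TT a (\<lambda>a1 a2. sweedler B ?TT b (\<lambda>b1 b2. ?q (?p a2 b1) (?p a1 b2)))"
      using A B a b
      by (intro sw_cong cocomm[of B ?TT "\<lambda>b1 b2. ?q (?p _ b1) (?p _ b2)"]) (auto intro!: lin_intros)
    also have "\<dots> = sweedler A ?TT a (\<lambda>a1 a2. sweedler B ?TT b (\<lambda>b1 b2. ?q (?p a1 b1) (?p a2 b2)))"
      using A B a b
      by (intro cocomm[of A ?TT "\<lambda>a1 a2. sweedler B ?TT b (\<lambda>b1 b2. ?q (?p a1 b1) (?p a2 b2))"])
        (auto intro!: lin_intros)
    also have "\<dots> = comult ?C (?p a b)"
      unfolding comult_tensor_coalg
      using a b tensor_coalg_comult_bil by (simp add: tensor_lift_pure)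
    finally show "sweedler ?C ?TT (?p a b) (\<lambda>x1 x2. ?q x2 x1) = comult ?C (?p a b)" .
  qed
  have sw: "sweedler ?C ?C x F = sweedler ?C ?T x F" for x F
    by (simp add: sweedler_def tensor_lift_psum psum_def)
  show ?thesis
    unfolding cocoalgebra_def tensor_coalg_TT CT sw
    using C dl el coas counit comm by auto
qed

(* as a rule without the assumptions of this context, it would loop *)
declare AB_mod [simp del]

end

lemmas sw_tensor = sw_tensor0[folded bil_tensor_coalg]

end

(* tensors are classes, hence sets, but are never compared element by element *)
declare subset_antisym [rule del]

context ground_field
begin

section \<open>Cocommutative Hopf algebras and the groups of coalgebra maps into them\<close>

abbreviation hopf :: "('k, 'u, 'm) hopf_scheme \<Rightarrow> bool"
  where "hopf H \<equiv> cocomm_hopf_algebra R H"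

lemma hopf_alg [simp]: "hopf H \<Longrightarrow> assoc_algebra R H"
  by (simp add: cocomm_hopf_algebra_def hopf_algebra_def bialgebra_def)

lemma hopf_bialgebra: "hopf H \<Longrightarrow> bialgebra R H"
  by (simp add: cocomm_hopf_algebra_def hopf_algebra_def)

lemma hopf_cocoalgebra [simp]:
  assumes "hopf H"
  shows "cocoalgebra H"
proof -
  interpret H: cocomm_hopf_algebra R H by (rule assms)
  show ?thesis
    unfolding cocoalgebra_def
    using H.comult_algebra_map H.counit_algebra_map H.coassoc H.counit_l H.cocomm assms
    by (auto simp: algebra_maps_def)
qed

lemma hopf_module [simp]: "hopf H \<Longrightarrow> module R H"
  by (rule alg_module[OF hopf_alg])

lemma comult_mult:
  assumes "hopf H" "x \<in> carrier H" "y \<in> carrier H"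
  shows "comult H (x \<otimes>\<^bsub>H\<^esub> y) = sweedler H (tensor R H H) x (\<lambda>x1 x2.
    sweedler H (tensor R H H) y (\<lambda>y1 y2. pure_tensor R H H (x1 \<otimes>\<^bsub>H\<^esub> y1) (x2 \<otimes>\<^bsub>H\<^esub> y2)))"
proof -
  interpret H: cocomm_hopf_algebra R H by (rule assms)
  have "comult H (x \<otimes>\<^bsub>H\<^esub> y) = comult H x \<otimes>\<^bsub>tensor R H H\<^esub> comult H y"
    using H.comult_algebra_map assms by (auto simp: algebra_maps_def)
  then show ?thesis
    using assms by (simp add: tensor_mult_lift sweedler_def)
qed

lemma comult_one: "hopf H \<Longrightarrow> comult H \<one>\<^bsub>H\<^esub> = pure_tensor R H H \<one>\<^bsub>H\<^esub> \<one>\<^bsub>H\<^esub>"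
  using bialgebra.comult_algebra_map[OF hopf_bialgebra[of H]]
  by (simp add: algebra_maps_def tensor_one)

lemma counit_mult [simp]:
  "hopf H \<Longrightarrow> x \<in> carrier H \<Longrightarrow> y \<in> carrier H \<Longrightarrow>
    counit H (x \<otimes>\<^bsub>H\<^esub> y) = counit H x \<otimes> counit H y"
  using bialgebra.counit_algebra_map[OF hopf_bialgebra] by (auto simp: algebra_maps_def)

lemma counit_one [simp]: "hopf H \<Longrightarrow> counit H \<one>\<^bsub>H\<^esub> = \<one>"
  using bialgebra.counit_algebra_map[OF hopf_bialgebra] by (auto simp: algebra_maps_def)

lemma sw_mult:
  assumes "hopf H" "module R V" "bil H H V F" "x \<in> carrier H" "y \<in> carrier H"
  shows "sweedler H V (x \<otimes>\<^bsub>H\<^esub> y) F = sweedler H V x (\<lambda>x1 x2.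
    sweedler H V y (\<lambda>y1 y2. F (x1 \<otimes>\<^bsub>H\<^esub> y1) (x2 \<otimes>\<^bsub>H\<^esub> y2)))"
proof -
  let ?T = "tensor R H H"
  have g: "lin ?T V (tensor_lift V F)" using assms by (intro tensor_lift_lin) auto
  have "sweedler H V (x \<otimes>\<^bsub>H\<^esub> y) F = tensor_lift V F (sweedler H ?T x (\<lambda>x1 x2.
    sweedler H ?T y (\<lambda>y1 y2. pure_tensor R H H (x1 \<otimes>\<^bsub>H\<^esub> y1) (x2 \<otimes>\<^bsub>H\<^esub> y2))))"
    using assms by (simp add: sweedler_def[of H V] comult_mult)
  also have "\<dots> = sweedler H V x (\<lambda>x1 x2.
    sweedler H V y (\<lambda>y1 y2. F (x1 \<otimes>\<^bsub>H\<^esub> y1) (x2 \<otimes>\<^bsub>H\<^esub> y2)))"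
    using assms g
    by (subst sw_map[of H ?T V]) (auto intro!: sw_cong simp: sw_map[of H ?T V] tensor_lift_pure)
  finally show ?thesis .
qed

lemma sw_one:
  assumes "hopf H" "module R V" "bil H H V F"
  shows "sweedler H V \<one>\<^bsub>H\<^esub> F = F \<one>\<^bsub>H\<^esub> \<one>\<^bsub>H\<^esub>"
  using assms by (simp add: sweedler_def comult_one tensor_lift_pure)

lemma antipode_lin: "hopf H \<Longrightarrow> lin H H (antipode H)"
  by (simp add: cocomm_hopf_algebra_def hopf_algebra_def hopf_algebra_axioms_def)

lemma antipode_closed [simp]: "hopf H \<Longrightarrow> x \<in> carrier H \<Longrightarrow> antipode H x \<in> carrier H"
  by (rule lin_closed[OF antipode_lin])

lemma lin_antipode: "hopf H \<Longrightarrow> lin M H f \<Longrightarrow> lin M H (\<lambda>x. antipode H (f x))"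
  by (rule lin_comp[OF _ antipode_lin])

lemma antipode_sw_l:
    "hopf H \<Longrightarrow> x \<in> carrier H \<Longrightarrow>
      sweedler H H x (\<lambda>x1 x2. antipode H x1 \<otimes>\<^bsub>H\<^esub> x2) = counit H x \<odot>\<^bsub>H\<^esub> \<one>\<^bsub>H\<^esub>"
  and antipode_sw_r:
    "hopf H \<Longrightarrow> x \<in> carrier H \<Longrightarrow>
      sweedler H H x (\<lambda>x1 x2. x1 \<otimes>\<^bsub>H\<^esub> antipode H x2) = counit H x \<odot>\<^bsub>H\<^esub> \<one>\<^bsub>H\<^esub>"
  by (simp_all add: cocomm_hopf_algebra_def hopf_algebra_def hopf_algebra_axioms_def)

text \<open>One-sided inverses for the convolution product of linear maps from a coalgebra to an algebra
  agree, as in any monoid.\<close>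

lemma conv_inverse_unique:
  assumes C: "cocoalgebra C" and E: "assoc_algebra R E"
    and l: "lin C E l" and f: "lin C E f" and r: "lin C E r"
    and lf: "\<And>c. c \<in> carrier C \<Longrightarrow> sweedler C E c (\<lambda>a b. l a \<otimes>\<^bsub>E\<^esub> f b) = counit C c \<odot>\<^bsub>E\<^esub> \<one>\<^bsub>E\<^esub>"
    and fr: "\<And>c. c \<in> carrier C \<Longrightarrow> sweedler C E c (\<lambda>a b. f a \<otimes>\<^bsub>E\<^esub> r b) = counit C c \<odot>\<^bsub>E\<^esub> \<one>\<^bsub>E\<^esub>"
    and c: "c \<in> carrier C"
  shows "l c = r c"
proof -
  note cl [simp] = lin_closed[OF l] lin_closed[OF f] lin_closed[OF r]
  have M [simp]: "module R E" using E by simp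
  have "l c = sweedler C E c (\<lambda>a b. counit C b \<odot>\<^bsub>E\<^esub> l a)"
    using C c l by (simp add: counit_sw_r)
  also have "\<dots> = sweedler C E c (\<lambda>a y. l a \<otimes>\<^bsub>E\<^esub> sweedler C E y (\<lambda>u v. f u \<otimes>\<^bsub>E\<^esub> r v))"
    using C c E by (intro sw_cong) (auto simp: fr)
  also have "\<dots> = sweedler C E c (\<lambda>a y. sweedler C E y (\<lambda>u v. l a \<otimes>\<^bsub>E\<^esub> f u \<otimes>\<^bsub>E\<^esub> r v))"
    using C c E
    by (intro sw_cong) (auto simp: alg_mult_assoc sw_map[of C E E "\<lambda>x. l _ \<otimes>\<^bsub>E\<^esub> x"] lin_mult_r
        intro!: sw_cong)
  also have "\<dots> = sweedler C E c (\<lambda>y v. sweedler C E y (\<lambda>a u. l a \<otimes>\<^bsub>E\<^esub> f u \<otimes>\<^bsub>E\<^esub> r v))"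
    using C c E l f r by (intro coassoc[symmetric] trilinearI lin_mult_l lin_mult_r) auto
  also have "\<dots> = sweedler C E c (\<lambda>y v. sweedler C E y (\<lambda>a u. l a \<otimes>\<^bsub>E\<^esub> f u) \<otimes>\<^bsub>E\<^esub> r v)"
    using C c E
    by (intro sw_cong) (auto simp: sw_map[of C E E "\<lambda>x. x \<otimes>\<^bsub>E\<^esub> r _"] lin_mult_l)
  also have "\<dots> = sweedler C E c (\<lambda>y v. counit C y \<odot>\<^bsub>E\<^esub> r v)"
    using C c E by (intro sw_cong) (auto simp: lf)
  also have "\<dots> = r c" using C c r by (simp add: counit_sw_l)
  finally show ?thesis .
qed

lemma counit_antipode [simp]:
  assumes H: "hopf H" and x: "x \<in> carrier H"
  shows "counit H (antipode H x) = counit H x"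
proof -
  let ?G = "ground R"
  have l: "lin H ?G (\<lambda>x. counit H (antipode H x))"
    using H by (intro lin_counit antipode_lin) auto
  have "counit H (antipode H x) = sweedler H ?G x (\<lambda>a b. counit H b \<odot>\<^bsub>?G\<^esub> counit H (antipode H a))"
    using H x l by (intro counit_sw_r[symmetric]) auto
  also have "\<dots> = sweedler H ?G x (\<lambda>a b. counit H (antipode H a \<otimes>\<^bsub>H\<^esub> b))"
    using H x by (intro sw_cong) (auto simp: m_comm)
  also have "\<dots> = counit H (sweedler H H x (\<lambda>a b. antipode H a \<otimes>\<^bsub>H\<^esub> b))"
    using H x by (intro sw_map[symmetric]) (auto simp: counit_lin)
  also have "\<dots> = counit H x"
    using H x by (simp add: antipode_sw_l lin_smult[OF counit_lin])
  finally show ?thesis .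
qed

text \<open>Both sides are convolution inverses of the coproduct \<open>H \<rightarrow> H \<otimes> H\<close>. That the right-hand
  side is one depends on cocommutativity.\<close>

lemma comult_antipode:
  assumes H: "hopf H" and x: "x \<in> carrier H"
  shows "comult H (antipode H x) = sweedler H (tensor R H H) x
    (\<lambda>a b. pure_tensor R H H (antipode H a) (antipode H b))"
proof -
  let ?T = "tensor R H H" and ?S = "antipode H" and ?p = "pure_tensor R H H"
  have E: "assoc_algebra R ?T" using H by (intro tensor_algebra) auto
  have C [simp]: "cocoalgebra H" and M [simp]: "module R H" using H by auto
  note lS = lin_intros lin_antipode[OF H]
  show ?thesis
  proof (rule conv_inverse_unique[OF C E _ comult_lin[OF C] _ _ _ x])
    show "lin H ?T (\<lambda>x. comult H (?S x))" using H by (intro lin_comp[OF antipode_lin comult_lin]) auto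
    show "lin H ?T (\<lambda>x. sweedler H ?T x (\<lambda>a b. ?p (?S a) (?S b)))"
      using H by (auto intro!: lS)
    fix c assume c: "c \<in> carrier H"
    have mult: "comult H u \<otimes>\<^bsub>?T\<^esub> comult H v = comult H (u \<otimes>\<^bsub>H\<^esub> v)"
      if "u \<in> carrier H" "v \<in> carrier H" for u v
      using bialgebra.comult_algebra_map[OF hopf_bialgebra[OF H]] that by (auto simp: algebra_maps_def)
    have "sweedler H ?T c (\<lambda>a b. comult H (?S a) \<otimes>\<^bsub>?T\<^esub> comult H b) =
        sweedler H ?T c (\<lambda>a b. comult H (?S a \<otimes>\<^bsub>H\<^esub> b))"
      using H c by (intro sw_cong) (auto simp: mult)
    also have "\<dots> = comult H (sweedler H H c (\<lambda>a b. ?S a \<otimes>\<^bsub>H\<^esub> b))"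
      using H c by (intro sw_map[symmetric]) (auto simp: comult_lin)
    also have "\<dots> = counit H c \<odot>\<^bsub>?T\<^esub> \<one>\<^bsub>?T\<^esub>"
      using H c by (simp add: antipode_sw_l lin_smult[OF comult_lin] comult_one tensor_one)
    finally show "sweedler H ?T c (\<lambda>a b. comult H (?S a) \<otimes>\<^bsub>?T\<^esub> comult H b) =
      counit H c \<odot>\<^bsub>?T\<^esub> \<one>\<^bsub>?T\<^esub>" .
    have "sweedler H ?T c (\<lambda>a b. comult H a \<otimes>\<^bsub>?T\<^esub> sweedler H ?T b (\<lambda>u v. ?p (?S u) (?S v))) =
       sweedler H ?T c (\<lambda>a b. sweedler H ?T a (\<lambda>a1 a2. ?p a1 a2) \<otimes>\<^bsub>?T\<^esub>
         sweedler H ?T b (\<lambda>u v. ?p (?S u) (?S v)))"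
      using c by (intro sw_cong) (auto simp: sw_pure)
    also have "\<dots> = sweedler H ?T c (\<lambda>a b. sweedler H ?T a (\<lambda>a1 a2. sweedler H ?T b (\<lambda>u v.
        ?p a1 a2 \<otimes>\<^bsub>?T\<^esub> ?p (?S u) (?S v))))"
      using H c E
      by (intro sw_cong[OF C c], subst sw_map[of H ?T ?T "\<lambda>x. x \<otimes>\<^bsub>?T\<^esub> sweedler H ?T _ _"])
        (auto intro!: lin_mult_l lin_id sw_cong[OF C] sw_map[of H ?T ?T "\<lambda>x. ?p _ _ \<otimes>\<^bsub>?T\<^esub> x"] lin_mult_r
          simp del: pure_mult)
    also have "\<dots> = sweedler H ?T c (\<lambda>a b. sweedler H ?T a (\<lambda>a1 a2. sweedler H ?T b (\<lambda>u v.
        ?p (a1 \<otimes>\<^bsub>H\<^esub> ?S u) (a2 \<otimes>\<^bsub>H\<^esub> ?S v))))"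
      using H c by (intro sw_cong) auto
    also have "\<dots> = sweedler H ?T c (\<lambda>a b. sweedler H ?T a (\<lambda>a1 a2. sweedler H ?T b (\<lambda>u v.
        ?p (a1 \<otimes>\<^bsub>H\<^esub> ?S a2) (u \<otimes>\<^bsub>H\<^esub> ?S v))))"
      using H c by (intro sw_middle_four[symmetric, of H ?T
            "\<lambda>a1 a2 u v. ?p (a1 \<otimes>\<^bsub>H\<^esub> ?S a2) (u \<otimes>\<^bsub>H\<^esub> ?S v)"] quadrilinearI trilinearI) (auto intro!: lS)
    also have "\<dots> = sweedler H ?T c (\<lambda>a b. sweedler H ?T a (\<lambda>a1 a2.
        ?p (a1 \<otimes>\<^bsub>H\<^esub> ?S a2) (counit H b \<odot>\<^bsub>H\<^esub> \<one>\<^bsub>H\<^esub>)))"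
      using H c
      by (intro sw_cong[OF C]) (auto simp: sw_map[of H H ?T "?p _", symmetric] lin_pure_r antipode_sw_r)
    also have "\<dots> = sweedler H ?T c (\<lambda>a b. counit H b \<odot>\<^bsub>?T\<^esub> sweedler H ?T a (\<lambda>a1 a2.
        ?p (a1 \<otimes>\<^bsub>H\<^esub> ?S a2) \<one>\<^bsub>H\<^esub>))"
      using H c
      by (intro sw_cong[OF C c])
        (auto simp: sw_map[of H ?T ?T "\<lambda>t. _ \<odot>\<^bsub>?T\<^esub> t"] lin_smult_r tensor_pure_smult pure_balanced
          intro!: sw_cong)
    also have "\<dots> = sweedler H ?T c (\<lambda>a1 a2. ?p (a1 \<otimes>\<^bsub>H\<^esub> ?S a2) \<one>\<^bsub>H\<^esub>)"
      using H c by (intro counit_sw_r) (auto intro!: lS)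
    also have "\<dots> = ?p (counit H c \<odot>\<^bsub>H\<^esub> \<one>\<^bsub>H\<^esub>) \<one>\<^bsub>H\<^esub>"
      using H c by (simp add: sw_map[of H H ?T "\<lambda>t. ?p t _", symmetric] lin_pure_l antipode_sw_r)
    also have "\<dots> = counit H c \<odot>\<^bsub>?T\<^esub> \<one>\<^bsub>?T\<^esub>"
      using H c by (simp add: tensor_pure_smult tensor_one)
    finally show "sweedler H ?T c (\<lambda>a b. comult H a \<otimes>\<^bsub>?T\<^esub>
        sweedler H ?T b (\<lambda>u v. ?p (?S u) (?S v))) = counit H c \<odot>\<^bsub>?T\<^esub> \<one>\<^bsub>?T\<^esub>" .
  qed
qed

definition coalg_map :: "('k, 'c, 'm) hopf_scheme \<Rightarrow> ('k, 'u, 'n) hopf_scheme \<Rightarrow> ('c \<Rightarrow> 'u) \<Rightarrow> bool"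
  where "coalg_map C H f \<longleftrightarrow> lin C H f \<and> (\<forall>c \<in> carrier C.
    comult H (f c) = sweedler C (tensor R H H) c (\<lambda>a b. pure_tensor R H H (f a) (f b)) \<and>
    counit H (f c) = counit C c)"

lemma coalg_mapD:
  assumes "coalg_map C H f"
  shows "lin C H f" "c \<in> carrier C \<Longrightarrow> f c \<in> carrier H"
    "c \<in> carrier C \<Longrightarrow> counit H (f c) = counit C c"
    "c \<in> carrier C \<Longrightarrow>
      comult H (f c) = sweedler C (tensor R H H) c (\<lambda>a b. pure_tensor R H H (f a) (f b))"
  using assms lin_closed[of f C H] by (auto simp: coalg_map_def)

text \<open>Coalgebra maps commute with passing to Sweedler components.\<close>

lemma sw_coalg_map:
  assumes "cocoalgebra C" "module R H" "module R V" "coalg_map C H f" "bil H H V F" "c \<in> carrier C"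
  shows "sweedler H V (f c) F = sweedler C V c (\<lambda>a b. F (f a) (f b))"
  using assms coalg_mapD[OF assms(4)] by (intro sw_of_comult) auto

lemma coalg_map_comp:
  assumes "cocoalgebra C" "cocoalgebra D" "coalg_map C D f" "coalg_map D H g" "module R H"
  shows "coalg_map C H (\<lambda>x. g (f x))"
  unfolding coalg_map_def
proof (intro conjI ballI)
  note f = coalg_mapD[OF assms(3)] and g = coalg_mapD[OF assms(4)]
  show "lin C H (\<lambda>x. g (f x))" by (rule lin_comp[OF f(1) g(1)])
  fix c assume c: "c \<in> carrier C"
  show "counit H (g (f c)) = counit C c" using c f g by simp
  show "comult H (g (f c)) =
      sweedler C (tensor R H H) c (\<lambda>a b. pure_tensor R H H (g (f a)) (g (f b)))"
    using c f g assms
    by (simp add: sw_coalg_map[of C D "tensor R H H" f] bilI lin_pure_l lin_pure_r)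
qed

lemma coalg_map_cong:
  assumes "cocoalgebra C" "coalg_map C H f" "\<And>c. c \<in> carrier C \<Longrightarrow> f c = g c"
  shows "coalg_map C H g"
  unfolding coalg_map_def
proof (intro conjI ballI)
  note f = coalg_mapD[OF assms(2)]
  show "lin C H g" by (rule lin_cong[OF f(1)]) (use assms in auto)
  fix c assume c: "c \<in> carrier C"
  show "counit H (g c) = counit C c" using c f assms(3) by metis
  show "comult H (g c) = sweedler C (tensor R H H) c (\<lambda>a b. pure_tensor R H H (g a) (g b))"
    using f(4)[OF c] sw_cong[OF assms(1) c, of "\<lambda>a b. pure_tensor R H H (f a) (f b)"
        "\<lambda>a b. pure_tensor R H H (g a) (g b)"] assms(3) c by simp
qed

text \<open>
  For a bilinear map \<open>op\<close>, the map \<open>conv C V op f g\<close> sends \<open>c\<close> to the sum of the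
  \<open>op (f c') (g c'')\<close>: it is \<open>op\<close> applied to the generalized elements \<open>f\<close> and \<open>g\<close>.
\<close>

definition conv :: "('k, 'c, 'm) hopf_scheme \<Rightarrow> ('k, 'v, 'n) module_scheme \<Rightarrow> ('a \<Rightarrow> 'b \<Rightarrow> 'v) \<Rightarrow>
    ('c \<Rightarrow> 'a) \<Rightarrow> ('c \<Rightarrow> 'b) \<Rightarrow> 'c \<Rightarrow> 'v"
  where "conv C V op f g = (\<lambda>c \<in> carrier C. sweedler C V c (\<lambda>a b. op (f a) (g b)))"

text \<open>
  Cocommutative Hopf algebras are the group objects among the cocommutative coalgebras: for every
  coalgebra \<open>C\<close> the coalgebra maps \<open>C \<rightarrow> H\<close> (the generalized elements of \<open>H\<close>) form a group under the
  convolution product. Maps are extensional, so that equality in the group is equality of functions.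
\<close>

definition cgroup :: "('k, 'c, 'm) hopf_scheme \<Rightarrow> ('k, 'u, 'n) hopf_scheme \<Rightarrow> ('c \<Rightarrow> 'u) monoid"
  where "cgroup C H = \<lparr>carrier = {f \<in> extensional (carrier C). coalg_map C H f},
    mult = conv C H (\<otimes>\<^bsub>H\<^esub>), one = (\<lambda>c \<in> carrier C. counit C c \<odot>\<^bsub>H\<^esub> \<one>\<^bsub>H\<^esub>)\<rparr>"

lemma cgroup_carrier: "f \<in> carrier (cgroup C H) \<longleftrightarrow> f \<in> extensional (carrier C) \<and> coalg_map C H f"
  and cgroup_mult: "f \<otimes>\<^bsub>cgroup C H\<^esub> g = conv C H (\<otimes>\<^bsub>H\<^esub>) f g"
  and cgroup_one: "\<one>\<^bsub>cgroup C H\<^esub> = (\<lambda>c \<in> carrier C. counit C c \<odot>\<^bsub>H\<^esub> \<one>\<^bsub>H\<^esub>)"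
  by (auto simp: cgroup_def)

lemma conv_ext [simp]: "conv C V op f g \<in> extensional (carrier C)"
  by (simp add: conv_def)

lemma conv_lin:
  assumes "cocoalgebra C" "module R V" "bil A B V op" "lin C A f" "lin C B g"
  shows "lin C V (conv C V op f g)"
proof (rule lin_cong)
  show "lin C V (\<lambda>c. sweedler C V c (\<lambda>a b. op (f a) (g b)))"
    using assms lin_closed[OF assms(4)] lin_closed[OF assms(5)]
    by (intro lin_sw lin_id bilI lin_comp[OF _ bil_l[OF assms(3)]] lin_comp[OF _ bil_r[OF assms(3)]])
      auto
qed (use assms in \<open>auto simp: conv_def\<close>)

text \<open>A bilinear map that is compatible with coproducts turns generalized elements into
  generalized elements.\<close>

lemma conv_coalg_map:
  assumes C: "cocoalgebra C" and A: "cocoalgebra A" and B: "cocoalgebra B" and V: "cocoalgebra V"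
    and op: "bil A B V op"
    and d: "\<And>x y. x \<in> carrier A \<Longrightarrow> y \<in> carrier B \<Longrightarrow> comult V (op x y) =
      sweedler A (tensor R V V) x (\<lambda>x1 x2. sweedler B (tensor R V V) y (\<lambda>y1 y2.
        pure_tensor R V V (op x1 y1) (op x2 y2)))"
    and e: "\<And>x y. x \<in> carrier A \<Longrightarrow> y \<in> carrier B \<Longrightarrow> counit V (op x y) = counit A x \<otimes> counit B y"
    and f: "coalg_map C A f" and g: "coalg_map C B g"
  shows "coalg_map C V (conv C V op f g)"
  unfolding coalg_map_def
proof (intro conjI ballI)
  let ?T = "tensor R V V" and ?p = "pure_tensor R V V"
  have M [simp]: "module R A" "module R B" "module R V" using A B V by auto
  note f' = coalg_mapD[OF f] and g' = coalg_mapD[OF g]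
  note [simp] = f'(2) g'(2) bil_closed[OF op]
  note fg = lin_comp[OF f'(1) bil_l[OF op]] lin_comp[OF g'(1) bil_r[OF op]]
  have bop: "bil C C V (\<lambda>a b. op (f a) (g b))" using fg by (intro bilI) auto
  show "lin C V (conv C V op f g)" using C f' g' op by (intro conv_lin) auto
  fix c assume c: "c \<in> carrier C"
  have "counit V (conv C V op f g c) = sweedler C (ground R) c (\<lambda>a b. counit V (op (f a) (g b)))"
    unfolding conv_def using C V c by (simp, intro sw_map) (auto intro: counit_lin)
  also have "\<dots> = sweedler C (ground R) c (\<lambda>a b. counit C a \<odot>\<^bsub>ground R\<^esub> counit C b)"
    using C c e f' g' by (intro sw_cong) auto
  also have "\<dots> = counit C c" using C c by (intro counit_sw_l counit_lin) auto
  finally show "counit V (conv C V op f g c) = counit C c" .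
  have "comult V (conv C V op f g c) = sweedler C ?T c (\<lambda>a b. comult V (op (f a) (g b)))"
    unfolding conv_def using C V c by (simp, intro sw_map) (auto intro: comult_lin)
  also have "\<dots> = sweedler C ?T c (\<lambda>a b. sweedler A ?T (f a) (\<lambda>x1 x2. sweedler B ?T (g b) (\<lambda>y1 y2.
      ?p (op x1 y1) (op x2 y2))))"
    using C c by (intro sw_cong) (auto simp: d)
  also have "\<dots> = sweedler C ?T c (\<lambda>a b. sweedler C ?T a (\<lambda>a1 a2. sweedler B ?T (g b) (\<lambda>y1 y2.
      ?p (op (f a1) y1) (op (f a2) y2))))"
    using A B C c f op
    by (intro sw_cong[OF C c] sw_coalg_map) (auto intro!: bilI lin_sw_param lin_pure_l lin_pure_r bil_l[OF op])
  also have "\<dots> = sweedler C ?T c (\<lambda>a b. sweedler C ?T a (\<lambda>a1 a2. sweedler C ?T b (\<lambda>b1 b2.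
      ?p (op (f a1) (g b1)) (op (f a2) (g b2)))))"
    using A B C c g op
    by (intro sw_cong[OF C] sw_coalg_map) (auto intro!: bilI lin_pure_l lin_pure_r bil_r[OF op])
  also have "\<dots> = sweedler C ?T c (\<lambda>a b. sweedler C ?T a (\<lambda>a1 a2. sweedler C ?T b (\<lambda>b1 b2.
      ?p (op (f a1) (g a2)) (op (f b1) (g b2)))))"
    using C c fg
    by (intro sw_middle_four[symmetric, of C ?T "\<lambda>a1 a2 b1 b2. ?p (op (f a1) (g a2)) (op (f b1) (g b2))"]
        quadrilinearI trilinearI lin_pure_l lin_pure_r) auto
  also have "\<dots> = sweedler C ?T c (\<lambda>a b. sweedler C ?T a (\<lambda>a1 a2.
      ?p (op (f a1) (g a2)) (conv C V op f g b)))"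
    using C c by (intro sw_cong[OF C])
      (auto simp: conv_def sw_map[of C V ?T "?p _", symmetric] lin_pure_r)
  also have "\<dots> = sweedler C ?T c (\<lambda>a b. ?p (conv C V op f g a) (conv C V op f g b))"
    using C c by (intro sw_cong[OF C])
      (auto simp: conv_def sw_map[of C V ?T "\<lambda>t. ?p t _", symmetric] lin_pure_l)
  finally show "comult V (conv C V op f g c) =
      sweedler C ?T c (\<lambda>a b. ?p (conv C V op f g a) (conv C V op f g b))" .
qed

lemma conv_assoc:
  assumes C: "cocoalgebra C" and E: "assoc_algebra R E"
    and l: "lin C E f" "lin C E g" "lin C E h"
  shows "conv C E (\<otimes>\<^bsub>E\<^esub>) (conv C E (\<otimes>\<^bsub>E\<^esub>) f g) h = conv C E (\<otimes>\<^bsub>E\<^esub>) f (conv C E (\<otimes>\<^bsub>E\<^esub>) g h)"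
proof -
  note [simp] = lin_closed[OF l(1)] lin_closed[OF l(2)] lin_closed[OF l(3)]
  have M [simp]: "module R E" using E by simp
  have "sweedler C E c (\<lambda>y b. sweedler C E y (\<lambda>a a'. f a \<otimes>\<^bsub>E\<^esub> g a') \<otimes>\<^bsub>E\<^esub> h b) =
      sweedler C E c (\<lambda>a y. f a \<otimes>\<^bsub>E\<^esub> sweedler C E y (\<lambda>a' b. g a' \<otimes>\<^bsub>E\<^esub> h b))"
    if c: "c \<in> carrier C" for c
  proof -
    have "sweedler C E c (\<lambda>y b. sweedler C E y (\<lambda>a a'. f a \<otimes>\<^bsub>E\<^esub> g a') \<otimes>\<^bsub>E\<^esub> h b) =
        sweedler C E c (\<lambda>y b. sweedler C E y (\<lambda>a a'. f a \<otimes>\<^bsub>E\<^esub> g a' \<otimes>\<^bsub>E\<^esub> h b))"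
      using C E c
      by (intro sw_cong) (auto simp: sw_map[of C E E "\<lambda>x. x \<otimes>\<^bsub>E\<^esub> h _"] lin_mult_l)
    also have "\<dots> = sweedler C E c (\<lambda>a y. sweedler C E y (\<lambda>a' b. f a \<otimes>\<^bsub>E\<^esub> g a' \<otimes>\<^bsub>E\<^esub> h b))"
      using C E c l by (intro coassoc trilinearI lin_mult_l lin_mult_r) auto
    also have "\<dots> = sweedler C E c (\<lambda>a y. f a \<otimes>\<^bsub>E\<^esub> sweedler C E y (\<lambda>a' b. g a' \<otimes>\<^bsub>E\<^esub> h b))"
      using C E c
      by (intro sw_cong) (auto simp: alg_mult_assoc sw_map[of C E E "\<lambda>x. f _ \<otimes>\<^bsub>E\<^esub> x"] lin_mult_r
          intro!: sw_cong)
    finally show ?thesis .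
  qed
  note * = this
  show ?thesis
    unfolding conv_def
  proof (rule restrict_ext)
    fix c assume c: "c \<in> carrier C"
    have "sweedler C E c (\<lambda>a b. (\<lambda>c \<in> carrier C. sweedler C E c (\<lambda>a b. f a \<otimes>\<^bsub>E\<^esub> g b)) a \<otimes>\<^bsub>E\<^esub> h b) =
        sweedler C E c (\<lambda>y b. sweedler C E y (\<lambda>a a'. f a \<otimes>\<^bsub>E\<^esub> g a') \<otimes>\<^bsub>E\<^esub> h b)"
      by (intro sw_cong[OF C c]) simp
    moreover have "sweedler C E c (\<lambda>a b. f a \<otimes>\<^bsub>E\<^esub> (\<lambda>c \<in> carrier C. sweedler C E c (\<lambda>a b. g a \<otimes>\<^bsub>E\<^esub> h b)) b) =
        sweedler C E c (\<lambda>a y. f a \<otimes>\<^bsub>E\<^esub> sweedler C E y (\<lambda>a' b. g a' \<otimes>\<^bsub>E\<^esub> h b))"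
      by (intro sw_cong[OF C c]) simp
    ultimately show "sweedler C E c (\<lambda>a b. (\<lambda>c \<in> carrier C. sweedler C E c (\<lambda>a b. f a \<otimes>\<^bsub>E\<^esub> g b)) a \<otimes>\<^bsub>E\<^esub> h b) =
        sweedler C E c (\<lambda>a b. f a \<otimes>\<^bsub>E\<^esub> (\<lambda>c \<in> carrier C. sweedler C E c (\<lambda>a b. g a \<otimes>\<^bsub>E\<^esub> h b)) b)"
      using *[OF c] by simp
  qed
qed

text \<open>Closure under products is compatibility of the product of \<open>H\<close> with coproducts; inverses
  are composites with the antipode, which is a coalgebra map because \<open>H\<close> is cocommutative.\<close>

lemma cgroup_group:
  assumes C: "cocoalgebra C" and H: "hopf H"
  shows "group (cgroup C H)"
proof (rule groupI)
  let ?G = "cgroup C H" and ?e = "\<lambda>c \<in> carrier C. counit C c \<odot>\<^bsub>H\<^esub> \<one>\<^bsub>H\<^esub>"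
  have M [simp]: "module R H" "cocoalgebra H" "assoc_algebra R H" using H by auto
  show mc: "f \<otimes>\<^bsub>?G\<^esub> g \<in> carrier ?G" if "f \<in> carrier ?G" "g \<in> carrier ?G" for f g
    using that C H
    by (auto simp: cgroup_carrier cgroup_mult comult_mult
        intro!: conv_coalg_map[where A = H and B = H] alg_mult_bil)
  have e: "coalg_map C H (\<lambda>c. counit C c \<odot>\<^bsub>H\<^esub> \<one>\<^bsub>H\<^esub>)"
    unfolding coalg_map_def
  proof (intro conjI ballI)
    let ?T = "tensor R H H"
    show l: "lin C H (\<lambda>c. counit C c \<odot>\<^bsub>H\<^esub> \<one>\<^bsub>H\<^esub>)" using C H by (intro lin_smult_l counit_lin) auto
    fix c assume c: "c \<in> carrier C"
    show "counit H (counit C c \<odot>\<^bsub>H\<^esub> \<one>\<^bsub>H\<^esub>) = counit C c"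
      using C H c by (simp add: lin_smult[OF counit_lin])
    have "comult H (counit C c \<odot>\<^bsub>H\<^esub> \<one>\<^bsub>H\<^esub>) = pure_tensor R H H (counit C c \<odot>\<^bsub>H\<^esub> \<one>\<^bsub>H\<^esub>) \<one>\<^bsub>H\<^esub>"
      using C H c by (simp add: lin_smult[OF comult_lin] comult_one tensor_pure_smult)
    also have "\<dots> = sweedler C ?T c (\<lambda>a b. counit C b \<odot>\<^bsub>?T\<^esub> pure_tensor R H H (counit C a \<odot>\<^bsub>H\<^esub> \<one>\<^bsub>H\<^esub>) \<one>\<^bsub>H\<^esub>)"
      using C H c l by (intro counit_sw_r[symmetric] lin_pure_l) auto
    also have "\<dots> = sweedler C ?T c (\<lambda>a b.
        pure_tensor R H H (counit C a \<odot>\<^bsub>H\<^esub> \<one>\<^bsub>H\<^esub>) (counit C b \<odot>\<^bsub>H\<^esub> \<one>\<^bsub>H\<^esub>))"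
      using C H c
      by (intro sw_cong) (auto simp: tensor_pure_smult pure_balanced mod_smult_lcomm[of H])
    finally show "comult H (counit C c \<odot>\<^bsub>H\<^esub> \<one>\<^bsub>H\<^esub>) = sweedler C ?T c (\<lambda>a b.
        pure_tensor R H H (counit C a \<odot>\<^bsub>H\<^esub> \<one>\<^bsub>H\<^esub>) (counit C b \<odot>\<^bsub>H\<^esub> \<one>\<^bsub>H\<^esub>))" .
  qed
  then show "\<one>\<^bsub>?G\<^esub> \<in> carrier ?G"
    using C by (auto simp: cgroup_carrier cgroup_one intro: coalg_map_cong[OF C e])
  show "f \<otimes>\<^bsub>?G\<^esub> g \<otimes>\<^bsub>?G\<^esub> h = f \<otimes>\<^bsub>?G\<^esub> (g \<otimes>\<^bsub>?G\<^esub> h)"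
    if "f \<in> carrier ?G" "g \<in> carrier ?G" "h \<in> carrier ?G" for f g h
    unfolding cgroup_mult using that C coalg_mapD(1)
    by (intro conv_assoc) (auto simp: cgroup_carrier)
  fix f assume "f \<in> carrier ?G"
  then have f: "f \<in> extensional (carrier C)" "coalg_map C H f" by (auto simp: cgroup_carrier)
  note f' = coalg_mapD[OF f(2)]
  show "\<one>\<^bsub>?G\<^esub> \<otimes>\<^bsub>?G\<^esub> f = f"
  proof (rule extensionalityI[of _ "carrier C"])
    fix c assume c: "c \<in> carrier C"
    have "(\<one>\<^bsub>?G\<^esub> \<otimes>\<^bsub>?G\<^esub> f) c = sweedler C H c (\<lambda>a b. counit C a \<odot>\<^bsub>H\<^esub> f b)"
      unfolding cgroup_mult conv_def cgroup_one using C H c f' by (auto intro!: sw_cong)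
    also have "\<dots> = f c" using C c f' by (intro counit_sw_l) auto
    finally show "(\<one>\<^bsub>?G\<^esub> \<otimes>\<^bsub>?G\<^esub> f) c = f c" .
  qed (use f in \<open>auto simp: cgroup_mult\<close>)
  have S: "coalg_map H H (antipode H)"
    using H by (auto simp: coalg_map_def antipode_lin comult_antipode)
  have Sf: "coalg_map C H (\<lambda>c. antipode H (f c))"
    by (rule coalg_map_comp[OF C _ f(2) S]) auto
  have "(\<lambda>c \<in> carrier C. antipode H (f c)) \<otimes>\<^bsub>?G\<^esub> f = \<one>\<^bsub>?G\<^esub>"
    unfolding cgroup_mult conv_def cgroup_one
  proof (rule restrict_ext)
    fix c assume c: "c \<in> carrier C"
    have "sweedler C H c (\<lambda>a b. (\<lambda>c \<in> carrier C. antipode H (f c)) a \<otimes>\<^bsub>H\<^esub> f b) =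
        sweedler C H c (\<lambda>a b. antipode H (f a) \<otimes>\<^bsub>H\<^esub> f b)"
      using C c by (intro sw_cong) auto
    also have "\<dots> = sweedler H H (f c) (\<lambda>a b. antipode H a \<otimes>\<^bsub>H\<^esub> b)"
      using C H c f by (intro sw_coalg_map[symmetric] bilI lin_mult_l lin_mult_r antipode_lin lin_id) auto
    also have "\<dots> = counit C c \<odot>\<^bsub>H\<^esub> \<one>\<^bsub>H\<^esub>" using H c f' by (simp add: antipode_sw_l)
    finally show "sweedler C H c (\<lambda>a b. (\<lambda>c \<in> carrier C. antipode H (f c)) a \<otimes>\<^bsub>H\<^esub> f b) =
      counit C c \<odot>\<^bsub>H\<^esub> \<one>\<^bsub>H\<^esub>" .
  qed
  moreover have "(\<lambda>c \<in> carrier C. antipode H (f c)) \<in> carrier ?G"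
    using C by (auto simp: cgroup_carrier intro: coalg_map_cong[OF C Sf])
  ultimately show "\<exists>g \<in> carrier ?G. g \<otimes>\<^bsub>?G\<^esub> f = \<one>\<^bsub>?G\<^esub>" by blast
qed

end


context ground_field
begin

lemma cgroup_inv:
  assumes C: "cocoalgebra C" and H: "hopf H" and f: "f \<in> carrier (cgroup C H)"
  shows "inv\<^bsub>cgroup C H\<^esub> f = (\<lambda>c \<in> carrier C. antipode H (f c))"
proof -
  interpret G: group "cgroup C H" by (rule cgroup_group[OF C H])
  have fc: "coalg_map C H f" using f by (simp add: cgroup_carrier)
  note f' = coalg_mapD[OF fc]
  let ?g = "inv\<^bsub>cgroup C H\<^esub> f"
  have g: "coalg_map C H ?g" "?g \<in> extensional (carrier C)"
    using G.inv_closed[OF f] by (auto simp: cgroup_carrier)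
  have M [simp]: "module R H" "cocoalgebra H" "assoc_algebra R H" using H by auto
  show ?thesis
  proof (rule extensionalityI[OF g(2)])
    fix c assume c: "c \<in> carrier C"
    have "?g c = antipode H (f c)"
    proof (rule conv_inverse_unique[OF C _ coalg_mapD(1)[OF g(1)] f'(1) _ _ _ c])
      show "lin C H (\<lambda>c. antipode H (f c))" using H f' by (intro lin_antipode)
      fix c assume c: "c \<in> carrier C"
      have "(?g \<otimes>\<^bsub>cgroup C H\<^esub> f) c = \<one>\<^bsub>cgroup C H\<^esub> c" using f by simp
      then show "sweedler C H c (\<lambda>a b. ?g a \<otimes>\<^bsub>H\<^esub> f b) = counit C c \<odot>\<^bsub>H\<^esub> \<one>\<^bsub>H\<^esub>"
        using c by (simp add: cgroup_mult conv_def cgroup_one)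
      have "sweedler C H c (\<lambda>a b. f a \<otimes>\<^bsub>H\<^esub> antipode H (f b)) =
          sweedler H H (f c) (\<lambda>a b. a \<otimes>\<^bsub>H\<^esub> antipode H b)"
        using C H c fc by (intro sw_coalg_map[symmetric] bilI lin_mult_l lin_mult_r antipode_lin lin_id) auto
      then show "sweedler C H c (\<lambda>a b. f a \<otimes>\<^bsub>H\<^esub> antipode H (f b)) = counit C c \<odot>\<^bsub>H\<^esub> \<one>\<^bsub>H\<^esub>"
        using H c f' by (simp add: antipode_sw_r)
    qed simp
    then show "?g c = (\<lambda>c \<in> carrier C. antipode H (f c)) c" using c by simp
  qed simp
qed

lemma hopf_mapD:
  assumes "d \<in> hopf_maps R A B"
  shows "coalg_map A B d" "lin A B d" "d \<in> extensional (carrier A)"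
    "x \<in> carrier A \<Longrightarrow> d x \<in> carrier B"
    "x \<in> carrier A \<Longrightarrow> counit B (d x) = counit A x"
    "x \<in> carrier A \<Longrightarrow> y \<in> carrier A \<Longrightarrow> d (x \<otimes>\<^bsub>A\<^esub> y) = d x \<otimes>\<^bsub>B\<^esub> d y"
    "d \<one>\<^bsub>A\<^esub> = \<one>\<^bsub>B\<^esub>"
proof -
  have *: "lin A B d" using assms by (simp add: hopf_maps_def algebra_maps_def)
  then show "lin A B d" .
  show "x \<in> carrier A \<Longrightarrow> d x \<in> carrier B" by (rule lin_closed[OF *])
  show "coalg_map A B d" "d \<in> extensional (carrier A)"
    "x \<in> carrier A \<Longrightarrow> counit B (d x) = counit A x"
    "x \<in> carrier A \<Longrightarrow> y \<in> carrier A \<Longrightarrow> d (x \<otimes>\<^bsub>A\<^esub> y) = d x \<otimes>\<^bsub>B\<^esub> d y"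
    "d \<one>\<^bsub>A\<^esub> = \<one>\<^bsub>B\<^esub>"
    using assms * by (simp_all add: hopf_maps_def algebra_maps_def coalg_map_def)
qed

lemma compose_coalg_map:
  assumes "cocoalgebra C" "cocoalgebra A" "module R B" "coalg_map C A f" "coalg_map A B d"
  shows "coalg_map C B (compose (carrier C) d f)"
  by (rule coalg_map_cong[OF assms(1) coalg_map_comp[OF assms(1,2,4,5,3)]]) (simp add: compose_eq)

text \<open>A Hopf algebra map induces group homomorphisms on generalized elements.\<close>

lemma compose_hom:
  assumes C: "cocoalgebra C" and A: "hopf A" and B: "hopf B" and d: "d \<in> hopf_maps R A B"
  shows "compose (carrier C) d \<in> hom (cgroup C A) (cgroup C B)"
proof (rule homI)
  note d' = hopf_mapD[OF d]
  fix f assume "f \<in> carrier (cgroup C A)"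
  then have f: "coalg_map C A f" by (simp add: cgroup_carrier)
  then show "compose (carrier C) d f \<in> carrier (cgroup C B)"
    using compose_coalg_map[OF C _ _ f d'(1)] A B by (simp add: cgroup_carrier)
  fix g assume "g \<in> carrier (cgroup C A)"
  then have g: "coalg_map C A g" by (simp add: cgroup_carrier)
  show "compose (carrier C) d (f \<otimes>\<^bsub>cgroup C A\<^esub> g) =
      compose (carrier C) d f \<otimes>\<^bsub>cgroup C B\<^esub> compose (carrier C) d g"
    unfolding cgroup_mult
  proof (rule extensionalityI[of _ "carrier C"])
    fix c assume c: "c \<in> carrier C"
    have "d (sweedler C A c (\<lambda>a b. f a \<otimes>\<^bsub>A\<^esub> g b)) = sweedler C B c (\<lambda>a b. d (f a \<otimes>\<^bsub>A\<^esub> g b))"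
      using C A B c f g d' by (intro sw_map) (auto simp: coalg_mapD)
    also have "\<dots> = sweedler C B c (\<lambda>a b. compose (carrier C) d f a \<otimes>\<^bsub>B\<^esub> compose (carrier C) d g b)"
      using C c f g d' by (intro sw_cong) (auto simp: coalg_mapD compose_eq)
    finally show "compose (carrier C) d (conv C A (\<otimes>\<^bsub>A\<^esub>) f g) c =
        conv C B (\<otimes>\<^bsub>B\<^esub>) (compose (carrier C) d f) (compose (carrier C) d g) c"
      using c by (simp add: conv_def compose_eq)
  qed simp_all
qed

lemma id_cgroup: "hopf H \<Longrightarrow> (\<lambda>x \<in> carrier H. x) \<in> carrier (cgroup H H)"
  unfolding cgroup_carrier
  by (rule conjI[OF _ coalg_map_cong[of H H "\<lambda>x. x"]]) (simp_all add: coalg_map_def sw_pure)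

text \<open>The induced homomorphism preserves the inverse of the generic element \<open>id : A \<rightarrow> A\<close>.\<close>

lemma hopf_map_antipode:
  assumes A: "hopf A" and B: "hopf B" and d: "d \<in> hopf_maps R A B" and x: "x \<in> carrier A"
  shows "d (antipode A x) = antipode B (d x)"
proof -
  let ?i = "\<lambda>x \<in> carrier A. x"
  have C: "cocoalgebra A" using A by simp
  interpret GA: group "cgroup A A" by (rule cgroup_group[OF C A])
  interpret GB: group "cgroup A B" by (rule cgroup_group[OF C B])
  interpret h: group_hom "cgroup A A" "cgroup A B" "compose (carrier A) d"
    using compose_hom[OF C A B d] by unfold_locales
  have i: "?i \<in> carrier (cgroup A A)" by (rule id_cgroup[OF A])
  have "compose (carrier A) d (inv\<^bsub>cgroup A A\<^esub> ?i) x = (inv\<^bsub>cgroup A B\<^esub> (compose (carrier A) d ?i)) x"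
    using h.hom_inv[OF i] by simp
  then show ?thesis
    using x h.hom_closed[OF i] by (simp add: cgroup_inv[OF C A i] cgroup_inv[OF C B] compose_eq)
qed

lemma antipode_one:
  assumes H: "hopf H"
  shows "antipode H \<one>\<^bsub>H\<^esub> = \<one>\<^bsub>H\<^esub>"
proof -
  have "sweedler H H \<one>\<^bsub>H\<^esub> (\<lambda>x1 x2. antipode H x1 \<otimes>\<^bsub>H\<^esub> x2) = antipode H \<one>\<^bsub>H\<^esub> \<otimes>\<^bsub>H\<^esub> \<one>\<^bsub>H\<^esub>"
    using H by (intro sw_one bilI lin_mult_l lin_mult_r antipode_lin lin_id) auto
  then show ?thesis using H antipode_sw_l[OF H, of "\<one>\<^bsub>H\<^esub>"] by simp
qed


section \<open>Kernels of linear maps and tensor products\<close>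

definition idtensor :: "('k, 'u, 'm) module_scheme \<Rightarrow> ('k, 'v, 'n) module_scheme \<Rightarrow> ('w \<Rightarrow> 'v) \<Rightarrow>
    ('u \<times> 'w) list set \<Rightarrow> ('u \<times> 'v) list set"
  where "idtensor A V f = tensor_lift (tensor R A V) (\<lambda>a b. pure_tensor R A V a (f b))"

context
  fixes A :: "('k, 'u, 'm) module_scheme" and B :: "('k, 'w, 'p) module_scheme"
  assumes A [simp]: "module R A" and B [simp]: "module R B"
begin

lemma idtensor_bil: "module R V \<Longrightarrow> lin B V f \<Longrightarrow>
    bil A B (tensor R A V) (\<lambda>a b. pure_tensor R A V a (f b))"
  by (intro bilI lin_pure_l lin_pure_r) (auto simp: lin_closed)

lemma idtensor_lin: "module R V \<Longrightarrow> lin B V f \<Longrightarrow> lin (tensor R A B) (tensor R A V) (idtensor A V f)"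
  unfolding idtensor_def by (intro tensor_lift_lin idtensor_bil) auto

lemma idtensor_pure: "module R V \<Longrightarrow> lin B V f \<Longrightarrow> a \<in> carrier A \<Longrightarrow> b \<in> carrier B \<Longrightarrow>
    idtensor A V f (pure_tensor R A B a b) = pure_tensor R A V a (f b)"
  unfolding idtensor_def by (simp add: tensor_lift_pure idtensor_bil)

lemma idtensor_diff:
  assumes V: "module R V" and f: "lin B V f" and g: "lin B V g" and t: "t \<in> carrier (tensor R A B)"
  shows "idtensor A V (\<lambda>b. f b \<oplus>\<^bsub>V\<^esub> \<ominus>\<^bsub>V\<^esub> g b) t =
    idtensor A V f t \<oplus>\<^bsub>tensor R A V\<^esub> \<ominus>\<^bsub>tensor R A V\<^esub> idtensor A V g t"
proof (rule lin_tensor_ext[OF A B _ _ _ _ t])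
  note d = lin_diff[OF B V f g]
  show "lin (tensor R A B) (tensor R A V) (idtensor A V (\<lambda>b. f b \<oplus>\<^bsub>V\<^esub> \<ominus>\<^bsub>V\<^esub> g b))"
    by (rule idtensor_lin[OF V d])
  show "lin (tensor R A B) (tensor R A V)
      (\<lambda>t. idtensor A V f t \<oplus>\<^bsub>tensor R A V\<^esub> \<ominus>\<^bsub>tensor R A V\<^esub> idtensor A V g t)"
    using V f g by (intro lin_diff idtensor_lin) auto
  fix a b assume a: "a \<in> carrier A" and b: "b \<in> carrier B"
  show "idtensor A V (\<lambda>b. f b \<oplus>\<^bsub>V\<^esub> \<ominus>\<^bsub>V\<^esub> g b) (pure_tensor R A B a b) =
      idtensor A V f (pure_tensor R A B a b) \<oplus>\<^bsub>tensor R A V\<^esub>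
      \<ominus>\<^bsub>tensor R A V\<^esub> idtensor A V g (pure_tensor R A B a b)"
    using a b V f g lin_minus[OF V _ lin_pure_r[OF A V lin_id a], of "g b"]
    by (simp add: idtensor_pure d lin_closed[OF f] lin_closed[OF g] pure_add_r)
qed (use V in simp)

lemma idtensor_comp:
  assumes V: "module R V" and W: "module R W" and f: "lin B V f" and g: "lin V W g"
    and t: "t \<in> carrier (tensor R A B)"
  shows "tensor_lift (tensor R A W) (\<lambda>a b. pure_tensor R A W a (g b)) (idtensor A V f t) =
    idtensor A W (\<lambda>b. g (f b)) t"
proof (rule lin_tensor_ext[OF A B _ _ _ _ t])
  note gf = lin_comp[OF f g]
  have bl: "bil A V (tensor R A W) (\<lambda>a b. pure_tensor R A W a (g b))"
    using V W g by (intro bilI lin_pure_l lin_pure_r) (auto simp: lin_closed)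
  show "lin (tensor R A B) (tensor R A W) (idtensor A W (\<lambda>b. g (f b)))"
    by (rule idtensor_lin[OF W gf])
  show "lin (tensor R A B) (tensor R A W)
     (\<lambda>t. tensor_lift (tensor R A W) (\<lambda>a b. pure_tensor R A W a (g b)) (idtensor A V f t))"
    using V W bl by (intro lin_tensor_lift[of A V] idtensor_lin f) auto
  fix a b assume a: "a \<in> carrier A" and b: "b \<in> carrier B"
  show "tensor_lift (tensor R A W) (\<lambda>a b. pure_tensor R A W a (g b))
      (idtensor A V f (pure_tensor R A B a b)) = idtensor A W (\<lambda>b. g (f b)) (pure_tensor R A B a b)"
    using a b V W f gf bl by (simp add: idtensor_pure lin_closed[OF f] tensor_lift_pure)
qed (use W in simp)

end

text \<open>
  This is the flatness of \<open>A\<close> in the form \<open>A \<otimes> (ker \<phi>\<^sub>0 \<inter> \<dots>) = ker (id \<otimes> \<phi>\<^sub>0) \<inter> \<dots>\<close>: the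
  retraction \<open>r\<close> onto the common kernel is built one map at a time, by subtracting a
  generalized inverse of the next map, so that \<open>id \<otimes> r\<close> fixes the right-hand side.
\<close>

lemma common_kernel_retraction:
  fixes n :: nat and A :: "('k, 'u, 'm) module_scheme" and V :: "('k, 'v, 'p) module_scheme"
  assumes A: "module R A" and V: "module R V" and \<phi>: "\<And>i. i < n \<Longrightarrow> lin A V (\<phi> i)"
  shows "\<exists>r. lin A A r \<and> (\<forall>x \<in> carrier A. \<forall>i < n. \<phi> i (r x) = \<zero>\<^bsub>V\<^esub>) \<and>
    (\<forall>x \<in> carrier A. (\<forall>i < n. \<phi> i x = \<zero>\<^bsub>V\<^esub>) \<longrightarrow> r x = x) \<and>
    (\<forall>t \<in> carrier (tensor R A A).
      (\<forall>i < n. idtensor A V (\<phi> i) t = \<zero>\<^bsub>tensor R A V\<^esub>) \<longrightarrow> idtensor A A r t = t)"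
  using \<phi>
proof (induction n)
  case 0
  show ?case
    by (intro exI[of _ "\<lambda>x. x"]) (auto simp: idtensor_def tensor_lift_id A)
next
  case (Suc n)
  have "\<exists>r. lin A A r \<and> (\<forall>x \<in> carrier A. \<forall>i < n. \<phi> i (r x) = \<zero>\<^bsub>V\<^esub>) \<and>
    (\<forall>x \<in> carrier A. (\<forall>i < n. \<phi> i x = \<zero>\<^bsub>V\<^esub>) \<longrightarrow> r x = x) \<and>
    (\<forall>t \<in> carrier (tensor R A A).
      (\<forall>i < n. idtensor A V (\<phi> i) t = \<zero>\<^bsub>tensor R A V\<^esub>) \<longrightarrow> idtensor A A r t = t)"
    by (rule Suc.IH) (simp add: Suc.prems)
  then obtain r where r: "lin A A r" "\<And>x i. x \<in> carrier A \<Longrightarrow> i < n \<Longrightarrow> \<phi> i (r x) = \<zero>\<^bsub>V\<^esub>"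
    "\<And>x. x \<in> carrier A \<Longrightarrow> (\<And>i. i < n \<Longrightarrow> \<phi> i x = \<zero>\<^bsub>V\<^esub>) \<Longrightarrow> r x = x"
    "\<And>t. t \<in> carrier (tensor R A A) \<Longrightarrow>
      (\<And>i. i < n \<Longrightarrow> idtensor A V (\<phi> i) t = \<zero>\<^bsub>tensor R A V\<^esub>) \<Longrightarrow> idtensor A A r t = t"
    by (elim exE conjE) blast
  note \<phi> = Suc.prems
  have f: "lin A V (\<lambda>x. \<phi> n (r x))" by (rule lin_comp[OF r(1) \<phi>]) simp
  obtain g where g: "lin V A g" "\<And>a. a \<in> carrier A \<Longrightarrow> \<phi> n (r (g (\<phi> n (r a)))) = \<phi> n (r a)"
    by (rule generalized_inverse_ex[OF A V f]) blast
  define q where "q = (\<lambda>v. r (g v))"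
  have q: "lin V A q" unfolding q_def by (rule lin_comp[OF g(1) r(1)])
  define r' where "r' = (\<lambda>x. r x \<oplus>\<^bsub>A\<^esub> \<ominus>\<^bsub>A\<^esub> q (\<phi> n (r x)))"
  have qf: "lin A A (\<lambda>x. q (\<phi> n (r x)))" by (rule lin_comp[OF f q])
  have r': "lin A A r'" unfolding r'_def by (rule lin_diff[OF A A r(1) qf])
  note cl [simp] = lin_closed[OF r(1)] lin_closed[OF q] lin_closed[OF f] lin_closed[OF g(1)]
  have \<phi>cl: "\<phi> i x \<in> carrier V" if "i < Suc n" "x \<in> carrier A" for i x
    by (rule lin_closed[OF \<phi>[OF that(1)] that(2)])
  have \<phi>r': "\<phi> i (r' x) = \<phi> i (r x) \<oplus>\<^bsub>V\<^esub> \<ominus>\<^bsub>V\<^esub> \<phi> i (q (\<phi> n (r x)))"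
    if "i < Suc n" "x \<in> carrier A" for i x
    using that A V lin_closed[OF qf] lin_add[OF \<phi>[OF that(1)]] lin_minus[OF A V \<phi>[OF that(1)]]
    unfolding r'_def by simp
  show ?case
  proof (intro exI[of _ r'] conjI ballI allI impI)
    show "lin A A r'" by (rule r')
    fix x assume x: "x \<in> carrier A"
    {
      fix i assume i: "i < Suc n"
      show "\<phi> i (r' x) = \<zero>\<^bsub>V\<^esub>"
      proof (cases "i = n")
        case True
        then show ?thesis using \<phi>r'[OF i x] g(2)[OF x] \<phi>cl[OF i] x V by (simp add: q_def mod_r_neg)
      next
        case False
        then have "i < n" using i by simp
        then show ?thesis using \<phi>r'[OF i x] r(2) x V
          by (simp add: q_def mod_r_neg)
      qed
    next
      assume 0: "\<forall>i < Suc n. \<phi> i x = \<zero>\<^bsub>V\<^esub>"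
      then have "r x = x" using r(3) x by simp
      then show "r' x = x"
        using 0 x A V lin_zero[OF V A q] mod_minus_smult[OF A] by (simp add: r'_def)
    }
  next
    fix t assume t: "t \<in> carrier (tensor R A A)"
      and 0: "\<forall>i < Suc n. idtensor A V (\<phi> i) t = \<zero>\<^bsub>tensor R A V\<^esub>"
    let ?T = "tensor R A A"
    have T: "module R ?T" using A by simp
    have rt: "idtensor A A r t = t" using r(4)[OF t] 0 by simp
    let ?L = "tensor_lift ?T (\<lambda>a b. pure_tensor R A A a (q b))"
    have L: "lin (tensor R A V) ?T ?L"
      using A V q by (intro tensor_lift_lin bilI lin_pure_l lin_pure_r) auto
    have "idtensor A A (\<lambda>x. q (\<phi> n (r x))) t = ?L (idtensor A V (\<lambda>x. \<phi> n (r x)) t)"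
      using idtensor_comp[OF A A V A f q t] by simp
    also have "idtensor A V (\<lambda>x. \<phi> n (r x)) t = idtensor A V (\<phi> n) (idtensor A A r t)"
      using idtensor_comp[OF A A A V r(1) \<phi>[of n] t] by (simp add: idtensor_def)
    also have "\<dots> = \<zero>\<^bsub>tensor R A V\<^esub>" using rt 0 by simp
    also have "?L \<dots> = \<zero>\<^bsub>?T\<^esub>" using A V by (intro lin_zero[OF _ _ L]) auto
    finally have z: "idtensor A A (\<lambda>x. q (\<phi> n (r x))) t = \<zero>\<^bsub>?T\<^esub>" .
    have "idtensor A A r' t = t \<oplus>\<^bsub>?T\<^esub> \<ominus>\<^bsub>?T\<^esub> \<zero>\<^bsub>?T\<^esub>"
      unfolding r'_def using idtensor_diff[OF A A A r(1) qf t] rt z by simp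
    then show "idtensor A A r' t = t" using t T mod_minus_smult[OF T] by simp
  qed
qed


section \<open>Hopf subalgebras\<close>

text \<open>
  A subspace \<open>N\<close> is a subcoalgebra as soon as the coproducts of its elements are fixed by
  \<open>r \<otimes> r\<close>, for some linear retraction \<open>r\<close> onto \<open>N\<close>; the retraction also shows that
  \<open>N \<otimes> N \<rightarrow> A \<otimes> A\<close> is injective.
\<close>

definition subcoalg :: "('k, 'u) hopf \<Rightarrow> 'u set \<Rightarrow> ('u \<Rightarrow> 'u) \<Rightarrow> bool"
  where "subcoalg A N r \<longleftrightarrow> vsubspace A N \<and> lin A A r \<and> (\<forall>x \<in> carrier A. r x \<in> N) \<and>
    (\<forall>x \<in> N. r x = x) \<and>
    (\<forall>x \<in> N. comult A x =
      sweedler A (tensor R A A) x (\<lambda>a b. pure_tensor R A A (r a) (r b)))"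

lemma sub_hopf_simps [simp]:
  "carrier (sub_hopf R A N) = N" "add (sub_hopf R A N) = add A" "zero (sub_hopf R A N) = zero A"
  "smult (sub_hopf R A N) = smult A" "mult (sub_hopf R A N) = mult A" "one (sub_hopf R A N) = one A"
  "counit (sub_hopf R A N) = counit A" "antipode (sub_hopf R A N) = antipode A"
  by (simp_all add: sub_hopf_def)

lemma sw_sub_hopf_target: "sweedler C (sub_hopf R A N) c F = sweedler C A c F"
  by (simp add: sweedler_def tensor_lift_def)

context
  fixes A :: "('k, 'u) hopf" and N :: "'u set" and r :: "'u \<Rightarrow> 'u"
  assumes hA: "hopf A" and sub: "subcoalg A N r"
begin

private abbreviation "K \<equiv> sub_hopf R A N"

lemma sub_mods: "module R A" "cocoalgebra A" "assoc_algebra R A" "vsubspace A N"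
  using hA sub by (auto simp: subcoalg_def)

lemma sub_r: "lin A A r" "x \<in> carrier A \<Longrightarrow> r x \<in> N" "x \<in> N \<Longrightarrow> r x = x" "x \<in> N \<Longrightarrow> x \<in> carrier A"
  using sub vsubspaceD(1) by (auto simp: subcoalg_def)

lemma sub_module: "module R K"
  by (rule module_cong[OF vsubspace_module[OF sub_mods(1,4)]]) auto

lemma lin_to_sub: "lin M A f \<Longrightarrow> (\<And>x. x \<in> carrier M \<Longrightarrow> f x \<in> N) \<Longrightarrow> lin M K f"
  by (intro linI) (auto simp: lin_add lin_smult)

lemma lin_from_sub: "lin A V f \<Longrightarrow> lin K V f"
  using sub_r(4) by (intro linI) (auto simp: lin_add lin_smult lin_closed)

lemma bil_from_sub: "bil A A V F \<Longrightarrow> bil K K V F"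
  using sub_r(4) by (intro bilI lin_from_sub) (auto intro: bil_l bil_r)

lemma r_lin: "lin A K r"
  using sub_r by (intro lin_to_sub) auto

text \<open>
  The coproduct of \<open>N\<close>, defined by a description, is computed by the retraction. Uniqueness holds
  because \<open>r \<otimes> r\<close> is a left inverse of \<open>N \<otimes> N \<rightarrow> A \<otimes> A\<close>.
\<close>

lemma comult_sub:
  assumes x: "x \<in> N"
  shows "comult K x = sweedler A (tensor R K K) x (\<lambda>a b. pure_tensor R K K (r a) (r b))"
proof -
  let ?TK = "tensor R K K" and ?T = "tensor R A A"
  let ?\<iota> = "tensor_lift ?T (pure_tensor R A A)"
  let ?\<rho> = "tensor_lift ?TK (\<lambda>a b. pure_tensor R K K (r a) (r b))"
  note [simp] = sub_mods(1,2) sub_module sub_r(2,3,4)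
  have b1: "bil K K ?T (pure_tensor R A A)"
    by (intro bil_from_sub pure_bil) auto
  have b2: "bil A A ?TK (\<lambda>a b. pure_tensor R K K (r a) (r b))"
    by (intro bilI lin_pure_l lin_pure_r r_lin) auto
  have \<iota>: "lin ?TK ?T ?\<iota>" using b1 by (intro tensor_lift_lin) auto
  have \<rho>: "lin ?T ?TK ?\<rho>" using b2 by (intro tensor_lift_lin) auto
  have \<rho>\<iota>: "?\<rho> (?\<iota> t) = t" if t: "t \<in> carrier ?TK" for t
    by (rule lin_tensor_ext[OF sub_module sub_module _ lin_comp[OF \<iota> \<rho>] lin_id _ t])
      (simp_all add: tensor_lift_pure[OF sub_module sub_module _ b1]
        tensor_lift_pure[OF sub_mods(1) sub_mods(1) _ b2])
  let ?t = "sweedler A ?TK x (\<lambda>a b. pure_tensor R K K (r a) (r b))"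
  have t: "?t \<in> carrier ?TK" using x by (intro sw_closed) auto
  have "?\<iota> ?t = sweedler A ?T x (\<lambda>a b. ?\<iota> (pure_tensor R K K (r a) (r b)))"
    using x \<iota> by (intro sw_map) auto
  also have "\<dots> = sweedler A ?T x (\<lambda>a b. pure_tensor R A A (r a) (r b))"
    using x by (intro sw_cong) (auto simp: tensor_lift_pure[OF sub_module sub_module _ b1])
  also have "\<dots> = comult A x" using sub x by (simp add: subcoalg_def)
  finally have \<iota>t: "?\<iota> ?t = comult A x" .
  have TK: "tensor R (A\<lparr>carrier := N\<rparr>) (A\<lparr>carrier := N\<rparr>) = ?TK"
    by (rule tensor_cong) auto
  have "comult K x = (THE t. t \<in> carrier (tensor R (A\<lparr>carrier := N\<rparr>) (A\<lparr>carrier := N\<rparr>)) \<and>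
      ?\<iota> t = comult A x)"
    by (simp add: sub_hopf_def)
  also have "\<dots> = (THE t. t \<in> carrier ?TK \<and> ?\<iota> t = comult A x)" unfolding TK ..
  also have "\<dots> = ?t"
  proof (rule the_equality)
    show "?t \<in> carrier ?TK \<and> ?\<iota> ?t = comult A x" using t \<iota>t by simp
    fix s assume "s \<in> carrier ?TK \<and> ?\<iota> s = comult A x"
    then show "s = ?t" using \<rho>\<iota>[of s] \<rho>\<iota>[OF t] \<iota>t by simp
  qed
  finally show ?thesis .
qed

lemma sw_sub_r:
  assumes "module R V" "bil K K V F" "x \<in> N"
  shows "sweedler K V x F = sweedler A V x (\<lambda>a b. F (r a) (r b))"
  using assms sub_mods sub_r sub_module
  by (intro sw_of_comult[OF _ _ _ _ comult_sub]) auto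

text \<open>The retraction can be inserted into, or removed from, Sweedler sums of elements of \<open>N\<close>. Thus the
  identities for \<open>N\<close> below are transferred to \<open>A\<close>, where they are known.\<close>

lemma sw_r:
  assumes "module R V" "bil A A V F" "x \<in> N"
  shows "sweedler A V x (\<lambda>a b. F (r a) (r b)) = sweedler A V x F"
  using assms sub_mods sub_r sub
  by (intro sw_of_comult[of A A, symmetric]) (auto simp: subcoalg_def)

lemma sw_sub:
  assumes "module R V" "bil A A V F" "x \<in> N"
  shows "sweedler K V x F = sweedler A V x F"
  using sw_sub_r[OF assms(1) bil_from_sub[OF assms(2)] assms(3)] sw_r[OF assms] by simp

lemma sub_cocoalgebra: "cocoalgebra K"
proof -
  note [simp] = sub_mods(1,2) sub_module sub_r(2,3,4)
  note cl = sub_r(4)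
  let ?TK = "tensor R K K" and ?W = "tensor R K (tensor R K K)"
  let ?P = "\<lambda>x1 x2 x3. pure_tensor R K ?TK x1 (pure_tensor R K K x2 x3)"
  let ?Q = "\<lambda>x1 x2 x3. ?P (r x1) (r x2) (r x3)"
  note li = lin_intros r_lin
  have dl: "lin K ?TK (comult K)"
  proof (rule lin_cong)
    show "lin K ?TK (\<lambda>x. sweedler A ?TK x (\<lambda>a b. pure_tensor R K K (r a) (r b)))"
      by (rule lin_from_sub) (auto intro!: li)
  qed (auto simp: comult_sub)
  have i1: "sweedler K ?W y (\<lambda>x1 x2. ?P x1 x2 x3) = sweedler A ?W y (\<lambda>x1 x2. ?P (r x1) (r x2) x3)"
    if "y \<in> N" "x3 \<in> N" for y x3
    using that by (intro sw_sub_r bilI lin_pure_l lin_pure_r lin_id) auto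
  have i2: "sweedler K ?W y (\<lambda>x2 x3. ?P x1 x2 x3) = sweedler A ?W y (\<lambda>x2 x3. ?P x1 (r x2) (r x3))"
    if "y \<in> N" "x1 \<in> N" for y x1
    using that by (intro sw_sub_r bilI lin_pure_l lin_pure_r lin_id) auto
  have sK: "lin K A (\<lambda>x. x)" by (rule lin_from_sub[OF lin_id])
  have s1: "sweedler K ?W x (\<lambda>y x3. sweedler K ?W y (\<lambda>x1 x2. ?P x1 x2 x3)) =
      sweedler A ?W x (\<lambda>y x3. sweedler A ?W y (\<lambda>x1 x2. ?Q x1 x2 x3))" if x: "x \<in> N" for x
  proof -
    have b: "bil K K ?W (\<lambda>y x3. sweedler A ?W y (\<lambda>x1 x2. ?P (r x1) (r x2) x3))"
      by (auto intro!: li sK)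
    have e: "bil K K ?W (\<lambda>y x3. sweedler K ?W y (\<lambda>x1 x2. ?P x1 x2 x3))"
      by (intro bilI; rule lin_cong[OF bil_r[OF b]] lin_cong[OF bil_l[OF b]]) (auto simp: i1)
    have "sweedler K ?W x (\<lambda>y x3. sweedler K ?W y (\<lambda>x1 x2. ?P x1 x2 x3)) =
        sweedler A ?W x (\<lambda>y x3. sweedler K ?W (r y) (\<lambda>x1 x2. ?P x1 x2 (r x3)))"
      using x e by (intro sw_sub_r) auto
    also have "\<dots> = sweedler A ?W x (\<lambda>y x3. sweedler A ?W (r y) (\<lambda>x1 x2. ?Q x1 x2 (r x3)))"
      using x by (intro sw_cong) (auto simp: i1)
    also have "\<dots> = sweedler A ?W x (\<lambda>y x3. sweedler A ?W y (\<lambda>x1 x2. ?Q x1 x2 x3))"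
      using x by (intro sw_r) (auto intro!: li)
    finally show ?thesis .
  qed
  have s2: "sweedler K ?W x (\<lambda>x1 y. sweedler K ?W y (\<lambda>x2 x3. ?P x1 x2 x3)) =
      sweedler A ?W x (\<lambda>x1 y. sweedler A ?W y (\<lambda>x2 x3. ?Q x1 x2 x3))" if x: "x \<in> N" for x
  proof -
    have b: "bil K K ?W (\<lambda>x1 y. sweedler A ?W y (\<lambda>x2 x3. ?P x1 (r x2) (r x3)))"
      by (auto intro!: li sK)
    have e: "bil K K ?W (\<lambda>x1 y. sweedler K ?W y (\<lambda>x2 x3. ?P x1 x2 x3))"
      by (intro bilI; rule lin_cong[OF bil_r[OF b]] lin_cong[OF bil_l[OF b]]) (auto simp: i2)
    have "sweedler K ?W x (\<lambda>x1 y. sweedler K ?W y (\<lambda>x2 x3. ?P x1 x2 x3)) =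
        sweedler A ?W x (\<lambda>x1 y. sweedler K ?W (r y) (\<lambda>x2 x3. ?P (r x1) x2 x3))"
      using x e by (intro sw_sub_r) auto
    also have "\<dots> = sweedler A ?W x (\<lambda>x1 y. sweedler A ?W (r y) (\<lambda>x2 x3. ?Q (r x1) x2 x3))"
      using x by (intro sw_cong) (auto simp: i2)
    also have "\<dots> = sweedler A ?W x (\<lambda>x1 y. sweedler A ?W y (\<lambda>x2 x3. ?Q x1 x2 x3))"
      using x by (intro sw_r) (auto intro!: li)
    finally show ?thesis .
  qed
  have coas: "sweedler A ?W x (\<lambda>y x3. sweedler A ?W y (\<lambda>x1 x2. ?Q x1 x2 x3)) =
      sweedler A ?W x (\<lambda>x1 y. sweedler A ?W y (\<lambda>x2 x3. ?Q x1 x2 x3))" if "x \<in> N" for x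
    using that by (intro coassoc trilinearI) (auto intro!: li)
  have cu: "sweedler K A x (\<lambda>x1 x2. counit A x1 \<odot>\<^bsub>A\<^esub> x2) = x" if x: "x \<in> N" for x
  proof -
    have "sweedler K A x (\<lambda>x1 x2. counit A x1 \<odot>\<^bsub>A\<^esub> x2) =
        sweedler A A x (\<lambda>x1 x2. counit A x1 \<odot>\<^bsub>A\<^esub> x2)"
      using x by (intro sw_sub) (auto intro!: lin_intros)
    also have "\<dots> = x" using x counit_sw_l[of A A "\<lambda>x. x" x] by simp
    finally show ?thesis .
  qed
  have cc: "sweedler K ?TK x (\<lambda>x1 x2. pure_tensor R K K x2 x1) = comult K x" if x: "x \<in> N" for x
  proof -
    have "sweedler K ?TK x (\<lambda>x1 x2. pure_tensor R K K x2 x1) =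
        sweedler A ?TK x (\<lambda>x1 x2. pure_tensor R K K (r x2) (r x1))"
      using x by (intro sw_sub_r bilI lin_pure_l lin_pure_r lin_id) auto
    also have "\<dots> = sweedler A ?TK x (\<lambda>x1 x2. pure_tensor R K K (r x1) (r x2))"
      using x by (intro cocomm[of A ?TK "\<lambda>x1 x2. pure_tensor R K K (r x1) (r x2)"]) (auto intro!: li)
    finally show ?thesis using x by (simp add: comult_sub)
  qed
  have "lin K (ground R) (counit A)" by (intro lin_from_sub counit_lin) auto
  then show ?thesis
    unfolding cocoalgebra_def using dl s1 s2 coas cu cc
    by (simp add: sw_sub_hopf_target)
qed

lemma sub_incl: "coalg_map K A (\<lambda>x. x)"
  unfolding coalg_map_def
  using sub_mods sub_r lin_from_sub[OF lin_id] by (auto simp: sw_sub pure_bil sw_pure)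

text \<open>Hence a generalized element of \<open>A\<close> only needs to take its values in \<open>N\<close> to be one of \<open>N\<close>: the
  retraction acts as the identity on its values.\<close>

lemma coalg_map_into_sub:
  assumes C: "cocoalgebra C" and f: "coalg_map C A f" and N: "\<And>c. c \<in> carrier C \<Longrightarrow> f c \<in> N"
  shows "coalg_map C K f"
  unfolding coalg_map_def
proof (intro conjI ballI)
  note [simp] = sub_mods(1,2) sub_module sub_r(2,3,4)
  note f' = coalg_mapD[OF f]
  show "lin C K f" using f' N by (intro lin_to_sub) auto
  fix c assume c: "c \<in> carrier C"
  show "counit K (f c) = counit C c" using f' c by simp
  have "comult K (f c) = sweedler C (tensor R K K) c (\<lambda>a b. pure_tensor R K K (r (f a)) (r (f b)))"
    unfolding comult_sub[OF N[OF c]] using C f c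
    by (intro sw_coalg_map) (auto intro!: lin_intros r_lin)
  also have "\<dots> = sweedler C (tensor R K K) c (\<lambda>a b. pure_tensor R K K (f a) (f b))"
    using C c N by (intro sw_cong) auto
  finally show "comult K (f c) = sweedler C (tensor R K K) c (\<lambda>a b. pure_tensor R K K (f a) (f b))" .
qed

lemma sub_hopf_hopf:
  assumes one: "\<one>\<^bsub>A\<^esub> \<in> N" and mult: "\<And>x y. x \<in> N \<Longrightarrow> y \<in> N \<Longrightarrow> x \<otimes>\<^bsub>A\<^esub> y \<in> N"
    and anti: "\<And>x. x \<in> N \<Longrightarrow> antipode A x \<in> N"
  shows "hopf K"
proof -
  note [simp] = sub_mods(1,2,3) sub_module sub_r(2,3,4)
  have C: "cocoalgebra K" by (rule sub_cocoalgebra)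
  interpret A: cocomm_hopf_algebra R A by (rule hA)
  interpret AG: abelian_group K using sub_module by (simp add: module_def)
  have "ring K"
    by (intro ringI monoidI AG.abelian_group_axioms)
      (use one mult in \<open>auto simp: alg_mult_assoc A.l_distr A.r_distr\<close>)
  then have alg: "assoc_algebra R K"
    using sub_module by (intro assoc_algebra.intro assoc_algebra_axioms.intro) auto
  let ?TK = "tensor R K K" let ?p = "pure_tensor R K K"
  have mm: "comult K (x \<otimes>\<^bsub>A\<^esub> y) = comult K x \<otimes>\<^bsub>?TK\<^esub> comult K y" if x: "x \<in> N" and y: "y \<in> N" for x y
  proof -
    have li: "lin A K (\<lambda>a. r (a \<otimes>\<^bsub>A\<^esub> b))" "lin A K (\<lambda>a. r (b \<otimes>\<^bsub>A\<^esub> a))" if "b \<in> carrier A" for b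
      using that by (auto intro!: lin_comp[OF _ r_lin] lin_mult_l lin_mult_r)
    have li': "lin A K (\<lambda>a. r a \<otimes>\<^bsub>A\<^esub> b)" "lin A K (\<lambda>a. b \<otimes>\<^bsub>A\<^esub> r a)" if "b \<in> N" for b
      using lin_mult_l[OF alg r_lin, of b] lin_mult_r[OF alg r_lin, of b] that by auto
    have kl: "lin K K (\<lambda>a. a \<otimes>\<^bsub>A\<^esub> b)" "lin K K (\<lambda>a. b \<otimes>\<^bsub>A\<^esub> a)" if "b \<in> N" for b
      using lin_mult_l[OF alg lin_id, of b] lin_mult_r[OF alg lin_id, of b] that by auto
    have "comult K (x \<otimes>\<^bsub>A\<^esub> y) = sweedler A ?TK (x \<otimes>\<^bsub>A\<^esub> y) (\<lambda>a b. ?p (r a) (r b))"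
      using mult x y by (intro comult_sub) auto
    also have "\<dots> = sweedler A ?TK x (\<lambda>x1 x2. sweedler A ?TK y (\<lambda>y1 y2.
        ?p (r (x1 \<otimes>\<^bsub>A\<^esub> y1)) (r (x2 \<otimes>\<^bsub>A\<^esub> y2))))"
      using x y hA by (intro sw_mult) (auto intro!: lin_intros r_lin)
    also have "\<dots> = sweedler A ?TK x (\<lambda>x1 x2. sweedler A ?TK y (\<lambda>y1 y2.
        ?p (r (r x1 \<otimes>\<^bsub>A\<^esub> y1)) (r (r x2 \<otimes>\<^bsub>A\<^esub> y2))))"
      using x y by (intro sw_r[symmetric]) (auto intro!: lin_intros li)
    also have "\<dots> = sweedler A ?TK x (\<lambda>x1 x2. sweedler A ?TK y (\<lambda>y1 y2.
        ?p (r (r x1 \<otimes>\<^bsub>A\<^esub> r y1)) (r (r x2 \<otimes>\<^bsub>A\<^esub> r y2))))"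
      using x y by (intro sw_cong sw_r[symmetric]) (auto intro!: lin_intros li)
    also have "\<dots> = sweedler A ?TK x (\<lambda>x1 x2. sweedler A ?TK y (\<lambda>y1 y2.
        ?p (r x1 \<otimes>\<^bsub>A\<^esub> r y1) (r x2 \<otimes>\<^bsub>A\<^esub> r y2)))"
      using x y mult by (intro sw_cong) auto
    also have "\<dots> = sweedler A ?TK x (\<lambda>x1 x2. sweedler K ?TK y (\<lambda>y1 y2.
        ?p (r x1 \<otimes>\<^bsub>A\<^esub> y1) (r x2 \<otimes>\<^bsub>A\<^esub> y2)))"
      using x y mult
      by (intro sw_cong sw_sub_r[symmetric] bilI lin_pure_l lin_pure_r kl) auto
    also have "\<dots> = sweedler K ?TK x (\<lambda>x1 x2. sweedler K ?TK y (\<lambda>y1 y2.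
        ?p (x1 \<otimes>\<^bsub>A\<^esub> y1) (x2 \<otimes>\<^bsub>A\<^esub> y2)))"
      using x y mult C
      by (intro sw_sub_r[symmetric] bilI lin_sw_param lin_pure_l lin_pure_r kl) auto
    also have "\<dots> = comult K x \<otimes>\<^bsub>?TK\<^esub> comult K y"
      using x y C alg by (simp add: tensor_mult_lift sweedler_def)
    finally show ?thesis .
  qed
  have bl: "bil A A ?TK (\<lambda>a b. ?p (r a) (r b))" by (auto intro!: lin_intros r_lin)
  have m1: "comult K \<one>\<^bsub>A\<^esub> = \<one>\<^bsub>?TK\<^esub>"
    using one hA bl by (simp add: comult_sub sw_one tensor_one)
  have cr: "sweedler K A x (\<lambda>x1 x2. counit A x2 \<odot>\<^bsub>A\<^esub> x1) = x" if x: "x \<in> N" for x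
  proof -
    have "sweedler K A x (\<lambda>x1 x2. counit A x2 \<odot>\<^bsub>A\<^esub> x1) =
        sweedler A A x (\<lambda>x1 x2. counit A x2 \<odot>\<^bsub>A\<^esub> x1)"
      using x by (intro sw_sub) (auto intro!: lin_intros)
    also have "\<dots> = x" using x counit_sw_r[of A A "\<lambda>x. x" x] by simp
    finally show ?thesis .
  qed
  have S: "lin K K (antipode A)"
    using anti hA by (intro lin_to_sub lin_from_sub antipode_lin) auto
  have Sl: "sweedler K A x (\<lambda>x1 x2. antipode A x1 \<otimes>\<^bsub>A\<^esub> x2) = counit A x \<odot>\<^bsub>A\<^esub> \<one>\<^bsub>A\<^esub>" if "x \<in> N" for x
    using that hA antipode_sw_l[OF hA, of x]
    by (subst sw_sub) (auto intro!: lin_intros antipode_lin)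
  have Sr: "sweedler K A x (\<lambda>x1 x2. x1 \<otimes>\<^bsub>A\<^esub> antipode A x2) = counit A x \<odot>\<^bsub>A\<^esub> \<one>\<^bsub>A\<^esub>" if "x \<in> N" for x
    using that hA antipode_sw_r[OF hA, of x]
    by (subst sw_sub) (auto intro!: lin_intros antipode_lin)
  have "bialgebra R K"
    unfolding bialgebra_def bialgebra_axioms_def
    using C alg mm m1 cr hA one by (auto simp: field_axioms cocoalgebra_def algebra_maps_def sw_sub_hopf_target)
  then show ?thesis
    unfolding cocomm_hopf_algebra_def hopf_algebra_def hopf_algebra_axioms_def
      cocomm_hopf_algebra_axioms_def
    using C S Sl Sr by (auto simp: cocoalgebra_def sw_sub_hopf_target)
qed

end

end

section \<open>Simplicial groups with trivial third Moore group\<close>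

lemma (in group) cancel_l [simp]:
  "x \<in> carrier G \<Longrightarrow> y \<in> carrier G \<Longrightarrow> inv x \<otimes> (x \<otimes> y) = y"
  "x \<in> carrier G \<Longrightarrow> y \<in> carrier G \<Longrightarrow> x \<otimes> (inv x \<otimes> y) = y"
  by (simp_all flip: m_assoc)

text \<open>These are simplicial groups truncated at dimension three. The identities below live in dimensions at
  most two, and dimension three serves to prove them.\<close>

locale simplicial_group3 =
  fixes G :: "nat \<Rightarrow> ('g, 'm) monoid_scheme" and d s :: "nat \<Rightarrow> nat \<Rightarrow> 'g \<Rightarrow> 'g"
  assumes grp: "group (G n)"
    and d_hom: "i \<le> Suc n \<Longrightarrow> d (Suc n) i \<in> hom (G (Suc n)) (G n)"
    and s_hom: "j \<le> n \<Longrightarrow> s n j \<in> hom (G n) (G (Suc n))"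
    and dd: "\<lbrakk>i \<le> j; j \<le> Suc n; x \<in> carrier (G (Suc (Suc n)))\<rbrakk> \<Longrightarrow>
      d (Suc n) i (d (Suc (Suc n)) (Suc j) x) = d (Suc n) j (d (Suc (Suc n)) i x)"
    and ss: "\<lbrakk>i \<le> j; j \<le> n; x \<in> carrier (G n)\<rbrakk> \<Longrightarrow>
      s (Suc n) i (s n j x) = s (Suc n) (Suc j) (s n i x)"
    and ds_less: "\<lbrakk>i \<le> j; j \<le> n; x \<in> carrier (G (Suc n))\<rbrakk> \<Longrightarrow>
      d (Suc (Suc n)) i (s (Suc n) (Suc j) x) = s n j (d (Suc n) i x)"
    and ds_same: "\<lbrakk>j \<le> n; x \<in> carrier (G n)\<rbrakk> \<Longrightarrow> d (Suc n) j (s n j x) = x"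
    and ds_Suc: "\<lbrakk>j \<le> n; x \<in> carrier (G n)\<rbrakk> \<Longrightarrow> d (Suc n) (Suc j) (s n j x) = x"
    and ds_greater: "\<lbrakk>j < i; i \<le> Suc n; x \<in> carrier (G (Suc n))\<rbrakk> \<Longrightarrow>
      d (Suc (Suc n)) (Suc i) (s (Suc n) j x) = s n j (d (Suc n) i x)"
    and N3: "\<lbrakk>w \<in> carrier (G 3); d 3 0 w = \<one>\<^bsub>G 2\<^esub>; d 3 1 w = \<one>\<^bsub>G 2\<^esub>; d 3 2 w = \<one>\<^bsub>G 2\<^esub>\<rbrakk> \<Longrightarrow>
      w = \<one>\<^bsub>G 3\<^esub>"
begin

(* the dimensions are written as numerals, and the rules below are stated for them *)
declare One_nat_def [simp del]

sublocale G0: group "G 0" by (rule grp)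
sublocale G1: group "G 1" by (rule grp)
sublocale G2: group "G 2" by (rule grp)
sublocale G3: group "G 3" by (rule grp)

lemma homs:
  "s 0 0 \<in> hom (G 0) (G 1)" "s 1 0 \<in> hom (G 1) (G 2)" "s 1 1 \<in> hom (G 1) (G 2)"
  "s 2 0 \<in> hom (G 2) (G 3)" "s 2 1 \<in> hom (G 2) (G 3)" "s 2 2 \<in> hom (G 2) (G 3)"
  "d 1 0 \<in> hom (G 1) (G 0)" "d 1 1 \<in> hom (G 1) (G 0)"
  "d 2 0 \<in> hom (G 2) (G 1)" "d 2 1 \<in> hom (G 2) (G 1)" "d 2 2 \<in> hom (G 2) (G 1)"
  "d 3 0 \<in> hom (G 3) (G 2)" "d 3 1 \<in> hom (G 3) (G 2)" "d 3 2 \<in> hom (G 3) (G 2)"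
  "d 3 3 \<in> hom (G 3) (G 2)"
  using s_hom[of 0 0] s_hom[of 0 1] s_hom[of 1 1] s_hom[of 0 2] s_hom[of 1 2] s_hom[of 2 2]
    d_hom[of 0 0] d_hom[of 1 0] d_hom[of 0 1] d_hom[of 1 1] d_hom[of 2 1]
    d_hom[of 0 2] d_hom[of 1 2] d_hom[of 2 2] d_hom[of 3 2]
  by (simp_all add: eval_nat_numeral One_nat_def)

sublocale s00: group_hom "G 0" "G 1" "s 0 0" using homs by unfold_locales simp
sublocale s10: group_hom "G 1" "G 2" "s 1 0" using homs by unfold_locales simp
sublocale s11: group_hom "G 1" "G 2" "s 1 1" using homs by unfold_locales simp
sublocale s20: group_hom "G 2" "G 3" "s 2 0" using homs by unfold_locales simp
sublocale s21: group_hom "G 2" "G 3" "s 2 1" using homs by unfold_locales simp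
sublocale s22: group_hom "G 2" "G 3" "s 2 2" using homs by unfold_locales simp
sublocale d10: group_hom "G 1" "G 0" "d 1 0" using homs by unfold_locales simp
sublocale d11: group_hom "G 1" "G 0" "d 1 1" using homs by unfold_locales simp
sublocale d20: group_hom "G 2" "G 1" "d 2 0" using homs by unfold_locales simp
sublocale d21: group_hom "G 2" "G 1" "d 2 1" using homs by unfold_locales simp
sublocale d22: group_hom "G 2" "G 1" "d 2 2" using homs by unfold_locales simp
sublocale d30: group_hom "G 3" "G 2" "d 3 0" using homs by unfold_locales simp
sublocale d31: group_hom "G 3" "G 2" "d 3 1" using homs by unfold_locales simp
sublocale d32: group_hom "G 3" "G 2" "d 3 2" using homs by unfold_locales simp
sublocale d33: group_hom "G 3" "G 2" "d 3 3" using homs by unfold_locales simp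

lemma face_degen [simp]:
  "x \<in> carrier (G 1) \<Longrightarrow> d 2 0 (s 1 0 x) = x"
  "x \<in> carrier (G 1) \<Longrightarrow> d 2 1 (s 1 0 x) = x"
  "x \<in> carrier (G 1) \<Longrightarrow> d 2 2 (s 1 0 x) = s 0 0 (d 1 1 x)"
  "x \<in> carrier (G 1) \<Longrightarrow> d 2 0 (s 1 1 x) = s 0 0 (d 1 0 x)"
  "x \<in> carrier (G 1) \<Longrightarrow> d 2 1 (s 1 1 x) = x"
  "x \<in> carrier (G 1) \<Longrightarrow> d 2 2 (s 1 1 x) = x"
  "k \<in> carrier (G 2) \<Longrightarrow> d 3 0 (s 2 0 k) = k"
  "k \<in> carrier (G 2) \<Longrightarrow> d 3 1 (s 2 0 k) = k"
  "k \<in> carrier (G 2) \<Longrightarrow> d 3 2 (s 2 0 k) = s 1 0 (d 2 1 k)"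
  "k \<in> carrier (G 2) \<Longrightarrow> d 3 3 (s 2 0 k) = s 1 0 (d 2 2 k)"
  "k \<in> carrier (G 2) \<Longrightarrow> d 3 0 (s 2 1 k) = s 1 0 (d 2 0 k)"
  "k \<in> carrier (G 2) \<Longrightarrow> d 3 1 (s 2 1 k) = k"
  "k \<in> carrier (G 2) \<Longrightarrow> d 3 2 (s 2 1 k) = k"
  "k \<in> carrier (G 2) \<Longrightarrow> d 3 3 (s 2 1 k) = s 1 1 (d 2 2 k)"
  "k \<in> carrier (G 2) \<Longrightarrow> d 3 0 (s 2 2 k) = s 1 1 (d 2 0 k)"
  "k \<in> carrier (G 2) \<Longrightarrow> d 3 1 (s 2 2 k) = s 1 1 (d 2 1 k)"
  "k \<in> carrier (G 2) \<Longrightarrow> d 3 2 (s 2 2 k) = k"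
  "k \<in> carrier (G 2) \<Longrightarrow> d 3 3 (s 2 2 k) = k"
  using ds_same[of 0 1 x] ds_Suc[of 0 1 x] ds_greater[of 0 1 0 x] ds_less[of 0 0 0 x]
    ds_same[of 1 1 x] ds_Suc[of 1 1 x]
    ds_same[of 0 2 k] ds_Suc[of 0 2 k] ds_greater[of 0 1 1 k] ds_greater[of 0 2 1 k]
    ds_less[of 0 0 1 k] ds_same[of 1 2 k] ds_Suc[of 1 2 k] ds_greater[of 1 2 1 k]
    ds_less[of 0 1 1 k] ds_less[of 1 1 1 k] ds_same[of 2 2 k] ds_Suc[of 2 2 k]
  by (simp_all add: eval_nat_numeral One_nat_def)

lemma degen_degen: "a \<in> carrier (G 0) \<Longrightarrow> s 1 0 (s 0 0 a) = s 1 1 (s 0 0 a)"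
  using ss[of 0 0 0 a] by (simp add: One_nat_def)

lemma face_face: "k \<in> carrier (G 2) \<Longrightarrow> d 1 1 (d 2 2 k) = d 1 1 (d 2 1 k)"
    "k \<in> carrier (G 2) \<Longrightarrow> d 1 0 (d 2 2 k) = d 1 1 (d 2 0 k)"
    "k \<in> carrier (G 2) \<Longrightarrow> d 1 0 (d 2 1 k) = d 1 0 (d 2 0 k)"
  using dd[of 1 1 0 k] dd[of 0 1 0 k] dd[of 0 0 0 k] by (simp_all add: eval_nat_numeral One_nat_def)

definition N1 :: "'g set"
  where "N1 = {x \<in> carrier (G 1). d 1 0 x = \<one>\<^bsub>G 0\<^esub>}"

definition N2 :: "'g set"
  where "N2 = {k \<in> carrier (G 2). d 2 0 k = \<one>\<^bsub>G 1\<^esub> \<and> d 2 1 k = \<one>\<^bsub>G 1\<^esub>}"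

lemma N1D: "x \<in> N1 \<Longrightarrow> x \<in> carrier (G 1)" "x \<in> N1 \<Longrightarrow> d 1 0 x = \<one>\<^bsub>G 0\<^esub>"
  and N2D: "k \<in> N2 \<Longrightarrow> k \<in> carrier (G 2)" "k \<in> N2 \<Longrightarrow> d 2 0 k = \<one>\<^bsub>G 1\<^esub>"
    "k \<in> N2 \<Longrightarrow> d 2 1 k = \<one>\<^bsub>G 1\<^esub>"
  by (auto simp: N1_def N2_def)

lemma bd_in_N1: "k \<in> N2 \<Longrightarrow> d 2 2 k \<in> N1"
  using N2D[of k] by (simp add: N1_def face_face)

lemma bd_bd: "k \<in> N2 \<Longrightarrow> d 1 1 (d 2 2 k) = \<one>\<^bsub>G 0\<^esub>"
  using N2D[of k] by (simp add: face_face)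

definition conj1 :: "'g \<Rightarrow> 'g \<Rightarrow> 'g"
  where "conj1 x y = x \<otimes>\<^bsub>G 1\<^esub> y \<otimes>\<^bsub>G 1\<^esub> inv\<^bsub>G 1\<^esub> x"

definition conj2 :: "'g \<Rightarrow> 'g \<Rightarrow> 'g"
  where "conj2 x y = x \<otimes>\<^bsub>G 2\<^esub> y \<otimes>\<^bsub>G 2\<^esub> inv\<^bsub>G 2\<^esub> x"

text \<open>The Peiffer lifting \<open>s\<^sub>1x s\<^sub>1y s\<^sub>1x\<inverse> (s\<^sub>0x s\<^sub>1y s\<^sub>0x\<inverse>)\<inverse>\<close> for groups.\<close>

definition lift :: "'g \<Rightarrow> 'g \<Rightarrow> 'g"
  where "lift x y = conj2 (s 1 1 x) (s 1 1 y) \<otimes>\<^bsub>G 2\<^esub> inv\<^bsub>G 2\<^esub> (conj2 (s 1 0 x) (s 1 1 y))"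

lemma conj_closed [simp]:
  "x \<in> carrier (G 1) \<Longrightarrow> y \<in> carrier (G 1) \<Longrightarrow> conj1 x y \<in> carrier (G 1)"
  "x \<in> carrier (G 2) \<Longrightarrow> y \<in> carrier (G 2) \<Longrightarrow> conj2 x y \<in> carrier (G 2)"
  by (simp_all add: conj1_def conj2_def)

lemma lift_closed [simp]:
  "x \<in> carrier (G 1) \<Longrightarrow> y \<in> carrier (G 1) \<Longrightarrow> lift x y \<in> carrier (G 2)"
  by (simp add: lift_def)

lemmas grp_simps = conj1_def conj2_def G1.m_assoc G2.m_assoc G3.m_assoc
  G1.inv_mult_group G2.inv_mult_group G3.inv_mult_group

lemma conj1_in_N1:
  assumes "x \<in> carrier (G 1)" "y \<in> N1"
  shows "conj1 x y \<in> N1"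
  using assms(1) N1D[OF assms(2)] by (simp add: N1_def conj1_def)

lemma conj2_in_N2:
  assumes "x \<in> carrier (G 2)" "y \<in> N2"
  shows "conj2 x y \<in> N2"
  using assms(1) N2D[OF assms(2)] by (simp add: N2_def conj2_def)

lemma lift_in_N2:
  assumes "x \<in> N1" "y \<in> N1"
  shows "lift x y \<in> N2"
  using N1D[OF assms(1)] N1D[OF assms(2)] by (simp add: N2_def lift_def grp_simps)

lemma bd_lift:
  assumes "x \<in> N1" "y \<in> N1"
  shows "d 2 2 (lift x y) = conj1 x y \<otimes>\<^bsub>G 1\<^esub> conj1 (s 0 0 (d 1 1 x)) (inv\<^bsub>G 1\<^esub> y)"
  using N1D[OF assms(1)] N1D[OF assms(2)] by (simp add: lift_def grp_simps)

text \<open>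
  The next three identities are where the triviality of the third Moore group enters. In each
  case a word \<open>w\<close> in degenerate elements is killed by \<open>d\<^sub>0\<close>, \<open>d\<^sub>1\<close> and \<open>d\<^sub>2\<close>, hence \<open>w = 1\<close>,
  and the identity is \<open>d\<^sub>3 w = 1\<close>. The word is found by replacing each factor of the identity by a
  degenerate element that \<open>d\<^sub>3\<close> maps to it, \<open>s\<^sub>1d\<^sub>2k\<close> by \<open>s\<^sub>1k\<close> and \<open>k\<close> by \<open>s\<^sub>2k\<close> for instance: the lower faces
  then make the factors cancel in pairs.
\<close>

lemma conj_via_bd:
  assumes u: "u \<in> carrier (G 2)" and k: "k \<in> N2"
  shows "conj2 (s 1 1 (d 2 2 u)) k = conj2 u k"
proof -
  note [simp] = u N2D[OF k]
  let ?w = "s 2 1 u \<otimes>\<^bsub>G 3\<^esub> s 2 2 k \<otimes>\<^bsub>G 3\<^esub> inv\<^bsub>G 3\<^esub> (s 2 1 u) \<otimes>\<^bsub>G 3\<^esub>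
    inv\<^bsub>G 3\<^esub> (s 2 2 u \<otimes>\<^bsub>G 3\<^esub> s 2 2 k \<otimes>\<^bsub>G 3\<^esub> inv\<^bsub>G 3\<^esub> (s 2 2 u))"
  have "?w = \<one>\<^bsub>G 3\<^esub>" by (rule N3) (simp_all add: grp_simps)
  then have "d 3 3 ?w = \<one>\<^bsub>G 2\<^esub>" by simp
  then have "conj2 (s 1 1 (d 2 2 u)) k \<otimes>\<^bsub>G 2\<^esub> inv\<^bsub>G 2\<^esub> (conj2 u k) = \<one>\<^bsub>G 2\<^esub>"
    by (simp add: conj2_def)
  then show ?thesis by (simp add: G2.inv_solve_right')
qed

lemma lift_bd_l:
  assumes k: "k \<in> N2" and x: "x \<in> N1"
  shows "lift (d 2 2 k) x = conj2 k (s 1 1 x) \<otimes>\<^bsub>G 2\<^esub> inv\<^bsub>G 2\<^esub> (s 1 1 x)"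
proof -
  note [simp] = N1D[OF x] N2D[OF k]
  let ?y = "s 2 1 (s 1 1 x)"
  have y [simp]: "d 3 0 ?y = \<one>\<^bsub>G 2\<^esub>" "d 3 1 ?y = s 1 1 x" "d 3 2 ?y = s 1 1 x"
    "d 3 3 ?y = s 1 1 x" by simp_all
  let ?w = "s 2 1 k \<otimes>\<^bsub>G 3\<^esub> ?y \<otimes>\<^bsub>G 3\<^esub> inv\<^bsub>G 3\<^esub> (s 2 1 k) \<otimes>\<^bsub>G 3\<^esub>
    inv\<^bsub>G 3\<^esub> (s 2 0 k \<otimes>\<^bsub>G 3\<^esub> ?y \<otimes>\<^bsub>G 3\<^esub> inv\<^bsub>G 3\<^esub> (s 2 0 k)) \<otimes>\<^bsub>G 3\<^esub>
    inv\<^bsub>G 3\<^esub> (s 2 2 k \<otimes>\<^bsub>G 3\<^esub> ?y \<otimes>\<^bsub>G 3\<^esub> inv\<^bsub>G 3\<^esub> (s 2 2 k) \<otimes>\<^bsub>G 3\<^esub> inv\<^bsub>G 3\<^esub> ?y)"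
  have "?w = \<one>\<^bsub>G 3\<^esub>"
    by (rule N3) (simp_all add: grp_simps)
  then have "d 3 3 ?w = \<one>\<^bsub>G 2\<^esub>" by simp
  then have "lift (d 2 2 k) x \<otimes>\<^bsub>G 2\<^esub>
      inv\<^bsub>G 2\<^esub> (conj2 k (s 1 1 x) \<otimes>\<^bsub>G 2\<^esub> inv\<^bsub>G 2\<^esub> (s 1 1 x)) = \<one>\<^bsub>G 2\<^esub>"
    by (simp add: conj2_def lift_def)
  then show ?thesis by (simp add: G2.inv_solve_right')
qed

lemma lift_bd_r:
  assumes k: "k \<in> N2" and x: "x \<in> N1"
  shows "lift x (d 2 2 k) = conj2 (s 1 1 x) k \<otimes>\<^bsub>G 2\<^esub> conj2 (s 1 0 x) (inv\<^bsub>G 2\<^esub> k)"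
proof -
  note [simp] = N1D[OF x] N2D[OF k]
  let ?p = "s 2 1 (s 1 1 x)" and ?q = "s 2 2 (s 1 0 x)"
  have p [simp]: "d 3 0 ?p = \<one>\<^bsub>G 2\<^esub>" "d 3 1 ?p = s 1 1 x" "d 3 2 ?p = s 1 1 x"
    "d 3 3 ?p = s 1 1 x" by simp_all
  have q [simp]: "d 3 1 ?q = s 1 1 x" "d 3 2 ?q = s 1 0 x" "d 3 3 ?q = s 1 0 x" by simp_all
  let ?w = "?p \<otimes>\<^bsub>G 3\<^esub> s 2 1 k \<otimes>\<^bsub>G 3\<^esub> inv\<^bsub>G 3\<^esub> ?p \<otimes>\<^bsub>G 3\<^esub>
    inv\<^bsub>G 3\<^esub> (?q \<otimes>\<^bsub>G 3\<^esub> s 2 1 k \<otimes>\<^bsub>G 3\<^esub> inv\<^bsub>G 3\<^esub> ?q) \<otimes>\<^bsub>G 3\<^esub>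
    inv\<^bsub>G 3\<^esub> (?p \<otimes>\<^bsub>G 3\<^esub> s 2 2 k \<otimes>\<^bsub>G 3\<^esub> inv\<^bsub>G 3\<^esub> ?p \<otimes>\<^bsub>G 3\<^esub>
      (?q \<otimes>\<^bsub>G 3\<^esub> inv\<^bsub>G 3\<^esub> (s 2 2 k) \<otimes>\<^bsub>G 3\<^esub> inv\<^bsub>G 3\<^esub> ?q))"
  have "?w = \<one>\<^bsub>G 3\<^esub>"
    by (rule N3) (simp_all add: grp_simps)
  then have "d 3 3 ?w = \<one>\<^bsub>G 2\<^esub>" by simp
  then have "lift x (d 2 2 k) \<otimes>\<^bsub>G 2\<^esub>
      inv\<^bsub>G 2\<^esub> (conj2 (s 1 1 x) k \<otimes>\<^bsub>G 2\<^esub> conj2 (s 1 0 x) (inv\<^bsub>G 2\<^esub> k)) = \<one>\<^bsub>G 2\<^esub>"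
    by (simp add: conj2_def lift_def)
  then show ?thesis by (simp add: G2.inv_solve_right')
qed

text \<open>The action of \<open>N\<^sub>1\<close> on \<open>N\<^sub>2\<close> that is defined by the lifting is conjugation by \<open>s\<^sub>1x\<close>.\<close>

lemma lift_act:
  assumes k: "k \<in> N2" and x: "x \<in> N1"
  shows "k \<otimes>\<^bsub>G 2\<^esub> lift (d 2 2 (inv\<^bsub>G 2\<^esub> k)) x = conj2 (s 1 1 x) k"
proof -
  have "inv\<^bsub>G 2\<^esub> k \<in> N2" using N2D[OF k] by (simp add: N2_def)
  from lift_bd_l[OF this x] show ?thesis
    using N1D[OF x] N2D[OF k] by (simp add: grp_simps)
qed

lemma lift_bd_bd:
  assumes "k \<in> N2" "l \<in> N2"
  shows "lift (d 2 2 k) (d 2 2 l) = conj2 k l \<otimes>\<^bsub>G 2\<^esub> inv\<^bsub>G 2\<^esub> l"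
proof -
  have "inv\<^bsub>G 2\<^esub> k \<in> N2" using N2D[OF assms(1)] by (simp add: N2_def)
  from conj_via_bd[OF N2D(1)[OF assms(2)] this]
  have "s 1 1 (d 2 2 l) \<otimes>\<^bsub>G 2\<^esub> (inv\<^bsub>G 2\<^esub> k \<otimes>\<^bsub>G 2\<^esub> inv\<^bsub>G 2\<^esub> (s 1 1 (d 2 2 l))) =
      l \<otimes>\<^bsub>G 2\<^esub> (inv\<^bsub>G 2\<^esub> k \<otimes>\<^bsub>G 2\<^esub> inv\<^bsub>G 2\<^esub> l)"
    using N2D[OF assms(1)] N2D[OF assms(2)] by (simp add: grp_simps)
  then show ?thesis
    using N2D[OF assms(1)] N2D[OF assms(2)] lift_bd_l[OF assms(1) bd_in_N1[OF assms(2)]]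
    by (simp add: grp_simps)
qed

text \<open>Expanding the left-hand side, the factor \<open>lift x z\<close> is conjugated by \<open>s\<^sub>0x s\<^sub>1y s\<^sub>0x\<inverse>\<close>, which by
  the first of the three identities may be replaced by \<open>s\<^sub>1\<close> of its image under \<open>d\<^sub>2\<close>.\<close>

lemma lift_mult_r:
  assumes x: "x \<in> N1" and y: "y \<in> N1" and z: "z \<in> N1"
  shows "lift x (y \<otimes>\<^bsub>G 1\<^esub> z) =
    lift x y \<otimes>\<^bsub>G 2\<^esub> conj2 (s 1 1 (conj1 (s 0 0 (d 1 1 x)) y)) (lift x z)"
proof -
  note [simp] = N1D[OF x] N1D[OF y] N1D[OF z]
  have "s 1 1 (conj1 (s 0 0 (d 1 1 x)) y) = s 1 1 (d 2 2 (conj2 (s 1 0 x) (s 1 1 y)))"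
    by (simp add: conj1_def conj2_def)
  then have "conj2 (s 1 1 (conj1 (s 0 0 (d 1 1 x)) y)) (lift x z) =
      conj2 (conj2 (s 1 0 x) (s 1 1 y)) (lift x z)"
    using conj_via_bd[OF _ lift_in_N2[OF x z]] by simp
  then show ?thesis by (simp add: lift_def grp_simps)
qed

lemma conj_degen:
  assumes x: "x \<in> N1" and k: "k \<in> N2"
  shows "conj2 (s 1 1 (s 0 0 (d 1 1 x))) k = conj2 (s 1 0 x) k"
  using conj_via_bd[OF _ k, of "s 1 0 x"] N1D[OF x] by simp

lemma lift_mult_l:
  assumes x: "x \<in> N1" and y: "y \<in> N1" and z: "z \<in> N1"
  shows "lift (x \<otimes>\<^bsub>G 1\<^esub> y) z =
    lift x (conj1 y z) \<otimes>\<^bsub>G 2\<^esub> conj2 (s 1 1 (s 0 0 (d 1 1 x))) (lift y z)"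
  unfolding conj_degen[OF x lift_in_N2[OF y z]]
  using N1D[OF x] N1D[OF y] N1D[OF z] by (simp add: lift_def grp_simps)

lemma lift_bd_mixed:
  assumes k: "k \<in> N2" and x: "x \<in> N1"
  shows "lift (d 2 2 k) x \<otimes>\<^bsub>G 2\<^esub> lift x (d 2 2 k) =
    k \<otimes>\<^bsub>G 2\<^esub> conj2 (s 1 1 (s 0 0 (d 1 1 x))) (inv\<^bsub>G 2\<^esub> k)"
proof -
  have "inv\<^bsub>G 2\<^esub> k \<in> N2" using N2D[OF k] by (simp add: N2_def)
  show ?thesis
    unfolding conj_degen[OF x \<open>inv\<^bsub>G 2\<^esub> k \<in> N2\<close>]
    using N1D[OF x] N2D[OF k]
    by (simp add: lift_bd_l[OF k x] lift_bd_r[OF k x] grp_simps)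
qed

lemma lift_equivariant:
  assumes a: "a \<in> carrier (G 0)" and x: "x \<in> N1" and y: "y \<in> N1"
  shows "conj2 (s 1 1 (s 0 0 a)) (lift x y) = lift (conj1 (s 0 0 a) x) (conj1 (s 0 0 a) y)"
  using a N1D[OF x] N1D[OF y] by (simp add: lift_def grp_simps degen_degen)

end


context ground_field
begin

section \<open>Kernels of Hopf algebra maps\<close>

context
  fixes A :: "('k, 'u) hopf" and B :: "('k, 'v) hopf"
  assumes hA: "hopf A" and hB: "hopf B"
begin

lemma HKer_lin:
  assumes d: "d \<in> hopf_maps R A B"
  shows "lin A (tensor R A B) (\<lambda>x. sweedler A (tensor R A B) x (\<lambda>x1 x2. pure_tensor R A B x1 (d x2)))"
  using hA hB hopf_mapD[OF d] by (auto intro!: lin_intros)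

text \<open>A generalized element that \<open>d\<close> maps to the trivial one takes its values in the kernel of \<open>d\<close>. This
  and the converse, the next lemma, relate kernels of Hopf algebra maps to kernels of group
  homomorphisms.\<close>

lemma HKer_coalg_map:
  assumes d: "d \<in> hopf_maps R A B" and C: "cocoalgebra C" and f: "coalg_map C A f"
    and df: "\<And>c. c \<in> carrier C \<Longrightarrow> d (f c) = counit C c \<odot>\<^bsub>B\<^esub> \<one>\<^bsub>B\<^esub>" and c: "c \<in> carrier C"
  shows "f c \<in> HKer R A B d"
proof -
  let ?T = "tensor R A B"
  note d' = hopf_mapD[OF d] and f' = coalg_mapD[OF f]
  have [simp]: "module R A" "module R B" "assoc_algebra R B" "cocoalgebra A" using hA hB by auto
  have "sweedler A ?T (f c) (\<lambda>x1 x2. pure_tensor R A B x1 (d x2)) =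
      sweedler C ?T c (\<lambda>a b. pure_tensor R A B (f a) (d (f b)))"
    using C f c d' by (intro sw_coalg_map) (auto intro!: lin_intros)
  also have "\<dots> = sweedler C ?T c (\<lambda>a b. counit C b \<odot>\<^bsub>?T\<^esub> pure_tensor R A B (f a) \<one>\<^bsub>B\<^esub>)"
    using C c f' by (intro sw_cong) (auto simp: df tensor_pure_smult pure_balanced)
  also have "\<dots> = pure_tensor R A B (f c) \<one>\<^bsub>B\<^esub>"
    using C c f' by (intro counit_sw_r) (auto intro!: lin_intros)
  finally show ?thesis using f' c by (simp add: HKer_def)
qed

text \<open>Apply \<open>\<epsilon> \<otimes> id\<close> to the defining equation of the kernel.\<close>

lemma HKer_val:
  assumes d: "d \<in> hopf_maps R A B" and x: "x \<in> HKer R A B d"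
  shows "d x = counit A x \<odot>\<^bsub>B\<^esub> \<one>\<^bsub>B\<^esub>"
proof -
  let ?T = "tensor R A B"
  note d' = hopf_mapD[OF d]
  have [simp]: "module R A" "module R B" "assoc_algebra R B" "cocoalgebra A" using hA hB by auto
  let ?g = "tensor_lift B (\<lambda>a b. counit A a \<odot>\<^bsub>B\<^esub> b)"
  have b: "bil A B B (\<lambda>a b. counit A a \<odot>\<^bsub>B\<^esub> b)" by (auto intro!: lin_intros)
  have g: "lin ?T B ?g" using b by (intro tensor_lift_lin) auto
  have xA: "x \<in> carrier A" using x by (simp add: HKer_def)
  have "d x = sweedler A B x (\<lambda>x1 x2. counit A x1 \<odot>\<^bsub>B\<^esub> d x2)"
    using xA d' by (intro counit_sw_l[symmetric]) auto
  also have "\<dots> = sweedler A B x (\<lambda>x1 x2. ?g (pure_tensor R A B x1 (d x2)))"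
    using xA d' b by (intro sw_cong) (auto simp: tensor_lift_pure)
  also have "\<dots> = ?g (sweedler A ?T x (\<lambda>x1 x2. pure_tensor R A B x1 (d x2)))"
    using xA d' g by (intro sw_map[symmetric]) auto
  also have "\<dots> = ?g (pure_tensor R A B x \<one>\<^bsub>B\<^esub>)" using x by (simp add: HKer_def)
  also have "\<dots> = counit A x \<odot>\<^bsub>B\<^esub> \<one>\<^bsub>B\<^esub>" using xA b by (simp add: tensor_lift_pure)
  finally show ?thesis .
qed

lemma HKer_one: "d \<in> hopf_maps R A B \<Longrightarrow> \<one>\<^bsub>A\<^esub> \<in> HKer R A B d"
  using hA hB hopf_mapD[of d A B] unfolding HKer_def
  by (simp, subst sw_one) (auto intro!: lin_intros)

text \<open>In the algebra \<open>A \<otimes> B\<close>, the defining equation for \<open>x y\<close> is the product of those for \<open>x\<close> and \<open>y\<close>.\<close>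

lemma HKer_mult:
  assumes d: "d \<in> hopf_maps R A B" and x: "x \<in> HKer R A B d" and y: "y \<in> HKer R A B d"
  shows "x \<otimes>\<^bsub>A\<^esub> y \<in> HKer R A B d"
proof -
  let ?T = "tensor R A B" and ?p = "pure_tensor R A B"
  note d' = hopf_mapD[OF d]
  have [simp]: "module R A" "module R B" "assoc_algebra R A" "assoc_algebra R B" "cocoalgebra A"
    using hA hB by auto
  have T: "assoc_algebra R ?T" by (intro tensor_algebra) auto
  have xA: "x \<in> carrier A" "y \<in> carrier A" using x y by (auto simp: HKer_def)
  have "sweedler A ?T (x \<otimes>\<^bsub>A\<^esub> y) (\<lambda>x1 x2. ?p x1 (d x2)) =
      sweedler A ?T x (\<lambda>x1 x2. sweedler A ?T y (\<lambda>y1 y2. ?p (x1 \<otimes>\<^bsub>A\<^esub> y1) (d (x2 \<otimes>\<^bsub>A\<^esub> y2))))"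
    using hA d' xA by (intro sw_mult) (auto intro!: lin_intros)
  also have "\<dots> = sweedler A ?T x (\<lambda>x1 x2. sweedler A ?T y (\<lambda>y1 y2. ?p x1 (d x2) \<otimes>\<^bsub>?T\<^esub> ?p y1 (d y2)))"
    using d' xA by (intro sw_cong) auto
  also have "\<dots> = sweedler A ?T x (\<lambda>x1 x2. ?p x1 (d x2) \<otimes>\<^bsub>?T\<^esub> sweedler A ?T y (\<lambda>y1 y2. ?p y1 (d y2)))"
    using d' xA T
    by (intro sw_cong sw_map[of A ?T ?T "\<lambda>t. ?p _ _ \<otimes>\<^bsub>?T\<^esub> t", symmetric]) (auto intro!: lin_intros)
  also have "\<dots> = sweedler A ?T x (\<lambda>x1 x2. ?p x1 (d x2)) \<otimes>\<^bsub>?T\<^esub> sweedler A ?T y (\<lambda>y1 y2. ?p y1 (d y2))"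
    using d' xA T
    by (intro sw_map[of A ?T ?T "\<lambda>t. t \<otimes>\<^bsub>?T\<^esub> sweedler A ?T y (\<lambda>y1 y2. ?p y1 (d y2))", symmetric])
      (auto intro!: lin_intros)
  also have "\<dots> = ?p (x \<otimes>\<^bsub>A\<^esub> y) \<one>\<^bsub>B\<^esub>" using x y by (simp add: HKer_def)
  finally show ?thesis using xA by (simp add: HKer_def)
qed

lemma HKer_antipode:
  assumes d: "d \<in> hopf_maps R A B" and x: "x \<in> HKer R A B d"
  shows "antipode A x \<in> HKer R A B d"
proof -
  let ?T = "tensor R A B" and ?p = "pure_tensor R A B"
  note d' = hopf_mapD[OF d]
  have [simp]: "module R A" "module R B" "assoc_algebra R A" "assoc_algebra R B" "cocoalgebra A"
    using hA hB by auto
  let ?g = "tensor_lift ?T (\<lambda>a b. ?p (antipode A a) (antipode B b))"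
  have b: "bil A B ?T (\<lambda>a b. ?p (antipode A a) (antipode B b))"
    using hA hB by (intro bilI lin_pure_l lin_pure_r antipode_lin) auto
  have g: "lin ?T ?T ?g" using b by (intro tensor_lift_lin) auto
  have xA: "x \<in> carrier A" using x by (simp add: HKer_def)
  have S: "coalg_map A A (antipode A)" using hA by (auto simp: coalg_map_def antipode_lin comult_antipode)
  have "sweedler A ?T (antipode A x) (\<lambda>x1 x2. ?p x1 (d x2)) =
      sweedler A ?T x (\<lambda>x1 x2. ?p (antipode A x1) (d (antipode A x2)))"
    using d' xA S by (intro sw_coalg_map) (auto intro!: lin_intros)
  also have "\<dots> = sweedler A ?T x (\<lambda>x1 x2. ?g (?p x1 (d x2)))"
    using xA d' b by (intro sw_cong) (auto simp: tensor_lift_pure hopf_map_antipode[OF hA hB d])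
  also have "\<dots> = ?g (sweedler A ?T x (\<lambda>x1 x2. ?p x1 (d x2)))"
    using xA d' g by (intro sw_map[symmetric]) auto
  also have "\<dots> = ?g (?p x \<one>\<^bsub>B\<^esub>)" using x by (simp add: HKer_def)
  also have "\<dots> = ?p (antipode A x) \<one>\<^bsub>B\<^esub>" using xA b hB by (simp add: tensor_lift_pure antipode_one)
  finally show ?thesis using xA hA by (simp add: HKer_def)
qed

text \<open>The defect of \<open>x\<close> from being in the kernel, as a linear map.\<close>

definition kdef :: "('u \<Rightarrow> 'v) \<Rightarrow> 'u \<Rightarrow> ('u \<times> 'v) list set"
  where "kdef d x = sweedler A (tensor R A B) x (\<lambda>x1 x2. pure_tensor R A B x1 (d x2))
    \<oplus>\<^bsub>tensor R A B\<^esub> \<ominus>\<^bsub>tensor R A B\<^esub> pure_tensor R A B x \<one>\<^bsub>B\<^esub>"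

lemma kdef_lin: "d \<in> hopf_maps R A B \<Longrightarrow> lin A (tensor R A B) (kdef d)"
  unfolding kdef_def using hA hB by (intro lin_diff HKer_lin lin_pure_l lin_id) auto

lemma HKer_iff:
  assumes d: "d \<in> hopf_maps R A B"
  shows "x \<in> HKer R A B d \<longleftrightarrow> x \<in> carrier A \<and> kdef d x = \<zero>\<^bsub>tensor R A B\<^esub>"
proof (cases "x \<in> carrier A")
  case True
  then have "sweedler A (tensor R A B) x (\<lambda>x1 x2. pure_tensor R A B x1 (d x2)) \<in> carrier (tensor R A B)"
    using hA hB lin_closed[OF HKer_lin[OF d]] by blast
  then show ?thesis
    using True hA hB mod_eq_iff_minus[of "tensor R A B"
        "sweedler A (tensor R A B) x (\<lambda>x1 x2. pure_tensor R A B x1 (d x2))"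
        "pure_tensor R A B x \<one>\<^bsub>B\<^esub>"]
    by (simp add: HKer_def kdef_def)
qed (simp add: HKer_def)

text \<open>Coassociativity: \<open>(id \<otimes> kdef d) (\<delta> x)\<close> is the image of \<open>kdef d x\<close> under \<open>\<delta> \<otimes> id\<close>.\<close>

lemma HKer_comult:
  assumes d: "d \<in> hopf_maps R A B" and x: "x \<in> HKer R A B d"
  shows "idtensor A (tensor R A B) (kdef d) (comult A x) = \<zero>\<^bsub>tensor R A (tensor R A B)\<^esub>"
proof -
  let ?T = "tensor R A B" and ?W = "tensor R A (tensor R A B)"
  let ?p = "pure_tensor R A B" and ?q = "pure_tensor R A (tensor R A B)"
  note d' = hopf_mapD[OF d]
  have [simp]: "module R A" "module R B" "assoc_algebra R A" "assoc_algebra R B" "cocoalgebra A"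
    using hA hB by auto
  have [simp]: "module R ?T" "module R ?W" by simp_all
  have xA: "x \<in> carrier A" using x by (simp add: HKer_def)
  let ?k = "\<lambda>x. sweedler A ?T x (\<lambda>x1 x2. ?p x1 (d x2))" and ?l = "\<lambda>x. ?p x \<one>\<^bsub>B\<^esub>"
  have k: "lin A ?T ?k" by (rule HKer_lin[OF d])
  have l: "lin A ?T ?l" by (intro lin_pure_l lin_id) auto
  let ?g = "tensor_lift ?W (\<lambda>a b. sweedler A ?W a (\<lambda>a1 a2. ?q a1 (?p a2 b)))"
  have b: "bil A B ?W (\<lambda>a b. sweedler A ?W a (\<lambda>a1 a2. ?q a1 (?p a2 b)))"
    by (auto intro!: lin_intros)
  have g: "lin ?T ?W ?g" using b by (intro tensor_lift_lin) auto
  have "idtensor A ?T ?k (comult A x) = sweedler A ?W x (\<lambda>a y. ?q a (sweedler A ?T y (\<lambda>b c. ?p b (d c))))"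
    by (simp add: idtensor_def sweedler_def)
  also have "\<dots> = sweedler A ?W x (\<lambda>a y. sweedler A ?W y (\<lambda>b c. ?q a (?p b (d c))))"
    using xA d' by (intro sw_cong sw_map) (auto intro!: lin_intros)
  also have "\<dots> = sweedler A ?W x (\<lambda>y c. sweedler A ?W y (\<lambda>a b. ?q a (?p b (d c))))"
    using xA d' by (intro coassoc[symmetric] trilinearI) (auto intro!: lin_intros)
  also have "\<dots> = sweedler A ?W x (\<lambda>y c. ?g (?p y (d c)))"
    using xA d' b by (intro sw_cong) (auto simp: tensor_lift_pure)
  also have "\<dots> = ?g (?k x)"
    using xA d' g by (intro sw_map[symmetric]) auto
  also have "\<dots> = ?g (?p x \<one>\<^bsub>B\<^esub>)" using x by (simp add: HKer_def)
  also have "\<dots> = sweedler A ?W x (\<lambda>a1 a2. ?q a1 (?p a2 \<one>\<^bsub>B\<^esub>))"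
    using xA b by (simp add: tensor_lift_pure)
  also have "\<dots> = idtensor A ?T ?l (comult A x)"
    by (simp add: idtensor_def sweedler_def)
  finally have e: "idtensor A ?T ?k (comult A x) = idtensor A ?T ?l (comult A x)" .
  have "idtensor A ?T ?l (comult A x) \<in> carrier ?W"
    using xA l by (intro lin_closed[OF idtensor_lin]) auto
  moreover have "idtensor A ?T (kdef d) (comult A x) =
      idtensor A ?T ?k (comult A x) \<oplus>\<^bsub>?W\<^esub> \<ominus>\<^bsub>?W\<^esub> idtensor A ?T ?l (comult A x)"
    using idtensor_diff[OF _ _ _ k l, of A "comult A x"] xA by (simp add: kdef_def[abs_def])
  ultimately show ?thesis by (simp add: e mod_r_neg)
qed

text \<open>
  By the previous lemma and flatness, \<open>id \<otimes> r\<close> fixes the coproduct of \<open>x \<in> N\<close> for a suitable retraction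
  \<open>r\<close>; by cocommutativity so does \<open>r \<otimes> id\<close>, and hence also \<open>r \<otimes> r\<close>.
\<close>

lemma common_HKer_subcoalg:
  fixes n :: nat and d :: "nat \<Rightarrow> 'u \<Rightarrow> 'v"
  assumes d: "\<And>i. i < n \<Longrightarrow> d i \<in> hopf_maps R A B"
    and N: "N = {x \<in> carrier A. \<forall>i < n. x \<in> HKer R A B (d i)}"
  shows "\<exists>r. subcoalg A N r"
proof -
  let ?T = "tensor R A B" and ?AA = "tensor R A A" and ?p = "pure_tensor R A A"
  have [simp]: "module R A" "module R B" "assoc_algebra R A" "assoc_algebra R B" "cocoalgebra A"
    "module R ?T" "module R ?AA"
    using hA hB by auto
  have N_iff: "x \<in> N \<longleftrightarrow> x \<in> carrier A \<and> (\<forall>i < n. kdef (d i) x = \<zero>\<^bsub>?T\<^esub>)" for x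
    using N HKer_iff[OF d] by auto
  have "\<exists>r. lin A A r \<and> (\<forall>x \<in> carrier A. \<forall>i < n. kdef (d i) (r x) = \<zero>\<^bsub>?T\<^esub>) \<and>
    (\<forall>x \<in> carrier A. (\<forall>i < n. kdef (d i) x = \<zero>\<^bsub>?T\<^esub>) \<longrightarrow> r x = x) \<and>
    (\<forall>t \<in> carrier ?AA.
      (\<forall>i < n. idtensor A ?T (kdef (d i)) t = \<zero>\<^bsub>tensor R A ?T\<^esub>) \<longrightarrow> idtensor A A r t = t)"
    using kdef_lin[OF d] by (intro common_kernel_retraction) auto
  then obtain r where r: "lin A A r" "\<And>x i. x \<in> carrier A \<Longrightarrow> i < n \<Longrightarrow> kdef (d i) (r x) = \<zero>\<^bsub>?T\<^esub>"
    "\<And>x. x \<in> carrier A \<Longrightarrow> (\<And>i. i < n \<Longrightarrow> kdef (d i) x = \<zero>\<^bsub>?T\<^esub>) \<Longrightarrow> r x = x"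
    "\<And>t. t \<in> carrier ?AA \<Longrightarrow> (\<And>i. i < n \<Longrightarrow> idtensor A ?T (kdef (d i)) t = \<zero>\<^bsub>tensor R A ?T\<^esub>) \<Longrightarrow>
      idtensor A A r t = t"
    by (elim exE conjE) blast
  note [simp] = lin_closed[OF r(1)]
  have "vsubspace A N"
    unfolding vsubspace_def N_iff
  proof (intro conjI ballI allI impI)
    show "N \<subseteq> carrier A" using N by blast
    fix i assume i: "i < n"
    note k = kdef_lin[OF d[OF i]]
    show "kdef (d i) \<zero>\<^bsub>A\<^esub> = \<zero>\<^bsub>?T\<^esub>" by (rule lin_zero[OF _ _ k]) auto
    fix x assume x: "x \<in> N"
    show "kdef (d i) (c \<odot>\<^bsub>A\<^esub> x) = \<zero>\<^bsub>?T\<^esub>" if "c \<in> carrier R" for c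
      using x i that by (simp add: N_iff lin_smult[OF k])
    fix y assume y: "y \<in> N"
    show "kdef (d i) (x \<oplus>\<^bsub>A\<^esub> y) = \<zero>\<^bsub>?T\<^esub>"
      using x y i by (simp add: N_iff lin_add[OF k])
  qed (simp_all add: N_iff)
  moreover have "comult A x = sweedler A ?AA x (\<lambda>a b. ?p (r a) (r b))" if x: "x \<in> N" for x
  proof -
    have xA: "x \<in> carrier A" using x N by simp
    have 1: "sweedler A ?AA x (\<lambda>a b. ?p a (r b)) = comult A x"
    proof -
      have "idtensor A A r (comult A x) = comult A x"
        using HKer_comult[OF d] x by (intro r(4)) (auto simp: N)
      then show ?thesis by (simp add: idtensor_def sweedler_def)
    qed
    let ?f = "tensor_lift ?AA (\<lambda>a b. ?p b a)" and ?h = "tensor_lift ?AA (\<lambda>a b. ?p (r a) b)"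
    have bf: "bil A A ?AA (\<lambda>a b. ?p b a)" and bh: "bil A A ?AA (\<lambda>a b. ?p (r a) b)"
      using r(1) by (auto intro!: lin_intros)
    have f: "lin ?AA ?AA ?f" and h: "lin ?AA ?AA ?h"
      using bf bh by (auto intro!: tensor_lift_lin)
    have flip: "?f (comult A x) = comult A x"
      using xA cocomm[of A ?AA ?p x] by (simp add: sweedler_def[of A ?AA] pure_bil tensor_lift_id)
    have "sweedler A ?AA x (\<lambda>a b. ?p (r a) b) = sweedler A ?AA x (\<lambda>a b. ?p (r b) a)"
      using xA bh by (intro cocomm[of A ?AA "\<lambda>a b. ?p (r a) b", symmetric]) auto
    also have "\<dots> = sweedler A ?AA x (\<lambda>a b. ?f (?p a (r b)))"
      using xA bf by (intro sw_cong) (auto simp: tensor_lift_pure)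
    also have "\<dots> = ?f (sweedler A ?AA x (\<lambda>a b. ?p a (r b)))"
      using xA f by (intro sw_map[symmetric]) auto
    also have "\<dots> = comult A x" using 1 flip by simp
    finally have 2: "sweedler A ?AA x (\<lambda>a b. ?p (r a) b) = comult A x" .
    have "sweedler A ?AA x (\<lambda>a b. ?p (r a) (r b)) = sweedler A ?AA x (\<lambda>a b. ?h (?p a (r b)))"
      using xA bh by (intro sw_cong) (auto simp: tensor_lift_pure)
    also have "\<dots> = ?h (sweedler A ?AA x (\<lambda>a b. ?p a (r b)))"
      using xA h by (intro sw_map[symmetric]) auto
    also have "\<dots> = sweedler A ?AA x (\<lambda>a b. ?p (r a) b)" using 1 by (simp add: sweedler_def)
    also have "\<dots> = comult A x" by (rule 2)
    finally show ?thesis by simp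
  qed
  ultimately have "subcoalg A N r"
    unfolding subcoalg_def using r(1,2,3) by (auto simp: N_iff)
  then show ?thesis by blast
qed

end


section \<open>Projections of a tensor product of coalgebras\<close>

definition proj1 :: "('k, 'u, 'm) hopf_scheme \<Rightarrow> ('k, 'v, 'n) hopf_scheme \<Rightarrow>
    ('u \<times> 'v) list set \<Rightarrow> 'u"
  where "proj1 A B = tensor_lift A (\<lambda>a b. counit B b \<odot>\<^bsub>A\<^esub> a)"

definition proj2 :: "('k, 'u, 'm) hopf_scheme \<Rightarrow> ('k, 'v, 'n) hopf_scheme \<Rightarrow>
    ('u \<times> 'v) list set \<Rightarrow> 'v"
  where "proj2 A B = tensor_lift B (\<lambda>a b. counit A a \<odot>\<^bsub>B\<^esub> b)"

context
  fixes A :: "('k, 'u, 'm) hopf_scheme" and B :: "('k, 'v, 'n) hopf_scheme"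
  assumes A: "cocoalgebra A" and B: "cocoalgebra B"
begin

private lemma mods [simp]: "module R A" "module R B" "cocoalgebra A" "cocoalgebra B"
  using A B by auto

lemma proj_bil: "bil A B A (\<lambda>a b. counit B b \<odot>\<^bsub>A\<^esub> a)" "bil A B B (\<lambda>a b. counit A a \<odot>\<^bsub>B\<^esub> b)"
  by (auto intro!: lin_intros)

lemma proj_lin: "lin (tensor_coalg A B) A (proj1 A B)" "lin (tensor_coalg A B) B (proj2 A B)"
  unfolding proj1_def proj2_def using proj_bil by (auto intro!: tensor_lift_lin)

lemma proj_pure [simp]:
  "a \<in> carrier A \<Longrightarrow> b \<in> carrier B \<Longrightarrow> proj1 A B (pure_tensor R A B a b) = counit B b \<odot>\<^bsub>A\<^esub> a"
  "a \<in> carrier A \<Longrightarrow> b \<in> carrier B \<Longrightarrow> proj2 A B (pure_tensor R A B a b) = counit A a \<odot>\<^bsub>B\<^esub> b"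
  unfolding proj1_def proj2_def using proj_bil by (simp_all add: tensor_lift_pure)

lemma sw_proj1_any:
  assumes V: "module R V" and F: "bil A (tensor_coalg A B) V F"
    and a: "a \<in> carrier A" and b: "b \<in> carrier B"
  shows "sweedler (tensor_coalg A B) V (pure_tensor R A B a b) (\<lambda>s t. F (proj1 A B s) t) =
    sweedler A V a (\<lambda>a1 a2. F a1 (pure_tensor R A B a2 b))"
proof -
  let ?p = "pure_tensor R A B" and ?C = "tensor_coalg A B"
  note F' = lin_comp[OF proj_lin(1) bil_l[OF F]] bil_r[OF F] bil_closed[OF F] bil_l[OF F]
  have pr: "proj1 A B t \<in> carrier A" if "t \<in> carrier (tensor R A B)" for t
    using lin_closed[OF proj_lin(1)] that by simp
  have "sweedler ?C V (?p a b) (\<lambda>s t. F (proj1 A B s) t) =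
      sweedler A V a (\<lambda>a1 a2. sweedler B V b (\<lambda>b1 b2. F (proj1 A B (?p a1 b1)) (?p a2 b2)))"
    using V a b F' pr by (intro sw_tensor[OF A B V]) (auto intro!: bilI simp del: bil_tensor_coalg)
  also have "\<dots> = sweedler A V a (\<lambda>a1 a2. sweedler B V b (\<lambda>b1 b2. counit B b1 \<odot>\<^bsub>V\<^esub> F a1 (?p a2 b2)))"
    using a b by (intro sw_cong) (auto simp: lin_smult[OF F'(4)])
  also have "\<dots> = sweedler A V a (\<lambda>a1 a2. F a1 (?p a2 b))"
    using V a b F'
    by (intro sw_cong counit_sw_l lin_comp[OF lin_pure_r[OF _ _ lin_id]]) auto
  finally show ?thesis .
qed

text \<open>A bilinear map of the two variables, as an operation on the two projections: the superfluous
  components are absorbed by the counit.\<close>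

lemma sw_proj12:
  assumes V: "module R V" and F: "bil A B V F" and a: "a \<in> carrier A" and b: "b \<in> carrier B"
  shows "sweedler (tensor_coalg A B) V (pure_tensor R A B a b) (\<lambda>s t. F (proj1 A B s) (proj2 A B t)) =
    F a b"
proof -
  let ?p = "pure_tensor R A B" and ?C = "tensor_coalg A B"
  note F' = lin_comp[OF proj_lin(2) bil_r[OF F]] bil_r[OF F] bil_closed[OF F] bil_l[OF F]
  have pr: "proj2 A B t \<in> carrier B" if "t \<in> carrier (tensor R A B)" for t
    using lin_closed[OF proj_lin(2)] that by simp
  have "sweedler ?C V (?p a b) (\<lambda>s t. F (proj1 A B s) (proj2 A B t)) =
      sweedler A V a (\<lambda>a1 a2. F a1 (proj2 A B (?p a2 b)))"
    using V a b F' pr by (intro sw_proj1_any[where F = "\<lambda>a t. F a (proj2 A B t)"]) (auto intro!: bilI)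
  also have "\<dots> = sweedler A V a (\<lambda>a1 a2. counit A a2 \<odot>\<^bsub>V\<^esub> F a1 b)"
    using a b by (intro sw_cong) (auto simp: lin_smult[OF F'(2)])
  also have "\<dots> = F a b"
    using V a b F' by (intro counit_sw_r) auto
  finally show ?thesis .
qed

lemma sw_proj21:
  assumes V: "module R V" and F: "bil B A V F" and a: "a \<in> carrier A" and b: "b \<in> carrier B"
  shows "sweedler (tensor_coalg A B) V (pure_tensor R A B a b) (\<lambda>s t. F (proj2 A B s) (proj1 A B t)) =
    F b a"
proof -
  let ?C = "tensor_coalg A B"
  have C: "cocoalgebra ?C" by (rule tensor_coalg_cocoalgebra[OF A B])
  have "bil ?C ?C V (\<lambda>s t. F (proj2 A B t) (proj1 A B s))"
    using lin_closed[OF proj_lin(1)] lin_closed[OF proj_lin(2)]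
    by (intro bilI lin_comp[OF proj_lin(1) bil_r[OF F]] lin_comp[OF proj_lin(2) bil_l[OF F]]) auto
  from cocomm[OF C V this, of "pure_tensor R A B a b"]
  have "sweedler ?C V (pure_tensor R A B a b) (\<lambda>s t. F (proj2 A B s) (proj1 A B t)) =
      sweedler ?C V (pure_tensor R A B a b) (\<lambda>s t. F (proj2 A B t) (proj1 A B s))"
    using a b by simp
  also have "\<dots> = F b a"
    using V a b F by (intro sw_proj12[where F = "\<lambda>a b. F b a"] bilI) (auto intro: bil_r bil_l)
  finally show ?thesis .
qed

lemma proj1_coalg_map: "coalg_map (tensor_coalg A B) A (proj1 A B)"
  unfolding coalg_map_def
proof (intro conjI ballI)
  let ?p = "pure_tensor R A B" and ?C = "tensor_coalg A B" and ?T = "tensor R A A"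
  have C: "cocoalgebra ?C" by (rule tensor_coalg_cocoalgebra[OF A B])
  note pr = proj_lin(1) lin_closed[OF proj_lin(1)]
  show "lin ?C A (proj1 A B)" by (rule proj_lin)
  fix c assume c: "c \<in> carrier ?C"
  then have c': "c \<in> carrier (tensor R A B)" by simp
  have e1: "lin (tensor R A B) (ground R) (counit ?C)" using counit_lin[OF C] by simp
  have e2: "lin (tensor R A B) (ground R) (\<lambda>c. counit A (proj1 A B c))"
    using lin_counit[OF A proj_lin(1)] by simp
  show "counit A (proj1 A B c) = counit ?C c"
    by (rule lin_tensor_ext[OF mods(1,2) _ e2 e1 _ c'])
      (use A B in \<open>auto simp: lin_smult[OF counit_lin[OF A]] m_comm\<close>)
  have l1: "lin ?C ?T (\<lambda>c. comult A (proj1 A B c))" by (rule lin_comp[OF proj_lin(1) comult_lin[OF A]])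
  have l2: "lin ?C ?T (\<lambda>c. sweedler ?C ?T c (\<lambda>a b. pure_tensor R A A (proj1 A B a) (proj1 A B b)))"
    using pr by (intro lin_sw[OF C] bilI lin_pure_l lin_pure_r lin_id) auto
  show "comult A (proj1 A B c) =
      sweedler ?C ?T c (\<lambda>a b. pure_tensor R A A (proj1 A B a) (proj1 A B b))"
  proof (rule lin_tensor_ext[OF mods(1,2) _ l1[unfolded lin_tensor_coalg] l2[unfolded lin_tensor_coalg] _ c'])
    fix a b assume a: "a \<in> carrier A" and b: "b \<in> carrier B"
    have "sweedler ?C ?T (?p a b) (\<lambda>s t. pure_tensor R A A (proj1 A B s) (proj1 A B t)) =
        sweedler A ?T a (\<lambda>a1 a2. pure_tensor R A A a1 (proj1 A B (?p a2 b)))"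
      using a b pr
      by (intro sw_proj1_any[where F = "\<lambda>a t. pure_tensor R A A a (proj1 A B t)"] bilI lin_pure_l lin_pure_r lin_id) auto
    also have "\<dots> = sweedler A ?T a (\<lambda>a1 a2. counit B b \<odot>\<^bsub>?T\<^esub> pure_tensor R A A a1 a2)"
      using a b by (intro sw_cong) (auto simp: tensor_pure_smult pure_balanced)
    also have "\<dots> = counit B b \<odot>\<^bsub>?T\<^esub> sweedler A ?T a (pure_tensor R A A)"
      using a b by (intro sw_map[symmetric] lin_smult_r lin_id) auto
    also have "\<dots> = comult A (proj1 A B (?p a b))"
      using a b by (simp add: sw_pure lin_smult[OF comult_lin])
    finally show "comult A (proj1 A B (?p a b)) =
      sweedler ?C ?T (?p a b) (\<lambda>s t. pure_tensor R A A (proj1 A B s) (proj1 A B t))" by simp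
  qed simp
qed

lemma sw_proj2_any:
  assumes V: "module R V" and F: "bil B (tensor_coalg A B) V F"
    and a: "a \<in> carrier A" and b: "b \<in> carrier B"
  shows "sweedler (tensor_coalg A B) V (pure_tensor R A B a b) (\<lambda>s t. F (proj2 A B s) t) =
    sweedler B V b (\<lambda>b1 b2. F b1 (pure_tensor R A B a b2))"
proof -
  let ?p = "pure_tensor R A B" and ?C = "tensor_coalg A B"
  note F' = lin_comp[OF proj_lin(2) bil_l[OF F]] bil_r[OF F] bil_closed[OF F] bil_l[OF F]
  have pr: "proj2 A B t \<in> carrier B" if "t \<in> carrier (tensor R A B)" for t
    using lin_closed[OF proj_lin(2)] that by simp
  have "sweedler ?C V (?p a b) (\<lambda>s t. F (proj2 A B s) t) =
      sweedler A V a (\<lambda>a1 a2. sweedler B V b (\<lambda>b1 b2. F (proj2 A B (?p a1 b1)) (?p a2 b2)))"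
    using V a b F' pr by (intro sw_tensor[OF A B V]) (auto intro!: bilI simp del: bil_tensor_coalg)
  also have "\<dots> = sweedler A V a (\<lambda>a1 a2. sweedler B V b (\<lambda>b1 b2. counit A a1 \<odot>\<^bsub>V\<^esub> F b1 (?p a2 b2)))"
    using a b by (intro sw_cong) (auto simp: lin_smult[OF F'(4)])
  also have "\<dots> = sweedler B V b (\<lambda>b1 b2. sweedler A V a (\<lambda>a1 a2. counit A a1 \<odot>\<^bsub>V\<^esub> F b1 (?p a2 b2)))"
    using V a b F' by (intro sw_swap) auto
  also have "\<dots> = sweedler B V b (\<lambda>b1 b2. F b1 (?p a b2))"
    using V a b F'
    by (intro sw_cong counit_sw_l lin_comp[OF lin_pure_l[OF _ _ lin_id]]) auto
  finally show ?thesis .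
qed

lemma proj2_coalg_map: "coalg_map (tensor_coalg A B) B (proj2 A B)"
  unfolding coalg_map_def
proof (intro conjI ballI)
  let ?p = "pure_tensor R A B" and ?C = "tensor_coalg A B" and ?T = "tensor R B B"
  have C: "cocoalgebra ?C" by (rule tensor_coalg_cocoalgebra[OF A B])
  note pr = proj_lin(2) lin_closed[OF proj_lin(2)]
  show "lin ?C B (proj2 A B)" by (rule proj_lin)
  fix c assume c: "c \<in> carrier ?C"
  then have c': "c \<in> carrier (tensor R A B)" by simp
  have e1: "lin (tensor R A B) (ground R) (counit ?C)" using counit_lin[OF C] by simp
  have e2: "lin (tensor R A B) (ground R) (\<lambda>c. counit B (proj2 A B c))"
    using lin_counit[OF B proj_lin(2)] by simp
  show "counit B (proj2 A B c) = counit ?C c"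
    by (rule lin_tensor_ext[OF mods(1,2) _ e2 e1 _ c'])
      (use A B in \<open>auto simp: lin_smult[OF counit_lin[OF B]] m_comm\<close>)
  have l1: "lin ?C ?T (\<lambda>c. comult B (proj2 A B c))" by (rule lin_comp[OF proj_lin(2) comult_lin[OF B]])
  have l2: "lin ?C ?T (\<lambda>c. sweedler ?C ?T c (\<lambda>a b. pure_tensor R B B (proj2 A B a) (proj2 A B b)))"
    using pr by (intro lin_sw[OF C] bilI lin_pure_l lin_pure_r lin_id) auto
  show "comult B (proj2 A B c) =
      sweedler ?C ?T c (\<lambda>a b. pure_tensor R B B (proj2 A B a) (proj2 A B b))"
  proof (rule lin_tensor_ext[OF mods(1,2) _ l1[unfolded lin_tensor_coalg] l2[unfolded lin_tensor_coalg] _ c'])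
    fix a b assume a: "a \<in> carrier A" and b: "b \<in> carrier B"
    have "sweedler ?C ?T (?p a b) (\<lambda>s t. pure_tensor R B B (proj2 A B s) (proj2 A B t)) =
        sweedler B ?T b (\<lambda>b1 b2. pure_tensor R B B b1 (proj2 A B (?p a b2)))"
      using a b pr
      by (intro sw_proj2_any[where F = "\<lambda>a t. pure_tensor R B B a (proj2 A B t)"] bilI lin_pure_l lin_pure_r lin_id) auto
    also have "\<dots> = sweedler B ?T b (\<lambda>b1 b2. counit A a \<odot>\<^bsub>?T\<^esub> pure_tensor R B B b1 b2)"
      using a b by (intro sw_cong) (auto simp: tensor_pure_smult pure_balanced)
    also have "\<dots> = counit A a \<odot>\<^bsub>?T\<^esub> sweedler B ?T b (pure_tensor R B B)"
      using a b by (intro sw_map[symmetric] lin_smult_r lin_id) auto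
    also have "\<dots> = comult B (proj2 A B (?p a b))"
      using a b by (simp add: sw_pure lin_smult[OF comult_lin])
    finally show "comult B (proj2 A B (?p a b)) =
      sweedler ?C ?T (?p a b) (\<lambda>s t. pure_tensor R B B (proj2 A B s) (proj2 A B t))" by simp
  qed simp
qed

(* as a rule without the assumptions of this context, it would loop *)
declare mods [simp del]

end

end


context ground_field
begin

section \<open>The adjoint action\<close>

lemma res_cgroup:
  assumes "cocoalgebra C" "coalg_map C H f"
  shows "restrict f (carrier C) \<in> carrier (cgroup C H)"
  unfolding cgroup_carrier
  by (rule conjI[OF _ coalg_map_cong[OF assms]]) simp_all

text \<open>A formula \<open>op x y = op\<^sub>1 x' y' op\<^sub>2 x'' y''\<close> for operations on elements becomes a product
  in the convolution algebra for generalized elements.\<close>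

lemma conv_prod:
  assumes C: "cocoalgebra C" and A: "cocoalgebra A" and B: "cocoalgebra B" and E: "assoc_algebra R E"
    and op1: "bil A B E op1" and op2: "bil A B E op2"
    and op: "\<And>x y. x \<in> carrier A \<Longrightarrow> y \<in> carrier B \<Longrightarrow> op x y =
      sweedler A E x (\<lambda>x1 x2. sweedler B E y (\<lambda>y1 y2. op1 x1 y1 \<otimes>\<^bsub>E\<^esub> op2 x2 y2))"
    and f: "coalg_map C A f" and g: "coalg_map C B g"
  shows "conv C E op f g = conv C E (\<otimes>\<^bsub>E\<^esub>) (conv C E op1 f g) (conv C E op2 f g)"
proof (rule extensionalityI[of _ "carrier C"])
  fix c assume c: "c \<in> carrier C"
  have M [simp]: "module R A" "module R B" "module R E"
    by (rule coalg_module[OF A], rule coalg_module[OF B], rule alg_module[OF E])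
  note f' = coalg_mapD[OF f] and g' = coalg_mapD[OF g]
  note [simp] = f'(2) g'(2) bil_closed[OF op1] bil_closed[OF op2]
  note fg = lin_comp[OF f'(1) bil_l[OF op1]] lin_comp[OF g'(1) bil_r[OF op1]]
    lin_comp[OF f'(1) bil_l[OF op2]] lin_comp[OF g'(1) bil_r[OF op2]]
  note ol = bil_l[OF op1] bil_r[OF op1] bil_l[OF op2] bil_r[OF op2]
  have "conv C E op f g c = sweedler C E c (\<lambda>a b. sweedler A E (f a) (\<lambda>x1 x2. sweedler B E (g b)
      (\<lambda>y1 y2. op1 x1 y1 \<otimes>\<^bsub>E\<^esub> op2 x2 y2)))"
    using c unfolding conv_def by (simp, intro sw_cong[OF C]) (auto simp: op)
  also have "\<dots> = sweedler C E c (\<lambda>a b. sweedler C E a (\<lambda>a1 a2. sweedler B E (g b)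
      (\<lambda>y1 y2. op1 (f a1) y1 \<otimes>\<^bsub>E\<^esub> op2 (f a2) y2)))"
    using A B E C c f
    by (intro sw_cong[OF C c] sw_coalg_map) (auto intro!: bilI lin_sw_param lin_mult_l lin_mult_r ol)
  also have "\<dots> = sweedler C E c (\<lambda>a b. sweedler C E a (\<lambda>a1 a2. sweedler C E b
      (\<lambda>b1 b2. op1 (f a1) (g b1) \<otimes>\<^bsub>E\<^esub> op2 (f a2) (g b2))))"
    using A B E C c g
    by (intro sw_cong[OF C] sw_coalg_map) (auto intro!: bilI lin_mult_l lin_mult_r ol)
  also have "\<dots> = sweedler C E c (\<lambda>a b. sweedler C E a (\<lambda>a1 a2. sweedler C E b
      (\<lambda>b1 b2. op1 (f a1) (g a2) \<otimes>\<^bsub>E\<^esub> op2 (f b1) (g b2))))"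
    using C E c fg
    by (intro sw_middle_four[symmetric, of C E "\<lambda>a1 a2 b1 b2. op1 (f a1) (g a2) \<otimes>\<^bsub>E\<^esub> op2 (f b1) (g b2)"]
        quadrilinearI trilinearI lin_mult_l lin_mult_r) auto
  also have "\<dots> = sweedler C E c (\<lambda>a b. sweedler C E a (\<lambda>a1 a2.
      op1 (f a1) (g a2) \<otimes>\<^bsub>E\<^esub> conv C E op2 f g b))"
    using C E c by (intro sw_cong[OF C])
      (auto simp: conv_def sw_map[of C E E "\<lambda>t. op1 _ _ \<otimes>\<^bsub>E\<^esub> t", symmetric] lin_mult_r)
  also have "\<dots> = sweedler C E c (\<lambda>a b. conv C E op1 f g a \<otimes>\<^bsub>E\<^esub> conv C E op2 f g b)"
    using C E c by (intro sw_cong[OF C])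
      (auto simp: conv_def sw_map[of C E E "\<lambda>t. t \<otimes>\<^bsub>E\<^esub> _", symmetric] lin_mult_l)
  finally show "conv C E op f g c = conv C E (\<otimes>\<^bsub>E\<^esub>) (conv C E op1 f g) (conv C E op2 f g) c"
    using c by (simp add: conv_def)
qed simp_all

text \<open>This is \<open>(X Y)\<inverse> = Y\<inverse> X\<inverse>\<close> for the two projections \<open>X, Y : H \<otimes> H \<rightarrow> H\<close> in the group of coalgebra maps.\<close>

lemma antipode_mult:
  assumes H: "hopf H" and x: "x \<in> carrier H" and y: "y \<in> carrier H"
  shows "antipode H (x \<otimes>\<^bsub>H\<^esub> y) = antipode H y \<otimes>\<^bsub>H\<^esub> antipode H x"
proof -
  let ?C = "tensor_coalg H H" and ?S = "antipode H"
  have [simp]: "cocoalgebra H" "module R H" "assoc_algebra R H" using H by auto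
  have C: "cocoalgebra ?C" by (intro tensor_coalg_cocoalgebra) auto
  interpret G: group "cgroup ?C H" by (rule cgroup_group[OF C H])
  let ?X = "restrict (proj1 H H) (carrier ?C)" and ?Y = "restrict (proj2 H H) (carrier ?C)"
  have X: "?X \<in> carrier (cgroup ?C H)" by (intro res_cgroup C proj1_coalg_map) auto
  have Y: "?Y \<in> carrier (cgroup ?C H)" by (intro res_cgroup C proj2_coalg_map) auto
  let ?p = "pure_tensor R H H x y"
  have p: "?p \<in> carrier ?C" using x y by simp
  have "(inv\<^bsub>cgroup ?C H\<^esub> (?X \<otimes>\<^bsub>cgroup ?C H\<^esub> ?Y)) ?p =
      ?S (sweedler ?C H ?p (\<lambda>s t. ?X s \<otimes>\<^bsub>H\<^esub> ?Y t))"
    using p G.m_closed[OF X Y] by (simp add: cgroup_inv[OF C H] cgroup_mult conv_def)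
  also have "sweedler ?C H ?p (\<lambda>s t. ?X s \<otimes>\<^bsub>H\<^esub> ?Y t) =
      sweedler ?C H ?p (\<lambda>s t. proj1 H H s \<otimes>\<^bsub>H\<^esub> proj2 H H t)"
    using p by (intro sw_cong[OF C]) auto
  also have "\<dots> = x \<otimes>\<^bsub>H\<^esub> y" using x y by (intro sw_proj12) (auto intro!: alg_mult_bil)
  finally have l: "(inv\<^bsub>cgroup ?C H\<^esub> (?X \<otimes>\<^bsub>cgroup ?C H\<^esub> ?Y)) ?p = ?S (x \<otimes>\<^bsub>H\<^esub> y)" .
  have "(inv\<^bsub>cgroup ?C H\<^esub> ?Y \<otimes>\<^bsub>cgroup ?C H\<^esub> inv\<^bsub>cgroup ?C H\<^esub> ?X) ?p =
      sweedler ?C H ?p (\<lambda>s t. ?S (proj2 H H s) \<otimes>\<^bsub>H\<^esub> ?S (proj1 H H t))"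
    using p X Y
    by (simp add: cgroup_inv[OF C H] cgroup_mult conv_def, intro sw_cong[OF C]) auto
  also have "\<dots> = ?S y \<otimes>\<^bsub>H\<^esub> ?S x"
    using x y H
    by (intro sw_proj21[where F = "\<lambda>b a. ?S b \<otimes>\<^bsub>H\<^esub> ?S a"] bilI lin_mult_l lin_mult_r antipode_lin) auto
  finally show ?thesis using l X Y by (simp add: G.inv_mult_group)
qed

lemma ad_bil:
  assumes H: "hopf H"
  shows "bil H H H (ad H)"
  unfolding ad_def using H
  by (intro bilI lin_sw lin_sw_param lin_mult_l lin_mult_r antipode_lin lin_id) auto

lemma ad_closed [simp]:
  "hopf H \<Longrightarrow> x \<in> carrier H \<Longrightarrow> y \<in> carrier H \<Longrightarrow> ad H x y \<in> carrier H"
  by (rule bil_closed[OF ad_bil])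

text \<open>On generalized elements the adjoint action is conjugation.\<close>

lemma conv_ad:
  assumes C: "cocoalgebra C" and H: "hopf H"
    and f: "f \<in> carrier (cgroup C H)" and g: "g \<in> carrier (cgroup C H)"
  shows "conv C H (ad H) f g = f \<otimes>\<^bsub>cgroup C H\<^esub> g \<otimes>\<^bsub>cgroup C H\<^esub> inv\<^bsub>cgroup C H\<^esub> f"
proof -
  have [simp]: "cocoalgebra H" "module R H" "assoc_algebra R H" using H by auto
  have fc: "coalg_map C H f" "coalg_map C H g" using f g by (auto simp: cgroup_carrier)
  note f' = coalg_mapD[OF fc(1)] and g' = coalg_mapD[OF fc(2)]
  let ?o = "\<lambda>x y. counit H y \<odot>\<^bsub>H\<^esub> antipode H x"
  have b: "bil H H H ?o"
    using H by (intro bilI lin_smult_l lin_smult_r counit_lin antipode_lin) auto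
  have "conv C H (ad H) f g = conv C H (\<otimes>\<^bsub>H\<^esub>) (conv C H (\<otimes>\<^bsub>H\<^esub>) f g) (conv C H ?o f g)"
  proof (rule conv_prod[OF C _ _ _ alg_mult_bil b _ fc])
    fix x y assume x: "x \<in> carrier H" and y: "y \<in> carrier H"
    show "ad H x y = sweedler H H x (\<lambda>x1 x2. sweedler H H y (\<lambda>y1 y2. (x1 \<otimes>\<^bsub>H\<^esub> y1) \<otimes>\<^bsub>H\<^esub> ?o x2 y2))"
      unfolding ad_def
    proof (rule sw_cong)
      fix a b assume a: "a \<in> carrier H" and b: "b \<in> carrier H"
      have "sweedler H H y (\<lambda>y1 y2. (a \<otimes>\<^bsub>H\<^esub> y1) \<otimes>\<^bsub>H\<^esub> ?o b y2) =
          sweedler H H y (\<lambda>y1 y2. counit H y2 \<odot>\<^bsub>H\<^esub> (a \<otimes>\<^bsub>H\<^esub> y1 \<otimes>\<^bsub>H\<^esub> antipode H b))"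
        using H a b y by (intro sw_cong) auto
      also have "\<dots> = a \<otimes>\<^bsub>H\<^esub> y \<otimes>\<^bsub>H\<^esub> antipode H b"
        using H a b y by (intro counit_sw_r lin_mult_l lin_mult_r lin_id) auto
      finally show "a \<otimes>\<^bsub>H\<^esub> y \<otimes>\<^bsub>H\<^esub> antipode H b =
          sweedler H H y (\<lambda>y1 y2. (a \<otimes>\<^bsub>H\<^esub> y1) \<otimes>\<^bsub>H\<^esub> ?o b y2)" by simp
    qed (use x in auto)
  qed auto
  moreover have "conv C H ?o f g = inv\<^bsub>cgroup C H\<^esub> f"
    unfolding cgroup_inv[OF C H f] conv_def
  proof (rule restrict_ext)
    fix c assume c: "c \<in> carrier C"
    have "sweedler C H c (\<lambda>a b. ?o (f a) (g b)) = sweedler C H c (\<lambda>a b. counit C b \<odot>\<^bsub>H\<^esub> antipode H (f a))"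
      using C c g' by (intro sw_cong) auto
    also have "\<dots> = antipode H (f c)"
      using C c f' H by (intro counit_sw_r lin_antipode) auto
    finally show "sweedler C H c (\<lambda>a b. ?o (f a) (g b)) = antipode H (f c)" .
  qed
  ultimately show ?thesis by (simp add: cgroup_mult)
qed

text \<open>The conjugate of the two projections \<open>H \<otimes> H \<rightarrow> H\<close> is again a coalgebra map, and it is the adjoint
  action.\<close>

lemma ad_coalg:
  assumes H: "hopf H" and x: "x \<in> carrier H" and y: "y \<in> carrier H"
  shows comult_ad: "comult H (ad H x y) = sweedler H (tensor R H H) x (\<lambda>x1 x2.
      sweedler H (tensor R H H) y (\<lambda>y1 y2. pure_tensor R H H (ad H x1 y1) (ad H x2 y2)))"
    and counit_ad: "counit H (ad H x y) = counit H x \<otimes> counit H y"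
proof -
  let ?C = "tensor_coalg H H" and ?T = "tensor R H H" and ?p = "pure_tensor R H H"
  have M [simp]: "cocoalgebra H" "module R H" "assoc_algebra R H" using H by auto
  have C: "cocoalgebra ?C" by (intro tensor_coalg_cocoalgebra) auto
  interpret G: group "cgroup ?C H" by (rule cgroup_group[OF C H])
  let ?X = "restrict (proj1 H H) (carrier ?C)" and ?Y = "restrict (proj2 H H) (carrier ?C)"
  have X: "?X \<in> carrier (cgroup ?C H)" by (intro res_cgroup C proj1_coalg_map) auto
  have Y: "?Y \<in> carrier (cgroup ?C H)" by (intro res_cgroup C proj2_coalg_map) auto
  define W where "W = conv ?C H (ad H) ?X ?Y"
  have "W \<in> carrier (cgroup ?C H)" 
    unfolding W_def conv_ad[OF C H X Y] using X Y by (intro G.m_closed G.inv_closed)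
  then have W: "coalg_map ?C H W" by (simp add: cgroup_carrier)
  note W' = coalg_mapD[OF W]
  have Wp: "W (?p a b) = ad H a b" if "a \<in> carrier H" "b \<in> carrier H" for a b
  proof -
    have "W (?p a b) = sweedler ?C H (?p a b) (\<lambda>s t. ad H (proj1 H H s) (proj2 H H t))"
      using that unfolding W_def conv_def by (simp, intro sw_cong[OF C]) auto
    then show ?thesis using that H by (simp add: sw_proj12 ad_bil)
  qed
  show "counit H (ad H x y) = counit H x \<otimes> counit H y"
    using W'(3)[of "?p x y"] x y by (simp add: Wp)
  have "comult H (ad H x y) = sweedler ?C ?T (?p x y) (\<lambda>s t. ?p (W s) (W t))"
    using W'(4)[of "?p x y"] x y by (simp add: Wp)
  also have "\<dots> = sweedler H ?T x (\<lambda>x1 x2. sweedler H ?T y (\<lambda>y1 y2. ?p (W (?p x1 y1)) (W (?p x2 y2))))"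
    using x y W'(1,2) by (intro sw_tensor bilI lin_pure_l lin_pure_r) auto
  also have "\<dots> = sweedler H ?T x (\<lambda>x1 x2. sweedler H ?T y (\<lambda>y1 y2. ?p (ad H x1 y1) (ad H x2 y2)))"
    using x y by (intro sw_cong) (auto simp: Wp)
  finally show "comult H (ad H x y) = sweedler H ?T x (\<lambda>x1 x2.
      sweedler H ?T y (\<lambda>y1 y2. ?p (ad H x1 y1) (ad H x2 y2)))" .
qed

lemma ad_one_l: "hopf H \<Longrightarrow> y \<in> carrier H \<Longrightarrow> ad H \<one>\<^bsub>H\<^esub> y = y"
  unfolding ad_def
  by (subst sw_one) (auto simp: antipode_one intro!: bilI lin_mult_l lin_mult_r antipode_lin lin_id)

lemma ad_one:
  assumes H: "hopf H" and x: "x \<in> carrier H"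
  shows "ad H x \<one>\<^bsub>H\<^esub> = counit H x \<odot>\<^bsub>H\<^esub> \<one>\<^bsub>H\<^esub>"
proof -
  have "ad H x \<one>\<^bsub>H\<^esub> = sweedler H H x (\<lambda>x1 x2. x1 \<otimes>\<^bsub>H\<^esub> antipode H x2)"
    unfolding ad_def using H x by (intro sw_cong) auto
  then show ?thesis using H x by (simp add: antipode_sw_r)
qed

lemma ad_mult_l:
  assumes H: "hopf H" and x: "x \<in> carrier H" and y: "y \<in> carrier H" and v: "v \<in> carrier H"
  shows "ad H (x \<otimes>\<^bsub>H\<^esub> y) v = ad H x (ad H y v)"
proof -
  let ?S = "antipode H"
  have [simp]: "cocoalgebra H" "module R H" "assoc_algebra R H" using H by auto
  have "ad H (x \<otimes>\<^bsub>H\<^esub> y) v = sweedler H H x (\<lambda>x1 x2. sweedler H H y (\<lambda>y1 y2.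
      x1 \<otimes>\<^bsub>H\<^esub> y1 \<otimes>\<^bsub>H\<^esub> v \<otimes>\<^bsub>H\<^esub> ?S (x2 \<otimes>\<^bsub>H\<^esub> y2)))"
    unfolding ad_def using H x y v
    by (intro sw_mult bilI lin_mult_l lin_mult_r antipode_lin lin_id) auto
  also have "\<dots> = sweedler H H x (\<lambda>x1 x2. sweedler H H y (\<lambda>y1 y2.
      x1 \<otimes>\<^bsub>H\<^esub> (y1 \<otimes>\<^bsub>H\<^esub> v \<otimes>\<^bsub>H\<^esub> ?S y2) \<otimes>\<^bsub>H\<^esub> ?S x2))"
    using H x y v by (intro sw_cong) (auto simp: antipode_mult alg_mult_assoc)
  also have "\<dots> = ad H x (ad H y v)"
    unfolding ad_def using H x y v
    by (intro sw_cong sw_map[of H H H "\<lambda>t. _ \<otimes>\<^bsub>H\<^esub> t \<otimes>\<^bsub>H\<^esub> ?S _", symmetric]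
        lin_mult_l lin_mult_r lin_id) auto
  finally show ?thesis .
qed

text \<open>The inner factors \<open>S(x'') x'''\<close> of the right-hand side cancel.\<close>

lemma ad_mult:
  assumes H: "hopf H" and x: "x \<in> carrier H" and u: "u \<in> carrier H" and v: "v \<in> carrier H"
  shows "ad H x (u \<otimes>\<^bsub>H\<^esub> v) = sweedler H H x (\<lambda>x1 x2. ad H x1 u \<otimes>\<^bsub>H\<^esub> ad H x2 v)"
proof -
  let ?S = "antipode H"
  have [simp]: "cocoalgebra H" "module R H" "assoc_algebra R H" using H by auto
  note li = bilI trilinearI lin_sw lin_sw_param lin_mult_l lin_mult_r antipode_lin lin_antipode lin_id
    lin_smult_l counit_lin
  have e1: "ad H a u \<otimes>\<^bsub>H\<^esub> w = sweedler H H a (\<lambda>a1 a2. a1 \<otimes>\<^bsub>H\<^esub> u \<otimes>\<^bsub>H\<^esub> ?S a2 \<otimes>\<^bsub>H\<^esub> w)"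
    if "a \<in> carrier H" "w \<in> carrier H" for a w
    unfolding ad_def using H u that
    by (intro sw_map[of H H H "\<lambda>t. t \<otimes>\<^bsub>H\<^esub> w"] lin_mult_l lin_id) auto
  have "sweedler H H x (\<lambda>a b. ad H a u \<otimes>\<^bsub>H\<^esub> ad H b v) = sweedler H H x (\<lambda>a b.
      sweedler H H a (\<lambda>a1 a2. a1 \<otimes>\<^bsub>H\<^esub> u \<otimes>\<^bsub>H\<^esub> ?S a2 \<otimes>\<^bsub>H\<^esub> ad H b v))"
    using H x v by (intro sw_cong e1) auto
  also have "\<dots> = sweedler H H x (\<lambda>a1 y. sweedler H H y (\<lambda>a2 b.
      a1 \<otimes>\<^bsub>H\<^esub> u \<otimes>\<^bsub>H\<^esub> ?S a2 \<otimes>\<^bsub>H\<^esub> ad H b v))"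
    using H x u v by (intro coassoc li bil_l[OF ad_bil]) auto
  also have "\<dots> = sweedler H H x (\<lambda>a1 y. sweedler H H y (\<lambda>a2 b. sweedler H H b (\<lambda>b1 b2.
      a1 \<otimes>\<^bsub>H\<^esub> u \<otimes>\<^bsub>H\<^esub> (?S a2 \<otimes>\<^bsub>H\<^esub> b1) \<otimes>\<^bsub>H\<^esub> v \<otimes>\<^bsub>H\<^esub> ?S b2)))"
  proof (intro sw_cong)
    fix a1 y a2 b assume c: "a1 \<in> carrier H" "y \<in> carrier H" "a2 \<in> carrier H" "b \<in> carrier H"
    have "a1 \<otimes>\<^bsub>H\<^esub> u \<otimes>\<^bsub>H\<^esub> ?S a2 \<otimes>\<^bsub>H\<^esub> ad H b v =
        sweedler H H b (\<lambda>b1 b2. a1 \<otimes>\<^bsub>H\<^esub> u \<otimes>\<^bsub>H\<^esub> ?S a2 \<otimes>\<^bsub>H\<^esub> (b1 \<otimes>\<^bsub>H\<^esub> v \<otimes>\<^bsub>H\<^esub> ?S b2))"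
      unfolding ad_def using H u v c by (intro sw_map lin_mult_r lin_id) auto
    also have "\<dots> = sweedler H H b (\<lambda>b1 b2.
        a1 \<otimes>\<^bsub>H\<^esub> u \<otimes>\<^bsub>H\<^esub> (?S a2 \<otimes>\<^bsub>H\<^esub> b1) \<otimes>\<^bsub>H\<^esub> v \<otimes>\<^bsub>H\<^esub> ?S b2)"
      using H u v c by (intro sw_cong) (auto simp: alg_mult_assoc)
    finally show "a1 \<otimes>\<^bsub>H\<^esub> u \<otimes>\<^bsub>H\<^esub> ?S a2 \<otimes>\<^bsub>H\<^esub> ad H b v = \<dots>" .
  qed (use x in auto)
  also have "\<dots> = sweedler H H x (\<lambda>a1 y. sweedler H H y (\<lambda>w b2. sweedler H H w (\<lambda>a2 b1.
      a1 \<otimes>\<^bsub>H\<^esub> u \<otimes>\<^bsub>H\<^esub> (?S a2 \<otimes>\<^bsub>H\<^esub> b1) \<otimes>\<^bsub>H\<^esub> v \<otimes>\<^bsub>H\<^esub> ?S b2)))"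
    using H x u v by (intro sw_cong[OF _ x] coassoc[symmetric] li) auto
  also have "\<dots> = sweedler H H x (\<lambda>a1 y. sweedler H H y (\<lambda>w b2. counit H w \<odot>\<^bsub>H\<^esub>
      (a1 \<otimes>\<^bsub>H\<^esub> u \<otimes>\<^bsub>H\<^esub> v \<otimes>\<^bsub>H\<^esub> ?S b2)))"
  proof (intro sw_cong)
    fix a1 y w b2 assume c: "a1 \<in> carrier H" "y \<in> carrier H" "w \<in> carrier H" "b2 \<in> carrier H"
    have "sweedler H H w (\<lambda>a2 b1. a1 \<otimes>\<^bsub>H\<^esub> u \<otimes>\<^bsub>H\<^esub> (?S a2 \<otimes>\<^bsub>H\<^esub> b1) \<otimes>\<^bsub>H\<^esub> v \<otimes>\<^bsub>H\<^esub> ?S b2) =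
        a1 \<otimes>\<^bsub>H\<^esub> u \<otimes>\<^bsub>H\<^esub> sweedler H H w (\<lambda>a2 b1. ?S a2 \<otimes>\<^bsub>H\<^esub> b1) \<otimes>\<^bsub>H\<^esub> v \<otimes>\<^bsub>H\<^esub> ?S b2"
      using H u v c
      by (intro sw_map[of H H H "\<lambda>t. a1 \<otimes>\<^bsub>H\<^esub> u \<otimes>\<^bsub>H\<^esub> t \<otimes>\<^bsub>H\<^esub> v \<otimes>\<^bsub>H\<^esub> ?S b2", symmetric]
          lin_mult_l lin_mult_r lin_id) auto
    then show "sweedler H H w (\<lambda>a2 b1. a1 \<otimes>\<^bsub>H\<^esub> u \<otimes>\<^bsub>H\<^esub> (?S a2 \<otimes>\<^bsub>H\<^esub> b1) \<otimes>\<^bsub>H\<^esub> v \<otimes>\<^bsub>H\<^esub> ?S b2) =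
        counit H w \<odot>\<^bsub>H\<^esub> (a1 \<otimes>\<^bsub>H\<^esub> u \<otimes>\<^bsub>H\<^esub> v \<otimes>\<^bsub>H\<^esub> ?S b2)"
      using H u v c by (simp add: antipode_sw_l)
  qed (use x in auto)
  also have "\<dots> = sweedler H H x (\<lambda>a1 y. a1 \<otimes>\<^bsub>H\<^esub> u \<otimes>\<^bsub>H\<^esub> v \<otimes>\<^bsub>H\<^esub> ?S y)"
    using H x u v by (intro sw_cong counit_sw_l lin_mult_l lin_mult_r antipode_lin) auto
  also have "\<dots> = ad H x (u \<otimes>\<^bsub>H\<^esub> v)"
    unfolding ad_def using H x u v by (intro sw_cong) (auto simp: alg_mult_assoc)
  finally show ?thesis by simp
qed

lemma hopf_map_ad:
  assumes A: "hopf A" and B: "hopf B" and d: "d \<in> hopf_maps R A B"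
    and x: "x \<in> carrier A" and y: "y \<in> carrier A"
  shows "d (ad A x y) = ad B (d x) (d y)"
proof -
  note d' = hopf_mapD[OF d]
  have [simp]: "module R A" "module R B" "assoc_algebra R A" "assoc_algebra R B" "cocoalgebra A"
    using A B by auto
  have "d (ad A x y) = sweedler A B x (\<lambda>x1 x2. d (x1 \<otimes>\<^bsub>A\<^esub> y \<otimes>\<^bsub>A\<^esub> antipode A x2))"
    unfolding ad_def using A B d' x y by (intro sw_map) auto
  also have "\<dots> = sweedler A B x (\<lambda>x1 x2. d x1 \<otimes>\<^bsub>B\<^esub> d y \<otimes>\<^bsub>B\<^esub> antipode B (d x2))"
    using A B d' x y by (intro sw_cong) (auto simp: hopf_map_antipode[OF A B d])
  also have "\<dots> = ad B (d x) (d y)"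
    unfolding ad_def using A B d' x y
    by (intro sw_coalg_map[symmetric] bilI lin_mult_l lin_mult_r antipode_lin lin_id) auto
  finally show ?thesis .
qed

text \<open>
  All actions below are of this form: \<open>h\<close> acts on the Hopf subalgebra \<open>N\<close> of \<open>A\<close> as the adjoint
  action of \<open>s h\<close>, where \<open>s\<close> preserves the bialgebra structure.
\<close>

lemma ad_module_bialgebra:
  fixes A :: "('k, 'u) hopf" and H :: "('k, 'v) hopf"
  assumes A: "hopf A" and H: "hopf H" and sub: "subcoalg A N r" and K: "hopf (sub_hopf R A N)"
    and s: "coalg_map H A s" and s1: "s \<one>\<^bsub>H\<^esub> = \<one>\<^bsub>A\<^esub>"
    and sm: "\<And>x y. x \<in> carrier H \<Longrightarrow> y \<in> carrier H \<Longrightarrow> s (x \<otimes>\<^bsub>H\<^esub> y) = s x \<otimes>\<^bsub>A\<^esub> s y"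
    and act: "\<And>h v. h \<in> carrier H \<Longrightarrow> v \<in> N \<Longrightarrow> act h v = ad A (s h) v"
    and N: "\<And>h v. h \<in> carrier H \<Longrightarrow> v \<in> N \<Longrightarrow> ad A (s h) v \<in> N"
  shows "module_bialgebra R H (sub_hopf R A N) act"
proof -
  let ?K = "sub_hopf R A N" let ?TK = "tensor R ?K ?K" let ?p = "pure_tensor R ?K ?K"
  note r = sub_r[OF A sub]
  note s' = coalg_mapD[OF s]
  have M [simp]: "cocoalgebra H" "module R H" "assoc_algebra R H" "cocoalgebra A" "module R A"
    "assoc_algebra R A" "cocoalgebra ?K" "module R ?K" "assoc_algebra R ?K"
    using A H K by auto
  note [simp] = r(2,3,4) s'(2)
  have rK: "lin A ?K r" by (rule r_lin[OF A sub])
  have toK: "lin M ?K f" if "lin M A f" "\<And>x. x \<in> carrier M \<Longrightarrow> f x \<in> N"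
    for M :: "('k, 'w, 'm3) module_scheme" and f
    using that by (rule lin_to_sub[OF A sub])
  have fromK: "lin ?K V f" if "lin A V f" for V :: "('k, 'w, 'm3) module_scheme" and f
    using that by (rule lin_from_sub[OF A sub])
  note al = lin_comp[OF s'(1) bil_l[OF ad_bil[OF A]]] bil_r[OF ad_bil[OF A]]
  have bil0: "bil H ?K ?K (\<lambda>h v. ad A (s h) v)"
    using N by (intro bilI toK fromK al) auto
  have bil: "bil H ?K ?K act"
  proof (rule bilI)
    show "lin ?K ?K (\<lambda>v. act h v)" if "h \<in> carrier H" for h
      by (rule lin_cong[OF bil_r[OF bil0 that]]) (use act that in auto)
    show "lin H ?K (\<lambda>h. act h v)" if "v \<in> carrier ?K" for v
      by (rule lin_cong[OF bil_l[OF bil0 that]]) (use act that in auto)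
  qed
  have cm: "comult ?K (act h v) = sweedler H ?TK h (\<lambda>x1 x2. sweedler ?K ?TK v (\<lambda>v1 v2.
      ?p (act x1 v1) (act x2 v2)))" if h: "h \<in> carrier H" and v: "v \<in> N" for h v
  proof -
    note l0 = lin_comp[OF bil_l[OF ad_bil[OF A]] rK] lin_comp[OF bil_r[OF ad_bil[OF A]] rK]
    have ls: "lin H ?K (\<lambda>x. r (ad A (s x) w))" if "w \<in> carrier A" for w
      using lin_comp[OF s'(1) l0(1)] that .
    have lr: "lin A ?K (\<lambda>w. r (ad A x (r w)))" if "x \<in> carrier A" for x
      using lin_comp[OF r(1) l0(2)] that .
    let ?F = "\<lambda>x1 x2 v1 v2. ?p (r (ad A x1 v1)) (r (ad A x2 v2))"
    have "comult ?K (act h v) = sweedler A ?TK (ad A (s h) v) (\<lambda>a b. ?p (r a) (r b))"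
      using h v N by (simp add: act comult_sub[OF A sub])
    also have "\<dots> = tensor_lift ?TK (\<lambda>a b. ?p (r a) (r b)) (comult A (ad A (s h) v))"
      by (simp add: sweedler_def)
    also have "\<dots> = sweedler A ?TK (s h) (\<lambda>x1 x2. sweedler A ?TK v (\<lambda>v1 v2. ?F x1 x2 v1 v2))"
    proof -
      let ?g = "tensor_lift ?TK (\<lambda>a b. ?p (r a) (r b))"
      have b: "bil A A ?TK (\<lambda>a b. ?p (r a) (r b))" by (intro bilI lin_pure_l lin_pure_r rK) auto
      have g: "lin (tensor R A A) ?TK ?g" using b by (intro tensor_lift_lin) auto
      let ?q = "pure_tensor R A A"
      have "?g (comult A (ad A (s h) v)) = ?g (sweedler A (tensor R A A) (s h) (\<lambda>x1 x2.
          sweedler A (tensor R A A) v (\<lambda>v1 v2. ?q (ad A x1 v1) (ad A x2 v2))))"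
        using h v A by (simp add: comult_ad)
      also have "\<dots> = sweedler A ?TK (s h) (\<lambda>x1 x2.
          ?g (sweedler A (tensor R A A) v (\<lambda>v1 v2. ?q (ad A x1 v1) (ad A x2 v2))))"
        using h v A by (intro sw_map[OF _ _ _ g]) auto
      also have "\<dots> = sweedler A ?TK (s h) (\<lambda>x1 x2.
          sweedler A ?TK v (\<lambda>v1 v2. ?g (?q (ad A x1 v1) (ad A x2 v2))))"
        using h v A by (intro sw_cong sw_map[OF _ _ _ g]) auto
      also have "\<dots> = sweedler A ?TK (s h) (\<lambda>x1 x2. sweedler A ?TK v (\<lambda>v1 v2. ?F x1 x2 v1 v2))"
        using h v A by (intro sw_cong) (auto simp: tensor_lift_pure[OF _ _ _ b])
      finally show ?thesis .
    qed
    also have "\<dots> = sweedler H ?TK h (\<lambda>x1 x2. sweedler A ?TK v (\<lambda>v1 v2. ?F (s x1) (s x2) v1 v2))"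
      using h v A s by (intro sw_coalg_map bilI lin_sw_param lin_pure_l lin_pure_r l0) auto
    also have "\<dots> = sweedler H ?TK h (\<lambda>x1 x2. sweedler A ?TK v (\<lambda>v1 v2. ?F (s x1) (s x2) (r v1) (r v2)))"
      using h v A
      by (intro sw_cong sw_r[OF A sub, symmetric] bilI lin_pure_l lin_pure_r l0) auto
    also have "\<dots> = sweedler H ?TK h (\<lambda>x1 x2. sweedler A ?TK v (\<lambda>v1 v2.
        ?p (act x1 (r v1)) (act x2 (r v2))))"
      using h v A N by (intro sw_cong) (auto simp: act)
    also have "\<dots> = sweedler H ?TK h (\<lambda>x1 x2. sweedler ?K ?TK v (\<lambda>v1 v2. ?p (act x1 v1) (act x2 v2)))"
      using h v A bil_closed[OF bil]
      by (intro sw_cong sw_sub_r[OF A sub, symmetric] bilI lin_pure_l lin_pure_r bil_r[OF bil]) auto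
    finally show ?thesis .
  qed
  have m: "act h (u \<otimes>\<^bsub>A\<^esub> v) = sweedler H A h (\<lambda>x1 x2. act x1 u \<otimes>\<^bsub>A\<^esub> act x2 v)"
    if h: "h \<in> carrier H" and u: "u \<in> N" and v: "v \<in> N" for h u v
  proof -
    have "u \<otimes>\<^bsub>A\<^esub> v \<in> N" using alg_simps(1)[OF M(9)] u v by simp
    then have "act h (u \<otimes>\<^bsub>A\<^esub> v) = sweedler A A (s h) (\<lambda>x1 x2. ad A x1 u \<otimes>\<^bsub>A\<^esub> ad A x2 v)"
      using h u v A by (simp add: act ad_mult)
    also have "\<dots> = sweedler H A h (\<lambda>x1 x2. ad A (s x1) u \<otimes>\<^bsub>A\<^esub> ad A (s x2) v)"
      using h u v A s by (intro sw_coalg_map bilI lin_mult_l lin_mult_r bil_l[OF ad_bil]) auto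
    also have "\<dots> = sweedler H A h (\<lambda>x1 x2. act x1 u \<otimes>\<^bsub>A\<^esub> act x2 v)"
      using h u v by (intro sw_cong) (auto simp: act)
    finally show ?thesis .
  qed
  have one: "\<one>\<^bsub>A\<^esub> \<in> N" using alg_simps(2)[OF M(9)] by simp
  interpret H: hopf_algebra R H using H by (simp add: cocomm_hopf_algebra_def)
  interpret K: bialgebra R ?K by (rule hopf_bialgebra[OF K])
  show ?thesis
  proof
    fix h v assume h: "h \<in> carrier H" and v: "v \<in> carrier ?K"
    show "counit ?K (act h v) = counit H h \<otimes> counit ?K v"
      using h v A s' by (simp add: act counit_ad)
  next
    fix x y v assume "x \<in> carrier H" "y \<in> carrier H" "v \<in> carrier ?K"
    then show "act (x \<otimes>\<^bsub>H\<^esub> y) v = act x (act y v)"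
      using A N by (simp add: act sm ad_mult_l)
  qed (use bil cm m one A s1 s' in \<open>auto simp: act ad_one_l ad_one sw_sub_hopf_target\<close>)
qed

end


section \<open>The Moore complex of a simplicial Hopf algebra\<close>

locale simplicial_hopf_field = ground_field R + simplicial_hopf R X
  for R :: "('k, 'r) ring_scheme" (structure) and X :: "('k, 'a) simp_hopf"
begin

(* the dimensions are written as numerals *)
declare One_nat_def [simp del]

lemma level_facts [simp]: "hopf (level X n)" "cocoalgebra (level X n)" "module R (level X n)"
  "assoc_algebra R (level X n)"
  using level_hopf[of n] by simp_all

lemma moore_carrier_Suc: "moore_carrier R X (Suc m) = {x \<in> carrier (level X (Suc m)).
    \<forall>i < Suc m. x \<in> HKer R (level X (Suc m)) (level X m) (face X (Suc m) i)}"
  by (simp add: moore_carrier_def)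

lemma moore_subcoalg: "\<exists>r. subcoalg (level X (Suc m)) (moore_carrier R X (Suc m)) r"
  by (rule common_HKer_subcoalg[OF level_hopf level_hopf _ moore_carrier_Suc])
    (simp add: face_hopf_map)

definition retr :: "nat \<Rightarrow> 'a \<Rightarrow> 'a"
  where "retr n = (SOME r. subcoalg (level X n) (moore_carrier R X n) r)"

lemma retr: "subcoalg (level X (Suc m)) (moore_carrier R X (Suc m)) (retr (Suc m))"
  unfolding retr_def by (rule someI_ex[OF moore_subcoalg])

lemma moore_hopf: "hopf (moore R X (Suc m))"
  unfolding moore_def
proof (rule sub_hopf_hopf[OF level_hopf retr])
  have d: "face X (Suc m) i \<in> hopf_maps R (level X (Suc m)) (level X m)" if "i < Suc m" for i
    using that by (simp add: face_hopf_map)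
  show "\<one>\<^bsub>level X (Suc m)\<^esub> \<in> moore_carrier R X (Suc m)"
    using HKer_one[OF _ _ d] by (simp add: moore_carrier_Suc)
  show "x \<otimes>\<^bsub>level X (Suc m)\<^esub> y \<in> moore_carrier R X (Suc m)"
    if "x \<in> moore_carrier R X (Suc m)" "y \<in> moore_carrier R X (Suc m)" for x y
    using that HKer_mult[OF _ _ d] by (simp add: moore_carrier_Suc)
  show "antipode (level X (Suc m)) x \<in> moore_carrier R X (Suc m)"
    if "x \<in> moore_carrier R X (Suc m)" for x
    using that HKer_antipode[OF _ _ d] by (simp add: moore_carrier_Suc)
qed

lemma moore_carrier_simp [simp]: "carrier (moore R X n) = moore_carrier R X n"
  by (simp add: moore_def)

lemma moore_sub_carrier: "x \<in> moore_carrier R X n \<Longrightarrow> x \<in> carrier (level X n)"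
  by (simp add: moore_carrier_def)

lemma moore_val:
  assumes "x \<in> moore_carrier R X (Suc m)" "i \<le> m"
  shows "face X (Suc m) i x = counit (level X (Suc m)) x \<odot>\<^bsub>level X m\<^esub> \<one>\<^bsub>level X m\<^esub>"
  using assms by (intro HKer_val[OF level_hopf level_hopf face_hopf_map]) (auto simp: moore_carrier_Suc)

text \<open>With the previous lemma, generalized elements of \<open>NH\<^sub>n\<close> are the generalized elements of \<open>H\<^sub>n\<close> that
  the faces \<open>d\<^sub>0, \<dots>, d\<^sub>n\<^sub>-\<^sub>1\<close> map to the trivial one.\<close>

lemma moore_coalg_map:
  assumes "cocoalgebra C" "coalg_map C (level X (Suc m)) f" "c \<in> carrier C"
    "\<And>c i. c \<in> carrier C \<Longrightarrow> i \<le> m \<Longrightarrow>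
      face X (Suc m) i (f c) = counit C c \<odot>\<^bsub>level X m\<^esub> \<one>\<^bsub>level X m\<^esub>"
  shows "f c \<in> moore_carrier R X (Suc m)"
  using assms coalg_mapD(2)[OF assms(2)]
  by (auto simp: moore_carrier_Suc intro!: HKer_coalg_map[OF level_hopf level_hopf face_hopf_map assms(1,2)])

lemma moore_incl: "coalg_map (moore R X (Suc m)) (level X (Suc m)) (\<lambda>x. x)"
  unfolding moore_def by (rule sub_incl[OF level_hopf retr])

lemma moore_into:
  "cocoalgebra C \<Longrightarrow> coalg_map C (level X (Suc m)) f \<Longrightarrow>
    (\<And>c. c \<in> carrier C \<Longrightarrow> f c \<in> moore_carrier R X (Suc m)) \<Longrightarrow> coalg_map C (moore R X (Suc m)) f"
  unfolding moore_def by (rule coalg_map_into_sub[OF level_hopf retr])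

lemma sw_moore:
  "module R V \<Longrightarrow> bil (level X (Suc m)) (level X (Suc m)) V F \<Longrightarrow> x \<in> moore_carrier R X (Suc m) \<Longrightarrow>
    sweedler (moore R X (Suc m)) V x F = sweedler (level X (Suc m)) V x F"
  unfolding moore_def by (rule sw_sub[OF level_hopf retr])

lemma sw_moore_target: "sweedler C (moore R X n) c F = sweedler C (level X n) c F"
  unfolding moore_def by (rule sw_sub_hopf_target)

lemma lin_to_moore:
  "lin M (level X (Suc m)) f \<Longrightarrow> (\<And>x. x \<in> carrier M \<Longrightarrow> f x \<in> moore_carrier R X (Suc m)) \<Longrightarrow>
    lin M (moore R X (Suc m)) f"
  unfolding moore_def by (rule lin_to_sub[OF level_hopf retr])

lemma moore_ops [simp]:
  "mult (moore R X n) = mult (level X n)" "one (moore R X n) = one (level X n)"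
  "add (moore R X n) = add (level X n)" "zero (moore R X n) = zero (level X n)"
  "smult (moore R X n) = smult (level X n)"
  "counit (moore R X n) = counit (level X n)" "antipode (moore R X n) = antipode (level X n)"
  by (simp_all add: moore_def)

lemma ad_moore:
  assumes "x \<in> moore_carrier R X (Suc m)" "y \<in> carrier (level X (Suc m))"
  shows "ad (moore R X (Suc m)) x y = ad (level X (Suc m)) x y"
  unfolding ad_def sw_moore_target moore_ops using assms
  by (intro sw_moore bilI lin_mult_l lin_mult_r antipode_lin lin_id)
    (auto simp: moore_sub_carrier)

end

text \<open>
  Generalized elements \<open>C \<rightarrow> H\<^sub>n\<close> form a simplicial group. If the Moore complex of \<open>X\<close> has
  length at most two, its third Moore group is trivial: an element of it takes its values in
  \<open>NH\<^sub>3 = \<kappa> 1\<close>, and the counit determines them.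
\<close>

locale simplicial_hopf2 = simplicial_hopf_field R X
  for R :: "('k, 'r) ring_scheme" (structure) and X :: "('k, 'a) simp_hopf" +
  assumes len: "moore_length_le R 2 X"

locale generalized_elements = simplicial_hopf2 R X
  for R :: "('k, 'r) ring_scheme" (structure) and X :: "('k, 'a) simp_hopf" +
  fixes C :: "('k, 'c, 'm) hopf_scheme"
  assumes C: "cocoalgebra C"
begin

lemma moore3_trivial:
  assumes w: "w \<in> carrier (cgroup C (level X 3))"
    and 0: "\<And>i. i \<le> 2 \<Longrightarrow> compose (carrier C) (face X 3 i) w = \<one>\<^bsub>cgroup C (level X 2)\<^esub>"
  shows "w = \<one>\<^bsub>cgroup C (level X 3)\<^esub>"
proof (rule extensionalityI)
  show "w \<in> extensional (carrier C)" using w by (simp add: cgroup_carrier)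
  show "\<one>\<^bsub>cgroup C (level X 3)\<^esub> \<in> extensional (carrier C)" by (simp add: cgroup_one)
  fix c assume c: "c \<in> carrier C"
  have w': "coalg_map C (level X 3) w" using w by (simp add: cgroup_carrier)
  have S: "Suc 2 = 3" by simp
  have "face X 3 i (w c) = counit C c \<odot>\<^bsub>level X 2\<^esub> \<one>\<^bsub>level X 2\<^esub>"
    if "i \<le> 2" "c \<in> carrier C" for i c
    using fun_cong[OF 0[OF that(1)], of c] that(2) by (simp add: compose_eq cgroup_one)
  then have "w c \<in> moore_carrier R X 3"
    using moore_coalg_map[OF C, of 2 w c] w' c by (simp add: S)
  moreover have "moore_carrier R X 3 = (\<lambda>c. c \<odot>\<^bsub>level X 3\<^esub> \<one>\<^bsub>level X 3\<^esub>) ` carrier R"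
    using len by (simp add: moore_length_le_def)
  ultimately obtain e where e: "e \<in> carrier R" "w c = e \<odot>\<^bsub>level X 3\<^esub> \<one>\<^bsub>level X 3\<^esub>" by blast
  have "counit C c = counit (level X 3) (w c)" using coalg_mapD(3)[OF w' c] by simp
  also have "\<dots> = e" using e by (simp add: lin_smult[OF counit_lin])
  finally show "w c = \<one>\<^bsub>cgroup C (level X 3)\<^esub> c" using c e by (simp add: cgroup_one)
qed

sublocale G: simplicial_group3 "\<lambda>n. cgroup C (level X n)"
  "\<lambda>n i. compose (carrier C) (face X n i)" "\<lambda>n j. compose (carrier C) (degen X n j)"
proof (rule simplicial_group3.intro)
  have cl: "f c \<in> carrier (level X n)" if "f \<in> carrier (cgroup C (level X n))" "c \<in> carrier C" for f c n
    using that coalg_mapD(2) by (auto simp: cgroup_carrier)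
  have ex: "f = g" if "f \<in> extensional (carrier C)" "g \<in> extensional (carrier C)"
    "\<And>c. c \<in> carrier C \<Longrightarrow> f c = g c" for f g :: "'c \<Rightarrow> 'a"
    using that by (rule extensionalityI)
  show "group (cgroup C (level X n))" for n by (rule cgroup_group[OF C level_hopf])
  show "compose (carrier C) (face X (Suc n) i) \<in> hom (cgroup C (level X (Suc n))) (cgroup C (level X n))"
    if "i \<le> Suc n" for i n
    using that by (intro compose_hom[OF C level_hopf level_hopf] face_hopf_map)
  show "compose (carrier C) (degen X n j) \<in> hom (cgroup C (level X n)) (cgroup C (level X (Suc n)))"
    if "j \<le> n" for j n
    using that by (intro compose_hom[OF C level_hopf level_hopf] degen_hopf_map)
  show "w = \<one>\<^bsub>cgroup C (level X 3)\<^esub>"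
    if "w \<in> carrier (cgroup C (level X 3))"
      "compose (carrier C) (face X 3 0) w = \<one>\<^bsub>cgroup C (level X 2)\<^esub>"
      "compose (carrier C) (face X 3 1) w = \<one>\<^bsub>cgroup C (level X 2)\<^esub>"
      "compose (carrier C) (face X 3 2) w = \<one>\<^bsub>cgroup C (level X 2)\<^esub>" for w
  proof (rule moore3_trivial[OF that(1)])
    fix i :: nat assume "i \<le> 2"
    then consider "i = 0" | "i = 1" | "i = 2" by linarith
    then show "compose (carrier C) (face X 3 i) w = \<one>\<^bsub>cgroup C (level X 2)\<^esub>"
      using that by cases simp_all
  qed
  fix n :: nat
  {
    fix i j and x :: "'c \<Rightarrow> 'a"
    assume "i \<le> j" "j \<le> Suc n" "x \<in> carrier (cgroup C (level X (Suc (Suc n))))"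
    then show "compose (carrier C) (face X (Suc n) i) (compose (carrier C) (face X (Suc (Suc n)) (Suc j)) x) =
        compose (carrier C) (face X (Suc n) j) (compose (carrier C) (face X (Suc (Suc n)) i) x)"
      by (intro ex) (simp_all add: compose_eq face_face cl)
  next
    fix i j and x :: "'c \<Rightarrow> 'a"
    assume "i \<le> j" "j \<le> n" "x \<in> carrier (cgroup C (level X n))"
    then show "compose (carrier C) (degen X (Suc n) i) (compose (carrier C) (degen X n j) x) =
        compose (carrier C) (degen X (Suc n) (Suc j)) (compose (carrier C) (degen X n i) x)"
      by (intro ex) (simp_all add: compose_eq degen_degen cl)
  next
    fix i j and x :: "'c \<Rightarrow> 'a"
    assume "i \<le> j" "j \<le> n" "x \<in> carrier (cgroup C (level X (Suc n)))"
    then show "compose (carrier C) (face X (Suc (Suc n)) i) (compose (carrier C) (degen X (Suc n) (Suc j)) x) =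
        compose (carrier C) (degen X n j) (compose (carrier C) (face X (Suc n) i) x)"
      by (intro ex) (simp_all add: compose_eq face_degen_less cl)
  next
    fix j and x :: "'c \<Rightarrow> 'a"
    assume "j \<le> n" "x \<in> carrier (cgroup C (level X n))"
    then show "compose (carrier C) (face X (Suc n) j) (compose (carrier C) (degen X n j) x) = x"
      by (intro ex) (simp_all add: compose_eq face_degen_same cl cgroup_carrier)
  next
    fix j and x :: "'c \<Rightarrow> 'a"
    assume "j \<le> n" "x \<in> carrier (cgroup C (level X n))"
    then show "compose (carrier C) (face X (Suc n) (Suc j)) (compose (carrier C) (degen X n j) x) = x"
      by (intro ex) (simp_all add: compose_eq face_degen_Suc cl cgroup_carrier)
  next
    fix i j and x :: "'c \<Rightarrow> 'a"
    assume "j < i" "i \<le> Suc n" "x \<in> carrier (cgroup C (level X (Suc n)))"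
    then show "compose (carrier C) (face X (Suc (Suc n)) (Suc i)) (compose (carrier C) (degen X (Suc n) j) x) =
        compose (carrier C) (degen X n j) (compose (carrier C) (face X (Suc n) i) x)"
      by (intro ex) (simp_all add: compose_eq face_degen_greater cl)
  }
qed

end

context simplicial_hopf_field
begin

lemma low_maps:
  "degen X 0 0 \<in> hopf_maps R (level X 0) (level X 1)"
  "degen X 1 0 \<in> hopf_maps R (level X 1) (level X 2)"
  "degen X 1 1 \<in> hopf_maps R (level X 1) (level X 2)"
  "face X 1 0 \<in> hopf_maps R (level X 1) (level X 0)"
  "face X 1 1 \<in> hopf_maps R (level X 1) (level X 0)"
  "face X 2 0 \<in> hopf_maps R (level X 2) (level X 1)"
  "face X 2 1 \<in> hopf_maps R (level X 2) (level X 1)"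
  "face X 2 2 \<in> hopf_maps R (level X 2) (level X 1)"
  using degen_hopf_map[of 0 0] degen_hopf_map[of 0 1] degen_hopf_map[of 1 1]
    face_hopf_map[of 0 0] face_hopf_map[of 1 0]
    face_hopf_map[of 0 1] face_hopf_map[of 1 1] face_hopf_map[of 2 1]
  by (simp_all add: eval_nat_numeral One_nat_def)

lemmas low_coalg_map = low_maps[THEN hopf_mapD(1)]
lemmas low_lin = low_maps[THEN hopf_mapD(2)]

lemmas low_closed [simp] = low_maps[THEN hopf_mapD(4)]

definition peiffer :: "'a \<Rightarrow> 'a \<Rightarrow> 'a"
  where "peiffer = (\<lambda>x y.
    sweedler (level X 1) (level X 2) x (\<lambda>x1 x2. sweedler (level X 1) (level X 2) y (\<lambda>y1 y2.
      ad (level X 2) (degen X 1 1 x1) (degen X 1 1 y1) \<otimes>\<^bsub>level X 2\<^esub>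
      antipode (level X 2) (ad (level X 2) (degen X 1 0 x2) (degen X 1 1 y2)))))"

lemma ad_degen_bil:
  "bil (level X 1) (level X 1) (level X 2) (\<lambda>x y. ad (level X 2) (degen X 1 1 x) (degen X 1 1 y))"
  "bil (level X 1) (level X 1) (level X 2) (\<lambda>x y. ad (level X 2) (degen X 1 0 x) (degen X 1 1 y))"
  by (intro bilI lin_comp[OF low_lin(2) bil_l[OF ad_bil]] lin_comp[OF low_lin(3) bil_l[OF ad_bil]]
      lin_comp[OF low_lin(3) bil_r[OF ad_bil]]; simp)+

lemma peiffer_bil: "bil (level X 1) (level X 1) (level X 2) peiffer"
  unfolding peiffer_def
  by (intro bilI lin_sw lin_sw_param lin_id lin_mult_l lin_mult_r lin_antipode
      lin_comp[OF low_lin(2) bil_l[OF ad_bil]] lin_comp[OF low_lin(3) bil_l[OF ad_bil]]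
      lin_comp[OF low_lin(3) bil_r[OF ad_bil]]; simp)

lemma peiffer_closed [simp]:
  "x \<in> carrier (level X 1) \<Longrightarrow> y \<in> carrier (level X 1) \<Longrightarrow> peiffer x y \<in> carrier (level X 2)"
  by (rule bil_closed[OF peiffer_bil])

end

context generalized_elements
begin

text \<open>
  The lemmas called \<open>ev\<close> evaluate the operations of the simplicial group of generalized elements at
  an element of \<open>C\<close>: products, conjugates and Peiffer liftings become Sweedler sums of the operations
  of the Hopf algebras.
\<close>

lemma elemD: "f \<in> carrier (cgroup C (level X n)) \<Longrightarrow> coalg_map C (level X n) f"
  "f \<in> carrier (cgroup C (level X n)) \<Longrightarrow> f \<in> extensional (carrier C)"
  "f \<in> carrier (cgroup C (level X n)) \<Longrightarrow> c \<in> carrier C \<Longrightarrow> f c \<in> carrier (level X n)"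
  using coalg_mapD(2) by (auto simp: cgroup_carrier)

lemma ev_mult: "c \<in> carrier C \<Longrightarrow> (f \<otimes>\<^bsub>cgroup C (level X n)\<^esub> g) c =
    sweedler C (level X n) c (\<lambda>a b. f a \<otimes>\<^bsub>level X n\<^esub> g b)"
  by (simp add: cgroup_mult conv_def)

lemma ev_inv: "f \<in> carrier (cgroup C (level X n)) \<Longrightarrow> c \<in> carrier C \<Longrightarrow>
    (inv\<^bsub>cgroup C (level X n)\<^esub> f) c = antipode (level X n) (f c)"
  by (simp add: cgroup_inv[OF C])

lemma ev_conj1: "f \<in> carrier (cgroup C (level X 1)) \<Longrightarrow> g \<in> carrier (cgroup C (level X 1)) \<Longrightarrow>
    c \<in> carrier C \<Longrightarrow> G.conj1 f g c = sweedler C (level X 1) c (\<lambda>a b. ad (level X 1) (f a) (g b))"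
  by (simp add: G.conj1_def conv_ad[OF C level_hopf, symmetric] conv_def)

lemma ev_conj2: "f \<in> carrier (cgroup C (level X 2)) \<Longrightarrow> g \<in> carrier (cgroup C (level X 2)) \<Longrightarrow>
    c \<in> carrier C \<Longrightarrow> G.conj2 f g c = sweedler C (level X 2) c (\<lambda>a b. ad (level X 2) (f a) (g b))"
  by (simp add: G.conj2_def conv_ad[OF C level_hopf, symmetric] conv_def)

lemma ev_lift:
  assumes f: "f \<in> carrier (cgroup C (level X 1))" and g: "g \<in> carrier (cgroup C (level X 1))"
    and c: "c \<in> carrier C"
  shows "G.lift f g c = sweedler C (level X 2) c (\<lambda>a b. peiffer (f a) (g b))"
proof -
  let ?A1 = "level X 1" and ?A2 = "level X 2"
  let ?s1 = "compose (carrier C) (degen X 1 1)" and ?s0 = "compose (carrier C) (degen X 1 0)"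
  let ?o1 = "\<lambda>x y. ad ?A2 (degen X 1 1 x) (degen X 1 1 y)"
  let ?o2 = "\<lambda>x y. antipode ?A2 (ad ?A2 (degen X 1 0 x) (degen X 1 1 y))"
  have b2: "bil ?A1 ?A1 ?A2 ?o2"
    using ad_degen_bil(2) by (intro bilI lin_antipode) (auto intro: bil_l bil_r)
  have s: "?s1 f \<in> carrier (cgroup C ?A2)" "?s1 g \<in> carrier (cgroup C ?A2)" "?s0 f \<in> carrier (cgroup C ?A2)"
    using f g by simp_all
  have 1: "conv C ?A2 ?o1 f g = G.conj2 (?s1 f) (?s1 g)"
    unfolding G.conj2_def conv_ad[OF C level_hopf s(1,2), symmetric] conv_def
    by (intro restrict_ext sw_cong[OF C]) (simp_all add: compose_eq)
  have 2: "conv C ?A2 ?o2 f g = inv\<^bsub>cgroup C ?A2\<^esub> (G.conj2 (?s0 f) (?s1 g))"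
  proof (rule extensionalityI[of _ "carrier C"])
    show "inv\<^bsub>cgroup C ?A2\<^esub> (G.conj2 (?s0 f) (?s1 g)) \<in> extensional (carrier C)"
      using s by (intro elemD(2)[of _ 2]) simp
    fix c assume c: "c \<in> carrier C"
    have "(inv\<^bsub>cgroup C ?A2\<^esub> (G.conj2 (?s0 f) (?s1 g))) c =
        antipode ?A2 (sweedler C ?A2 c (\<lambda>a b. ad ?A2 (?s0 f a) (?s1 g b)))"
      using s c by (simp add: ev_inv ev_conj2)
    also have "\<dots> = sweedler C ?A2 c (\<lambda>a b. antipode ?A2 (ad ?A2 (?s0 f a) (?s1 g b)))"
      using C c s elemD(3) by (intro sw_map antipode_lin) auto
    also have "\<dots> = conv C ?A2 ?o2 f g c"
      using c unfolding conv_def by (simp, intro sw_cong[OF C]) (simp_all add: compose_eq)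
    finally show "conv C ?A2 ?o2 f g c = (inv\<^bsub>cgroup C ?A2\<^esub> (G.conj2 (?s0 f) (?s1 g))) c" by simp
  qed simp
  have "conv C ?A2 peiffer f g = conv C ?A2 (\<otimes>\<^bsub>?A2\<^esub>) (conv C ?A2 ?o1 f g) (conv C ?A2 ?o2 f g)"
    using C ad_degen_bil(1) b2 elemD(1)[OF f] elemD(1)[OF g]
    by (intro conv_prod[of C ?A1 ?A1 ?A2]) (auto simp: peiffer_def)
  also have "\<dots> = G.lift f g"
    unfolding 1 2 G.lift_def cgroup_mult ..
  finally have "G.lift f g = conv C ?A2 peiffer f g" by simp
  then show ?thesis using c by (simp add: conv_def)
qed

lemma elem_N1:
  assumes f: "coalg_map C (level X 1) f" and N: "\<And>c. c \<in> carrier C \<Longrightarrow> f c \<in> moore_carrier R X 1"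
  shows "restrict f (carrier C) \<in> G.N1"
proof -
  have "compose (carrier C) (face X 1 0) (restrict f (carrier C)) = \<one>\<^bsub>cgroup C (level X 0)\<^esub>"
    unfolding cgroup_one compose_def
    using moore_val[of _ 0 0] N coalg_mapD(3)[OF f] by (intro restrict_ext) (simp add: One_nat_def)
  then show ?thesis using res_cgroup[OF C f] by (simp add: G.N1_def)
qed

lemma elem_N2:
  assumes f: "coalg_map C (level X 2) f" and N: "\<And>c. c \<in> carrier C \<Longrightarrow> f c \<in> moore_carrier R X 2"
  shows "restrict f (carrier C) \<in> G.N2"
proof -
  have S: "Suc 1 = 2" by simp
  have "compose (carrier C) (face X 2 i) (restrict f (carrier C)) = \<one>\<^bsub>cgroup C (level X 1)\<^esub>" if "i \<le> 1" for i
    unfolding cgroup_one compose_def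
    using moore_val[of _ 1 i] N coalg_mapD(3)[OF f] that by (intro restrict_ext) (simp add: S)
  then show ?thesis using res_cgroup[OF C f] by (simp add: G.N2_def)
qed

lemma N2_elem:
  assumes w: "w \<in> G.N2" and c: "c \<in> carrier C"
  shows "w c \<in> moore_carrier R X 2"
proof -
  have S: "Suc 1 = 2" by simp
  have w': "coalg_map C (level X 2) w" using G.N2D(1)[OF w] by (rule elemD(1))
  have "face X 2 i (w c) = counit C c \<odot>\<^bsub>level X 1\<^esub> \<one>\<^bsub>level X 1\<^esub>" if "c \<in> carrier C" "i \<le> 1" for c i
  proof -
    have "i = 0 \<or> i = 1" using that by linarith
    then have "compose (carrier C) (face X 2 i) w = \<one>\<^bsub>cgroup C (level X 1)\<^esub>"
      using G.N2D(2,3)[OF w] by auto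
    from fun_cong[OF this, of c] show ?thesis using that by (simp add: compose_eq cgroup_one)
  qed
  then show ?thesis using moore_coalg_map[OF C, of 1 w c] w' c by (simp add: S)
qed

lemma N1_elem:
  assumes w: "w \<in> G.N1" and c: "c \<in> carrier C"
  shows "w c \<in> moore_carrier R X 1"
proof -
  have S: "Suc 0 = 1" by simp
  have w': "coalg_map C (level X 1) w" using G.N1D(1)[OF w] by (rule elemD(1))
  have "face X 1 0 (w c) = counit C c \<odot>\<^bsub>level X 0\<^esub> \<one>\<^bsub>level X 0\<^esub>" if "c \<in> carrier C" for c
    using fun_cong[OF G.N1D(2)[OF w], of c] that by (simp add: compose_eq cgroup_one)
  then show ?thesis using moore_coalg_map[OF C, of 0 w c] w' c by (simp add: S)
qed

end


context ground_field
begin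

context
  fixes A :: "('k, 'u, 'm) hopf_scheme" and B :: "('k, 'v, 'n) hopf_scheme"
  assumes A: "cocoalgebra A" and B: "cocoalgebra B"
begin

lemma sw_any_proj2:
  assumes V: "module R V" and F: "bil (tensor_coalg A B) B V F"
    and a: "a \<in> carrier A" and b: "b \<in> carrier B"
  shows "sweedler (tensor_coalg A B) V (pure_tensor R A B a b) (\<lambda>s t. F s (proj2 A B t)) =
    sweedler B V b (\<lambda>b1 b2. F (pure_tensor R A B a b1) b2)"
proof -
  let ?C = "tensor_coalg A B"
  have C: "cocoalgebra ?C" by (rule tensor_coalg_cocoalgebra[OF A B])
  have p: "proj2 A B t \<in> carrier B" if "t \<in> carrier ?C" for t
    using lin_closed[OF proj_lin(2)[OF A B]] that by simp
  have "bil ?C ?C V (\<lambda>s t. F t (proj2 A B s))"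
    using p by (intro bilI bil_l[OF F] lin_comp[OF proj_lin(2)[OF A B] bil_r[OF F]]) auto
  from cocomm[OF C V this, of "pure_tensor R A B a b"]
  have "sweedler ?C V (pure_tensor R A B a b) (\<lambda>s t. F s (proj2 A B t)) =
      sweedler ?C V (pure_tensor R A B a b) (\<lambda>s t. F t (proj2 A B s))"
    using a b by simp
  also have "\<dots> = sweedler B V b (\<lambda>b1 b2. F (pure_tensor R A B a b2) b1)"
    using V a b F by (intro sw_proj2_any[OF A B, where F = "\<lambda>b t. F t b"] bilI bil_l[OF F] bil_r[OF F]) auto
  also have "\<dots> = sweedler B V b (\<lambda>b1 b2. F (pure_tensor R A B a b1) b2)"
    using A B V a b F
    by (intro cocomm[of B V "\<lambda>b1 b2. F (pure_tensor R A B a b1) b2"] bilI bil_r[OF F]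
        lin_comp[OF lin_pure_r[OF _ _ lin_id] bil_l[OF F, unfolded lin_tensor_coalg]]) auto
  finally show ?thesis .
qed

text \<open>The functions \<open>f\<close> and \<open>g\<close> depend only on the first and on the second variable.\<close>

lemma sw_ev12:
  assumes V: "module R V" and F: "bil A B V (\<lambda>a b. op (\<phi> a) (\<psi> b))"
    and a: "a \<in> carrier A" and b: "b \<in> carrier B"
    and f: "\<And>t. t \<in> carrier (tensor_coalg A B) \<Longrightarrow> f t = \<phi> (proj1 A B t)"
    and g: "\<And>t. t \<in> carrier (tensor_coalg A B) \<Longrightarrow> g t = \<psi> (proj2 A B t)"
  shows "sweedler (tensor_coalg A B) V (pure_tensor R A B a b) (\<lambda>s t. op (f s) (g t)) = op (\<phi> a) (\<psi> b)"
  using sw_cong[OF tensor_coalg_cocoalgebra[OF A B], of "pure_tensor R A B a b" "\<lambda>s t. op (f s) (g t)"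
      "\<lambda>s t. op (\<phi> (proj1 A B s)) (\<psi> (proj2 A B t))" V] sw_proj12[OF A B V F a b] a b f g
  by simp

lemma sw_ev21:
  assumes V: "module R V" and F: "bil B A V (\<lambda>b a. op (\<psi> b) (\<phi> a))"
    and a: "a \<in> carrier A" and b: "b \<in> carrier B"
    and f: "\<And>t. t \<in> carrier (tensor_coalg A B) \<Longrightarrow> f t = \<psi> (proj2 A B t)"
    and g: "\<And>t. t \<in> carrier (tensor_coalg A B) \<Longrightarrow> g t = \<phi> (proj1 A B t)"
  shows "sweedler (tensor_coalg A B) V (pure_tensor R A B a b) (\<lambda>s t. op (f s) (g t)) = op (\<psi> b) (\<phi> a)"
  using sw_cong[OF tensor_coalg_cocoalgebra[OF A B], of "pure_tensor R A B a b" "\<lambda>s t. op (f s) (g t)"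
      "\<lambda>s t. op (\<psi> (proj2 A B s)) (\<phi> (proj1 A B t))" V] sw_proj21[OF A B V F a b] a b f g
  by simp

text \<open>Here the first variable occurs twice and the second one once.\<close>

lemma sw_proj_112:
  assumes V: "module R V" and F1: "\<And>b b'. b \<in> carrier A \<Longrightarrow> b' \<in> carrier B \<Longrightarrow> lin A V (\<lambda>x. F x b b')"
    and F2: "\<And>b b'. b \<in> carrier A \<Longrightarrow> b' \<in> carrier B \<Longrightarrow> lin A V (\<lambda>x. F b x b')"
    and F3: "\<And>b b'. b \<in> carrier A \<Longrightarrow> b' \<in> carrier A \<Longrightarrow> lin B V (\<lambda>x. F b b' x)"
    and a: "a \<in> carrier A" and b: "b \<in> carrier B"
  shows "sweedler (tensor_coalg A B) V (pure_tensor R A B a b) (\<lambda>q1 q.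
      sweedler (tensor_coalg A B) V q (\<lambda>q2 q3. F (proj1 A B q1) (proj1 A B q2) (proj2 A B q3))) =
    sweedler A V a (\<lambda>a1 a2. F a1 a2 b)"
proof -
  let ?C = "tensor_coalg A B"
  have C: "cocoalgebra ?C" by (rule tensor_coalg_cocoalgebra[OF A B])
  have p: "proj1 A B t \<in> carrier A" "proj2 A B t \<in> carrier B" if "t \<in> carrier ?C" for t
    using lin_closed[OF proj_lin(1)[OF A B]] lin_closed[OF proj_lin(2)[OF A B]] that by auto
  have M: "module R A" "module R B" using A B by auto
  have "sweedler ?C V (pure_tensor R A B a b) (\<lambda>q1 q.
      sweedler ?C V q (\<lambda>q2 q3. F (proj1 A B q1) (proj1 A B q2) (proj2 A B q3))) =
    sweedler ?C V (pure_tensor R A B a b) (\<lambda>q q3.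
      sweedler ?C V q (\<lambda>q1 q2. F (proj1 A B q1) (proj1 A B q2) (proj2 A B q3)))"
    using a b p
    by (intro coassoc[OF C V, symmetric] trilinearI lin_comp[OF proj_lin(1)[OF A B] F1]
        lin_comp[OF proj_lin(1)[OF A B] F2] lin_comp[OF proj_lin(2)[OF A B] F3]) auto
  also have "\<dots> = sweedler ?C V (pure_tensor R A B a b) (\<lambda>q q3.
      sweedler A V (proj1 A B q) (\<lambda>a1 a2. F a1 a2 (proj2 A B q3)))"
    using a b p
    by (intro sw_cong[OF C] sw_coalg_map[OF C M(1) V proj1_coalg_map[OF A B], symmetric] bilI F1 F2) auto
  also have "\<dots> = sweedler A V a (\<lambda>a1 a2. F a1 a2 b)"
    using A V a b F1 F2 F3
    by (intro sw_proj12[OF A B V, where F = "\<lambda>a b. sweedler A V a (\<lambda>a1 a2. F a1 a2 b)"]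
        bilI lin_sw lin_sw_param lin_id) auto
  finally show ?thesis .
qed

end

declare tensor_coalg_simps(1) [simp del] lin_tensor_coalg [simp del] bil_tensor_coalg [simp del]

lemma pure_in_coalg [simp]: "a \<in> carrier A \<Longrightarrow> b \<in> carrier B \<Longrightarrow>
    pure_tensor R A B a b \<in> carrier (tensor_coalg A B)"
  by (simp add: tensor_coalg_simps(1))

end

context simplicial_hopf_field
begin

lemma lin_ad_l: "hopf H \<Longrightarrow> lin M H f \<Longrightarrow> v \<in> carrier H \<Longrightarrow> lin M H (\<lambda>x. ad H (f x) v)"
  by (rule lin_comp[OF _ bil_l[OF ad_bil]])

lemma lin_ad_r: "hopf H \<Longrightarrow> lin M H f \<Longrightarrow> v \<in> carrier H \<Longrightarrow> lin M H (\<lambda>x. ad H v (f x))"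
  by (rule lin_comp[OF _ bil_r[OF ad_bil]])

lemma lin_peiffer_l:
  "lin M (level X 1) f \<Longrightarrow> v \<in> carrier (level X 1) \<Longrightarrow> lin M (level X 2) (\<lambda>x. peiffer (f x) v)"
  by (rule lin_comp[OF _ bil_l[OF peiffer_bil]])

lemma lin_peiffer_r:
  "lin M (level X 1) f \<Longrightarrow> v \<in> carrier (level X 1) \<Longrightarrow> lin M (level X 2) (\<lambda>x. peiffer v (f x))"
  by (rule lin_comp[OF _ bil_r[OF peiffer_bil]])

lemmas lin_low = low_lin[THEN lin_comp[rotated]]

abbreviation NH1 :: "('k, 'a) hopf" where "NH1 \<equiv> moore R X 1"
abbreviation NH2 :: "('k, 'a) hopf" where "NH2 \<equiv> moore R X 2"

lemma IK_facts [simp]: "hopf NH1" "hopf NH2" "cocoalgebra NH1" "cocoalgebra NH2" "module R NH1" "module R NH2"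
  using moore_hopf[of 0] moore_hopf[of 1] by (simp_all add: eval_nat_numeral One_nat_def)

lemmas incl1 = moore_incl[of 0, folded One_nat_def] and incl2 = moore_incl[of 1, unfolded Suc_1]

lemma I_lin: "lin M NH1 f \<Longrightarrow> lin M (level X 1) f"
  by (rule lin_comp[OF _ coalg_mapD(1)[OF incl1]])

lemma K_lin: "lin M NH2 f \<Longrightarrow> lin M (level X 2) f"
  by (rule lin_comp[OF _ coalg_mapD(1)[OF incl2]])

lemma I_id: "lin NH1 (level X 1) (\<lambda>x. x)" by (rule I_lin[OF lin_id])

lemma K_id: "lin NH2 (level X 2) (\<lambda>x. x)" by (rule K_lin[OF lin_id])

lemmas mlin = bilI trilinearI I_id K_id lin_id lin_sw lin_sw_param lin_mult_l lin_mult_r lin_ad_l lin_ad_r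
  lin_peiffer_l lin_peiffer_r lin_low lin_antipode

lemma I_coalg_map: "cocoalgebra C \<Longrightarrow> coalg_map C NH1 f \<Longrightarrow> coalg_map C (level X 1) f"
  by (rule coalg_map_comp[OF _ _ _ incl1]) auto

lemma K_coalg_map: "cocoalgebra C \<Longrightarrow> coalg_map C NH2 f \<Longrightarrow> coalg_map C (level X 2) f"
  by (rule coalg_map_comp[OF _ _ _ incl2]) auto

lemma I_carrier [simp]: "x \<in> moore_carrier R X 1 \<Longrightarrow> x \<in> carrier (level X 1)"
  and K_carrier [simp]: "x \<in> moore_carrier R X 2 \<Longrightarrow> x \<in> carrier (level X 2)"
  by (rule moore_sub_carrier; assumption)+

end

context generalized_elements
begin

lemma I_elem:
  assumes "coalg_map C NH1 f"
  shows "restrict f (carrier C) \<in> G.N1"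
  using coalg_mapD(2)[OF assms] by (intro elem_N1 I_coalg_map[OF C assms]) simp

lemma K_elem:
  assumes "coalg_map C NH2 f"
  shows "restrict f (carrier C) \<in> G.N2"
  using coalg_mapD(2)[OF assms] by (intro elem_N2 K_coalg_map[OF C assms]) simp

lemma ev_comp: "c \<in> carrier C \<Longrightarrow> compose (carrier C) d f c = d (f c)"
  by (simp add: compose_eq)

end

section \<open>The identities of a 2-crossed module\<close>

context simplicial_hopf2
begin

lemma elements_of: "cocoalgebra C \<Longrightarrow> generalized_elements R X C"
  by unfold_locales

text \<open>
  Each identity below is an identity of the simplicial groups of generalized elements for
  the projections of a tensor product \<open>C\<close> of coalgebras, evaluated at a pure tensor.
\<close>

lemma ad_in_I:
  assumes x: "x \<in> carrier (level X 1)" and y: "y \<in> moore_carrier R X 1"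
  shows "ad (level X 1) x y \<in> moore_carrier R X 1"
proof -
  let ?A = "level X 1" let ?C = "tensor_coalg ?A NH1"
  let ?p = "pure_tensor R ?A NH1 x y"
  have C: "cocoalgebra ?C" by (rule tensor_coalg_cocoalgebra) auto
  interpret E: generalized_elements R X ?C by (rule elements_of[OF C])
  define x' where "x' = restrict (proj1 ?A NH1) (carrier ?C)"
  define y' where "y' = restrict (proj2 ?A NH1) (carrier ?C)"
  have x': "x' \<in> carrier (cgroup ?C ?A)" unfolding x'_def by (rule res_cgroup[OF C proj1_coalg_map]) auto
  have y': "y' \<in> E.G.N1" unfolding y'_def by (rule E.I_elem[OF proj2_coalg_map]) auto
  have p: "?p \<in> carrier ?C" using x y by simp
  have "E.G.conj1 x' y' ?p = sweedler ?C ?A ?p (\<lambda>s t. ad ?A (proj1 ?A NH1 s) (proj2 ?A NH1 t))"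
    unfolding E.ev_conj1[OF x' E.G.N1D(1)[OF y'] p]
    by (rule sw_cong[OF C p]) (simp add: x'_def y'_def)
  also have "\<dots> = ad ?A x y"
    using x y by (intro sw_proj12) (auto intro!: mlin)
  finally show ?thesis using E.N1_elem[OF E.G.conj1_in_N1[OF x' y'] p] by simp
qed

lemma ad_in_K:
  assumes x: "x \<in> carrier (level X 2)" and y: "y \<in> moore_carrier R X 2"
  shows "ad (level X 2) x y \<in> moore_carrier R X 2"
proof -
  let ?A = "level X 2" let ?C = "tensor_coalg ?A NH2"
  let ?p = "pure_tensor R ?A NH2 x y"
  have C: "cocoalgebra ?C" by (rule tensor_coalg_cocoalgebra) auto
  interpret E: generalized_elements R X ?C by (rule elements_of[OF C])
  define x' where "x' = restrict (proj1 ?A NH2) (carrier ?C)"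
  define y' where "y' = restrict (proj2 ?A NH2) (carrier ?C)"
  have x': "x' \<in> carrier (cgroup ?C ?A)" unfolding x'_def by (rule res_cgroup[OF C proj1_coalg_map]) auto
  have y': "y' \<in> E.G.N2" unfolding y'_def by (rule E.K_elem[OF proj2_coalg_map]) auto
  have p: "?p \<in> carrier ?C" using x y by simp
  have "E.G.conj2 x' y' ?p = sweedler ?C ?A ?p (\<lambda>s t. ad ?A (proj1 ?A NH2 s) (proj2 ?A NH2 t))"
    unfolding E.ev_conj2[OF x' E.G.N2D(1)[OF y'] p]
    by (rule sw_cong[OF C p]) (simp add: x'_def y'_def)
  also have "\<dots> = ad ?A x y"
    using x y by (intro sw_proj12) (auto intro!: mlin)
  finally show ?thesis using E.N2_elem[OF E.G.conj2_in_N2[OF x' y'] p] by simp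
qed

context
begin

private abbreviation "CII \<equiv> tensor_coalg NH1 NH1"

private lemma CII: "cocoalgebra CII"
  by (rule tensor_coalg_cocoalgebra) auto

interpretation E: generalized_elements R X CII
  by (rule elements_of[OF CII])

private definition "xp' = restrict (proj1 NH1 NH1) (carrier CII)"
private definition "yp' = restrict (proj2 NH1 NH1) (carrier CII)"

private lemma xp': "xp' \<in> E.G.N1" unfolding xp'_def by (rule E.I_elem[OF proj1_coalg_map]) auto
private lemma yp': "yp' \<in> E.G.N1" unfolding yp'_def by (rule E.I_elem[OF proj2_coalg_map]) auto

private lemma lift_xy:
  assumes "x \<in> moore_carrier R X 1" "y \<in> moore_carrier R X 1"
  shows "E.G.lift xp' yp' (pure_tensor R NH1 NH1 x y) = peiffer x y"
proof -
  let ?p = "pure_tensor R NH1 NH1 x y"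
  have p: "?p \<in> carrier CII" using assms by simp
  have "E.G.lift xp' yp' ?p = sweedler CII (level X 2) ?p (\<lambda>s t. peiffer (proj1 NH1 NH1 s) (proj2 NH1 NH1 t))"
    unfolding E.ev_lift[OF E.G.N1D(1)[OF xp'] E.G.N1D(1)[OF yp'] p]
    by (rule sw_cong[OF CII p]) (simp add: xp'_def yp'_def)
  also have "\<dots> = peiffer x y" using assms by (intro sw_proj12) (auto intro!: mlin)
  finally show ?thesis .
qed

lemma peiffer_in_K:
  assumes "x \<in> moore_carrier R X 1" "y \<in> moore_carrier R X 1"
  shows "peiffer x y \<in> moore_carrier R X 2"
  using E.N2_elem[OF E.G.lift_in_N2[OF xp' yp'], of "pure_tensor R NH1 NH1 x y"] assms
  by (simp add: lift_xy)

lemma bd_peiffer: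
  assumes x: "x \<in> moore_carrier R X 1" and y: "y \<in> moore_carrier R X 1"
  shows "face X 2 2 (peiffer x y) = sweedler NH1 (level X 1) x (\<lambda>x1 x2. sweedler NH1 (level X 1) y
    (\<lambda>y1 y2. ad (level X 1) x1 y1 \<otimes>\<^bsub>level X 1\<^esub>
      ad (level X 1) (degen X 0 0 (face X 1 1 x2)) (antipode (level X 1) y2)))"
proof -
  let ?p = "pure_tensor R NH1 NH1" and ?A = "level X 1"
  let ?s = "compose (carrier CII) (degen X 0 0) (compose (carrier CII) (face X 1 1) xp')"
  let ?u = "E.G.conj1 xp' yp'" and ?v = "E.G.conj1 ?s (inv\<^bsub>cgroup CII ?A\<^esub> yp')"
  have xc: "xp' \<in> carrier (cgroup CII ?A)" and yc: "yp' \<in> carrier (cgroup CII ?A)"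
    using E.G.N1D xp' yp' by auto
  have sc: "?s \<in> carrier (cgroup CII ?A)" using xc by simp
  have ic: "inv\<^bsub>cgroup CII ?A\<^esub> yp' \<in> carrier (cgroup CII ?A)" using yc by simp
  have uc: "?u \<in> carrier (cgroup CII ?A)" and vc: "?v \<in> carrier (cgroup CII ?A)"
    using xc yc sc ic by simp_all
  have u: "?u (?p a b) = ad ?A a b" if "a \<in> moore_carrier R X 1" "b \<in> moore_carrier R X 1" for a b
  proof -
    have p: "?p a b \<in> carrier CII" using that by simp
    have "?u (?p a b) = sweedler CII ?A (?p a b) (\<lambda>s t. ad ?A (proj1 NH1 NH1 s) (proj2 NH1 NH1 t))"
      unfolding E.ev_conj1[OF xc yc p] by (rule sw_cong[OF CII p]) (simp add: xp'_def yp'_def)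
    also have "\<dots> = ad ?A a b" using that by (intro sw_proj12) (auto intro!: mlin)
    finally show ?thesis .
  qed
  have v: "?v (?p a b) = ad ?A (degen X 0 0 (face X 1 1 a)) (antipode ?A b)"
    if "a \<in> moore_carrier R X 1" "b \<in> moore_carrier R X 1" for a b
  proof -
    have p: "?p a b \<in> carrier CII" using that by simp
    have "?v (?p a b) = sweedler CII ?A (?p a b) (\<lambda>s t.
        ad ?A (degen X 0 0 (face X 1 1 (proj1 NH1 NH1 s))) (antipode ?A (proj2 NH1 NH1 t)))"
      unfolding E.ev_conj1[OF sc ic p]
      by (rule sw_cong[OF CII p]) (simp add: E.ev_comp E.ev_inv[OF yc], simp add: xp'_def yp'_def)
    also have "\<dots> = ad ?A (degen X 0 0 (face X 1 1 a)) (antipode ?A b)"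
      using that
      by (intro sw_proj12[where F = "\<lambda>a b. ad ?A (degen X 0 0 (face X 1 1 a)) (antipode ?A b)"])
        (auto intro!: mlin)
    finally show ?thesis .
  qed
  have p: "?p x y \<in> carrier CII" using x y by simp
  have "face X 2 2 (peiffer x y) = (compose (carrier CII) (face X 2 2) (E.G.lift xp' yp')) (?p x y)"
    using p by (simp add: E.ev_comp lift_xy x y)
  also have "\<dots> = (?u \<otimes>\<^bsub>cgroup CII ?A\<^esub> ?v) (?p x y)" unfolding E.G.bd_lift[OF xp' yp'] ..
  also have "\<dots> = sweedler CII ?A (?p x y) (\<lambda>s t. ?u s \<otimes>\<^bsub>?A\<^esub> ?v t)" by (rule E.ev_mult[OF p])
  also have "\<dots> = sweedler NH1 ?A x (\<lambda>x1 x2. sweedler NH1 ?A y (\<lambda>y1 y2. ?u (?p x1 y1) \<otimes>\<^bsub>?A\<^esub> ?v (?p x2 y2)))"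
    using x y coalg_mapD(1,2)[OF E.elemD(1)[OF uc]] coalg_mapD(1,2)[OF E.elemD(1)[OF vc]]
    by (intro sw_tensor bilI lin_mult_l lin_mult_r) auto
  also have "\<dots> = sweedler NH1 ?A x (\<lambda>x1 x2. sweedler NH1 ?A y (\<lambda>y1 y2. ad ?A x1 y1 \<otimes>\<^bsub>?A\<^esub>
      ad ?A (degen X 0 0 (face X 1 1 x2)) (antipode ?A y2)))"
    using x y u v by (intro sw_cong) auto
  finally show ?thesis .
qed

end

end


context ground_field
begin

lemma sw_coalg_map_pure:
  assumes A: "cocoalgebra A" and B: "cocoalgebra B" and V: "module R V" and op: "bil H H' V op"
    and f: "coalg_map (tensor_coalg A B) H f" and g: "coalg_map (tensor_coalg A B) H' g"
    and a: "a \<in> carrier A" and b: "b \<in> carrier B"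
  shows "sweedler (tensor_coalg A B) V (pure_tensor R A B a b) (\<lambda>s t. op (f s) (g t)) =
    sweedler A V a (\<lambda>a1 a2. sweedler B V b (\<lambda>b1 b2.
      op (f (pure_tensor R A B a1 b1)) (g (pure_tensor R A B a2 b2))))"
  using V a b coalg_mapD(2)[OF f] coalg_mapD(2)[OF g]
  by (intro sw_tensor[OF A B] bilI lin_comp[OF coalg_mapD(1)[OF f] bil_l[OF op]]
      lin_comp[OF coalg_mapD(1)[OF g] bil_r[OF op]]) auto

lemma sw_ev_any2:
  assumes A: "cocoalgebra A" and B: "cocoalgebra B" and V: "module R V"
    and op: "bil H H' V op" and f: "coalg_map (tensor_coalg A B) H f" and \<psi>: "lin B H' \<psi>"
    and g: "\<And>t. t \<in> carrier (tensor_coalg A B) \<Longrightarrow> g t = \<psi> (proj2 A B t)"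
    and a: "a \<in> carrier A" and b: "b \<in> carrier B"
  shows "sweedler (tensor_coalg A B) V (pure_tensor R A B a b) (\<lambda>s t. op (f s) (g t)) =
    sweedler B V b (\<lambda>b1 b2. op (f (pure_tensor R A B a b1)) (\<psi> b2))"
proof -
  have "sweedler (tensor_coalg A B) V (pure_tensor R A B a b) (\<lambda>s t. op (f s) (g t)) =
      sweedler (tensor_coalg A B) V (pure_tensor R A B a b) (\<lambda>s t. op (f s) (\<psi> (proj2 A B t)))"
    using a b g by (intro sw_cong tensor_coalg_cocoalgebra A B) auto
  also have "\<dots> = sweedler B V b (\<lambda>b1 b2. op (f (pure_tensor R A B a b1)) (\<psi> b2))"
    using a b coalg_mapD(2)[OF f] lin_closed[OF \<psi>]
    by (intro sw_any_proj2[OF A B V, where F = "\<lambda>s b. op (f s) (\<psi> b)"] bilI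
        lin_comp[OF coalg_mapD(1)[OF f] bil_l[OF op]] lin_comp[OF \<psi> bil_r[OF op]]) auto
  finally show ?thesis .
qed

lemma sw_ev_1any:
  assumes A: "cocoalgebra A" and B: "cocoalgebra B" and V: "module R V"
    and op: "bil H H' V op" and g: "coalg_map (tensor_coalg A B) H' g" and \<phi>: "lin A H \<phi>"
    and f: "\<And>t. t \<in> carrier (tensor_coalg A B) \<Longrightarrow> f t = \<phi> (proj1 A B t)"
    and a: "a \<in> carrier A" and b: "b \<in> carrier B"
  shows "sweedler (tensor_coalg A B) V (pure_tensor R A B a b) (\<lambda>s t. op (f s) (g t)) =
    sweedler A V a (\<lambda>a1 a2. op (\<phi> a1) (g (pure_tensor R A B a2 b)))"
proof -
  have "sweedler (tensor_coalg A B) V (pure_tensor R A B a b) (\<lambda>s t. op (f s) (g t)) =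
      sweedler (tensor_coalg A B) V (pure_tensor R A B a b) (\<lambda>s t. op (\<phi> (proj1 A B s)) (g t))"
    using a b f by (intro sw_cong tensor_coalg_cocoalgebra A B) auto
  also have "\<dots> = sweedler A V a (\<lambda>a1 a2. op (\<phi> a1) (g (pure_tensor R A B a2 b)))"
    using a b coalg_mapD(2)[OF g] lin_closed[OF \<phi>]
    by (intro sw_proj1_any[OF A B V, where F = "\<lambda>a t. op (\<phi> a) (g t)"] bilI
        lin_comp[OF coalg_mapD(1)[OF g] bil_r[OF op]] lin_comp[OF \<phi> bil_l[OF op]]) auto
  finally show ?thesis .
qed

lemma mult_bil [simp]: "hopf H \<Longrightarrow> bil H H H (\<otimes>\<^bsub>H\<^esub>)"
  by (simp add: alg_mult_bil)

end

context simplicial_hopf2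
begin

context
begin

private abbreviation "CKK \<equiv> tensor_coalg NH2 NH2"
private abbreviation "pkk \<equiv> pure_tensor R NH2 NH2"

private lemma CKK: "cocoalgebra CKK"
  by (rule tensor_coalg_cocoalgebra) auto

interpretation E: generalized_elements R X CKK
  by (rule elements_of[OF CKK])

private definition "kk' = restrict (proj1 NH2 NH2) (carrier CKK)"
private definition "ll' = restrict (proj2 NH2 NH2) (carrier CKK)"

private lemma kl_in: "kk' \<in> E.G.N2" "ll' \<in> E.G.N2"
  unfolding kk'_def ll'_def by (auto intro!: E.K_elem[OF proj1_coalg_map] E.K_elem[OF proj2_coalg_map])

private lemma klc: "kk' \<in> carrier (cgroup CKK (level X 2))" "ll' \<in> carrier (cgroup CKK (level X 2))"
  using kl_in E.G.N2D by auto

private lemma kl_proj: "t \<in> carrier CKK \<Longrightarrow> kk' t = proj1 NH2 NH2 t"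
  "t \<in> carrier CKK \<Longrightarrow> ll' t = proj2 NH2 NH2 t"
  by (simp_all add: kk'_def ll'_def)

private lemma conj_kl:
  assumes "k \<in> moore_carrier R X 2" "l \<in> moore_carrier R X 2"
  shows "E.G.conj2 kk' ll' (pkk k l) = ad (level X 2) k l"
proof -
  have p: "pkk k l \<in> carrier CKK" using assms by simp
  show ?thesis
    unfolding E.ev_conj2[OF klc p] using assms
    by (intro sw_ev12[where \<phi> = "\<lambda>x. x" and \<psi> = "\<lambda>x. x"]) (auto simp: kl_proj intro!: mlin)
qed

lemma peiffer_bd_bd:
  assumes k: "k \<in> moore_carrier R X 2" and l: "l \<in> moore_carrier R X 2"
  shows "peiffer (face X 2 2 k) (face X 2 2 l) = sweedler NH2 (level X 2) l
    (\<lambda>l1 l2. ad (level X 2) k l1 \<otimes>\<^bsub>level X 2\<^esub> antipode (level X 2) l2)"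
proof -
  let ?A = "level X 2"
  let ?d = "compose (carrier CKK) (face X 2 2)"
  have p: "pkk k l \<in> carrier CKK" using k l by simp
  have c: "E.G.conj2 kk' ll' \<in> carrier (cgroup CKK ?A)" using klc by simp
  have "E.G.lift (?d kk') (?d ll') (pkk k l) = peiffer (face X 2 2 k) (face X 2 2 l)"
    unfolding E.ev_lift[OF E.G.d22.hom_closed[OF klc(1)] E.G.d22.hom_closed[OF klc(2)] p]
    using k l by (intro sw_ev12 mlin) (auto simp: E.ev_comp kl_proj)
  moreover have "(E.G.conj2 kk' ll' \<otimes>\<^bsub>cgroup CKK ?A\<^esub> inv\<^bsub>cgroup CKK ?A\<^esub> ll') (pkk k l) =
      sweedler NH2 ?A l (\<lambda>l1 l2. E.G.conj2 kk' ll' (pkk k l1) \<otimes>\<^bsub>?A\<^esub> antipode ?A l2)"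
    unfolding E.ev_mult[OF p] using k l klc
    by (intro sw_ev_any2[where H = ?A and H' = ?A and \<psi> = "antipode ?A"] mult_bil E.elemD(1)[OF c]
        lin_antipode[OF level_hopf K_id]) (auto simp: E.ev_inv kl_proj)
  moreover have "\<dots> = sweedler NH2 ?A l (\<lambda>l1 l2. ad ?A k l1 \<otimes>\<^bsub>?A\<^esub> antipode ?A l2)"
    using k l by (intro sw_cong) (auto simp: conj_kl)
  ultimately show ?thesis by (simp add: E.G.lift_bd_bd[OF kl_in])
qed

lemma ad_degen_bd:
  assumes k: "k \<in> moore_carrier R X 2" and l: "l \<in> moore_carrier R X 2"
  shows "ad (level X 2) (degen X 1 1 (face X 2 2 k)) l = ad (level X 2) k l"
proof -
  let ?u = "compose (carrier CKK) (degen X 1 1) (compose (carrier CKK) (face X 2 2) kk')"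
  have u: "?u \<in> carrier (cgroup CKK (level X 2))" using klc by simp
  have p: "pkk k l \<in> carrier CKK" using k l by simp
  have "E.G.conj2 ?u ll' (pkk k l) = ad (level X 2) (degen X 1 1 (face X 2 2 k)) l"
    unfolding E.ev_conj2[OF u klc(2) p] using k l
    by (intro sw_ev12[where \<phi> = "\<lambda>x. degen X 1 1 (face X 2 2 x)" and \<psi> = "\<lambda>x. x"] mlin)
      (auto simp: E.ev_comp kl_proj intro!: mlin)
  then show ?thesis using k l by (simp add: E.G.conj_via_bd[OF klc(1) kl_in(2)] conj_kl)
qed

end

context
begin

private abbreviation "CKI \<equiv> tensor_coalg NH2 NH1"
private abbreviation "pki \<equiv> pure_tensor R NH2 NH1"

private lemma CKI: "cocoalgebra CKI"
  by (rule tensor_coalg_cocoalgebra) auto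

interpretation E: generalized_elements R X CKI
  by (rule elements_of[OF CKI])

private definition "ki' = restrict (proj1 NH2 NH1) (carrier CKI)"
private definition "xi' = restrict (proj2 NH2 NH1) (carrier CKI)"

private lemma kx_in: "ki' \<in> E.G.N2" "xi' \<in> E.G.N1"
  unfolding ki'_def xi'_def by (auto intro!: E.K_elem[OF proj1_coalg_map] E.I_elem[OF proj2_coalg_map])

private lemma kxc: "ki' \<in> carrier (cgroup CKI (level X 2))" "xi' \<in> carrier (cgroup CKI (level X 1))"
  using kx_in E.G.N1D E.G.N2D by auto

private lemma kx_proj: "t \<in> carrier CKI \<Longrightarrow> ki' t = proj1 NH2 NH1 t"
  "t \<in> carrier CKI \<Longrightarrow> xi' t = proj2 NH2 NH1 t"
  by (simp_all add: ki'_def xi'_def)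

private lemma kx_in_proj: "t \<in> carrier CKI \<Longrightarrow> proj1 NH2 NH1 t \<in> moore_carrier R X 2"
  using coalg_mapD(2)[OF proj1_coalg_map[of NH2 NH1]] by simp

text \<open>Through the lifting, \<open>x\<close> acts as the adjoint action of \<open>s\<^sub>1x\<close>.\<close>

lemma lifting_act_ad:
  assumes k: "k \<in> moore_carrier R X 2" and x: "x \<in> moore_carrier R X 1"
  shows "sweedler NH2 (level X 2) k (\<lambda>k1 k2. k1 \<otimes>\<^bsub>level X 2\<^esub>
      peiffer (face X 2 2 (antipode (level X 2) k2)) x) = ad (level X 2) (degen X 1 1 x) k"
proof -
  let ?A = "level X 2"
  let ?u = "compose (carrier CKI) (face X 2 2) (inv\<^bsub>cgroup CKI ?A\<^esub> ki')"
  let ?v = "compose (carrier CKI) (degen X 1 1) xi'"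
  have u: "?u \<in> carrier (cgroup CKI (level X 1))" and v: "?v \<in> carrier (cgroup CKI ?A)"
    and uv: "E.G.lift ?u xi' \<in> carrier (cgroup CKI ?A)"
    using kxc by simp_all
  have p: "pki a x \<in> carrier CKI" if "a \<in> moore_carrier R X 2" for a using that x by simp
  have 1: "E.G.lift ?u xi' (pki a x) = peiffer (face X 2 2 (antipode ?A a)) x"
    if "a \<in> moore_carrier R X 2" for a
    unfolding E.ev_lift[OF u kxc(2) p[OF that]] using that x
    by (intro sw_ev12[where \<phi> = "\<lambda>a. face X 2 2 (antipode ?A a)" and \<psi> = "\<lambda>x. x"] mlin)
      (auto simp: E.ev_comp E.ev_inv kxc kx_proj kx_in_proj
        hopf_map_antipode[OF level_hopf level_hopf low_maps(8)] intro!: mlin)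
  have "(ki' \<otimes>\<^bsub>cgroup CKI ?A\<^esub> E.G.lift ?u xi') (pki k x) =
      sweedler NH2 ?A k (\<lambda>k1 k2. k1 \<otimes>\<^bsub>?A\<^esub> E.G.lift ?u xi' (pki k2 x))"
    unfolding E.ev_mult[OF p[OF k]] using k x
    by (intro sw_ev_1any[where H = ?A and H' = ?A and \<phi> = "\<lambda>x. x"] mult_bil E.elemD(1)[OF uv] mlin) (auto simp: kx_proj intro!: mlin)
  also have "\<dots> = sweedler NH2 ?A k (\<lambda>k1 k2. k1 \<otimes>\<^bsub>?A\<^esub> peiffer (face X 2 2 (antipode ?A k2)) x)"
    using k by (intro sw_cong) (auto simp: 1)
  finally have "sweedler NH2 ?A k (\<lambda>k1 k2. k1 \<otimes>\<^bsub>?A\<^esub> peiffer (face X 2 2 (antipode ?A k2)) x) =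
      E.G.conj2 ?v ki' (pki k x)"
    by (simp add: E.G.lift_act[OF kx_in])
  also have "\<dots> = ad ?A (degen X 1 1 x) k"
    unfolding E.ev_conj2[OF v kxc(1) p[OF k]] using k x
    by (intro sw_ev21[where \<psi> = "degen X 1 1" and \<phi> = "\<lambda>x. x"] mlin)
      (auto simp: E.ev_comp kx_proj intro!: mlin)
  finally show ?thesis .
qed

lemma peiffer_bd_mixed:
  assumes k: "k \<in> moore_carrier R X 2" and x: "x \<in> moore_carrier R X 1"
  shows "sweedler NH2 (level X 2) k (\<lambda>k1 k2. sweedler NH1 (level X 2) x (\<lambda>x1 x2.
      peiffer (face X 2 2 k1) x1 \<otimes>\<^bsub>level X 2\<^esub> peiffer x2 (face X 2 2 k2))) =
    sweedler NH2 (level X 2) k (\<lambda>k1 k2. k1 \<otimes>\<^bsub>level X 2\<^esub>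
      ad (level X 2) (degen X 1 1 (degen X 0 0 (face X 1 1 x))) (antipode (level X 2) k2))"
proof -
  let ?A = "level X 2"
  let ?u = "compose (carrier CKI) (face X 2 2) ki'" and ?i = "inv\<^bsub>cgroup CKI ?A\<^esub> ki'"
  let ?v = "compose (carrier CKI) (degen X 1 1) (compose (carrier CKI) (degen X 0 0)
    (compose (carrier CKI) (face X 1 1) xi'))"
  have u: "?u \<in> carrier (cgroup CKI (level X 1))" and v: "?v \<in> carrier (cgroup CKI ?A)"
    and i: "?i \<in> carrier (cgroup CKI ?A)"
    and l1: "E.G.lift ?u xi' \<in> carrier (cgroup CKI ?A)" and l2: "E.G.lift xi' ?u \<in> carrier (cgroup CKI ?A)"
    and vi: "E.G.conj2 ?v ?i \<in> carrier (cgroup CKI ?A)"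
    using kxc by simp_all
  have cvi: "coalg_map CKI ?A (E.G.conj2 ?v ?i)" by (rule E.elemD(1)[OF vi])
  have p: "pki a b \<in> carrier CKI" if "a \<in> moore_carrier R X 2" "b \<in> moore_carrier R X 1" for a b
    using that by simp
  have 1: "E.G.lift ?u xi' (pki a b) = peiffer (face X 2 2 a) b"
    if "a \<in> moore_carrier R X 2" "b \<in> moore_carrier R X 1" for a b
    unfolding E.ev_lift[OF u kxc(2) p[OF that]] using that
    by (intro sw_ev12[where \<phi> = "face X 2 2" and \<psi> = "\<lambda>x. x"] mlin)
      (auto simp: E.ev_comp kx_proj intro!: mlin)
  have 2: "E.G.lift xi' ?u (pki a b) = peiffer b (face X 2 2 a)"
    if "a \<in> moore_carrier R X 2" "b \<in> moore_carrier R X 1" for a b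
    unfolding E.ev_lift[OF kxc(2) u p[OF that]] using that
    by (intro sw_ev21[where \<phi> = "face X 2 2" and \<psi> = "\<lambda>x. x"] mlin)
      (auto simp: E.ev_comp kx_proj intro!: mlin)
  have 3: "E.G.conj2 ?v ?i (pki a b) =
      ad ?A (degen X 1 1 (degen X 0 0 (face X 1 1 b))) (antipode ?A a)"
    if "a \<in> moore_carrier R X 2" "b \<in> moore_carrier R X 1" for a b
    unfolding E.ev_conj2[OF v i p[OF that]] using that
    by (intro sw_ev21[where \<psi> = "\<lambda>b. degen X 1 1 (degen X 0 0 (face X 1 1 b))" and \<phi> = "antipode ?A"] mlin)
      (auto simp: E.ev_comp E.ev_inv kxc kx_proj intro!: mlin)
  have "sweedler NH2 ?A k (\<lambda>k1 k2. sweedler NH1 ?A x (\<lambda>x1 x2.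
      peiffer (face X 2 2 k1) x1 \<otimes>\<^bsub>?A\<^esub> peiffer x2 (face X 2 2 k2))) =
    sweedler NH2 ?A k (\<lambda>k1 k2. sweedler NH1 ?A x (\<lambda>x1 x2.
      E.G.lift ?u xi' (pki k1 x1) \<otimes>\<^bsub>?A\<^esub> E.G.lift xi' ?u (pki k2 x2)))"
    using k x by (intro sw_cong) (auto simp: 1 2)
  also have "\<dots> = (E.G.lift ?u xi' \<otimes>\<^bsub>cgroup CKI ?A\<^esub> E.G.lift xi' ?u) (pki k x)"
    unfolding E.ev_mult[OF p[OF k x]] using k x
    by (intro sw_coalg_map_pure[symmetric, where H = ?A and H' = ?A] E.elemD(1)[OF l1] E.elemD(1)[OF l2]) auto
  also have "\<dots> = (ki' \<otimes>\<^bsub>cgroup CKI ?A\<^esub> E.G.conj2 ?v ?i) (pki k x)"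
    unfolding E.G.lift_bd_mixed[OF kx_in] ..
  also have "\<dots> = sweedler NH2 ?A k (\<lambda>k1 k2. k1 \<otimes>\<^bsub>?A\<^esub> E.G.conj2 ?v ?i (pki k2 x))"
    unfolding E.ev_mult[OF p[OF k x]] using k x
    by (intro sw_ev_1any[where H = ?A and H' = ?A and \<phi> = "\<lambda>x. x"] mult_bil cvi mlin) (auto simp: kx_proj intro!: mlin)
  also have "\<dots> = sweedler NH2 ?A k (\<lambda>k1 k2. k1 \<otimes>\<^bsub>?A\<^esub>
      ad ?A (degen X 1 1 (degen X 0 0 (face X 1 1 x))) (antipode ?A k2))"
    using k x by (intro sw_cong) (auto simp: 3)
  finally show ?thesis .
qed

end

text \<open>
  Three variables: \<open>C = A \<otimes> T\<close> with \<open>T = NH\<^sub>1 \<otimes> NH\<^sub>1\<close>, the second and the third variable being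
  the projections of the second factor. The coalgebra \<open>A\<close> is \<open>H\<^sub>0\<close> for the equivariance of the lifting and
  \<open>NH\<^sub>1\<close> for its behaviour on products.
\<close>

context
  fixes A :: "('k, 'a) hopf"
  assumes A: "cocoalgebra A"
begin

private abbreviation "T \<equiv> tensor_coalg NH1 NH1"
private abbreviation "CT \<equiv> tensor_coalg A T"
private abbreviation "pp \<equiv> pure_tensor R A T"
private abbreviation "pI \<equiv> pure_tensor R NH1 NH1"
private abbreviation "fst' \<equiv> proj1 NH1 NH1"
private abbreviation "snd' \<equiv> proj2 NH1 NH1"

private lemma T: "cocoalgebra T" "module R T"
  using tensor_coalg_cocoalgebra[of NH1 NH1] by auto

private lemma CT: "cocoalgebra CT"
  by (rule tensor_coalg_cocoalgebra[OF A T(1)])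

interpretation E: generalized_elements R X CT
  by (rule elements_of[OF CT])

private definition "y3' = (\<lambda>t \<in> carrier CT. fst' (proj2 A T t))"
private definition "z3' = (\<lambda>t \<in> carrier CT. snd' (proj2 A T t))"

private lemma yz': "y3' \<in> E.G.N1" "z3' \<in> E.G.N1"
  unfolding y3'_def z3'_def
  by (intro E.I_elem coalg_map_comp[OF CT T(1) proj2_coalg_map[OF A T(1)]] proj1_coalg_map proj2_coalg_map; simp)+

private lemma yzc: "y3' \<in> carrier (cgroup CT (level X 1))" "z3' \<in> carrier (cgroup CT (level X 1))"
  using yz' E.G.N1D by auto

private lemma yz_proj: "t \<in> carrier CT \<Longrightarrow> y3' t = fst' (proj2 A T t)"
  "t \<in> carrier CT \<Longrightarrow> z3' t = snd' (proj2 A T t)"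
  by (simp_all add: y3'_def z3'_def)

private lemma fs_lin: "lin T NH1 fst'" "lin T NH1 snd'"
  using proj_lin[of NH1 NH1] by auto

private lemma fs_in: "q \<in> carrier T \<Longrightarrow> fst' q \<in> moore_carrier R X 1"
  "q \<in> carrier T \<Longrightarrow> snd' q \<in> moore_carrier R X 1"
  using lin_closed[OF fs_lin(1)] lin_closed[OF fs_lin(2)] by auto

private lemmas tlin = mlin I_lin[OF fs_lin(1)] I_lin[OF fs_lin(2)]

text \<open>The lifting, the adjoint action and the product of the last two variables, as linear maps on \<open>T\<close>.\<close>

private definition "L q = sweedler T (level X 2) q (\<lambda>a b. peiffer (fst' a) (snd' b))"
private definition "W q = sweedler T (level X 1) q (\<lambda>a b. ad (level X 1) (fst' a) (snd' b))"
private definition "M q = sweedler T (level X 1) q (\<lambda>a b. fst' a \<otimes>\<^bsub>level X 1\<^esub> snd' b)"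

private lemma LWM_pure:
  assumes "y \<in> moore_carrier R X 1" "z \<in> moore_carrier R X 1"
  shows "L (pI y z) = peiffer y z" "W (pI y z) = ad (level X 1) y z" "M (pI y z) = y \<otimes>\<^bsub>level X 1\<^esub> z"
  unfolding L_def W_def M_def using assms by (intro sw_proj12; auto intro!: mlin)+

private lemma LWM_lin: "lin T (level X 2) L" "lin T (level X 1) W" "lin T (level X 1) M"
  unfolding L_def[abs_def] W_def[abs_def] M_def[abs_def] using T fs_in by (auto intro!: tlin)

private lemma LWM_in: assumes "q \<in> carrier T"
  shows "L q \<in> carrier (level X 2)" "W q \<in> carrier (level X 1)" "M q \<in> carrier (level X 1)"
  using lin_closed[OF LWM_lin(1) assms] lin_closed[OF LWM_lin(2) assms] lin_closed[OF LWM_lin(3) assms] .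

private lemma LWM_ev:
  assumes t: "t \<in> carrier CT"
  shows "E.G.lift y3' z3' t = L (proj2 A T t)" "E.G.conj1 y3' z3' t = W (proj2 A T t)"
    "(y3' \<otimes>\<^bsub>cgroup CT (level X 1)\<^esub> z3') t = M (proj2 A T t)"
  unfolding L_def W_def M_def E.ev_lift[OF yzc t] E.ev_conj1[OF yzc t] E.ev_mult[OF t]
  using CT T t fs_in
  by (subst sw_coalg_map[OF CT T(2) _ proj2_coalg_map[OF A T(1)]]; (intro sw_cong[OF CT])?;
      auto simp: yz_proj intro!: tlin)+

lemma peiffer_equivariant0:
  assumes A0: "A = level X 0"
    and a: "a \<in> carrier A" and y: "y \<in> moore_carrier R X 1" and z: "z \<in> moore_carrier R X 1"
  shows "ad (level X 2) (degen X 1 1 (degen X 0 0 a)) (peiffer y z) =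
    sweedler A (level X 2) a (\<lambda>a1 a2. peiffer (ad (level X 1) (degen X 0 0 a1) y)
      (ad (level X 1) (degen X 0 0 a2) z))"
proof -
  let ?A1 = "level X 1" and ?A2 = "level X 2"
  define x3' where "x3' = restrict (proj1 A T) (carrier CT)"
  have x3': "x3' \<in> carrier (cgroup CT (level X 0))"
    unfolding x3'_def using res_cgroup[OF CT proj1_coalg_map[OF A T(1)]] A0 by simp
  let ?b = "compose (carrier CT) (degen X 0 0) x3'"
  let ?v = "compose (carrier CT) (degen X 1 1) ?b"
  have b: "?b \<in> carrier (cgroup CT ?A1)" and v: "?v \<in> carrier (cgroup CT ?A2)"
    and l: "E.G.lift y3' z3' \<in> carrier (cgroup CT ?A2)"
    and by': "E.G.conj1 ?b y3' \<in> carrier (cgroup CT ?A1)" and bz': "E.G.conj1 ?b z3' \<in> carrier (cgroup CT ?A1)"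
    using x3' yzc by simp_all
  have p: "pp u q \<in> carrier CT" if "u \<in> carrier A" "q \<in> carrier T" for u q using that by simp
  have q: "pI y z \<in> carrier T" using y z by simp
  have aA: "u \<in> carrier (level X 0)" if "u \<in> carrier A" for u using that A0 by simp
  have l0: "lin A (level X 0) (\<lambda>x. x)" by (simp add: A0)
  have "E.G.conj2 ?v (E.G.lift y3' z3') (pp a (pI y z)) =
      ad ?A2 (degen X 1 1 (degen X 0 0 a)) (L (pI y z))"
    unfolding E.ev_conj2[OF v l p[OF a q]] using a q aA LWM_in LWM_lin T
    by (intro sw_ev12[OF A T(1), where \<phi> = "\<lambda>a. degen X 1 1 (degen X 0 0 a)" and \<psi> = L])
      (auto simp: E.ev_comp x3'_def LWM_ev intro!: tlin l0)
  moreover have "E.G.lift (E.G.conj1 ?b y3') (E.G.conj1 ?b z3') (pp a (pI y z)) =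
      sweedler A ?A2 a (\<lambda>a1 a2. peiffer (ad ?A1 (degen X 0 0 a1) y) (ad ?A1 (degen X 0 0 a2) z))"
  proof -
    have 1: "E.G.conj1 ?b y3' (pp u q) = ad ?A1 (degen X 0 0 u) (fst' q)"
      if "u \<in> carrier A" "q \<in> carrier T" for u q
      unfolding E.ev_conj1[OF b yzc(1) p[OF that]] using that aA fs_in T
      by (intro sw_ev12[OF A T(1), where \<phi> = "degen X 0 0" and \<psi> = fst'])
        (auto simp: E.ev_comp x3'_def yz_proj intro!: tlin l0)
    have 2: "E.G.conj1 ?b z3' (pp u q) = ad ?A1 (degen X 0 0 u) (snd' q)"
      if "u \<in> carrier A" "q \<in> carrier T" for u q
      unfolding E.ev_conj1[OF b yzc(2) p[OF that]] using that aA fs_in T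
      by (intro sw_ev12[OF A T(1), where \<phi> = "degen X 0 0" and \<psi> = snd'])
        (auto simp: E.ev_comp x3'_def yz_proj intro!: tlin l0)
    have "E.G.lift (E.G.conj1 ?b y3') (E.G.conj1 ?b z3') (pp a (pI y z)) =
        sweedler A ?A2 a (\<lambda>a1 a2. sweedler T ?A2 (pI y z) (\<lambda>q1 q2.
          peiffer (E.G.conj1 ?b y3' (pp a1 q1)) (E.G.conj1 ?b z3' (pp a2 q2))))"
      unfolding E.ev_lift[OF by' bz' p[OF a q]] using a q
      by (intro sw_coalg_map_pure[OF A T(1) _ peiffer_bil] E.elemD(1)[OF by'] E.elemD(1)[OF bz']) auto
    also have "\<dots> = sweedler A ?A2 a (\<lambda>a1 a2. sweedler T ?A2 (pI y z) (\<lambda>q1 q2.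
        peiffer (ad ?A1 (degen X 0 0 a1) (fst' q1)) (ad ?A1 (degen X 0 0 a2) (snd' q2))))"
      using a q by (intro sw_cong A T) (auto simp: 1 2)
    also have "\<dots> = sweedler A ?A2 a (\<lambda>a1 a2. peiffer (ad ?A1 (degen X 0 0 a1) y) (ad ?A1 (degen X 0 0 a2) z))"
      using a aA y z
      by (intro sw_cong A sw_proj12[where F = "\<lambda>y z. peiffer (ad ?A1 (degen X 0 0 _) y) (ad ?A1 (degen X 0 0 _) z)"])
        (auto intro!: mlin)
    finally show ?thesis .
  qed
  ultimately show ?thesis
    using E.G.lift_equivariant[OF x3' yz'] y z by (simp add: LWM_pure)
qed

context
  assumes A1: "A = NH1"
begin

private definition "x3' = restrict (proj1 A T) (carrier CT)"

private lemma x3': "x3' \<in> E.G.N1"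
  unfolding x3'_def
proof (rule E.I_elem)
  show "coalg_map CT NH1 (proj1 A T)" using proj1_coalg_map[OF A T(1)] by (simp add: A1)
qed

private lemma xc: "x3' \<in> carrier (cgroup CT (level X 1))"
  using x3' E.G.N1D by auto

private lemma x_proj: "t \<in> carrier CT \<Longrightarrow> x3' t = proj1 A T t"
  by (simp add: x3'_def)

private lemma A_carrier: "carrier A = moore_carrier R X 1"
  by (simp add: A1)

private lemma A_id: "lin A (level X 1) (\<lambda>x. x)"
  by (simp add: A1 I_id)

private lemma p_in: "u \<in> moore_carrier R X 1 \<Longrightarrow> q \<in> carrier T \<Longrightarrow> pp u q \<in> carrier CT"
  by (simp add: A1)

private abbreviation "b' \<equiv> compose (carrier CT) (degen X 0 0) (compose (carrier CT) (face X 1 1) x3')"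

private lemma bc: "b' \<in> carrier (cgroup CT (level X 1))"
  using xc by simp

lemma peiffer_mult_l0:
  assumes x: "x \<in> moore_carrier R X 1" and y: "y \<in> moore_carrier R X 1" and z: "z \<in> moore_carrier R X 1"
  shows "peiffer (x \<otimes>\<^bsub>level X 1\<^esub> y) z = sweedler A (level X 2) x (\<lambda>x1 x2. sweedler NH1 (level X 2) y
    (\<lambda>y1 y2. sweedler NH1 (level X 2) z (\<lambda>z1 z2. peiffer x1 (ad (level X 1) y1 z1) \<otimes>\<^bsub>level X 2\<^esub>
      ad (level X 2) (degen X 1 1 (degen X 0 0 (face X 1 1 x2))) (peiffer y2 z2))))"
proof -
  let ?A1 = "level X 1" and ?A2 = "level X 2"
  let ?v = "compose (carrier CT) (degen X 1 1) b'"
  let ?m = "x3' \<otimes>\<^bsub>cgroup CT ?A1\<^esub> y3'"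
  let ?f = "E.G.lift x3' (E.G.conj1 y3' z3')" and ?g = "E.G.conj2 ?v (E.G.lift y3' z3')"
  have v: "?v \<in> carrier (cgroup CT ?A2)" and m: "?m \<in> carrier (cgroup CT ?A1)"
    and f: "?f \<in> carrier (cgroup CT ?A2)" and g: "?g \<in> carrier (cgroup CT ?A2)"
    and c: "E.G.conj1 y3' z3' \<in> carrier (cgroup CT ?A1)" and l: "E.G.lift y3' z3' \<in> carrier (cgroup CT ?A2)"
    using xc bc yzc by simp_all
  have q: "pI y z \<in> carrier T" using y z by simp
  have xA: "x \<in> carrier A" using x by (simp add: A1)
  have p: "pp x (pI y z) \<in> carrier CT" by (rule p_in[OF x q])
  have mp: "?m (pp x q) = x \<otimes>\<^bsub>?A1\<^esub> fst' q" if "q \<in> carrier T" for q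
    unfolding E.ev_mult[OF p_in[OF x that]] using that xA fs_in T
    by (intro sw_ev12[OF A T(1), where \<phi> = "\<lambda>x. x" and \<psi> = fst'])
      (auto simp: x_proj yz_proj A_carrier intro!: tlin A_id)
  have "E.G.lift ?m z3' (pp x (pI y z)) = sweedler T ?A2 (pI y z) (\<lambda>q1 q2. peiffer (?m (pp x q1)) (snd' q2))"
    unfolding E.ev_lift[OF m yzc(2) p] using q xA
    by (intro sw_ev_any2[OF A T(1) _ peiffer_bil] E.elemD(1)[OF m] I_lin fs_lin) (auto simp: yz_proj)
  also have "\<dots> = sweedler T ?A2 (pI y z) (\<lambda>q1 q2. peiffer (x \<otimes>\<^bsub>?A1\<^esub> fst' q1) (snd' q2))"
    using q by (intro sw_cong T) (auto simp: mp)
  also have "\<dots> = peiffer (x \<otimes>\<^bsub>?A1\<^esub> y) z"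
    using x y z by (intro sw_proj12[where F = "\<lambda>y z. peiffer (x \<otimes>\<^bsub>?A1\<^esub> y) z"]) (auto intro!: mlin)
  finally have 0: "E.G.lift ?m z3' (pp x (pI y z)) = peiffer (x \<otimes>\<^bsub>?A1\<^esub> y) z" .
  have 1: "?f (pp u q) = peiffer u (W q)" if "u \<in> moore_carrier R X 1" "q \<in> carrier T" for u q
    unfolding E.ev_lift[OF xc c p_in[OF that]] using that LWM_in LWM_lin T
    by (intro sw_ev12[OF A T(1), where \<phi> = "\<lambda>x. x" and \<psi> = W])
      (auto simp: x_proj LWM_ev A_carrier intro!: tlin A_id)
  have 2: "?g (pp u q) = ad ?A2 (degen X 1 1 (degen X 0 0 (face X 1 1 u))) (L q)"
    if "u \<in> moore_carrier R X 1" "q \<in> carrier T" for u q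
    unfolding E.ev_conj2[OF v l p_in[OF that]] using that LWM_in LWM_lin T
    by (intro sw_ev12[OF A T(1), where \<phi> = "\<lambda>u. degen X 1 1 (degen X 0 0 (face X 1 1 u))" and \<psi> = L])
      (auto simp: E.ev_comp x_proj LWM_ev A_carrier intro!: tlin A_id)
  have "(?f \<otimes>\<^bsub>cgroup CT ?A2\<^esub> ?g) (pp x (pI y z)) = sweedler A ?A2 x (\<lambda>x1 x2. sweedler T ?A2 (pI y z)
      (\<lambda>q1 q2. ?f (pp x1 q1) \<otimes>\<^bsub>?A2\<^esub> ?g (pp x2 q2)))"
    unfolding E.ev_mult[OF p] using xA q
    by (intro sw_coalg_map_pure[OF A T(1) _ mult_bil] E.elemD(1)[OF f] E.elemD(1)[OF g]) auto
  also have "\<dots> = sweedler A ?A2 x (\<lambda>x1 x2. sweedler T ?A2 (pI y z) (\<lambda>q1 q2.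
      peiffer x1 (W q1) \<otimes>\<^bsub>?A2\<^esub> ad ?A2 (degen X 1 1 (degen X 0 0 (face X 1 1 x2))) (L q2)))"
    using xA q by (intro sw_cong A T) (auto simp: 1 2 A_carrier)
  also have "\<dots> = sweedler A ?A2 x (\<lambda>x1 x2. sweedler NH1 ?A2 y (\<lambda>y1 y2. sweedler NH1 ?A2 z (\<lambda>z1 z2.
      peiffer x1 (W (pI y1 z1)) \<otimes>\<^bsub>?A2\<^esub>
      ad ?A2 (degen X 1 1 (degen X 0 0 (face X 1 1 x2))) (L (pI y2 z2)))))"
    using xA y z LWM_in LWM_lin
    by (intro sw_cong A sw_tensor) (auto simp: A_carrier intro!: tlin)
  also have "\<dots> = sweedler A ?A2 x (\<lambda>x1 x2. sweedler NH1 ?A2 y (\<lambda>y1 y2. sweedler NH1 ?A2 z (\<lambda>z1 z2.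
      peiffer x1 (ad ?A1 y1 z1) \<otimes>\<^bsub>?A2\<^esub>
      ad ?A2 (degen X 1 1 (degen X 0 0 (face X 1 1 x2))) (peiffer y2 z2))))"
    using xA y z by (intro sw_cong A) (auto simp: LWM_pure)
  finally show ?thesis using 0 by (simp add: E.G.lift_mult_l[OF x3' yz'])
qed

text \<open>Evaluating the right-hand side splits \<open>x\<close> and \<open>y \<otimes> z\<close> into three components each. Of the
  components of \<open>y \<otimes> z\<close>, the first two enter only through \<open>y\<close> and the last one only through \<open>z\<close>.\<close>

lemma peiffer_mult_r0:
  assumes x: "x \<in> moore_carrier R X 1" and y: "y \<in> moore_carrier R X 1" and z: "z \<in> moore_carrier R X 1"
  shows "peiffer x (y \<otimes>\<^bsub>level X 1\<^esub> z) = sweedler A (level X 2) x (\<lambda>x1 xx. sweedler A (level X 2) xx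
    (\<lambda>x2 x3. sweedler NH1 (level X 2) y (\<lambda>y1 y2. peiffer x1 y1 \<otimes>\<^bsub>level X 2\<^esub>
      ad (level X 2) (degen X 1 1 (ad (level X 1) (degen X 0 0 (face X 1 1 x2)) y2)) (peiffer x3 z))))"
proof -
  let ?A1 = "level X 1" and ?A2 = "level X 2"
  let ?m = "y3' \<otimes>\<^bsub>cgroup CT ?A1\<^esub> z3'" and ?c = "E.G.conj1 b' y3'"
  let ?v = "compose (carrier CT) (degen X 1 1) ?c"
  let ?f = "E.G.lift x3' y3'" and ?h = "E.G.lift x3' z3'" let ?g = "E.G.conj2 ?v ?h"
  have v: "?v \<in> carrier (cgroup CT ?A2)" and m: "?m \<in> carrier (cgroup CT ?A1)"
    and f: "?f \<in> carrier (cgroup CT ?A2)" and h: "?h \<in> carrier (cgroup CT ?A2)"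
    and g: "?g \<in> carrier (cgroup CT ?A2)" and c: "?c \<in> carrier (cgroup CT ?A1)"
    using xc bc yzc by simp_all
  have q: "pI y z \<in> carrier T" using y z by simp
  have xA: "x \<in> carrier A" using x by (simp add: A1)
  have p: "pp x (pI y z) \<in> carrier CT" by (rule p_in[OF x q])
  have 0: "E.G.lift x3' ?m (pp x (pI y z)) = peiffer x (M (pI y z))"
    unfolding E.ev_lift[OF xc m p] using xA q LWM_in LWM_lin T
    by (intro sw_ev12[OF A T(1), where \<phi> = "\<lambda>x. x" and \<psi> = M])
      (auto simp: x_proj LWM_ev A_carrier intro!: tlin A_id)
  have 1: "?f (pp u q) = peiffer u (fst' q)" if "u \<in> moore_carrier R X 1" "q \<in> carrier T" for u q
    unfolding E.ev_lift[OF xc yzc(1) p_in[OF that]] using that fs_in T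
    by (intro sw_ev12[OF A T(1), where \<phi> = "\<lambda>x. x" and \<psi> = fst'])
      (auto simp: x_proj yz_proj A_carrier intro!: tlin A_id)
  have 2: "?h (pp u q) = peiffer u (snd' q)" if "u \<in> moore_carrier R X 1" "q \<in> carrier T" for u q
    unfolding E.ev_lift[OF xc yzc(2) p_in[OF that]] using that fs_in T
    by (intro sw_ev12[OF A T(1), where \<phi> = "\<lambda>x. x" and \<psi> = snd'])
      (auto simp: x_proj yz_proj A_carrier intro!: tlin A_id)
  have 3: "?c (pp u q) = ad ?A1 (degen X 0 0 (face X 1 1 u)) (fst' q)"
    if "u \<in> moore_carrier R X 1" "q \<in> carrier T" for u q
    unfolding E.ev_conj1[OF bc yzc(1) p_in[OF that]] using that fs_in T
    by (intro sw_ev12[OF A T(1), where \<phi> = "\<lambda>u. degen X 0 0 (face X 1 1 u)" and \<psi> = fst'])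
      (auto simp: E.ev_comp x_proj yz_proj A_carrier intro!: tlin A_id)
  have 4: "?g (pp u q) = sweedler A ?A2 u (\<lambda>x2 x3. sweedler T ?A2 q (\<lambda>q2 q3.
      ad ?A2 (degen X 1 1 (ad ?A1 (degen X 0 0 (face X 1 1 x2)) (fst' q2))) (peiffer x3 (snd' q3))))"
    if u: "u \<in> moore_carrier R X 1" and q: "q \<in> carrier T" for u q
  proof -
    have uA: "u \<in> carrier A" using u by (simp add: A1)
    have "?g (pp u q) = sweedler A ?A2 u (\<lambda>x2 x3. sweedler T ?A2 q (\<lambda>q2 q3.
        ad ?A2 (?v (pp x2 q2)) (?h (pp x3 q3))))"
      unfolding E.ev_conj2[OF v h p_in[OF u q]] using uA q
      by (intro sw_coalg_map_pure[OF A T(1) _ ad_bil] E.elemD(1)[OF v] E.elemD(1)[OF h]) auto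
    then show ?thesis
      using uA q p_in
      by (simp, intro sw_cong A T) (auto simp: E.ev_comp 2 3 A_carrier)
  qed
  let ?G = "\<lambda>x1 x2 x3 y1 y2 z. peiffer x1 y1 \<otimes>\<^bsub>?A2\<^esub>
      ad ?A2 (degen X 1 1 (ad ?A1 (degen X 0 0 (face X 1 1 x2)) y2)) (peiffer x3 z)"
  have "(?f \<otimes>\<^bsub>cgroup CT ?A2\<^esub> ?g) (pp x (pI y z)) = sweedler A ?A2 x (\<lambda>x1 xx. sweedler T ?A2 (pI y z)
      (\<lambda>q1 q'. ?f (pp x1 q1) \<otimes>\<^bsub>?A2\<^esub> ?g (pp xx q')))"
    unfolding E.ev_mult[OF p] using xA q
    by (intro sw_coalg_map_pure[OF A T(1) _ mult_bil] E.elemD(1)[OF f] E.elemD(1)[OF g]) auto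
  also have "\<dots> = sweedler A ?A2 x (\<lambda>x1 xx. sweedler T ?A2 (pI y z) (\<lambda>q1 q'.
      sweedler A ?A2 xx (\<lambda>x2 x3. sweedler T ?A2 q' (\<lambda>q2 q3. ?G x1 x2 x3 (fst' q1) (fst' q2) (snd' q3)))))"
  proof (intro sw_cong A T)
    fix x1 xx q1 q' assume a: "x1 \<in> carrier A" "xx \<in> carrier A" "q1 \<in> carrier T" "q' \<in> carrier T"
    then have "?f (pp x1 q1) \<otimes>\<^bsub>?A2\<^esub> ?g (pp xx q') = peiffer x1 (fst' q1) \<otimes>\<^bsub>?A2\<^esub>
        sweedler A ?A2 xx (\<lambda>x2 x3. sweedler T ?A2 q' (\<lambda>q2 q3.
      ad ?A2 (degen X 1 1 (ad ?A1 (degen X 0 0 (face X 1 1 x2)) (fst' q2))) (peiffer x3 (snd' q3))))"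
      by (simp add: 1 4 A_carrier)
    also have "\<dots> = sweedler A ?A2 xx (\<lambda>x2 x3. peiffer x1 (fst' q1) \<otimes>\<^bsub>?A2\<^esub> sweedler T ?A2 q' (\<lambda>q2 q3.
      ad ?A2 (degen X 1 1 (ad ?A1 (degen X 0 0 (face X 1 1 x2)) (fst' q2))) (peiffer x3 (snd' q3))))"
      using a A T fs_in by (intro sw_map lin_mult_r lin_id) (auto simp: A_carrier)
    also have "\<dots> = sweedler A ?A2 xx (\<lambda>x2 x3. sweedler T ?A2 q' (\<lambda>q2 q3. ?G x1 x2 x3 (fst' q1) (fst' q2) (snd' q3)))"
      using a A T fs_in by (intro sw_cong sw_map lin_mult_r lin_id) (auto simp: A_carrier)
    finally show "?f (pp x1 q1) \<otimes>\<^bsub>?A2\<^esub> ?g (pp xx q') = \<dots>" .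
  qed (use xA q in auto)
  also have "\<dots> = sweedler A ?A2 x (\<lambda>x1 xx. sweedler A ?A2 xx (\<lambda>x2 x3. sweedler T ?A2 (pI y z) (\<lambda>q1 q'.
      sweedler T ?A2 q' (\<lambda>q2 q3. ?G x1 x2 x3 (fst' q1) (fst' q2) (snd' q3)))))"
    using xA q A T fs_in by (intro sw_cong sw_swap) (auto simp: A_carrier)
  also have "\<dots> = sweedler A ?A2 x (\<lambda>x1 xx. sweedler A ?A2 xx (\<lambda>x2 x3. sweedler NH1 ?A2 y (\<lambda>y1 y2.
      ?G x1 x2 x3 y1 y2 z)))"
  proof (intro sw_cong A)
    fix x1 xx x2 x3 assume a: "x1 \<in> carrier A" "x2 \<in> carrier A" "x3 \<in> carrier A"
    show "sweedler T ?A2 (pI y z) (\<lambda>q1 q'. sweedler T ?A2 q' (\<lambda>q2 q3.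
        ?G x1 x2 x3 (fst' q1) (fst' q2) (snd' q3))) = sweedler NH1 ?A2 y (\<lambda>y1 y2. ?G x1 x2 x3 y1 y2 z)"
      using a y z by (intro sw_proj_112[where F = "?G x1 x2 x3"]) (auto simp: A_carrier intro!: mlin)
  qed (use xA in auto)
  finally show ?thesis using 0 y z by (simp add: E.G.lift_mult_r[OF x3' yz'] LWM_pure)
qed

end

end

lemmas peiffer_equivariant = peiffer_equivariant0[OF level_facts(2) HOL.refl]
lemmas peiffer_mult_l = peiffer_mult_l0[OF IK_facts(3) HOL.refl]
lemmas peiffer_mult_r = peiffer_mult_r0[OF IK_facts(3) HOL.refl]

end


section \<open>The 2-crossed module of a simplicial Hopf algebra\<close>

context ground_field
begin

lemma hopf_mapsI:
  assumes "f \<in> extensional (carrier A)" "coalg_map A B f"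
    "\<And>x y. x \<in> carrier A \<Longrightarrow> y \<in> carrier A \<Longrightarrow> f (x \<otimes>\<^bsub>A\<^esub> y) = f x \<otimes>\<^bsub>B\<^esub> f y" "f \<one>\<^bsub>A\<^esub> = \<one>\<^bsub>B\<^esub>"
  shows "f \<in> hopf_maps R A B"
  using assms by (simp add: hopf_maps_def algebra_maps_def coalg_map_def)

lemma hopf_maps_restrict:
  assumes A: "hopf A" and f: "coalg_map A B f"
    and "\<And>x y. x \<in> carrier A \<Longrightarrow> y \<in> carrier A \<Longrightarrow> f (x \<otimes>\<^bsub>A\<^esub> y) = f x \<otimes>\<^bsub>B\<^esub> f y" "f \<one>\<^bsub>A\<^esub> = \<one>\<^bsub>B\<^esub>"
  shows "restrict f (carrier A) \<in> hopf_maps R A B"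
proof (rule hopf_mapsI)
  show "coalg_map A B (restrict f (carrier A))"
    by (rule coalg_map_cong[OF _ f]) (use A in simp_all)
qed (use assms in simp_all)

lemma id_hopf_map: "hopf A \<Longrightarrow> (\<lambda>x \<in> carrier A. x) \<in> hopf_maps R A A"
  by (rule hopf_maps_restrict) (simp_all add: coalg_map_def sw_pure)

lemma compose_hopf_map:
  assumes A: "hopf A" and B: "hopf B" and C: "hopf C"
    and f: "f \<in> hopf_maps R A B" and g: "g \<in> hopf_maps R B C"
  shows "compose (carrier A) g f \<in> hopf_maps R A C"
  unfolding compose_def
  using A hopf_mapD[OF f] hopf_mapD[OF g] B C
  by (intro hopf_maps_restrict coalg_map_comp[of A B f C g]) simp_all

end

context simplicial_hopf2
begin

lemma bd2_in_NH1:
  assumes k: "k \<in> moore_carrier R X 2"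
  shows "face X 2 2 k \<in> moore_carrier R X 1"
    and bd1_bd2: "face X 1 1 (face X 2 2 k) = counit (level X 2) k \<odot>\<^bsub>level X 0\<^esub> \<one>\<^bsub>level X 0\<^esub>"
proof -
  interpret E: generalized_elements R X NH2 by (rule elements_of) simp
  let ?k = "restrict (\<lambda>x. x) (carrier NH2)"
  have c: "coalg_map NH2 NH2 (\<lambda>x. x)" by (simp add: coalg_map_def sw_pure)
  have k': "?k \<in> E.G.N2" by (rule E.K_elem[OF c])
  show "face X 2 2 k \<in> moore_carrier R X 1"
    using E.N1_elem[OF E.G.bd_in_N1[OF k'], of k] k by (simp add: compose_eq)
  show "face X 1 1 (face X 2 2 k) = counit (level X 2) k \<odot>\<^bsub>level X 0\<^esub> \<one>\<^bsub>level X 0\<^esub>"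
    using fun_cong[OF E.G.bd_bd[OF k'], of k] k by (simp add: compose_eq cgroup_one)
qed

lemma moore_bd_simps [simp]:
  "k \<in> moore_carrier R X 2 \<Longrightarrow> moore_bd R X 2 k = face X 2 2 k"
  "x \<in> moore_carrier R X 1 \<Longrightarrow> moore_bd R X 1 x = face X 1 1 x"
  by (simp_all add: moore_bd_def)

lemma NH_closed [simp]:
  "k \<in> moore_carrier R X 2 \<Longrightarrow> antipode (level X 2) k \<in> moore_carrier R X 2"
  "k \<in> moore_carrier R X 2 \<Longrightarrow> l \<in> moore_carrier R X 2 \<Longrightarrow>
    k \<otimes>\<^bsub>level X 2\<^esub> l \<in> moore_carrier R X 2"
  "x \<in> moore_carrier R X 1 \<Longrightarrow> antipode (level X 1) x \<in> moore_carrier R X 1"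
  "x \<in> moore_carrier R X 1 \<Longrightarrow> y \<in> moore_carrier R X 1 \<Longrightarrow>
    x \<otimes>\<^bsub>level X 1\<^esub> y \<in> moore_carrier R X 1"
  "\<one>\<^bsub>level X 2\<^esub> \<in> moore_carrier R X 2" "\<one>\<^bsub>level X 1\<^esub> \<in> moore_carrier R X 1"
  using antipode_closed[of NH2 k] antipode_closed[of NH1 x]
    alg_simps(1)[of NH2 k l] alg_simps(1)[of NH1 x y] alg_simps(2)[of NH2] alg_simps(2)[of NH1]
  by simp_all

lemma bd2_hopf_map: "moore_bd R X 2 \<in> hopf_maps R NH2 NH1"
proof -
  have S: "Suc 0 = 1" by simp
  have "coalg_map NH2 (level X 1) (face X 2 2)"
    by (rule coalg_map_comp[OF _ _ incl2 low_coalg_map(8)]) simp_all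
  then have "coalg_map NH2 NH1 (face X 2 2)"
    using moore_into[of NH2 0 "face X 2 2"] bd2_in_NH1(1) by (simp add: S)
  from hopf_maps_restrict[OF _ this] show ?thesis
    using hopf_mapD(6,7)[OF low_maps(8)] by (simp add: moore_bd_def)
qed

lemma bd1_hopf_map: "moore_bd R X 1 \<in> hopf_maps R NH1 (level X 0)"
proof -
  have "coalg_map NH1 (level X 0) (face X 1 1)"
    by (rule coalg_map_comp[OF _ _ incl1 low_coalg_map(5)]) simp_all
  from hopf_maps_restrict[OF _ this] show ?thesis
    using hopf_mapD(6,7)[OF low_maps(5)] by (simp add: moore_bd_def)
qed

lemma retr1: "subcoalg (level X 1) (moore_carrier R X 1) (retr 1)"
  and retr2: "subcoalg (level X 2) (moore_carrier R X 2) (retr 2)"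
  using retr[of 0] retr[of 1] by (simp_all add: eval_nat_numeral One_nat_def)

lemma act_mid_module: "module_bialgebra R (level X 0) NH1 (\<lambda>n m. ad (level X 1) (degen X 0 0 n) m)"
  unfolding moore_def
  by (rule ad_module_bialgebra[OF level_hopf level_hopf retr1, where s = "degen X 0 0"])
    (use low_coalg_map(1) hopf_mapD(6,7)[OF low_maps(1)] IK_facts(1) in \<open>simp_all add: ad_in_I flip: moore_def\<close>)

lemma act_top_module:
  "module_bialgebra R (level X 0) NH2 (\<lambda>n l. ad (level X 2) (degen X 1 1 (degen X 0 0 n)) l)"
proof -
  have "coalg_map (level X 0) (level X 2) (\<lambda>n. degen X 1 1 (degen X 0 0 n))"
    by (rule coalg_map_comp[OF _ _ low_coalg_map(1,3)]) simp_all
  then show ?thesis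
    unfolding moore_def
    by (intro ad_module_bialgebra[OF level_hopf level_hopf retr2, where s = "\<lambda>n. degen X 1 1 (degen X 0 0 n)"])
      (use hopf_mapD(6,7)[OF low_maps(1)] hopf_mapD(6,7)[OF low_maps(3)] IK_facts(2)
        in \<open>simp_all add: ad_in_K flip: moore_def\<close>)
qed

lemma lifting_act_eq:
  assumes x: "x \<in> moore_carrier R X 1" and k: "k \<in> moore_carrier R X 2"
  shows "lifting_act NH2 (moore_bd R X 2) peiffer x k = ad (level X 2) (degen X 1 1 x) k"
proof -
  have "lifting_act NH2 (moore_bd R X 2) peiffer x k = sweedler NH2 (level X 2) k (\<lambda>k1 k2.
      k1 \<otimes>\<^bsub>level X 2\<^esub> peiffer (face X 2 2 (antipode (level X 2) k2)) x)"
    unfolding lifting_act_def sw_moore_target moore_ops using k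
    by (intro sw_cong) simp_all
  then show ?thesis by (simp add: lifting_act_ad[OF k x])
qed

text \<open>The action is the adjoint action of \<open>s\<^sub>1\<close>, and the Peiffer identity says that \<open>s\<^sub>1d\<^sub>2u\<close> and \<open>u\<close> act alike
  on \<open>NH\<^sub>2\<close>.\<close>

lemma lifting_crossed_module:
  "crossed_module R NH1 NH2 (moore_bd R X 2) (lifting_act NH2 (moore_bd R X 2) peiffer)"
proof (intro crossed_module.intro crossed_module_axioms.intro)
  let ?act = "lifting_act NH2 (moore_bd R X 2) peiffer"
  show "hopf NH1" "hopf NH2" by simp_all
  have "coalg_map NH1 (level X 2) (degen X 1 1)"
    by (rule coalg_map_comp[OF _ _ incl1 low_coalg_map(3)]) simp_all
  then show "module_bialgebra R NH1 NH2 ?act"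
    unfolding moore_def[of R X 2]
    by (intro ad_module_bialgebra[OF level_hopf _ retr2, where s = "degen X 1 1"])
      (use hopf_mapD(6,7)[OF low_maps(3)] in
        \<open>simp_all add: ad_in_K lifting_act_eq flip: moore_def\<close>)
  show "moore_bd R X 2 \<in> hopf_maps R NH2 NH1" by (rule bd2_hopf_map)
  show "moore_bd R X 2 (?act x v) = ad NH1 x (moore_bd R X 2 v)"
    if "x \<in> carrier NH1" "v \<in> carrier NH2" for x v
  proof -
    have x: "x \<in> moore_carrier R X 1" and v: "v \<in> moore_carrier R X 2" using that by simp_all
    have "face X 2 2 (degen X 1 1 x) = x"
      using face_degen_Suc[of 1 1 x] x by (simp add: Suc_1)
    then have "face X 2 2 (ad (level X 2) (degen X 1 1 x) v) = ad (level X 1) x (face X 2 2 v)"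
      using x v hopf_map_ad[OF level_hopf level_hopf low_maps(8)] by simp
    moreover have "ad NH1 x (face X 2 2 v) = ad (level X 1) x (face X 2 2 v)"
      
      using ad_moore[of x 0 "face X 2 2 v", folded One_nat_def] x v by (simp add: bd2_in_NH1)
    ultimately show ?thesis
      using x v by (simp add: lifting_act_eq ad_in_K)
  qed
  show "?act (moore_bd R X 2 u) v = ad NH2 u v" if "u \<in> carrier NH2" "v \<in> carrier NH2" for u v
    using that ad_moore[of u 1 v, unfolded Suc_1]
    by (simp add: lifting_act_eq bd2_in_NH1 ad_degen_bd)
qed

theorem two_crossed:
  "two_crossed_module R (level X 0) NH1 NH2 (moore_bd R X 2) (moore_bd R X 1)
    (\<lambda>n m. ad (level X 1) (degen X 0 0 n) m)
    (\<lambda>n l. ad (level X 2) (degen X 1 1 (degen X 0 0 n)) l) peiffer"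
proof (intro two_crossed_module.intro two_crossed_module_axioms.intro)
  let ?A0 = "level X 0" and ?A1 = "level X 1" and ?A2 = "level X 2"
  let ?act1 = "\<lambda>n m. ad ?A1 (degen X 0 0 n) m"
  let ?act2 = "\<lambda>n l. ad ?A2 (degen X 1 1 (degen X 0 0 n)) l"
  let ?bd2 = "moore_bd R X 2" and ?bd1 = "moore_bd R X 1"
  show "hopf ?A0" "hopf NH1" "hopf NH2" by simp_all
  show "module_bialgebra R ?A0 NH1 ?act1" by (rule act_mid_module)
  show "module_bialgebra R ?A0 NH2 ?act2" by (rule act_top_module)
  show "?bd2 \<in> hopf_maps R NH2 NH1" by (rule bd2_hopf_map)
  show "?bd1 \<in> hopf_maps R NH1 ?A0" by (rule bd1_hopf_map)
  show "crossed_module R NH1 NH2 ?bd2 (lifting_act NH2 ?bd2 peiffer)" by (rule lifting_crossed_module)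
  have ad1: "ad NH1 x y = ad ?A1 x y" if "x \<in> moore_carrier R X 1" "y \<in> moore_carrier R X 1" for x y
    using ad_moore[of x 0 y, folded One_nat_def] that by simp
  have ad2: "ad NH2 x y = ad ?A2 x y" if "x \<in> moore_carrier R X 2" "y \<in> moore_carrier R X 2" for x y
    using ad_moore[of x 1 y, unfolded Suc_1] that by simp
  have pk: "lin NH1 NH2 f" if "lin NH1 ?A2 f" "\<And>x. x \<in> moore_carrier R X 1 \<Longrightarrow> f x \<in> moore_carrier R X 2" for f
    using lin_to_moore[of f NH1 1] that by (simp add: Suc_1)
  show "peiffer \<in> bilinear_maps R NH1 NH1 NH2"
    by (intro bilI pk) (auto intro!: mlin simp: peiffer_in_K)
  fix k assume "k \<in> carrier NH2"
  then have k: "k \<in> moore_carrier R X 2" by simp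
  show "?bd1 (?bd2 k) = counit NH2 k \<odot>\<^bsub>?A0\<^esub> \<one>\<^bsub>?A0\<^esub>"
    using k by (simp add: bd2_in_NH1)
  {
    fix a assume a: "a \<in> carrier ?A0"
    have "face X 2 2 (degen X 1 1 (degen X 0 0 a)) = degen X 0 0 a"
      using face_degen_Suc[of 1 1 "degen X 0 0 a"] a by (simp add: Suc_1)
    then show "?bd2 (?act2 a k) = ?act1 a (?bd2 k)"
      using a k hopf_map_ad[OF level_hopf level_hopf low_maps(8)] by (simp add: ad_in_K)
  next
    fix l assume "l \<in> carrier NH2"
    then have l: "l \<in> moore_carrier R X 2" by simp
    have "sweedler NH2 ?A2 l (\<lambda>l1 l2. ad NH2 k l1 \<otimes>\<^bsub>?A2\<^esub> antipode ?A2 l2) =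
        sweedler NH2 ?A2 l (\<lambda>l1 l2. ad ?A2 k l1 \<otimes>\<^bsub>?A2\<^esub> antipode ?A2 l2)"
      using k l by (intro sw_cong) (simp_all add: ad2)
    then show "peiffer (?bd2 k) (?bd2 l) =
        sweedler NH2 NH2 l (\<lambda>l1 l2. ad NH2 k l1 \<otimes>\<^bsub>NH2\<^esub> antipode NH2 l2)"
      using k l by (simp add: sw_moore_target peiffer_bd_bd)
  next
    fix x assume "x \<in> carrier NH1"
    then have x: "x \<in> moore_carrier R X 1" by simp
    have "sweedler NH2 ?A2 k (\<lambda>k1 k2. sweedler NH1 ?A2 x (\<lambda>x1 x2.
        peiffer (?bd2 k1) x1 \<otimes>\<^bsub>?A2\<^esub> peiffer x2 (?bd2 k2))) =
      sweedler NH2 ?A2 k (\<lambda>k1 k2. sweedler NH1 ?A2 x (\<lambda>x1 x2.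
        peiffer (face X 2 2 k1) x1 \<otimes>\<^bsub>?A2\<^esub> peiffer x2 (face X 2 2 k2)))"
      using k x by (intro sw_cong) simp_all
    then show "sweedler NH2 NH2 k (\<lambda>k1 k2. sweedler NH1 NH2 x (\<lambda>x1 x2.
        peiffer (?bd2 k1) x1 \<otimes>\<^bsub>NH2\<^esub> peiffer x2 (?bd2 k2))) =
      sweedler NH2 NH2 k (\<lambda>k1 k2. k1 \<otimes>\<^bsub>NH2\<^esub> ?act2 (?bd1 x) (antipode NH2 k2))"
      using k x by (simp add: sw_moore_target peiffer_bd_mixed)
  }
next
  let ?A0 = "level X 0" and ?A1 = "level X 1" and ?A2 = "level X 2"
  let ?act1 = "\<lambda>n m. ad ?A1 (degen X 0 0 n) m"
  let ?act2 = "\<lambda>n l. ad ?A2 (degen X 1 1 (degen X 0 0 n)) l"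
  let ?bd2 = "moore_bd R X 2" and ?bd1 = "moore_bd R X 1"
  have ad1: "ad NH1 x y = ad ?A1 x y" if "x \<in> moore_carrier R X 1" "y \<in> moore_carrier R X 1" for x y
    using ad_moore[of x 0 y, folded One_nat_def] that by simp
  fix x assume "x \<in> carrier NH1"
  then have x: "x \<in> moore_carrier R X 1" by simp
  {
    fix a assume a: "a \<in> carrier ?A0"
    have "face X 1 1 (degen X 0 0 a) = a"
      using face_degen_Suc[of 0 0 a] a by (simp add: One_nat_def)
    then show "?bd1 (?act1 a x) = ad ?A0 a (?bd1 x)"
      using a x hopf_map_ad[OF level_hopf level_hopf low_maps(5)] by (simp add: ad_in_I)
  }
  fix y assume "y \<in> carrier NH1"
  then have y: "y \<in> moore_carrier R X 1" by simp
  {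
    fix a assume a: "a \<in> carrier ?A0"
    show "?act2 a (peiffer x y) = sweedler ?A0 NH2 a (\<lambda>a1 a2. peiffer (?act1 a1 x) (?act1 a2 y))"
      using a x y by (simp add: sw_moore_target peiffer_equivariant)
  next
    have "sweedler NH1 ?A1 x (\<lambda>x1 x2. sweedler NH1 ?A1 y (\<lambda>y1 y2.
        ad NH1 x1 y1 \<otimes>\<^bsub>?A1\<^esub> ?act1 (?bd1 x2) (antipode ?A1 y2))) =
      sweedler NH1 ?A1 x (\<lambda>x1 x2. sweedler NH1 ?A1 y (\<lambda>y1 y2.
        ad ?A1 x1 y1 \<otimes>\<^bsub>?A1\<^esub> ?act1 (face X 1 1 x2) (antipode ?A1 y2)))"
      using x y by (intro sw_cong) (simp_all add: ad1)
    then show "?bd2 (peiffer x y) = sweedler NH1 NH1 x (\<lambda>x1 x2. sweedler NH1 NH1 y (\<lambda>y1 y2.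
        ad NH1 x1 y1 \<otimes>\<^bsub>NH1\<^esub> ?act1 (?bd1 x2) (antipode NH1 y2)))"
      using x y by (simp add: sw_moore_target peiffer_in_K bd_peiffer)
  next
    fix z assume "z \<in> carrier NH1"
    then have z: "z \<in> moore_carrier R X 1" by simp
    let ?l = "lifting_act NH2 ?bd2 peiffer"
    have "sweedler NH1 ?A2 x (\<lambda>x1 w. sweedler NH1 ?A2 w (\<lambda>x2 x3. sweedler NH1 ?A2 y (\<lambda>y1 y2.
        peiffer x1 y1 \<otimes>\<^bsub>?A2\<^esub> ?l (?act1 (?bd1 x2) y2) (peiffer x3 z)))) =
      sweedler NH1 ?A2 x (\<lambda>x1 w. sweedler NH1 ?A2 w (\<lambda>x2 x3. sweedler NH1 ?A2 y (\<lambda>y1 y2.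
        peiffer x1 y1 \<otimes>\<^bsub>?A2\<^esub> ad ?A2 (degen X 1 1 (?act1 (face X 1 1 x2) y2)) (peiffer x3 z))))"
      using x y z by (intro sw_cong) (simp_all add: lifting_act_eq ad_in_I peiffer_in_K)
    then show "peiffer x (y \<otimes>\<^bsub>NH1\<^esub> z) = sweedler3 NH1 NH2 x (\<lambda>x1 x2 x3. sweedler NH1 NH2 y (\<lambda>y1 y2.
        peiffer x1 y1 \<otimes>\<^bsub>NH2\<^esub> ?l (?act1 (?bd1 x2) y2) (peiffer x3 z)))"
      using x y z by (simp add: sweedler3_def sw_moore_target peiffer_mult_r)
    have "sweedler NH1 ?A2 x (\<lambda>x1 x2. sweedler NH1 ?A2 y (\<lambda>y1 y2. sweedler NH1 ?A2 z (\<lambda>z1 z2.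
        peiffer x1 (ad NH1 y1 z1) \<otimes>\<^bsub>?A2\<^esub> ?act2 (?bd1 x2) (peiffer y2 z2)))) =
      sweedler NH1 ?A2 x (\<lambda>x1 x2. sweedler NH1 ?A2 y (\<lambda>y1 y2. sweedler NH1 ?A2 z (\<lambda>z1 z2.
        peiffer x1 (ad ?A1 y1 z1) \<otimes>\<^bsub>?A2\<^esub> ?act2 (face X 1 1 x2) (peiffer y2 z2))))"
      using x y z by (intro sw_cong) (simp_all add: ad1)
    then show "peiffer (x \<otimes>\<^bsub>NH1\<^esub> y) z = sweedler NH1 NH2 x (\<lambda>x1 x2. sweedler NH1 NH2 y (\<lambda>y1 y2.
        sweedler NH1 NH2 z (\<lambda>z1 z2.
          peiffer x1 (ad NH1 y1 z1) \<otimes>\<^bsub>NH2\<^esub> ?act2 (?bd1 x2) (peiffer y2 z2))))"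
      using x y z by (simp add: sw_moore_target peiffer_mult_l)
  }
qed

end

section \<open>Functoriality\<close>

context ground_field
begin

context
  fixes X Y :: "('k, 'a) simp_hopf" and f :: "nat \<Rightarrow> 'a \<Rightarrow> 'a"
  assumes X: "simplicial_hopf2 R X" and Y: "simplicial_hopf2 R Y" and f: "f \<in> simp_hopf_maps R X Y"
begin

interpretation X: simplicial_hopf2 R X by (rule X)
interpretation Y: simplicial_hopf2 R Y by (rule Y)

lemma f_hopf: "f n \<in> hopf_maps R (level X n) (level Y n)"
  using f by (simp add: simp_hopf_maps_def)

lemma f_face: "i \<le> Suc n \<Longrightarrow> x \<in> carrier (level X (Suc n)) \<Longrightarrow>
    f n (face X (Suc n) i x) = face Y (Suc n) i (f (Suc n) x)"
  using f by (simp add: simp_hopf_maps_def)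

lemma f_degen: "j \<le> n \<Longrightarrow> x \<in> carrier (level X n) \<Longrightarrow>
    f (Suc n) (degen X n j x) = degen Y n j (f n x)"
  using f by (simp add: simp_hopf_maps_def)

text \<open>The inclusion of \<open>NH\<^sub>n\<close> into \<open>H\<^sub>n\<close> is a generalized element that the faces trivialize, and its
  composite with a simplicial map is again one.\<close>

lemma f_moore:
  assumes x: "x \<in> moore_carrier R X (Suc m)"
  shows "f (Suc m) x \<in> moore_carrier R Y (Suc m)"
proof -
  have C: "cocoalgebra (moore R X (Suc m))" using X.moore_hopf by simp
  have c: "coalg_map (moore R X (Suc m)) (level Y (Suc m)) (f (Suc m))"
    by (rule coalg_map_comp[OF C _ X.moore_incl hopf_mapD(1)[OF f_hopf]]) simp_all
  show ?thesis
  proof (rule Y.moore_coalg_map[OF C c, of x])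
    show "x \<in> carrier (moore R X (Suc m))" using x by simp
    fix c i assume "c \<in> carrier (moore R X (Suc m))" and i: "i \<le> m"
    then have c: "c \<in> moore_carrier R X (Suc m)" by simp
    have "face Y (Suc m) i (f (Suc m) c) = f m (face X (Suc m) i c)"
      using i X.moore_sub_carrier[OF c] by (simp add: f_face)
    then show "face Y (Suc m) i (f (Suc m) c) =
        counit (moore R X (Suc m)) c \<odot>\<^bsub>level Y m\<^esub> \<one>\<^bsub>level Y m\<^esub>"
      using X.moore_sub_carrier[OF c] hopf_mapD(7)[OF f_hopf]
      by (simp add: X.moore_val[OF c i] lin_smult[OF hopf_mapD(2)[OF f_hopf]])
  qed
qed

lemma f_moore_hopf_map:
  "restrict (f (Suc m)) (moore_carrier R X (Suc m)) \<in> hopf_maps R (moore R X (Suc m)) (moore R Y (Suc m))"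
proof -
  have C: "cocoalgebra (moore R X (Suc m))" using X.moore_hopf by simp
  have "coalg_map (moore R X (Suc m)) (level Y (Suc m)) (f (Suc m))"
    by (rule coalg_map_comp[OF C _ X.moore_incl hopf_mapD(1)[OF f_hopf]]) simp_all
  then have "coalg_map (moore R X (Suc m)) (moore R Y (Suc m)) (f (Suc m))"
    using f_moore by (intro Y.moore_into[OF C]) simp_all
  from hopf_maps_restrict[OF X.moore_hopf this] show ?thesis
    using hopf_mapD(6,7)[OF f_hopf] X.moore_sub_carrier by simp
qed

lemma f_peiffer:
  assumes x: "x \<in> carrier (level X 1)" and y: "y \<in> carrier (level X 1)"
  shows "f 2 (X.peiffer x y) = Y.peiffer (f 1 x) (f 1 y)"
proof -
  let ?X1 = "level X 1" and ?X2 = "level X 2" and ?Y1 = "level Y 1" and ?Y2 = "level Y 2"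
  have s: "f 2 (degen X 1 j u) = degen Y 1 j (f 1 u)" if "j \<le> 1" "u \<in> carrier ?X1" for j u
    using f_degen[of j 1 u] that by (simp add: Suc_1)
  note f1 = hopf_mapD[OF f_hopf[of 1]] and f2 = hopf_mapD[OF f_hopf[of 2]]
  note ml = Y.mlin lin_comp[OF f1(2)]
  let ?P = "\<lambda>x1 x2 y1 y2. ad ?Y2 (degen Y 1 1 x1) (degen Y 1 1 y1) \<otimes>\<^bsub>?Y2\<^esub>
      antipode ?Y2 (ad ?Y2 (degen Y 1 0 x2) (degen Y 1 1 y2))"
  have "f 2 (X.peiffer x y) = sweedler ?X1 ?Y2 x (\<lambda>x1 x2. f 2 (sweedler ?X1 ?X2 y (\<lambda>y1 y2.
      ad ?X2 (degen X 1 1 x1) (degen X 1 1 y1) \<otimes>\<^bsub>?X2\<^esub>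
      antipode ?X2 (ad ?X2 (degen X 1 0 x2) (degen X 1 1 y2)))))"
    unfolding X.peiffer_def using x y f2(2) by (intro sw_map) simp_all
  also have "\<dots> = sweedler ?X1 ?Y2 x (\<lambda>x1 x2. sweedler ?X1 ?Y2 y (\<lambda>y1 y2. f 2 (
      ad ?X2 (degen X 1 1 x1) (degen X 1 1 y1) \<otimes>\<^bsub>?X2\<^esub>
      antipode ?X2 (ad ?X2 (degen X 1 0 x2) (degen X 1 1 y2)))))"
    using x y f2(2) by (intro sw_cong sw_map) simp_all
  also have "\<dots> = sweedler ?X1 ?Y2 x (\<lambda>x1 x2. sweedler ?X1 ?Y2 y (\<lambda>y1 y2. ?P (f 1 x1) (f 1 x2) (f 1 y1) (f 1 y2)))"
    using x y f2 by (intro sw_cong) (simp_all add: s hopf_map_ad[OF X.level_hopf Y.level_hopf f_hopf]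
        hopf_map_antipode[OF X.level_hopf Y.level_hopf f_hopf])
  also have "\<dots> = sweedler ?X1 ?Y2 x (\<lambda>x1 x2. sweedler ?Y1 ?Y2 (f 1 y) (\<lambda>y1 y2. ?P (f 1 x1) (f 1 x2) y1 y2))"
    using x y f1 by (intro sw_cong sw_coalg_map[symmetric]) (auto intro!: Y.mlin)
  also have "\<dots> = sweedler ?Y1 ?Y2 (f 1 x) (\<lambda>x1 x2. sweedler ?Y1 ?Y2 (f 1 y) (\<lambda>y1 y2. ?P x1 x2 y1 y2))"
    using x y f1 by (intro sw_coalg_map[symmetric]) (auto intro!: Y.mlin)
  also have "\<dots> = Y.peiffer (f 1 x) (f 1 y)" by (simp add: Y.peiffer_def)
  finally show ?thesis .
qed

lemma X2_map_in: "X2_map R X Y f \<in> two_crossed_maps R (X2_ob R X) (X2_ob R Y)"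
proof -
  have S: "Suc 0 = 1" "Suc 1 = 2" by simp_all
  note f1 = hopf_mapD[OF f_hopf[of 1]] and f2 = hopf_mapD[OF f_hopf[of 2]] and f0 = hopf_mapD[OF f_hopf[of 0]]
  have m1: "f 1 x \<in> moore_carrier R Y 1" if "x \<in> moore_carrier R X 1" for x
    using f_moore[of x 0] that by (simp add: S del: One_nat_def)
  have m2: "f 2 x \<in> moore_carrier R Y 2" if "x \<in> moore_carrier R X 2" for x
    using f_moore[of x 1] that by (simp only: S)
  have h1: "restrict (f 1) (moore_carrier R X 1) \<in> hopf_maps R X.NH1 Y.NH1"
    using f_moore_hopf_map[of 0] by (simp only: S)
  have h2: "restrict (f 2) (moore_carrier R X 2) \<in> hopf_maps R X.NH2 Y.NH2"
    using f_moore_hopf_map[of 1] by (simp only: S)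
  have d1: "f 0 (face X 1 1 x) = face Y 1 1 (f 1 x)" if "x \<in> carrier (level X 1)" for x
    using f_face[of 1 0 x] that by (simp only: S le_refl)
  have d2: "f 1 (face X 2 2 k) = face Y 2 2 (f 2 k)" if "k \<in> carrier (level X 2)" for k
    using f_face[of 2 1 k] that by (simp only: S le_refl)
  have s0: "f 1 (degen X 0 0 a) = degen Y 0 0 (f 0 a)" if "a \<in> carrier (level X 0)" for a
    using f_degen[of 0 0 a] that by (simp only: S le_refl)
  have s1: "f 2 (degen X 1 1 u) = degen Y 1 1 (f 1 u)" if "u \<in> carrier (level X 1)" for u
    using f_degen[of 1 1 u] that by (simp only: S le_refl)
  have pe: "lifting (X2_ob R X) = X.peiffer" "lifting (X2_ob R Y) = Y.peiffer"
    by (simp_all add: X2_ob_def X.peiffer_def Y.peiffer_def)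
  show ?thesis
    unfolding two_crossed_maps_def X2_map_def mem_Collect_eq prod.case pe
    using f_hopf[of 0] h1 h2
    by (simp add: X2_ob_def d1 d2 s0 s1 m1 m2 X.bd2_in_NH1 X.ad_in_I X.ad_in_K X.peiffer_in_K
        f_peiffer hopf_map_ad[OF X.level_hopf Y.level_hopf f_hopf] del: One_nat_def)
qed

end

lemma simp_hopf_obD: "X \<in> Ob (SimpHopf_le R 2) \<Longrightarrow> simplicial_hopf2 R X"
  by (simp add: SimpHopf_le_def simplicial_hopf2_def simplicial_hopf2_axioms_def
      simplicial_hopf_field_def ground_field_axioms)

lemma simp_hopf_hom_ext:
  assumes "f \<in> Hom (SimpHopf_le R 2) X Y"
  shows "f n \<in> extensional (carrier (level X n))" "f n \<in> hopf_maps R (level X n) (level Y n)"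
    "f n \<in> carrier (level X n) \<rightarrow> carrier (level Y n)"
proof -
  show *: "f n \<in> hopf_maps R (level X n) (level Y n)"
    using assms by (simp add: SimpHopf_le_def simp_hopf_maps_def)
  show "f n \<in> extensional (carrier (level X n))" "f n \<in> carrier (level X n) \<rightarrow> carrier (level Y n)"
    using hopf_mapD(3,4)[OF *] by auto
qed

lemma simp_hopf_hom_in: "f \<in> Hom (SimpHopf_le R 2) X Y \<Longrightarrow> x \<in> carrier (level X n) \<Longrightarrow> f n x \<in> carrier (level Y n)"
  using simp_hopf_hom_ext(3) by blast

lemma SimpHopf_category: "category (SimpHopf_le R 2 :: (('k, 'a) simp_hopf, nat \<Rightarrow> 'a \<Rightarrow> 'a) cat)"
proof
  let ?C = "SimpHopf_le R 2 :: (('k, 'a) simp_hopf, nat \<Rightarrow> 'a \<Rightarrow> 'a) cat"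
  have Id: "Ident ?C = (\<lambda>X m. restrict (\<lambda>x. x) (carrier (level X m)))"
    and Co: "Comp ?C = (\<lambda>X Y Z g f m. compose (carrier (level X m)) (g m) (f m))"
    by (simp_all add: SimpHopf_le_def)
  {
    fix X assume "X \<in> Ob ?C"
    then interpret X: simplicial_hopf2 R X by (rule simp_hopf_obD)
    show "Ident ?C X \<in> Hom ?C X X"
      using hopf_mapD(4)[OF X.face_hopf_map] hopf_mapD(4)[OF X.degen_hopf_map]
      by (simp add: SimpHopf_le_def simp_hopf_maps_def id_hopf_map)
    fix Y f assume f: "f \<in> Hom ?C X Y"
    show "Comp ?C X X Y f (Ident ?C X) = f"
    proof
      fix n
      show "Comp ?C X X Y f (Ident ?C X) n = f n"
        by (rule extensionalityI[OF _ simp_hopf_hom_ext(1)[OF f]]) (simp_all add: Id Co compose_eq)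
    qed
    show "Comp ?C X Y Y (Ident ?C Y) f = f"
    proof
      fix n
      show "Comp ?C X Y Y (Ident ?C Y) f n = f n"
        by (rule extensionalityI[OF _ simp_hopf_hom_ext(1)[OF f]])
          (use simp_hopf_hom_in[OF f] in \<open>simp_all add: Id Co compose_eq\<close>)
    qed
    assume "Y \<in> Ob ?C"
    then interpret Y: simplicial_hopf2 R Y by (rule simp_hopf_obD)
    fix Z g assume "Z \<in> Ob ?C" and g: "g \<in> Hom ?C Y Z"
    then interpret Z: simplicial_hopf2 R Z by (metis simp_hopf_obD)
    have fm: "f \<in> simp_hopf_maps R X Y" and gm: "g \<in> simp_hopf_maps R Y Z"
      using f g by (simp_all add: SimpHopf_le_def)
    have "compose (carrier (level X n)) (g n) (f n) \<in> hopf_maps R (level X n) (level Z n)" for n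
      by (rule compose_hopf_map[OF X.level_hopf Y.level_hopf Z.level_hopf simp_hopf_hom_ext(2)[OF f]
            simp_hopf_hom_ext(2)[OF g]])
    then show "Comp ?C X Y Z g f \<in> Hom ?C X Z"
      using hopf_mapD(4)[OF X.face_hopf_map] hopf_mapD(4)[OF X.degen_hopf_map] simp_hopf_hom_in[OF f]
      by (simp add: SimpHopf_le_def simp_hopf_maps_def[of R X Z] compose_eq
          f_face[OF X.simplicial_hopf2_axioms Y.simplicial_hopf2_axioms fm]
          f_face[OF Y.simplicial_hopf2_axioms Z.simplicial_hopf2_axioms gm]
          f_degen[OF X.simplicial_hopf2_axioms Y.simplicial_hopf2_axioms fm]
          f_degen[OF Y.simplicial_hopf2_axioms Z.simplicial_hopf2_axioms gm])
  }
  fix W X Y Z :: "('k, 'a) simp_hopf" and f g h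
  assume f: "f \<in> Hom ?C W X"
  show "Comp ?C W Y Z h (Comp ?C W X Y g f) = Comp ?C W X Z (Comp ?C X Y Z h g) f"
    unfolding Co by (rule ext) (rule compose_assoc[OF simp_hopf_hom_ext(3)[OF f]])
qed

lemma X2_ob_in:
  assumes "X \<in> Ob (SimpHopf_le R 2)"
  shows "X2_ob R X \<in> Ob (X2Hopf R)"
proof -
  interpret X: simplicial_hopf2 R X by (rule simp_hopf_obD[OF assms])
  show ?thesis using X.two_crossed by (simp add: X2Hopf_def X2_ob_def X.peiffer_def)
qed

lemma X2Hopf_category:
  "category (X2Hopf R :: (('k, 'a) two_crossed, ('a \<Rightarrow> 'a) \<times> ('a \<Rightarrow> 'a) \<times> ('a \<Rightarrow> 'a)) cat)"
proof
  let ?D = "X2Hopf R :: (('k, 'a) two_crossed, ('a \<Rightarrow> 'a) \<times> ('a \<Rightarrow> 'a) \<times> ('a \<Rightarrow> 'a)) cat"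
  have ob: "two_crossed_module R (base_alg X) (mid_alg X) (top_alg X) (bdry2 X) (bdry1 X) (act_mid X)
      (act_top X) (lifting X)" if "X \<in> Ob ?D" for X
    using that by (simp add: X2Hopf_def)
  have hp: "hopf (base_alg X)" "hopf (mid_alg X)" "hopf (top_alg X)" if "X \<in> Ob ?D" for X
    using ob[OF that] by (simp_all add: two_crossed_module_def)
  have Id: "Ident ?D X = (restrict (\<lambda>x. x) (carrier (base_alg X)),
        restrict (\<lambda>x. x) (carrier (mid_alg X)), restrict (\<lambda>x. x) (carrier (top_alg X)))" for X
    by (simp add: X2Hopf_def)
  have Co: "Comp ?D X Y Z (g0, g1, g2) (f0, f1, f2) = (compose (carrier (base_alg X)) g0 f0,
        compose (carrier (mid_alg X)) g1 f1, compose (carrier (top_alg X)) g2 f2)" for X Y Z g0 g1 g2 f0 f1 f2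
    by (simp add: X2Hopf_def)
  have Ho: "Hom ?D X Y = two_crossed_maps R X Y" for X Y by (simp add: X2Hopf_def)
  have hm: "f0 \<in> hopf_maps R (base_alg X) (base_alg Y)" "f1 \<in> hopf_maps R (mid_alg X) (mid_alg Y)"
    "f2 \<in> hopf_maps R (top_alg X) (top_alg Y)" if "(f0, f1, f2) \<in> Hom ?D X Y" for X Y f0 f1 f2
    using that by (auto simp: Ho two_crossed_maps_def)
  have cl: "a \<in> carrier (base_alg X) \<Longrightarrow> x \<in> carrier (mid_alg X) \<Longrightarrow> act_mid X a x \<in> carrier (mid_alg X)"
    "a \<in> carrier (base_alg X) \<Longrightarrow> k \<in> carrier (top_alg X) \<Longrightarrow> act_top X a k \<in> carrier (top_alg X)"
    "x \<in> carrier (mid_alg X) \<Longrightarrow> y \<in> carrier (mid_alg X) \<Longrightarrow> lifting X x y \<in> carrier (top_alg X)"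
    "k \<in> carrier (top_alg X) \<Longrightarrow> bdry2 X k \<in> carrier (mid_alg X)"
    "x \<in> carrier (mid_alg X) \<Longrightarrow> bdry1 X x \<in> carrier (base_alg X)"
    if "X \<in> Ob ?D" for X a x y k
  proof -
    interpret X: two_crossed_module R "base_alg X" "mid_alg X" "top_alg X" "bdry2 X" "bdry1 X" "act_mid X"
      "act_top X" "lifting X" by (rule ob[OF that])
    show "a \<in> carrier (base_alg X) \<Longrightarrow> x \<in> carrier (mid_alg X) \<Longrightarrow> act_mid X a x \<in> carrier (mid_alg X)"
      by (rule bil_closed[OF X.HI.act_bilinear])
    show "a \<in> carrier (base_alg X) \<Longrightarrow> k \<in> carrier (top_alg X) \<Longrightarrow> act_top X a k \<in> carrier (top_alg X)"
      by (rule bil_closed[OF X.HK.act_bilinear])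
    show "x \<in> carrier (mid_alg X) \<Longrightarrow> y \<in> carrier (mid_alg X) \<Longrightarrow> lifting X x y \<in> carrier (top_alg X)"
      by (rule bil_closed[OF X.lifting_bilinear])
    show "k \<in> carrier (top_alg X) \<Longrightarrow> bdry2 X k \<in> carrier (mid_alg X)"
      by (rule hopf_mapD(4)[OF X.bd2_hopf_map])
    show "x \<in> carrier (mid_alg X) \<Longrightarrow> bdry1 X x \<in> carrier (base_alg X)"
      by (rule hopf_mapD(4)[OF X.bd1_hopf_map])
  qed
  have id_r: "compose S f (restrict (\<lambda>x. x) S) = f" if "f \<in> extensional S" for S :: "'a set" and f :: "'a \<Rightarrow> 'a"
    by (rule extensionalityI[OF _ that]) (simp_all add: compose_eq)
  have id_l: "compose S (restrict (\<lambda>x. x) S') f = f" if "f \<in> extensional S" "\<And>x. x \<in> S \<Longrightarrow> f x \<in> S'"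
    for S S' :: "'a set" and f :: "'a \<Rightarrow> 'a"
    by (rule extensionalityI[OF _ that(1)]) (simp_all add: compose_eq that(2))
  {
    fix X assume X: "X \<in> Ob ?D"
    show "Ident ?D X \<in> Hom ?D X X"
      using hp[OF X] cl[OF X] by (simp add: Id Ho two_crossed_maps_def id_hopf_map)
    fix Y and f assume f: "f \<in> Hom ?D X Y"
    obtain f0 f1 f2 where f3: "f = (f0, f1, f2)" by (cases f) auto
    note h = hm[OF f[unfolded f3]]
    note hd = hopf_mapD(3,4)[OF h(1)] hopf_mapD(3,4)[OF h(2)] hopf_mapD(3,4)[OF h(3)]
    show "Comp ?D X X Y f (Ident ?D X) = f"
      unfolding f3 Id Co using hd by (simp add: id_r)
    show "Comp ?D X Y Y (Ident ?D Y) f = f"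
      unfolding f3 Id Co using hd by (simp add: id_l)
    fix Z g assume Y: "Y \<in> Ob ?D" and Z: "Z \<in> Ob ?D" and g: "g \<in> Hom ?D Y Z"
    obtain g0 g1 g2 where g3: "g = (g0, g1, g2)" by (cases g) auto
    have fg: "(f0, f1, f2) \<in> two_crossed_maps R X Y" "(g0, g1, g2) \<in> two_crossed_maps R Y Z"
      using f g by (simp_all add: f3 g3 Ho)
    show "Comp ?D X Y Z g f \<in> Hom ?D X Z"
      unfolding f3 g3 Co Ho using fg hd cl[OF X] hp[OF X] hp[OF Y] hp[OF Z]
      by (simp add: two_crossed_maps_def compose_hopf_map compose_eq)
  }
  fix W X Y Z :: "('k, 'a) two_crossed" and f g h :: "('a \<Rightarrow> 'a) \<times> ('a \<Rightarrow> 'a) \<times> ('a \<Rightarrow> 'a)"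
  assume f: "f \<in> Hom ?D W X"
  obtain f0 f1 f2 where f3: "f = (f0, f1, f2)" by (cases f) auto
  obtain g0 g1 g2 where g3: "g = (g0, g1, g2)" by (cases g) auto
  obtain h0 h1 h2 where h3: "h = (h0, h1, h2)" by (cases h) auto
  note hf = hm[OF f[unfolded f3]]
  have "f0 \<in> carrier (base_alg W) \<rightarrow> carrier (base_alg X)" "f1 \<in> carrier (mid_alg W) \<rightarrow> carrier (mid_alg X)"
    "f2 \<in> carrier (top_alg W) \<rightarrow> carrier (top_alg X)"
    using hopf_mapD(4)[OF hf(1)] hopf_mapD(4)[OF hf(2)] hopf_mapD(4)[OF hf(3)] by auto
  then show "Comp ?D W Y Z h (Comp ?D W X Y g f) = Comp ?D W X Z (Comp ?D X Y Z h g) f"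
    unfolding f3 g3 h3 Co by (simp add: compose_assoc)
qed

theorem X2_functor:
  "cat_functor (SimpHopf_le R 2 :: (('k, 'a) simp_hopf, nat \<Rightarrow> 'a \<Rightarrow> 'a) cat) (X2Hopf R)
    (X2_ob R) (X2_map R)"
proof (intro cat_functor.intro cat_functor_axioms.intro)
  let ?C = "SimpHopf_le R 2 :: (('k, 'a) simp_hopf, nat \<Rightarrow> 'a \<Rightarrow> 'a) cat"
  let ?D = "X2Hopf R :: (('k, 'a) two_crossed, ('a \<Rightarrow> 'a) \<times> ('a \<Rightarrow> 'a) \<times> ('a \<Rightarrow> 'a)) cat"
  show "category ?C" by (rule SimpHopf_category)
  show "category ?D" by (rule X2Hopf_category)
  fix X assume X: "X \<in> Ob ?C"
  interpret X: simplicial_hopf2 R X by (rule simp_hopf_obD[OF X])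
  show "X2_ob R X \<in> Ob ?D" by (rule X2_ob_in[OF X])
  show "X2_map R X X (Ident ?C X) = Ident ?D (X2_ob R X)"
    using X.moore_sub_carrier
    by (auto simp: X2_map_def SimpHopf_le_def X2Hopf_def X2_ob_def intro!: restrict_ext)
  fix Y f assume Y: "Y \<in> Ob ?C" and f: "f \<in> Hom ?C X Y"
  have f': "f \<in> simp_hopf_maps R X Y" using f by (simp add: SimpHopf_le_def)
  show "X2_map R X Y f \<in> Hom ?D (X2_ob R X) (X2_ob R Y)"
    using X2_map_in[OF simp_hopf_obD[OF X] simp_hopf_obD[OF Y] f'] by (simp add: X2Hopf_def)
  fix Z g
  have m1: "f 1 x \<in> moore_carrier R Y 1" if "x \<in> moore_carrier R X 1" for x
    using f_moore[OF simp_hopf_obD[OF X] simp_hopf_obD[OF Y] f', of x 0, folded One_nat_def] that by simp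
  have m2: "f 2 x \<in> moore_carrier R Y 2" if "x \<in> moore_carrier R X 2" for x
    using f_moore[OF simp_hopf_obD[OF X] simp_hopf_obD[OF Y] f', of x 1, unfolded Suc_1] that by simp
  show "X2_map R X Z (Comp ?C X Y Z g f) =
      Comp ?D (X2_ob R X) (X2_ob R Y) (X2_ob R Z) (X2_map R Y Z g) (X2_map R X Y f)"
    using X.moore_sub_carrier m1 m2
    by (auto simp: X2_map_def SimpHopf_le_def X2Hopf_def X2_ob_def compose_def intro!: restrict_ext)
qed

end

theorem corollary6p15:
  fixes R :: "('k, 'r) ring_scheme"
  assumes "field R"
  shows "cat_functor
      (SimpHopf_le R 2 :: (('k, 'a) simp_hopf, nat \<Rightarrow> 'a \<Rightarrow> 'a) cat)
      (X2Hopf R)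
      (X2_ob R) (X2_map R)"
proof -
  interpret ground_field R using assms by (simp add: ground_field_def)
  show ?thesis by (rule X2_functor)
qed

end
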